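(* Let $0<\rho\le 1$, $0\le\delta<1$, $\delta\le\rho$, $m\in\mathbb R$ and $a\in APS^m_{\rho,\delta}$. Then for every $s\in\mathbb R$ the operator $U(a)(D)$ (initially defined on $\mathscr S(\mathbb R^d,l^2_f)$) extends to a continuous linear map $$U(a)(D):\ H^s(\mathbb R^d,l^2_s)\longrightarrow H^{s-|s|-|m-s|}(\mathbb R^d,l^2_{s-m}).$$ If $m\le 0$, then $U(a)(D)\in\mathscr L(L^2(\mathbb R^d,l^2))$, i.e. it extends to a bounded operator on $L^2(\mathbb R^d,l^2)$.
   Context: Notation: $\langle\xi\rangle=(1+|\xi|^2)^{1/2}$. $C_{\rm ap}(\mathbb R^d)$ is the space of Bohr almost periodic functions, i.e. uniform limits of trigonometric polynomials (finite linear combinations of $e_\lambda(x)=e^{2\pi i\lambda\cdot x}$). The mean value is $\mathscr M(f)=\lim_{T\to\infty}T^{-d}\int_{[0,T]^d}f(x)\,dx$; $\mathscr M_x$ is the mean in the variable $x$. Fourier transform: $\widehat f(\xi)=\int f(x)e^{-2\pi i x\cdot\xi}dx$, also for Hilbert space valued functions. Symbols: $APS^m_{\rho,\delta}$ is the set of $a\in C^\infty(\mathbb R^{2d})$ such that $a(\cdot,\xi)\in C_{\rm ap}(\mathbb R^d)$ for all $\xi$ and $\sup_{x,\xi}\langle\xi\rangle^{-m+\rho|\alpha|-\delta|\beta|}|\partial_\xi^\alpha\partial_x^\beta a(x,\xi)|<\infty$ for all multi-indices $\alpha,\beta$. Sequence spaces: $l^2_s=l^2_s(\mathbb R^d)$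 is the Hilbert space of functions $z=(z_\lambda)_{\lambda\in\mathbb R^d}$ with at most countably many nonzero entries and $\|z\|_{l^2_s}^2=\sum_\lambda\langle\lambda\rangle^{2s}|z_\lambda|^2<\infty$; $l^2=l^2_0$; $l^2_f$ is the space of finitely supported sequences. $\mathscr S(\mathbb R^d,l^2_f)$ consists of the finite sums $\sum_j\varphi_j\,\delta_{(\lambda_j)}$ with $\varphi_j\in\mathscr S(\mathbb R^d)$, $\lambda_j\in\mathbb R^d$, where $\delta_{(\lambda)}$ is the sequence equal to $1$ at $\lambda$ and $0$ elsewhere. Vector-valued Sobolev spaces: $H^t(\mathbb R^d,l^2_s)$ is the space of tempered $l^2_s$-valued distributions $F$ with $\widehat F\in L^2_{\rm loc}(\mathbb R^d,l^2_s)$ (Bochner sense) and $\|F\|^2=\int_{\mathbb R^d}\|\widehat F(\xi)\|_{l^2_s}^2\langle\xi\rangle^{2t}d\xi<\infty$. $L^2(\mathbb R^d,l^2)$ is the Bochner $L^2$ space. The transform $U$: put $a_\lambda(\xi)=\mathscr M_x(a(x,\xi)e^{-2\pi i\lambda\cdot x})$. For $\xi\in\mathbb R^d$, $U(a)(\xi)$ is the operator on sequences given by $(U(a)(\xi)z)_\lambda=\sum_{\lambda'}a_{\lambda'-\lambda}(\xi-\lambda')z_{\lambda'}$. The Fourier multiplier operator $U(a)(D)$ is $U(a)(D)F(x)=\int_{\mathbb R^d}e^{2\pi i\xi\cdot x}\,U(a)(\xi)\cdot\widehat F(\xi)\,d\xi$. *)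

theory Defs
  imports "HOL-Analysis.Analysis"
begin

text \<open>
  The space \<open>\<real>\<^sup>d\<close> is a type \<^typ>\<open>'a::euclidean_space\<close> with its coordinate basis \<^term>\<open>Basis\<close>, so
  \<open>d = DIM('a)\<close> and \<open>\<real>\<^sup>2\<^sup>d\<close> is \<^typ>\<open>'a::euclidean_space \<times> 'a\<close>.
  A sequence indexed by \<open>\<real>\<^sup>d\<close> is a function \<^typ>\<open>'a::euclidean_space \<Rightarrow> complex\<close>.  The
  spaces \<open>l\<^sup>2\<^sub>s\<close> are not separable, hence outside the scope of the type-class based Bochner integral
  of the library; measurability and integration of \<open>l\<^sup>2\<^sub>s\<close>-valued functions are introduced below by
  approximation with simple functions, exactly as in \<^theory>\<open>HOL-Analysis.Bochner_Integration\<close>.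
\<close>

definition bracket :: "'a::euclidean_space \<Rightarrow> real" where
  "bracket \<xi> = sqrt (1 + (norm \<xi>)\<^sup>2)"

definition character :: "'a::euclidean_space \<Rightarrow> 'a \<Rightarrow> complex" where
  "character \<mu> x = cis (2 * pi * (\<mu> \<bullet> x))"


section \<open>Smooth functions\<close>

definition dir_deriv :: "'a::euclidean_space \<Rightarrow> ('a \<Rightarrow> complex) \<Rightarrow> 'a \<Rightarrow> complex" where
  "dir_deriv v f x = vector_derivative (\<lambda>t. f (x + t *\<^sub>R v)) (at 0)"

text \<open>
  A multi-index \<open>\<alpha>\<close> is written as a list of basis vectors, \<open>|\<alpha>|\<close> being its length.  A multi-index
  corresponds to several lists, but on smooth functions partial derivatives commute, so that all
  of these give the same \<open>\<partial>\<^sup>\<alpha>\<close>.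
\<close>

definition partial_derivs :: "'a::euclidean_space list \<Rightarrow> ('a \<Rightarrow> complex) \<Rightarrow> 'a \<Rightarrow> complex" where
  "partial_derivs \<alpha> f = foldr dir_deriv \<alpha> f"

text \<open>All iterated partial derivatives exist and are continuous.\<close>

definition smooth :: "('a::euclidean_space \<Rightarrow> complex) \<Rightarrow> bool" where
  "smooth f \<longleftrightarrow>
     (\<forall>\<alpha>\<in>lists Basis. continuous_on UNIV (partial_derivs \<alpha> f) \<and>
        (\<forall>v\<in>Basis. \<forall>x. (\<lambda>t. partial_derivs \<alpha> f (x + t *\<^sub>R v)) differentiable at (0::real)))"


section \<open>Almost periodic functions and symbols\<close>

definition trig_polynomial :: "('a::euclidean_space \<Rightarrow> complex) \<Rightarrow> bool" where
  "trig_polynomial p \<longleftrightarrow>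
     (\<exists>\<Lambda> c. finite \<Lambda> \<and> p = (\<lambda>x. \<Sum>\<mu>\<in>\<Lambda>. c \<mu> * character \<mu> x))"

definition almost_periodic :: "('a::euclidean_space \<Rightarrow> complex) \<Rightarrow> bool" where
  "almost_periodic f \<longleftrightarrow>
     (\<exists>p. (\<forall>n. trig_polynomial (p n)) \<and> uniform_limit UNIV p f sequentially)"

definition mean_value :: "('a::euclidean_space \<Rightarrow> complex) \<Rightarrow> complex" where
  "mean_value f =
     Lim at_top (\<lambda>T::real. (LINT x:cbox 0 (T *\<^sub>R One)|lborel. f x) / of_real (T ^ DIM('a)))"

text \<open>In \<^term>\<open>a (x, \<xi>)\<close>, the first argument is the position and the second one the frequency.\<close>

definition APS :: "real \<Rightarrow> real \<Rightarrow> real \<Rightarrow> ('a::euclidean_space \<times> 'a \<Rightarrow> complex) set" where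
  "APS m \<rho> \<delta> = {a. smooth a \<and> (\<forall>\<xi>. almost_periodic (\<lambda>x. a (x, \<xi>))) \<and>
     (\<forall>\<alpha>\<in>lists Basis. \<forall>\<beta>\<in>lists Basis.
        bdd_above (range (\<lambda>(x, \<xi>).
          bracket \<xi> powr (- m + \<rho> * real (length \<alpha>) - \<delta> * real (length \<beta>)) *
          cmod (partial_derivs (map (\<lambda>v. (0, v)) \<alpha>)
                 (partial_derivs (map (\<lambda>v. (v, 0)) \<beta>) a) (x, \<xi>)))))}"


section \<open>The sequence spaces \<open>l\<^sup>2\<^sub>s\<close> and Bochner integration in them\<close>

definition l2 :: "real \<Rightarrow> ('a::euclidean_space \<Rightarrow> complex) set" where
  "l2 s = {z. countable {\<mu>. z \<mu> \<noteq> 0} \<and>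
              (\<lambda>\<mu>. bracket \<mu> powr (2 * s) * (cmod (z \<mu>))\<^sup>2) summable_on UNIV}"

definition l2_norm :: "real \<Rightarrow> ('a::euclidean_space \<Rightarrow> complex) \<Rightarrow> real" where
  "l2_norm s z = sqrt (\<Sum>\<^sub>\<infinity>\<mu>\<in>UNIV. bracket \<mu> powr (2 * s) * (cmod (z \<mu>))\<^sup>2)"

definition delta_seq :: "'a::euclidean_space \<Rightarrow> 'a \<Rightarrow> complex" where
  "delta_seq \<mu> = (\<lambda>\<nu>. if \<nu> = \<mu> then 1 else 0)"

definition l2_simple :: "real \<Rightarrow> ('a::euclidean_space \<Rightarrow> 'a \<Rightarrow> complex) \<Rightarrow> bool" where
  "l2_simple s S \<longleftrightarrow> simple_function lborel S \<and> range S \<subseteq> l2 s"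

text \<open>Strong measurability: almost everywhere norm limit of simple functions.\<close>

definition l2_measurable :: "real \<Rightarrow> ('a::euclidean_space \<Rightarrow> 'a \<Rightarrow> complex) \<Rightarrow> bool" where
  "l2_measurable s F \<longleftrightarrow> range F \<subseteq> l2 s \<and>
     (\<exists>S. (\<forall>n. l2_simple s (S n)) \<and>
          (AE x in lborel. (\<lambda>n. l2_norm s (\<lambda>\<mu>. F x \<mu> - S n x \<mu>)) \<longlonglongrightarrow> 0))"

definition l2_simple_integrable :: "real \<Rightarrow> ('a::euclidean_space \<Rightarrow> 'a \<Rightarrow> complex) \<Rightarrow> bool" where
  "l2_simple_integrable s S \<longleftrightarrow>
     l2_simple s S \<and> emeasure lborel {x. S x \<noteq> (\<lambda>_. 0)} \<noteq> \<infinity>"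

definition l2_simple_integral :: "('a::euclidean_space \<Rightarrow> 'a \<Rightarrow> complex) \<Rightarrow> 'a \<Rightarrow> complex" where
  "l2_simple_integral S =
     (\<lambda>\<mu>. \<Sum>z\<in>range S. of_real (measure lborel {x. S x = z}) * z \<mu>)"

definition l2_has_integral ::
  "real \<Rightarrow> ('a::euclidean_space \<Rightarrow> 'a \<Rightarrow> complex) \<Rightarrow> ('a \<Rightarrow> complex) \<Rightarrow> bool" where
  "l2_has_integral s F I \<longleftrightarrow> l2_measurable s F \<and> I \<in> l2 s \<and>
     (\<exists>S. (\<forall>n. l2_simple_integrable s (S n)) \<and>
          (\<lambda>n. \<integral>\<^sup>+x. ennreal (l2_norm s (\<lambda>\<mu>. F x \<mu> - S n x \<mu>)) \<partial>lborel) \<longlonglongrightarrow> 0 \<and>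
          (\<lambda>n. l2_norm s (\<lambda>\<mu>. l2_simple_integral (S n) \<mu> - I \<mu>)) \<longlonglongrightarrow> 0)"

definition l2_integral :: "real \<Rightarrow> ('a::euclidean_space \<Rightarrow> 'a \<Rightarrow> complex) \<Rightarrow> 'a \<Rightarrow> complex" where
  "l2_integral s F =
     (if \<exists>I. l2_has_integral s F I then THE I. l2_has_integral s F I else (\<lambda>_. 0))"


section \<open>Schwartz functions and vector-valued tempered distributions\<close>

definition schwartz_seminorm ::
  "nat \<Rightarrow> 'a::euclidean_space list \<Rightarrow> ('a \<Rightarrow> complex) \<Rightarrow> real" where
  "schwartz_seminorm k \<alpha> \<phi> = (SUP x. bracket x ^ k * cmod (partial_derivs \<alpha> \<phi> x))"

definition schwartz :: "('a::euclidean_space \<Rightarrow> complex) set" where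
  "schwartz = {\<phi>. smooth \<phi> \<and>
     (\<forall>k. \<forall>\<alpha>\<in>lists Basis. bdd_above (range (\<lambda>x. bracket x ^ k * cmod (partial_derivs \<alpha> \<phi> x))))}"

definition test_function :: "('a::euclidean_space \<Rightarrow> complex) \<Rightarrow> bool" where
  "test_function \<phi> \<longleftrightarrow> smooth \<phi> \<and> compact (closure {x. \<phi> x \<noteq> 0})"

definition fourier :: "('a::euclidean_space \<Rightarrow> complex) \<Rightarrow> 'a \<Rightarrow> complex" where
  "fourier \<phi> \<xi> = (LINT x|lborel. \<phi> x * cis (- 2 * pi * (x \<bullet> \<xi>)))"

text \<open>
  An \<open>l\<^sup>2\<^sub>s\<close>-valued tempered distribution is a continuous linear map from the Schwartz space to
  \<open>l\<^sup>2\<^sub>s\<close>.  As functions are total, it is extended by \<open>0\<close> outside the Schwartz space; thus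
  distributions that agree on all Schwartz functions are equal.
\<close>

definition tempered_dist ::
  "real \<Rightarrow> (('a::euclidean_space \<Rightarrow> complex) \<Rightarrow> 'a \<Rightarrow> complex) \<Rightarrow> bool" where
  "tempered_dist s u \<longleftrightarrow>
     (\<forall>\<phi>. \<phi> \<notin> schwartz \<longrightarrow> u \<phi> = (\<lambda>_. 0)) \<and>
     (\<forall>\<phi>\<in>schwartz. u \<phi> \<in> l2 s) \<and>
     (\<forall>\<phi>\<in>schwartz. \<forall>\<psi>\<in>schwartz. \<forall>c.
        u (\<lambda>x. c * \<phi> x + \<psi> x) = (\<lambda>\<mu>. c * u \<phi> \<mu> + u \<psi> \<mu>)) \<and>
     (\<exists>C N. \<forall>\<phi>\<in>schwartz. l2_norm s (u \<phi>) \<le>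
        C * (\<Sum>\<alpha>\<in>{\<alpha>. set \<alpha> \<subseteq> Basis \<and> length \<alpha> \<le> N}. schwartz_seminorm N \<alpha> \<phi>))"

text \<open>The distribution given by a (polynomially bounded) \<open>l\<^sup>2\<^sub>s\<close>-valued function.\<close>

definition dist_of_fun ::
  "real \<Rightarrow> ('a::euclidean_space \<Rightarrow> 'a \<Rightarrow> complex) \<Rightarrow> ('a \<Rightarrow> complex) \<Rightarrow> 'a \<Rightarrow> complex" where
  "dist_of_fun s F \<phi> =
     (if \<phi> \<in> schwartz then l2_integral s (\<lambda>x \<mu>. \<phi> x * F x \<mu>) else (\<lambda>_. 0))"

definition dist_fourier ::
  "(('a::euclidean_space \<Rightarrow> complex) \<Rightarrow> 'a \<Rightarrow> complex) \<Rightarrow> ('a \<Rightarrow> complex) \<Rightarrow> 'a \<Rightarrow> complex" where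
  "dist_fourier u \<phi> = (if \<phi> \<in> schwartz then u (fourier \<phi>) else (\<lambda>_. 0))"


section \<open>Vector-valued Sobolev and Lebesgue spaces\<close>

definition L2_loc :: "real \<Rightarrow> ('a::euclidean_space \<Rightarrow> 'a \<Rightarrow> complex) set" where
  "L2_loc s = {G. l2_measurable s G \<and>
     (\<forall>K. compact K \<longrightarrow> (\<integral>\<^sup>+\<xi>\<in>K. ennreal ((l2_norm s (G \<xi>))\<^sup>2) \<partial>lborel) < \<infinity>)}"

text \<open>\<^term>\<open>G\<close> is locally square integrable and equals the Fourier transform of \<^term>\<open>u\<close> in the sense
  of distributions, i.e. against compactly supported smooth functions.\<close>

definition fourier_density ::
  "real \<Rightarrow> (('a::euclidean_space \<Rightarrow> complex) \<Rightarrow> 'a \<Rightarrow> complex) \<Rightarrow> ('a \<Rightarrow> 'a \<Rightarrow> complex) \<Rightarrow> bool" where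
  "fourier_density s u G \<longleftrightarrow> G \<in> L2_loc s \<and>
     (\<forall>\<phi>. test_function \<phi> \<longrightarrow>
        l2_has_integral s (\<lambda>\<xi> \<mu>. \<phi> \<xi> * G \<xi> \<mu>) (dist_fourier u \<phi>))"

definition weighted_energy ::
  "real \<Rightarrow> real \<Rightarrow> ('a::euclidean_space \<Rightarrow> 'a \<Rightarrow> complex) \<Rightarrow> ennreal" where
  "weighted_energy t s G =
     (\<integral>\<^sup>+\<xi>. ennreal ((l2_norm s (G \<xi>))\<^sup>2 * bracket \<xi> powr (2 * t)) \<partial>lborel)"

text \<open>\<open>H\<^sup>t(\<real>\<^sup>d, l\<^sup>2\<^sub>s)\<close> is \<open>Sobolev t s\<close>.\<close>

definition Sobolev ::
  "real \<Rightarrow> real \<Rightarrow> (('a::euclidean_space \<Rightarrow> complex) \<Rightarrow> 'a \<Rightarrow> complex) set" where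
  "Sobolev t s = {u. tempered_dist s u \<and> (\<exists>G. fourier_density s u G \<and> weighted_energy t s G < \<infinity>)}"

text \<open>The density is unique up to null sets, so the choice of the representative is irrelevant.\<close>

definition Sobolev_norm ::
  "real \<Rightarrow> real \<Rightarrow> (('a::euclidean_space \<Rightarrow> complex) \<Rightarrow> 'a \<Rightarrow> complex) \<Rightarrow> real" where
  "Sobolev_norm t s u = sqrt (enn2real (weighted_energy t s (SOME G. fourier_density s u G)))"

text \<open>\<open>L\<^sup>2(\<real>\<^sup>d, l\<^sup>2)\<close>, whose elements are considered modulo equality almost everywhere.\<close>

definition L2_l2 :: "('a::euclidean_space \<Rightarrow> 'a \<Rightarrow> complex) set" where
  "L2_l2 = {F. l2_measurable 0 F \<and> (\<integral>\<^sup>+x. ennreal ((l2_norm 0 (F x))\<^sup>2) \<partial>lborel) < \<infinity>}"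

definition L2_l2_norm :: "('a::euclidean_space \<Rightarrow> 'a \<Rightarrow> complex) \<Rightarrow> real" where
  "L2_l2_norm F = sqrt (enn2real (\<integral>\<^sup>+x. ennreal ((l2_norm 0 (F x))\<^sup>2) \<partial>lborel))"

definition ae_eq :: "('a::euclidean_space \<Rightarrow> 'a \<Rightarrow> complex) \<Rightarrow> ('a \<Rightarrow> 'a \<Rightarrow> complex) \<Rightarrow> bool" where
  "ae_eq F G \<longleftrightarrow> (AE x in lborel. F x = G x)"

text \<open>
  Continuous, i.e. bounded, complex linear maps between two normed spaces \<open>(V, nV)\<close> and \<open>(W, nW)\<close>
  of sequence-valued functions, where \<open>eq\<close> is the equality of \<open>W\<close>: genuine equality for
  distributions and \<^const>\<open>ae_eq\<close> for \<open>L\<^sup>2\<close> functions.  Linearity and boundedness imply that the map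
  respects equality almost everywhere of its arguments in the latter case.
\<close>

definition bounded_linear_map ::
  "('i \<Rightarrow> 'a \<Rightarrow> complex) set \<Rightarrow> (('i \<Rightarrow> 'a \<Rightarrow> complex) \<Rightarrow> real) \<Rightarrow>
   ('i \<Rightarrow> 'a \<Rightarrow> complex) set \<Rightarrow> (('i \<Rightarrow> 'a \<Rightarrow> complex) \<Rightarrow> real) \<Rightarrow>
   (('i \<Rightarrow> 'a \<Rightarrow> complex) \<Rightarrow> ('i \<Rightarrow> 'a \<Rightarrow> complex) \<Rightarrow> bool) \<Rightarrow>
   (('i \<Rightarrow> 'a \<Rightarrow> complex) \<Rightarrow> 'i \<Rightarrow> 'a \<Rightarrow> complex) \<Rightarrow> bool" where
  "bounded_linear_map V nV W nW eq T \<longleftrightarrow>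
     (\<forall>u\<in>V. T u \<in> W) \<and>
     (\<forall>u\<in>V. \<forall>v\<in>V. \<forall>c.
        eq (T (\<lambda>i \<mu>. c * u i \<mu> + v i \<mu>)) (\<lambda>i \<mu>. c * T u i \<mu> + T v i \<mu>)) \<and>
     (\<exists>C. \<forall>u\<in>V. nW (T u) \<le> C * nV u)"


section \<open>The transform \<open>U\<close>\<close>

definition fourier_coeff ::
  "('a::euclidean_space \<times> 'a \<Rightarrow> complex) \<Rightarrow> 'a \<Rightarrow> 'a \<Rightarrow> complex" where
  "fourier_coeff a \<mu> \<xi> = mean_value (\<lambda>x. a (x, \<xi>) * cis (- 2 * pi * (\<mu> \<bullet> x)))"

definition U_symbol ::
  "('a::euclidean_space \<times> 'a \<Rightarrow> complex) \<Rightarrow> 'a \<Rightarrow> ('a \<Rightarrow> complex) \<Rightarrow> 'a \<Rightarrow> complex" where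
  "U_symbol a \<xi> z = (\<lambda>\<mu>. \<Sum>\<^sub>\<infinity>\<mu>'\<in>UNIV. fourier_coeff a (\<mu>' - \<mu>) (\<xi> - \<mu>') * z \<mu>')"

definition schwartz_l2f :: "('a::euclidean_space \<Rightarrow> 'a \<Rightarrow> complex) set" where
  "schwartz_l2f = {F. \<exists>(n::nat) \<phi> \<mu>. (\<forall>j<n. \<phi> j \<in> schwartz) \<and>
     F = (\<lambda>x \<nu>. \<Sum>j<n. \<phi> j x * delta_seq (\<mu> j) \<nu>)}"

definition l2_fourier :: "('a::euclidean_space \<Rightarrow> 'a \<Rightarrow> complex) \<Rightarrow> 'a \<Rightarrow> 'a \<Rightarrow> complex" where
  "l2_fourier F \<xi> = l2_integral 0 (\<lambda>x \<mu>. cis (- 2 * pi * (x \<bullet> \<xi>)) * F x \<mu>)"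

text \<open>The operator \<open>U(a)(D)\<close> on \<^const>\<open>schwartz_l2f\<close>; the integral is taken in \<open>l\<^sup>2\<close>.\<close>

definition U_multiplier ::
  "('a::euclidean_space \<times> 'a \<Rightarrow> complex) \<Rightarrow> ('a \<Rightarrow> 'a \<Rightarrow> complex) \<Rightarrow> 'a \<Rightarrow> 'a \<Rightarrow> complex" where
  "U_multiplier a F x =
     l2_integral 0 (\<lambda>\<xi> \<mu>. cis (2 * pi * (\<xi> \<bullet> x)) * U_symbol a \<xi> (l2_fourier F \<xi>) \<mu>)"

end

theory Submission
  imports Defs "HOL-Probability.Characteristic_Functions" "HOL-Probability.Sinc_Integral"
    "HOL-Real_Asymp.Real_Asymp"
begin

text \<open>
  The entries of \<open>U(a)(\<xi>)\<close> are those of the matrix \<open>K(\<kappa>, \<kappa>') = a\<^bsub>\<kappa>-\<kappa>'\<^esub>(\<kappa>')\<close> after the substitution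
  \<open>\<kappa> = \<xi> - \<lambda>\<close>, so Peetre's inequality reduces the bound
  \<open>\<parallel>U(a)(\<xi>)\<parallel> \<le> C \<langle>\<xi>\<rangle>\<^bsup>|s|+|m-s|\<^esup>\<close> from \<open>l\<^sup>2\<^sub>s\<close> to \<open>l\<^sup>2\<^bsub>s-m\<^esub>\<close> to the boundedness of
  \<open>\<langle>\<kappa>\<rangle>\<^bsup>s-m\<^esup> K \<langle>\<kappa>'\<rangle>\<^bsup>-s\<^esup>\<close> on \<open>l\<^sup>2\<close>. For the latter, \<open>\<kappa>'\<close> is localised to a dyadic shell
  \<open>|\<kappa>'| \<sim> 2\<^sup>k\<close> and then to cubes of side \<open>2\<^bsup>\<delta>k\<^esup>\<close>. On one cube the symbol is nearly constant in the
  frequency, and Bessel's inequality in mean gives the bound. A derivative in \<open>x\<close> multiplies \<open>K\<close> by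
  \<open>2\<pi>i(\<kappa> - \<kappa>')\<close> and costs only \<open>2\<^bsup>\<delta>k\<^esup>\<close>; solving the resulting Sylvester equations gives decay in
  the distance of two cubes, and, as \<open>\<delta> < 1\<close>, in the distance of two shells, and Schur's test sums
  the blocks. The operator \<open>U(a)(D)\<close> is then multiplication by \<open>U(a)\<close> of the Fourier density, which is
  unique by testing against bump functions, and on \<open>L\<^sup>2\<close> it is conjugated with the Fourier transform.
\<close>

text \<open>Since \<delta> \<le> \<rho>, the symbol obeys bounds of type \<delta>, \<delta>, and
  2^(\<delta> k) is the scale L at which a frequency derivative gains what an x-derivative costs. In
  one coordinate, two x-derivatives cost L^2 while a separation by n cells is worth (n L)^-2; the
  scale cancels and the summable 1/n^2 remains. Between shells, 2^(\<delta> k) is exchanged for the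
  larger radius, and \<delta> < 1 lets enough repetitions beat any weight. Each Sylvester equation
  is solved by absorption, which starts from an a priori bound; hence bounds without decay precede
  those with decay. All matrix bounds are stated for finite sections, so no question of convergence
  arises before \<open>kernel_apply\<close>. The spaces l2_s are not separable. A countable set of
  indices valid for all frequencies, obtained from the countable spectrum of the symbol, takes the
  place of separability, and Bochner integrals become families of scalar integrals.\<close>

lemma
 fixes f :: "'a::euclidean_space => real => 'b::{real_normed_field,banach,second_countable_topology}"
 assumes f: "\<And>b. b \<in> Basis ==> integrable lborel (f b)"
 shows integrable_lborel_prod: "integrable lborel (\<lambda>x::'a. \<Prod>b\<in>Basis. f b (x \<bullet> b))"
  and integral_lborel_prod:
   "(LINT x|lborel. (\<Prod>b\<in>Basis. f b (x \<bullet> b))) = (\<Prod>b\<in>Basis. LINT t|lborel. f b t)"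
proof -
 interpret product_sigma_finite "\<lambda>_::'a. lborel::real measure" ..
 \<comment> \<open>Lebesgue measure is the image of the product measure under \<open>?h\<close>, so
   both claims are transported product formulas. They serve for characters on cubes, for Gaussians
   and for the integrable weight on the space.\<close>
 let ?h = "\<lambda>g. \<Sum>b\<in>(Basis::'a set). (g b :: real) *\<^sub>R b"
 have coord: "?h g \<bullet> c = g c" if "c \<in> Basis" for g c
  using that by (simp add: inner_sum_left inner_Basis if_distrib sum.If_cases cong: if_cong)
 have meas: "(\<lambda>x::'a. \<Prod>b\<in>Basis. f b (x \<bullet> b)) \<in> borel_measurable borel"
  using f by (intro borel_measurable_prod) (auto intro!: measurable_compose[OF _ borel_measurable_integrable])
 have h: "?h \<in> measurable (\<Pi>\<^sub>M b\<in>Basis. lborel) borel" by measurable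
 have eq: "(\<Prod>b\<in>Basis. f b (?h g \<bullet> b)) = (\<Prod>b\<in>Basis. f b (g b))" for g
  by (intro prod.cong refl) (simp add: coord)
 show "integrable lborel (\<lambda>x::'a. \<Prod>b\<in>Basis. f b (x \<bullet> b))"
  unfolding lborel_eq[where ?'a='a] integrable_distr_eq[OF h meas] eq
  by (rule product_integrable_prod) (auto intro: f)
 show "(LINT x|lborel. (\<Prod>b\<in>Basis. f b (x \<bullet> b))) = (\<Prod>b\<in>Basis. LINT t|lborel. f b t)"
  unfolding lborel_eq[where ?'a='a] integral_distr[OF h meas] eq by (rule product_integral_prod) (auto intro: f)
qed

section \<open>Mean values of almost periodic functions\<close>

definition cube_average :: "real => ('a::euclidean_space => complex) => complex" where
 "cube_average T f = (LINT x:cbox 0 (T *\<^sub>R One)|lborel. f x) / of_real (T ^ DIM('a))"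

text \<open>\<open>mean_value\<close> is a \<open>Lim\<close>, which has an arbitrary value where no
  limit exists; the relation records existence. Continuity is bundled in because it makes every cube
  average a genuine integral, hence additive and monotone.\<close>

definition has_mean :: "('a::euclidean_space => complex) => complex => bool" where
 "has_mean f L \<longleftrightarrow> continuous_on UNIV f \<and> ((\<lambda>T. cube_average T f) \<longlongrightarrow> L) at_top"

lemma mean_value_eq: "has_mean f L ==> mean_value f = L" unfolding has_mean_def mean_value_def cube_average_def
 by (intro tendsto_Lim) auto

lemma measure_cube:
 assumes "T \<ge> 0"
 shows "measure lborel (cbox (0::'a::euclidean_space) (T *\<^sub>R One)) = T ^ DIM('a)"
 using assms by (subst content_cbox) (auto simp: inner_sum_left inner_Basis if_distrib sum.If_cases cong: if_cong)

lemma set_integrable_continuous_cbox: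
 fixes f :: "'a::euclidean_space => 'b::euclidean_space"
 assumes "continuous_on UNIV f"
 shows "set_integrable lborel (cbox u v) f" unfolding set_integrable_def
 using borel_integrable_compact[of "cbox u v" f] continuous_on_subset[OF assms]
 by (auto simp: indicator_def cong: if_cong)

lemma cube_average_add:
 assumes "continuous_on UNIV f" "continuous_on UNIV g"
 shows "cube_average T (\<lambda>x. f x + g x) = cube_average T f + cube_average T g" unfolding cube_average_def
 by (subst set_integral_add) (auto intro!: set_integrable_continuous_cbox assms simp: add_divide_distrib)

lemma cube_average_cmult: "cube_average T (\<lambda>x. c * f x) = c * cube_average T f"
 unfolding cube_average_def by simp

lemma cube_average_le:
 fixes f :: "'a::euclidean_space => complex"
 assumes "continuous_on UNIV f" "continuous_on UNIV g" "\<And>x. cmod (f x) \<le> g x" "T > 0"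
 shows "cmod (cube_average T f) \<le> Re (cube_average T (\<lambda>x. of_real (g x)))"
proof -
 have "cmod (LINT x:cbox 0 (T *\<^sub>R One)|lborel. f x) \<le> (LINT x:cbox 0 (T *\<^sub>R One)|lborel. g x)"
 proof -
  have "cmod (LINT x:cbox 0 (T *\<^sub>R One)|lborel. f x) \<le> (LINT x:cbox 0 (T *\<^sub>R One)|lborel. cmod (f x))"
   using set_integrable_continuous_cbox[OF assms(1)] by (rule set_integral_norm_bound)
  also have "... \<le> (LINT x:cbox 0 (T *\<^sub>R One)|lborel. g x)"
   by (intro set_integral_mono set_integrable_continuous_cbox assms continuous_on_norm)
  finally show ?thesis .
 qed
 moreover have "(LINT x:cbox (0::'a) (T *\<^sub>R One)|lborel. complex_of_real (g x))
   = of_real (LINT x:cbox 0 (T *\<^sub>R One)|lborel. g x)" by (rule set_integral_complex_of_real)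
 moreover have "Re (of_real u / of_real v) = u / v" for u v :: real by (metis Re_complex_of_real of_real_divide)
 ultimately show ?thesis using \<open>T > 0\<close> unfolding cube_average_def
  by (simp add: norm_divide norm_power divide_right_mono flip: of_real_power)
qed

lemma cube_average_const: "T > 0 ==> cube_average T (\<lambda>x::'a::euclidean_space. c) = c"
 unfolding cube_average_def set_lebesgue_integral_def by (simp add: measure_cube scaleR_conv_of_real)

lemma cube_average_bound:
 assumes "continuous_on UNIV f" "\<And>x. cmod (f x) \<le> B" "T > 0"
 shows "cmod (cube_average T f) \<le> B"
 using cube_average_le[of f "\<lambda>_. B" T] assms by (simp add: cube_average_const)

lemma has_mean_add: "has_mean f L ==> has_mean g M ==> has_mean (\<lambda>x. f x + g x) (L + M)"
 unfolding has_mean_def by (auto simp: cube_average_add intro!: tendsto_intros continuous_intros)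

lemma has_mean_cmult: "has_mean f L ==> has_mean (\<lambda>x. c * f x) (c * L)"
 unfolding has_mean_def by (auto simp: cube_average_cmult intro!: tendsto_intros continuous_intros)

lemma has_mean_const: "has_mean (\<lambda>_. c) c" unfolding has_mean_def
 by (auto intro!: tendsto_eventually eventually_mono[OF eventually_gt_at_top[of 0]] simp: cube_average_const)

lemma has_mean_sum:
 assumes "finite I" "\<And>i. i \<in> I ==> has_mean (f i) (L i)"
 shows "has_mean (\<lambda>x. \<Sum>i\<in>I. f i x) (\<Sum>i\<in>I. L i)"
 using assms by (induction I) (auto intro: has_mean_add has_mean_const)

lemma has_mean_le:
 assumes "has_mean f L" "has_mean (\<lambda>x. of_real (g x)) M" "\<And>x. cmod (f x) \<le> g x"
 shows "cmod L \<le> Re M"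
proof (rule tendsto_le[OF trivial_limit_at_top_linorder])
 show "((\<lambda>T. Re (cube_average T (\<lambda>x. of_real (g x)))) \<longlongrightarrow> Re M) at_top"
  using assms(2) by (auto simp: has_mean_def intro!: tendsto_intros)
 show "((\<lambda>T. cmod (cube_average T f)) \<longlongrightarrow> cmod L) at_top"
  using assms(1) by (auto simp: has_mean_def intro!: tendsto_intros)
 have g: "continuous_on UNIV g"
  using assms(2) continuous_on_Re[of UNIV "\<lambda>x. complex_of_real (g x)"] by (auto simp: has_mean_def)
 show "\<forall>\<^sub>F T in at_top. cmod (cube_average T f) \<le> Re (cube_average T (\<lambda>x. of_real (g x)))"
  using eventually_gt_at_top[of 0]
  by eventually_elim (use assms g in \<open>auto simp: has_mean_def intro!: cube_average_le\<close>)
qed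

lemma has_mean_bound:
 assumes "has_mean f L" "\<And>x. cmod (f x) \<le> B"
 shows "cmod L \<le> B" using has_mean_le[OF assms(1) has_mean_const, of "B"] assms(2) by simp

text \<open>Cube averages contract the supremum norm. Hence the means \<open>L n\<close> are Cauchy,
  and the averages of \<open>p n\<close> converge to those of \<open>f\<close> uniformly in
  \<open>T > 0\<close>, which justifies interchanging the two limits.\<close>

lemma has_mean_uniform_limit:
 assumes p: "\<And>n. has_mean (p n) (L n)" and lim: "uniform_limit UNIV p f sequentially"
 shows "\<exists>M. has_mean f M \<and> L \<longlonglongrightarrow> M"
proof -
 have cf: "continuous_on UNIV f" using lim p by (intro uniform_limit_theorem[OF _ lim]) (auto simp: has_mean_def)
 have "Cauchy L"
 proof (rule metric_CauchyI)
  fix e :: real assume "e > 0"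
  then obtain N where N: "\<And>n x. n \<ge> N ==> cmod (p n x - f x) < e/3"
   using lim unfolding uniform_limit_sequentially_iff dist_norm by (metis UNIV_I divide_pos_pos zero_less_numeral)
  have "dist (L m) (L n) < e" if "m \<ge> N" "n \<ge> N" for m n
  proof -
   have "has_mean (\<lambda>x. p m x + (-1) * p n x) (L m + (-1) * L n)" by (intro has_mean_add has_mean_cmult p)
   moreover have "cmod (p m x + (-1) * p n x) \<le> e/3 + e/3" for x
   proof -
    have "p m x + (-1) * p n x = (p m x - f x) - (p n x - f x)" by simp
    then show ?thesis
     using order_trans[OF norm_triangle_ineq4 add_mono[OF less_imp_le[OF N] less_imp_le[OF N]]] that by metis
   qed
   ultimately have "cmod (L m + (-1) * L n) \<le> e/3 + e/3" by (rule has_mean_bound)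
   then show ?thesis using \<open>e > 0\<close> by (simp add: dist_norm)
  qed
  then show "\<exists>M. \<forall>m\<ge>M. \<forall>n\<ge>M. dist (L m) (L n) < e" by blast
 qed
 then obtain M where M: "L \<longlonglongrightarrow> M" using Cauchy_convergent_iff convergent_def by blast
 have "((\<lambda>T. cube_average T f) \<longlongrightarrow> M) at_top"
 proof (rule swap_uniform_limit'[OF _ M, where f="\<lambda>n T. cube_average T (p n)" and S="{0<..}"])
  show "\<forall>\<^sub>F n in sequentially. ((\<lambda>T. cube_average T (p n)) \<longlongrightarrow> L n) at_top"
   using p by (auto simp: has_mean_def)
  show "\<forall>\<^sub>F T in at_top. T \<in> {0::real<..}"
   using eventually_gt_at_top[of "0::real"] by eventually_elim auto
  show "uniform_limit {0<..} (\<lambda>n T. cube_average T (p n)) (\<lambda>T. cube_average T f) sequentially"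
  proof (rule uniform_limitI)
   fix e :: real assume "e > 0"
   then have "\<forall>\<^sub>F n in sequentially. \<forall>x\<in>UNIV. dist (p n x) (f x) < e/2"
    using lim by (intro uniform_limitD) auto
   then show "\<forall>\<^sub>F n in sequentially. \<forall>T\<in>{0<..}. dist (cube_average T (p n)) (cube_average T f) < e"
   proof eventually_elim
    case (elim n)
    show ?case
    proof
     fix T :: real assume "T \<in> {0<..}"
     have "cmod (cube_average T (\<lambda>x. p n x + (-1) * f x)) \<le> e/2"
      using elim \<open>T \<in> _\<close> p[of n] cf
      by (intro cube_average_bound) (auto simp: dist_norm has_mean_def less_imp_le intro!: continuous_intros)
     also have "cube_average T (\<lambda>x. p n x + (-1) * f x) = cube_average T (p n) + (-1) * cube_average T f"
      using p[of n] cf by (subst cube_average_add, (auto simp: has_mean_def intro!: continuous_intros)[2])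
       (simp only: cube_average_cmult)
     finally show "dist (cube_average T (p n)) (cube_average T f) < e"
      using \<open>e > 0\<close> by (simp add: dist_norm)
    qed
   qed
  qed
 qed auto
 with cf M show ?thesis by (auto simp: has_mean_def)
qed

lemma character_add: "character (mu + nu) x = character mu x * character nu x"
 by (simp add: character_def cis_mult algebra_simps inner_add_left)

lemma character_shift: "character mu (x + h) = character mu h * character mu x"
 by (simp add: character_def cis_mult algebra_simps inner_add_right)

lemma character_0 [simp]: "character 0 x = 1" by (simp add: character_def)

lemma cnj_character: "cnj (character mu x) = character (- mu) x" by (simp add: character_def cis_cnj)

lemma norm_character [simp]: "cmod (character mu x) = 1" by (simp add: character_def)

lemma cis_eq_character: "cis (- 2 * pi * (mu \<bullet> x)) = character (- mu) x" by (simp add: character_def)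

lemma continuous_character [continuous_intros]:
 "continuous_on S f ==> continuous_on S (\<lambda>x. character mu (f x))"
 unfolding character_def cis_conv_exp by (intro continuous_intros) auto

lemma character_prod:
 "character mu (x::'a::euclidean_space) = (\<Prod>b\<in>Basis. cis (2 * pi * (mu \<bullet> b) * (x \<bullet> b)))"
proof -
 have "cis (2 * pi * (\<Sum>b\<in>B. (mu \<bullet> b) * (x \<bullet> b))) = (\<Prod>b\<in>B. cis (2 * pi * (mu \<bullet> b) * (x \<bullet> b)))"
  if "finite B" for B :: "'a set" using that by induction (simp_all add: ring_distribs mult.assoc flip: cis_mult)
 from this[of Basis] show ?thesis by (simp add: character_def euclidean_inner[of mu x])
qed

lemma integral_cis_interval_bound:
 assumes "c \<noteq> 0" "T \<ge> 0"
 shows "cmod (LINT t|lborel. indicator {0..T} t *\<^sub>R cis (c * t)) \<le> 2 / \<bar>c\<bar>"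
proof -
 have "(LINT t|lborel. indicator {0..T} t *\<^sub>R cis (c * t)) = cis (c * T) / (\<i> * c) - cis (c * 0) / (\<i> * c)"
 proof (rule integral_FTC_atLeastAtMost[OF \<open>T \<ge> 0\<close>])
  show "((\<lambda>t. cis (c * t) / (\<i> * c)) has_vector_derivative cis (c * x)) (at x within {0..T})" for x
   using assms unfolding cis_conv_exp
   by (auto intro!: derivative_eq_intros has_vector_derivative_real_field simp: field_simps)
  show "continuous_on {0..T} (\<lambda>t. cis (c * t))" unfolding cis_conv_exp by (intro continuous_intros)
 qed
 also have "cmod ... \<le> 1/\<bar>c\<bar> + 1/\<bar>c\<bar>"
  by (rule order_trans[OF norm_triangle_ineq4]) (simp add: norm_divide norm_mult)
 finally show ?thesis by simp
qed

text \<open>For \<open>mu \<noteq> 0\<close> some coordinate \<open>mu \<bullet> e\<close> is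
  nonzero. The integral over the cube factors over the coordinates; the factor of \<open>e\<close>
  stays bounded while every other one is at most \<open>T\<close>, so the average is O(1/T).\<close>

lemma has_mean_character:
 "has_mean (character (mu::'a::euclidean_space)) (if mu = 0 then 1 else 0)"
proof (cases "mu = 0")
 case True
 then show ?thesis using has_mean_const[of 1] by (simp add: character_def[abs_def])
next
 case False
 then obtain e where e: "e \<in> Basis" "mu \<bullet> e \<noteq> 0" by (metis euclidean_eqI inner_zero_left)
 define c where "c b = 2 * pi * (mu \<bullet> b)" for b
 have ce: "c e \<noteq> 0" using e by (simp add: c_def)
 have int: "integrable lborel (\<lambda>t. indicator {0..T} t *\<^sub>R cis (c b * t))" for T b
  using set_integrable_continuous_cbox[of "\<lambda>t. cis (c b * t)" 0 T]
  by (simp add: set_integrable_def continuous_intros cis_conv_exp)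
 have bnd: "cmod (cube_average T (character mu)) \<le> (2 / \<bar>c e\<bar>) / T" if "T > 0" for T
 proof -
  have ind: "(indicator (cbox 0 (T *\<^sub>R One)) x :: real) = (\<Prod>b\<in>Basis. indicator {0..T} (x \<bullet> b))" for x :: 'a
   by (auto simp: indicator_def cbox_def inner_sum_left inner_Basis if_distrib sum.If_cases cong: if_cong)
  have "(LINT x:cbox 0 (T *\<^sub>R One)|lborel. character mu x)
   = (LINT x|lborel. (\<Prod>b\<in>Basis. indicator {0..T} (x \<bullet> b) *\<^sub>R cis (c b * (x \<bullet> b))))"
   unfolding set_lebesgue_integral_def ind character_prod by (simp add: scaleR_conv_of_real prod.distrib c_def)
  also have "... = (\<Prod>b\<in>Basis. LINT t|lborel. indicator {0..T} t *\<^sub>R cis (c b * t))"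
   by (rule integral_lborel_prod[OF int])
  also have "... = (LINT t|lborel. indicator {0..T} t *\<^sub>R cis (c e * t)) *
    (\<Prod>b\<in>Basis - {e}. LINT t|lborel. indicator {0..T} t *\<^sub>R cis (c b * t))"
   using e by (subst prod.remove[of _ e]) auto
  also have "cmod ... \<le> (2 / \<bar>c e\<bar>) * (\<Prod>b\<in>Basis - {e}. T)"
  proof -
   have "cmod (LINT t|lborel. indicator {0..T} t *\<^sub>R cis (c b * t)) \<le> T" for b
   proof -
    have "cmod (LINT t|lborel. indicator {0..T} t *\<^sub>R cis (c b * t))
      \<le> (LINT t|lborel. norm (indicator {0..T} t *\<^sub>R cis (c b * t)))" by (rule integral_norm_bound)
    also have "... = T" using that by simp
    finally show ?thesis .
   qed
   then show ?thesis unfolding norm_mult prod_norm[symmetric] using integral_cis_interval_bound[OF ce, of T] that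
    by (intro mult_mono prod_mono) (auto intro!: prod_nonneg)
  qed
  finally have "cmod (LINT x:cbox 0 (T *\<^sub>R One)|lborel. character mu x) \<le> (2 / \<bar>c e\<bar>) * T ^ (DIM('a) - 1)"
   using e by (simp add: card_Diff_singleton)
  moreover have "T ^ DIM('a) = T * T ^ (DIM('a) - 1)"
   using DIM_positive[where 'a='a] by (metis Suc_diff_1 power_Suc)
  ultimately show ?thesis using that unfolding cube_average_def
   by (simp add: norm_divide norm_power norm_mult field_simps)
 qed
 have "((\<lambda>T. cube_average T (character mu)) \<longlongrightarrow> 0) at_top"
 proof (rule Lim_null_comparison)
  show "\<forall>\<^sub>F T in at_top. cmod (cube_average T (character mu)) \<le> (2 / \<bar>c e\<bar>) / T"
   using eventually_gt_at_top[of 0] by eventually_elim (rule bnd)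
  show "((\<lambda>T. (2 / \<bar>c e\<bar>) / T) \<longlongrightarrow> 0) at_top"
   by (intro tendsto_divide_0[OF tendsto_const] filterlim_at_top_imp_at_infinity filterlim_ident)
 qed
 with False show ?thesis by (simp add: has_mean_def continuous_intros)
qed

lemma has_mean_trig_polynomial:
 assumes "finite La"
 shows "has_mean (\<lambda>x::'a::euclidean_space. \<Sum>mu\<in>La. c mu * character mu x) (if 0 \<in> La then c 0 else 0)"
proof -
 have "has_mean (\<lambda>x::'a. \<Sum>mu\<in>La. c mu * character mu x) (\<Sum>mu\<in>La. c mu * (if mu = 0 then 1 else 0))"
  using assms by (intro has_mean_sum has_mean_cmult has_mean_character)
 also have "(\<Sum>mu\<in>La. c mu * (if mu = 0 then 1 else 0)) = (if 0 \<in> La then c 0 else 0)"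
  using assms by (simp add: if_distrib cong: if_cong)
 finally show ?thesis .
qed

text \<open>Frequencies may coincide here: equal \<open>mu i\<close> are merged by adding their
  coefficients. The closure properties below produce sums of this form.\<close>

lemma trig_polynomialI:
 assumes "finite I"
 shows "trig_polynomial (\<lambda>x. \<Sum>i\<in>I. c i * character (mu i) x)"
proof -
 have "(\<lambda>x. \<Sum>i\<in>I. c i * character (mu i) x)
   = (\<lambda>x. \<Sum>nu\<in>mu ` I. (\<Sum>i\<in>{i\<in>I. mu i = nu}. c i) * character nu x)"
 proof
  fix x
  show "(\<Sum>i\<in>I. c i * character (mu i) x)
    = (\<Sum>nu\<in>mu ` I. (\<Sum>i\<in>{i\<in>I. mu i = nu}. c i) * character nu x)"
   by (subst sum.image_gen[OF assms, of _ mu]) (auto intro!: sum.cong simp: sum_distrib_right)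
 qed
 then show ?thesis using assms unfolding trig_polynomial_def
  by (intro exI[of _ "mu ` I"] exI[of _ "\<lambda>nu. \<Sum>i\<in>{i\<in>I. mu i = nu}. c i"]) simp
qed

lemma trig_polynomial_add:
 assumes "trig_polynomial p" "trig_polynomial q"
 shows "trig_polynomial (\<lambda>x. p x + q x)"
proof -
 from assms obtain A c B d where "finite A" "finite B"
  and p: "p = (\<lambda>x. \<Sum>mu\<in>A. c mu * character mu x)" and q: "q = (\<lambda>x. \<Sum>mu\<in>B. d mu * character mu x)"
  by (auto simp: trig_polynomial_def)
 \<comment> \<open>The disjoint sum keeps both summands when a frequency occurs in \<open>A\<close>
   and in \<open>B\<close>.\<close>
 then have "trig_polynomial (\<lambda>x. \<Sum>i\<in>A <+> B. case_sum c d i * character (case_sum id id i) x)"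
  by (intro trig_polynomialI) auto
 then show ?thesis using \<open>finite A\<close> \<open>finite B\<close> by (simp add: p q sum.Plus)
qed

lemma trig_polynomial_cmult:
 assumes "trig_polynomial p"
 shows "trig_polynomial (\<lambda>x. c * p x)"
proof -
 from assms obtain A d where "finite A" "p = (\<lambda>x. \<Sum>mu\<in>A. d mu * character mu x)"
  by (auto simp: trig_polynomial_def)
 then show ?thesis
  using trig_polynomialI[of A "\<lambda>mu. c * d mu" "\<lambda>mu. mu"] by (simp add: sum_distrib_left mult.assoc)
qed

lemma trig_polynomial_shift:
 assumes "trig_polynomial p"
 shows "trig_polynomial (\<lambda>x. p (x + h))"
proof -
 from assms obtain A d where "finite A" "p = (\<lambda>x. \<Sum>mu\<in>A. d mu * character mu x)"
  by (auto simp: trig_polynomial_def)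
 then show ?thesis
  using trig_polynomialI[of A "\<lambda>mu. d mu * character mu h" "\<lambda>mu. mu"] by (simp add: character_shift mult.assoc)
qed

lemma trig_polynomial_mult_character:
 assumes "trig_polynomial p"
 shows "trig_polynomial (\<lambda>x. p x * character nu x)"
proof -
 from assms obtain A d where "finite A" "p = (\<lambda>x. \<Sum>mu\<in>A. d mu * character mu x)"
  by (auto simp: trig_polynomial_def)
 then show ?thesis
  using trig_polynomialI[of A d "\<lambda>mu. mu + nu"] by (simp add: character_add sum_distrib_right mult.assoc)
qed

lemma almost_periodic_trig_polynomial: "trig_polynomial p ==> almost_periodic p"
 unfolding almost_periodic_def by (intro exI[of _ "\<lambda>_. p"]) (auto intro: uniform_limit_const)

lemma almost_periodic_iff:
 "almost_periodic f \<longleftrightarrow> (\<forall>e>0. \<exists>p. trig_polynomial p \<and> (\<forall>x. cmod (p x - f x) \<le> e))"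
proof
 assume "almost_periodic f"
 then obtain p where p: "\<And>n. trig_polynomial (p n)" "uniform_limit UNIV p f sequentially"
  by (auto simp: almost_periodic_def)
 show "\<forall>e>0. \<exists>p. trig_polynomial p \<and> (\<forall>x. cmod (p x - f x) \<le> e)"
 proof (intro allI impI)
  fix e :: real assume "e > 0"
  with p(2) obtain n where "\<forall>x. dist (p n x) (f x) < e"
   unfolding uniform_limit_sequentially_iff by (metis UNIV_I order_refl)
  with p(1) show "\<exists>p. trig_polynomial p \<and> (\<forall>x. cmod (p x - f x) \<le> e)"
   by (metis dist_norm less_imp_le)
 qed
next
 assume *: "\<forall>e>0. \<exists>p. trig_polynomial p \<and> (\<forall>x. cmod (p x - f x) \<le> e)"
 have "\<forall>n. \<exists>p. trig_polynomial p \<and> (\<forall>x. cmod (p x - f x) \<le> inverse (real (Suc n)))"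
  using * by auto
 then obtain p where p: "\<And>n. trig_polynomial (p n)" "\<And>n x. cmod (p n x - f x) \<le> inverse (real (Suc n))"
  by metis
 have "uniform_limit UNIV p f sequentially"
 proof (rule uniform_limitI)
  fix e :: real assume "e > 0"
  then have "\<forall>\<^sub>F n in sequentially. inverse (real (Suc n)) < e"
   using LIMSEQ_inverse_real_of_nat by (rule order_tendstoD(2)[rotated])
  then show "\<forall>\<^sub>F n in sequentially. \<forall>x\<in>UNIV. dist (p n x) (f x) < e"
   by eventually_elim (use p(2) in \<open>auto simp: dist_norm intro: le_less_trans\<close>)
 qed
 with p(1) show "almost_periodic f" by (auto simp: almost_periodic_def)
qed

lemma almost_periodic_approx:
 assumes "\<And>e. e > 0 ==> \<exists>g. almost_periodic g \<and> (\<forall>x. cmod (g x - f x) \<le> e)"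
 shows "almost_periodic f" unfolding almost_periodic_iff
proof (intro allI impI)
 fix e :: real assume "e > 0"
 then obtain g where g: "almost_periodic g" "\<And>x. cmod (g x - f x) \<le> e/2" using assms[of "e/2"] by auto
 then obtain p where p: "trig_polynomial p" "\<And>x. cmod (p x - g x) \<le> e/2"
  using \<open>e > 0\<close> by (metis almost_periodic_iff half_gt_zero)
 have "cmod (p x - f x) \<le> e" for x
  using norm_triangle_ineq[of "p x - g x" "g x - f x"] g(2)[of x] p(2)[of x] by simp
 with p(1) show "\<exists>p. trig_polynomial p \<and> (\<forall>x. cmod (p x - f x) \<le> e)" by blast
qed

lemma almost_periodic_add:
 assumes "almost_periodic f" "almost_periodic g"
 shows "almost_periodic (\<lambda>x. f x + g x)" unfolding almost_periodic_iff
proof (intro allI impI)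
 fix e :: real assume "e > 0"
 then obtain p q where pq: "trig_polynomial p" "\<And>x. cmod (p x - f x) \<le> e/2"
  "trig_polynomial q" "\<And>x. cmod (q x - g x) \<le> e/2" using assms by (metis almost_periodic_iff half_gt_zero)
 have "cmod ((p x + q x) - (f x + g x)) \<le> e" for x
  using norm_triangle_ineq[of "p x - f x" "q x - g x"] pq(2)[of x] pq(4)[of x] by (simp add: algebra_simps)
 with pq trig_polynomial_add show "\<exists>p. trig_polynomial p \<and> (\<forall>x. cmod (p x - (f x + g x)) \<le> e)" by blast
qed

lemma almost_periodic_cmult:
 assumes "almost_periodic f"
 shows "almost_periodic (\<lambda>x. c * f x)" unfolding almost_periodic_iff
proof (intro allI impI)
 fix e :: real assume "e > 0"
 then have "e / (cmod c + 1) > 0" by (intro divide_pos_pos) (auto intro: add_nonneg_pos)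
 then obtain p where p: "trig_polynomial p" "\<And>x. cmod (p x - f x) \<le> e / (cmod c + 1)"
  using assms by (metis almost_periodic_iff)
 have "cmod (c * p x - c * f x) \<le> e" for x
 proof -
  have "cmod (c * p x - c * f x) = cmod c * cmod (p x - f x)" by (metis norm_mult right_diff_distrib)
  also have "... \<le> (cmod c + 1) * (e / (cmod c + 1))" using p(2)[of x] by (intro mult_mono) auto
  also have "... = e" by (simp add: add_nonneg_eq_0_iff)
  finally show ?thesis .
 qed
 with p trig_polynomial_cmult show "\<exists>p. trig_polynomial p \<and> (\<forall>x. cmod (p x - c * f x) \<le> e)" by blast
qed

lemma almost_periodic_shift:
 assumes "almost_periodic f"
 shows "almost_periodic (\<lambda>x. f (x + h))"
 using assms trig_polynomial_shift unfolding almost_periodic_iff by metis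

lemma almost_periodic_mult_character:
 assumes "almost_periodic f"
 shows "almost_periodic (\<lambda>x. f x * character nu x)" unfolding almost_periodic_iff
proof (intro allI impI)
 fix e :: real assume "e > 0"
 then obtain p where p: "trig_polynomial p" "\<And>x. cmod (p x - f x) \<le> e"
  using assms by (metis almost_periodic_iff)
 have "cmod (p x * character nu x - f x * character nu x) \<le> e" for x
  using p(2)[of x] by (simp add: norm_mult flip: left_diff_distrib)
 with p trig_polynomial_mult_character
 show "\<exists>p. trig_polynomial p \<and> (\<forall>x. cmod (p x - f x * character nu x) \<le> e)" by blast
qed

lemma trig_polynomial_mean:
 assumes "trig_polynomial p"
 shows "has_mean p (mean_value p)"
 using assms has_mean_trig_polynomial mean_value_eq unfolding trig_polynomial_def by metis

lemma almost_periodic_mean: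
 assumes "almost_periodic f"
 shows "has_mean f (mean_value f)"
proof -
 obtain p where p: "\<And>n. trig_polynomial (p n)" "uniform_limit UNIV p f sequentially"
  using assms by (auto simp: almost_periodic_def)
 then obtain M where "has_mean f M"
  using has_mean_uniform_limit[of p "\<lambda>n. mean_value (p n)" f] trig_polynomial_mean by blast
 then show ?thesis using mean_value_eq by blast
qed

lemma mean_value_add:
 "almost_periodic f ==> almost_periodic g ==> mean_value (\<lambda>x. f x + g x) = mean_value f + mean_value g"
 by (intro mean_value_eq has_mean_add almost_periodic_mean)

lemma mean_value_cmult:
 "almost_periodic f ==> mean_value (\<lambda>x. c * f x) = c * mean_value f"
 by (intro mean_value_eq has_mean_cmult almost_periodic_mean)

lemma mean_value_bound:
 "almost_periodic f ==> (\<And>x. cmod (f x) \<le> B) ==> cmod (mean_value f) \<le> B"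
 by (rule has_mean_bound[OF almost_periodic_mean])

lemma mean_value_diff_bound:
 assumes "almost_periodic f" "almost_periodic g" "\<And>x. cmod (f x - g x) \<le> B"
 shows "cmod (mean_value f - mean_value g) \<le> B"
proof -
 have "mean_value (\<lambda>x. f x + (-1) * g x) = mean_value f + (-1) * mean_value g"
  by (simp only: mean_value_add mean_value_cmult almost_periodic_cmult assms)
 then have "mean_value f - mean_value g = mean_value (\<lambda>x. f x + (-1) * g x)" by simp
 also have "cmod ... \<le> B" using assms by (intro mean_value_bound almost_periodic_add almost_periodic_cmult) auto
 finally show ?thesis .
qed

lemma eq_0_if_norm_le:
 fixes z :: "'b::real_normed_vector"
 assumes "\<And>e. e > 0 ==> norm z \<le> e"
 shows "z = 0" using field_le_epsilon[of "norm z" 0] assms by simp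

text \<open>The Fourier coefficients of an almost periodic function, \<open>b\<^sub>\<mu>\<close> in the notation of the paper.\<close>

definition ap_coeff :: "('a::euclidean_space => complex) => 'a => complex" where
 "ap_coeff b mu = mean_value (\<lambda>x. b x * character (- mu) x)"

lemma fourier_coeff_eq: "fourier_coeff a mu xi = ap_coeff (\<lambda>x. a (x, xi)) mu"
 unfolding fourier_coeff_def ap_coeff_def cis_eq_character ..

lemma ap_coeff_diff_bound:
 assumes "almost_periodic f" "almost_periodic g" "\<And>x. cmod (f x - g x) \<le> B"
 shows "cmod (ap_coeff f mu - ap_coeff g mu) \<le> B" unfolding ap_coeff_def
 using assms by (intro mean_value_diff_bound almost_periodic_mult_character)
  (simp_all add: norm_mult flip: left_diff_distrib)

lemma ap_coeff_trig_polynomial: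
 assumes "finite La"
 shows "ap_coeff (\<lambda>x. \<Sum>mu\<in>La. c mu * character mu x) nu = (if nu \<in> La then c nu else 0)"
proof -
 have "has_mean (\<lambda>x. \<Sum>mu\<in>La. c mu * character (mu - nu) x) (\<Sum>mu\<in>La. c mu * (if mu - nu = 0 then 1 else 0))"
  using assms by (intro has_mean_sum has_mean_cmult has_mean_character)
 also have "(\<Sum>mu\<in>La. c mu * (if mu - nu = 0 then 1 else 0)) = (if nu \<in> La then c nu else 0)"
  using assms by (simp add: if_distrib cong: if_cong)
 also have "(\<lambda>x. \<Sum>mu\<in>La. c mu * character (mu - nu) x)
   = (\<lambda>x. (\<Sum>mu\<in>La. c mu * character mu x) * character (- nu) x)"
  using character_add[of _ "- nu"] by (simp add: sum_distrib_right mult.assoc)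
 finally show ?thesis unfolding ap_coeff_def by (rule mean_value_eq)
qed

text \<open>Coefficients depend continuously on the function in the supremum norm, and a
  trigonometric polynomial has no coefficients off its frequencies. So only the countably many
  frequencies of an approximating sequence can occur.\<close>

lemma countable_ap_spectrum:
 assumes "almost_periodic b"
 shows "countable {mu. ap_coeff b mu \<noteq> 0}"
proof -
 obtain p where p: "\<And>n. trig_polynomial (p n)" "uniform_limit UNIV p b sequentially"
  using assms by (auto simp: almost_periodic_def)
 then obtain La c where pn: "\<And>n. finite (La n)" "\<And>n. p n = (\<lambda>x. \<Sum>mu\<in>La n. c n mu * character mu x)"
  unfolding trig_polynomial_def by metis
 have "ap_coeff b mu = 0" if "mu \<notin> (\<Union>n. La n)" for mu
 proof -
  have "cmod (ap_coeff b mu) \<le> e" if "e > 0" for e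
  proof -
   obtain n where n: "\<forall>x. dist (p n x) (b x) < e"
    using p(2) \<open>e > 0\<close> unfolding uniform_limit_sequentially_iff by (metis UNIV_I order_refl)
   have "ap_coeff (p n) mu = 0"
    using \<open>mu \<notin> _\<close> by (simp add: pn(2) ap_coeff_trig_polynomial pn(1))
   moreover have "cmod (ap_coeff (p n) mu - ap_coeff b mu) \<le> e"
    using n by (intro ap_coeff_diff_bound[OF almost_periodic_trig_polynomial[OF p(1)] assms]) (auto simp: dist_norm less_imp_le)
   ultimately show ?thesis by simp
  qed
  then show ?thesis by (rule eq_0_if_norm_le)
 qed
 then have "{mu. ap_coeff b mu \<noteq> 0} \<subseteq> (\<Union>n. La n)" by blast
 then show ?thesis by (rule countable_subset) (auto intro: countable_finite pn)
qed

text \<open>Exact for trigonometric polynomials, and both sides are continuous in the supremum norm.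
  The approximation avoids estimating the difference of two shifted cubes.\<close>

lemma ap_coeff_shift:
 assumes "almost_periodic b"
 shows "ap_coeff (\<lambda>x. b (x + h)) mu = character mu h * ap_coeff b mu"
proof -
 have "cmod (ap_coeff (\<lambda>x. b (x + h)) mu - character mu h * ap_coeff b mu) \<le> e" if "e > 0" for e
 proof -
  obtain p where p: "trig_polynomial p" "\<And>x. cmod (p x - b x) \<le> e/2"
   using assms \<open>e > 0\<close> by (metis almost_periodic_iff half_gt_zero)
  then obtain La c where pL: "finite La" "p = (\<lambda>x. \<Sum>mu\<in>La. c mu * character mu x)"
   unfolding trig_polynomial_def by metis
  have "(\<lambda>x. p (x + h)) = (\<lambda>x. \<Sum>mu\<in>La. (c mu * character mu h) * character mu x)"
   by (simp add: pL(2) character_shift mult.assoc)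
  then have eq: "ap_coeff (\<lambda>x. p (x + h)) mu = character mu h * ap_coeff p mu"
   by (simp only: ap_coeff_trig_polynomial[OF pL(1)]) (simp add: pL ap_coeff_trig_polynomial)
  have p': "almost_periodic p" by (rule almost_periodic_trig_polynomial[OF p(1)])
  have "cmod (ap_coeff (\<lambda>x. p (x + h)) mu - ap_coeff (\<lambda>x. b (x + h)) mu) \<le> e/2"
   by (intro ap_coeff_diff_bound almost_periodic_shift p' assms p)
  moreover have "cmod (ap_coeff p mu - ap_coeff b mu) \<le> e/2" by (intro ap_coeff_diff_bound p' assms p)
  moreover have "cmod (ap_coeff (\<lambda>x. p (x + h)) mu - character mu h * ap_coeff b mu)
    = cmod (ap_coeff p mu - ap_coeff b mu)" unfolding eq by (simp add: norm_mult flip: right_diff_distrib)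
  ultimately show ?thesis
   using norm_triangle_ineq4[of "ap_coeff (\<lambda>x. p (x + h)) mu - character mu h * ap_coeff b mu"
    "ap_coeff (\<lambda>x. p (x + h)) mu - ap_coeff (\<lambda>x. b (x + h)) mu"] by simp
 qed
 then show ?thesis using eq_0_if_norm_le eq_iff_diff_eq_0 by blast
qed

section \<open>Derivatives of almost periodic functions along a direction\<close>

lemma line_deriv_shift:
 fixes f :: "'a::real_vector => 'b::real_normed_vector"
 assumes "\<And>x. ((\<lambda>t. f (x + t *\<^sub>R v)) has_vector_derivative f' x) (at 0)"
 shows "((\<lambda>t. f (x + t *\<^sub>R v)) has_vector_derivative f' (x + s *\<^sub>R v)) (at s)"
proof -
 have "((\<lambda>t. t - s) has_real_derivative 1) (at s)" by (auto intro!: derivative_eq_intros)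
 moreover have "((\<lambda>t. f (x + s *\<^sub>R v + t *\<^sub>R v)) has_vector_derivative f' (x + s *\<^sub>R v)) (at (s - s))"
  using assms by simp
 ultimately have "((\<lambda>t. f (x + s *\<^sub>R v + t *\<^sub>R v)) \<circ> (\<lambda>t. t - s) has_vector_derivative 1 *\<^sub>R f' (x + s *\<^sub>R v)) (at s)"
  unfolding has_real_derivative_iff_has_vector_derivative by (rule vector_diff_chain_at)
 moreover have "x + s *\<^sub>R v + (t - s) *\<^sub>R v = x + t *\<^sub>R v" for t by (simp add: algebra_simps)
 ultimately show ?thesis by (simp add: o_def)
qed

text \<open>The bound on the second derivative makes the difference quotients converge uniformly to
  \<open>b'\<close>. Almost periodicity and the coefficients pass to the uniform limit, and the
  coefficients of a quotient are those of \<open>b\<close> times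
  \<open>(character mu (t *\<^sub>R v) - 1) / t\<close>.\<close>

lemma
 fixes b b' b'' :: "'a::euclidean_space => complex"
 assumes b: "almost_periodic b"
  and d1: "\<And>x. ((\<lambda>t. b (x + t *\<^sub>R v)) has_vector_derivative b' x) (at 0)"
  and d2: "\<And>x. ((\<lambda>t. b' (x + t *\<^sub>R v)) has_vector_derivative b'' x) (at 0)"
  and bnd: "\<And>x. cmod (b'' x) \<le> B"
 shows almost_periodic_deriv: "almost_periodic b'"
  and ap_coeff_deriv: "ap_coeff b' mu = \<i> * of_real (2 * pi * (mu \<bullet> v)) * ap_coeff b mu"
proof -
 define q where "q t x = inverse (of_real t) * (b (x + t *\<^sub>R v) + (-1) * b x)" for t :: real and x
 have lip: "cmod (b' (x + s *\<^sub>R v) - b' x) \<le> B * \<bar>s\<bar>" for x s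
 proof -
  have "norm (b' (x + s *\<^sub>R v) - b' (x + 0 *\<^sub>R v)) \<le> B * norm (s - 0)"
   by (rule differentiable_bound[of UNIV "\<lambda>t. b' (x + t *\<^sub>R v)" "\<lambda>t h. h *\<^sub>R b'' (x + t *\<^sub>R v)"])
    (use line_deriv_shift[OF d2] bnd in \<open>auto simp: has_vector_derivative_def intro!: onorm_le simp: mult.commute[of B] mult_left_mono\<close>)
  then show ?thesis by simp
 qed
 have B: "B \<ge> 0" using bnd[of 0] norm_ge_zero order_trans by blast
 have qb: "cmod (q t x - b' x) \<le> B * \<bar>t\<bar>" if "t \<noteq> 0" for t x
 proof -
  \<comment> \<open>Mean value theorem for \<open>b\<close> along the line minus its linearisation
    at \<open>x\<close>. Between \<open>- \<bar>t\<bar>\<close> and \<open>\<bar>t\<bar>\<close> the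
    derivative of this difference is at most \<open>B * \<bar>t\<bar>\<close> by \<open>lip\<close>;
    the symmetric interval covers both signs of \<open>t\<close>.\<close>
  have "norm ((b (x + t *\<^sub>R v) - t *\<^sub>R b' x) - (b (x + 0 *\<^sub>R v) - 0 *\<^sub>R b' x)) \<le> (B * \<bar>t\<bar>) * norm (t - 0)"
  proof (rule differentiable_bound[of "{- \<bar>t\<bar>..\<bar>t\<bar>}" "\<lambda>s. b (x + s *\<^sub>R v) - s *\<^sub>R b' x" "\<lambda>s h. h *\<^sub>R (b' (x + s *\<^sub>R v) - b' x)"])
   fix s assume s: "s \<in> {- \<bar>t\<bar>..\<bar>t\<bar>}"
   have "((\<lambda>s. b (x + s *\<^sub>R v) - s *\<^sub>R b' x) has_vector_derivative (b' (x + s *\<^sub>R v) - b' x)) (at s)"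
    using line_deriv_shift[OF d1] by (auto intro!: derivative_eq_intros)
   then show "((\<lambda>s. b (x + s *\<^sub>R v) - s *\<^sub>R b' x) has_derivative (\<lambda>h. h *\<^sub>R (b' (x + s *\<^sub>R v) - b' x))) (at s within {- \<bar>t\<bar>..\<bar>t\<bar>})"
    by (auto simp: has_vector_derivative_def intro: has_derivative_at_withinI)
   have "cmod (b' (x + s *\<^sub>R v) - b' x) \<le> B * \<bar>t\<bar>"
    using lip[of x s] s B by (meson abs_le_iff atLeastAtMost_iff minus_le_iff mult_left_mono order_trans)
   then show "onorm (\<lambda>h. h *\<^sub>R (b' (x + s *\<^sub>R v) - b' x)) \<le> B * \<bar>t\<bar>"
    by (intro onorm_le) (auto simp: mult.commute[of "B * \<bar>t\<bar>"] mult_left_mono)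
  qed auto
  then have "cmod (b (x + t *\<^sub>R v) - b x - t *\<^sub>R b' x) \<le> B * \<bar>t\<bar> * \<bar>t\<bar>" by (simp add: algebra_simps)
  moreover have "q t x - b' x = inverse (of_real t) * (b (x + t *\<^sub>R v) - b x - t *\<^sub>R b' x)"
   using that by (simp add: q_def field_simps scaleR_conv_of_real)
  ultimately have "cmod (q t x - b' x) \<le> inverse \<bar>t\<bar> * (B * \<bar>t\<bar> * \<bar>t\<bar>)"
   by (simp only: norm_mult norm_inverse norm_of_real) (intro mult_left_mono, auto)
  also have "... = B * \<bar>t\<bar>" using that by (simp add: abs_if)
  finally show ?thesis .
 qed
 have q: "almost_periodic (q t)" for t
  unfolding q_def[abs_def] by (intro almost_periodic_cmult almost_periodic_add almost_periodic_shift b)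
 show b': "almost_periodic b'"
 proof (rule almost_periodic_approx)
  fix e :: real assume "e > 0"
  have "B * \<bar>e / (B + 1)\<bar> \<le> e" using B \<open>e > 0\<close> by (simp add: field_simps)
  moreover have "e / (B + 1) \<noteq> 0" using B \<open>e > 0\<close> by simp
  ultimately show "\<exists>g. almost_periodic g \<and> (\<forall>x. cmod (g x - b' x) \<le> e)"
   using q qb order_trans by blast
 qed
 define t where "t n = inverse (real (Suc n))" for n
 have t: "t \<longlonglongrightarrow> 0" "\<And>n. t n \<noteq> 0"
  using LIMSEQ_inverse_real_of_nat unfolding t_def by auto
 have "ap_coeff (q s) mu = inverse (of_real s) * (character mu (s *\<^sub>R v) - 1) * ap_coeff b mu" for s
 proof -
  have "ap_coeff (q s) mu = mean_value (\<lambda>x. inverse (of_real s) * (b (x + s *\<^sub>R v) * character (- mu) x + (-1) * (b x * character (- mu) x)))"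
   unfolding ap_coeff_def q_def by (simp add: algebra_simps)
  also have "... = inverse (of_real s) * (ap_coeff (\<lambda>x. b (x + s *\<^sub>R v)) mu + (-1) * ap_coeff b mu)"
   unfolding ap_coeff_def by (simp only: mean_value_cmult mean_value_add almost_periodic_cmult almost_periodic_add
     almost_periodic_mult_character almost_periodic_shift b)
  finally show ?thesis by (simp add: ap_coeff_shift[OF b] algebra_simps)
 qed
 then have c: "ap_coeff (q (t n)) mu = (character mu (t n *\<^sub>R v) - 1) / of_real (t n) * ap_coeff b mu" for n
  by (simp add: divide_inverse mult.commute mult.left_commute)
 have "(\<lambda>n. ap_coeff (q (t n)) mu) \<longlonglongrightarrow> ap_coeff b' mu"
 proof (rule LIM_zero_cancel, rule Lim_null_comparison)
  show "\<forall>\<^sub>F n in sequentially. cmod (ap_coeff (q (t n)) mu - ap_coeff b' mu) \<le> B * \<bar>t n\<bar>"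
   using t(2) by (auto intro!: always_eventually ap_coeff_diff_bound q b' qb)
  show "(\<lambda>n. B * \<bar>t n\<bar>) \<longlonglongrightarrow> 0"
   using t(1) by (auto intro!: tendsto_eq_intros)
 qed
 have lim: "(\<lambda>n. (character mu (t n *\<^sub>R v) - 1) / of_real (t n)) \<longlonglongrightarrow> \<i> * of_real (2 * pi * (mu \<bullet> v))"
 proof -
  let ?c = "\<i> * of_real (2 * pi * (mu \<bullet> v))"
  have "((\<lambda>z. exp (?c * z)) has_field_derivative ?c) (at 0)" by (auto intro!: derivative_eq_intros)
  then have "(\<lambda>h. (exp (?c * h) - 1) / h) \<midarrow>0\<rightarrow> ?c" by (simp add: DERIV_def)
  moreover have "filterlim (\<lambda>n. complex_of_real (t n)) (at 0) sequentially"
   using t tendsto_of_real[OF t(1), where 'a=complex] by (auto simp: filterlim_at)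
  ultimately have "(\<lambda>n. (exp (?c * of_real (t n)) - 1) / of_real (t n)) \<longlonglongrightarrow> ?c"
   by (rule filterlim_compose)
  then show ?thesis by (simp add: character_def cis_conv_exp mult_ac)
 qed
 have "(\<lambda>n. ap_coeff (q (t n)) mu) \<longlonglongrightarrow> \<i> * of_real (2 * pi * (mu \<bullet> v)) * ap_coeff b mu"
  unfolding c by (intro tendsto_mult tendsto_const lim)
 with \<open>(\<lambda>n. ap_coeff (q (t n)) mu) \<longlonglongrightarrow> ap_coeff b' mu\<close>
 show "ap_coeff b' mu = \<i> * of_real (2 * pi * (mu \<bullet> v)) * ap_coeff b mu" by (rule LIMSEQ_unique)
qed

section \<open>Bounded kernels on finitely supported sequences\<close>

text \<open>A bound for the operator norm on l2 of the submatrix with rows in \<open>S\<close> and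
  columns in \<open>S'\<close>, tested on finitely supported vectors so that no sum needs
  convergence. The form is bilinear rather than sesquilinear: this does not affect the bound and
  lets it carry over to the transposed matrix directly.\<close>

definition opbound :: "('a => 'b => complex) => 'a set => 'b set => real => bool" where
 "opbound K S S' C \<longleftrightarrow> (\<forall>F F' w z. finite F \<longrightarrow> F \<subseteq> S \<longrightarrow> finite F' \<longrightarrow> F' \<subseteq> S' \<longrightarrow>
  cmod (\<Sum>ka\<in>F. \<Sum>ka'\<in>F'. w ka * K ka ka' * z ka') \<le>
   C * (L2_set (\<lambda>ka. cmod (w ka)) F * L2_set (\<lambda>ka'. cmod (z ka')) F'))"

lemma opboundD:
 assumes "opbound K S S' C" "finite F" "F \<subseteq> S" "finite F'" "F' \<subseteq> S'"
 shows "cmod (\<Sum>ka\<in>F. \<Sum>ka'\<in>F'. w ka * K ka ka' * z ka') \<le>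
  C * (L2_set (\<lambda>ka. cmod (w ka)) F * L2_set (\<lambda>ka'. cmod (z ka')) F')"
 using assms(1)[unfolded opbound_def, rule_format, OF assms(2-5)] .

lemma opbound_mono:
 assumes "opbound K S S' C" "C \<le> D" "T \<subseteq> S" "T' \<subseteq> S'"
 shows "opbound K T T' D" unfolding opbound_def
proof (intro allI impI)
 fix F F' w z assume "finite F" "F \<subseteq> T" "finite F'" "F' \<subseteq> T'"
 then have "cmod (\<Sum>ka\<in>F. \<Sum>ka'\<in>F'. w ka * K ka ka' * z ka') \<le>
  C * (L2_set (\<lambda>ka. cmod (w ka)) F * L2_set (\<lambda>ka'. cmod (z ka')) F')"
  using assms by (intro opboundD[OF assms(1)]) auto
 also have "... \<le> D * (L2_set (\<lambda>ka. cmod (w ka)) F * L2_set (\<lambda>ka'. cmod (z ka')) F')"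
  using assms(2) by (intro mult_right_mono mult_nonneg_nonneg L2_set_nonneg)
 finally show "cmod (\<Sum>ka\<in>F. \<Sum>ka'\<in>F'. w ka * K ka ka' * z ka') \<le>
  D * (L2_set (\<lambda>ka. cmod (w ka)) F * L2_set (\<lambda>ka'. cmod (z ka')) F')" .
qed

lemma opbound_cong:
 assumes "opbound K S S' C" "\<And>ka ka'. ka \<in> S ==> ka' \<in> S' ==> K' ka ka' = K ka ka'"
 shows "opbound K' S S' C" unfolding opbound_def
proof (intro allI impI)
 fix F F' w z assume F: "finite F" "F \<subseteq> S" "finite F'" "F' \<subseteq> S'"
 have "(\<Sum>ka\<in>F. \<Sum>ka'\<in>F'. w ka * K' ka ka' * z ka') = (\<Sum>ka\<in>F. \<Sum>ka'\<in>F'. w ka * K ka ka' * z ka')"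
  using F assms(2) by (intro sum.cong refl) (auto simp: subset_iff)
 then show "cmod (\<Sum>ka\<in>F. \<Sum>ka'\<in>F'. w ka * K' ka ka' * z ka') \<le>
   C * (L2_set (\<lambda>ka. cmod (w ka)) F * L2_set (\<lambda>ka'. cmod (z ka')) F')"
  using opboundD[OF assms(1) F] by simp
qed

lemma opbound_add:
 assumes "opbound K S S' C" "opbound K' S S' C'"
 shows "opbound (\<lambda>ka ka'. K ka ka' + K' ka ka') S S' (C + C')" unfolding opbound_def
proof (intro allI impI)
 fix F F' w z assume F: "finite F" "F \<subseteq> S" "finite F'" "F' \<subseteq> S'"
 let ?n = "L2_set (\<lambda>ka. cmod (w ka)) F * L2_set (\<lambda>ka'. cmod (z ka')) F'"
 have "(\<Sum>ka\<in>F. \<Sum>ka'\<in>F'. w ka * (K ka ka' + K' ka ka') * z ka') =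
  (\<Sum>ka\<in>F. \<Sum>ka'\<in>F'. w ka * K ka ka' * z ka') + (\<Sum>ka\<in>F. \<Sum>ka'\<in>F'. w ka * K' ka ka' * z ka')"
  by (simp add: algebra_simps sum.distrib)
 also have "cmod ... \<le> C * ?n + C' * ?n"
  by (intro order_trans[OF norm_triangle_ineq add_mono] opboundD[OF assms(1) F] opboundD[OF assms(2) F])
 finally show "cmod (\<Sum>ka\<in>F. \<Sum>ka'\<in>F'. w ka * (K ka ka' + K' ka ka') * z ka') \<le> (C + C') * ?n"
  by (simp add: algebra_simps)
qed

lemma opbound_0: "opbound (\<lambda>_ _. 0) S S' 0" by (simp add: opbound_def)

lemma opbound_sum:
 assumes "finite E" "\<And>e. e \<in> E ==> opbound (K e) S S' (C e)"
 shows "opbound (\<lambda>ka ka'. \<Sum>e\<in>E. K e ka ka') S S' (\<Sum>e\<in>E. C e)"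
 using assms by (induction E) (auto intro: opbound_0 opbound_add)

lemma L2_set_mult_le:
 assumes "\<And>x. x \<in> F ==> cmod (f x) \<le> M" "M \<ge> 0"
 shows "L2_set (\<lambda>x. cmod (f x * w x)) F \<le> M * L2_set (\<lambda>x. cmod (w x)) F"
proof -
 have "L2_set (\<lambda>x. cmod (f x * w x)) F \<le> L2_set (\<lambda>x. M * cmod (w x)) F"
  using assms by (intro L2_set_mono) (auto simp: norm_mult mult_right_mono)
 also have "... = M * L2_set (\<lambda>x. cmod (w x)) F" using assms by (simp add: L2_set_right_distrib)
 finally show ?thesis .
qed

lemma opbound_mult:
 assumes K: "opbound K S S' C" and "C \<ge> 0"
  and f: "\<And>ka. ka \<in> S ==> cmod (f ka) \<le> M" "M \<ge> 0"
  and g: "\<And>ka'. ka' \<in> S' ==> cmod (g ka') \<le> M'" "M' \<ge> 0"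
 shows "opbound (\<lambda>ka ka'. f ka * K ka ka' * g ka') S S' (M * M' * C)" unfolding opbound_def
proof (intro allI impI)
 fix F F' w z assume F: "finite F" "F \<subseteq> S" "finite F'" "F' \<subseteq> S'"
 let ?w = "L2_set (\<lambda>ka. cmod (w ka)) F" and ?z = "L2_set (\<lambda>ka'. cmod (z ka')) F'"
 have "cmod (\<Sum>ka\<in>F. \<Sum>ka'\<in>F'. w ka * (f ka * K ka ka' * g ka') * z ka')
  = cmod (\<Sum>ka\<in>F. \<Sum>ka'\<in>F'. (f ka * w ka) * K ka ka' * (g ka' * z ka'))"
  by (simp add: algebra_simps)
 also have "... \<le> C * (L2_set (\<lambda>ka. cmod (f ka * w ka)) F * L2_set (\<lambda>ka'. cmod (g ka' * z ka')) F')"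
  by (rule opboundD[OF K F])
 also have "... \<le> C * ((M * ?w) * (M' * ?z))"
  using F f g \<open>C \<ge> 0\<close> by (intro mult_left_mono mult_mono L2_set_mult_le) auto
 finally show "cmod (\<Sum>ka\<in>F. \<Sum>ka'\<in>F'. w ka * (f ka * K ka ka' * g ka') * z ka') \<le> M * M' * C * (?w * ?z)"
  by (simp add: algebra_simps)
qed

lemma opbound_mult_left:
 assumes "opbound K S S' C" "C \<ge> 0" "\<And>ka. ka \<in> S ==> cmod (f ka) \<le> M" "M \<ge> 0"
 shows "opbound (\<lambda>ka ka'. f ka * K ka ka') S S' (M * C)"
 using opbound_mult[OF assms, where g = "\<lambda>_. 1" and M' = 1] by simp

lemma opbound_mult_right:
 assumes "opbound K S S' C" "C \<ge> 0" "\<And>ka'. ka' \<in> S' ==> cmod (g ka') \<le> M'" "M' \<ge> 0"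
 shows "opbound (\<lambda>ka ka'. g ka' * K ka ka') S S' (M' * C)"
proof -
 have "opbound (\<lambda>ka ka'. 1 * K ka ka' * g ka') S S' (1 * M' * C)" by (rule opbound_mult) (use assms in auto)
 then show ?thesis by (simp add: mult.commute)
qed

text \<open>Iterating \<open>step\<close> from the a priori bound \<open>D\<close> yields
  \<open>D / 2 ^ n + 2 * c\<close> for every \<open>n\<close>. This turns an identity expressing
  \<open>K\<close> by small multiples of itself and a controlled remainder into a bound by the
  remainder alone.\<close>

lemma opbound_absorb:
 assumes "opbound K S S' D" "D \<ge> 0" "c \<ge> 0"
  and step: "\<And>D. D \<ge> 0 ==> opbound K S S' D ==> opbound K S S' (D / 2 + c)"
 shows "opbound K S S' (2 * c)"
proof -
 have n: "opbound K S S' (D / 2 ^ n + 2 * c)" for n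
 proof (induction n)
  case 0
  show ?case by (rule opbound_mono[OF assms(1)]) (use assms in auto)
 next
  case (Suc n)
  from step[OF _ this] assms(2,3) show ?case by (simp add: field_simps)
 qed
 show ?thesis unfolding opbound_def
 proof (intro allI impI)
  fix F F' w z assume F: "finite F" "F \<subseteq> S" "finite F'" "F' \<subseteq> S'"
  show "cmod (\<Sum>ka\<in>F. \<Sum>ka'\<in>F'. w ka * K ka ka' * z ka') \<le>
    2 * c * (L2_set (\<lambda>ka. cmod (w ka)) F * L2_set (\<lambda>ka'. cmod (z ka')) F')"
  proof (rule LIMSEQ_le_const)
   have "(\<lambda>n. D / 2 ^ n + 2 * c) \<longlonglongrightarrow> 0 + 2 * c"
    by (intro tendsto_add tendsto_const) real_asymp
   then show "(\<lambda>n. (D / 2 ^ n + 2 * c) * (L2_set (\<lambda>ka. cmod (w ka)) F * L2_set (\<lambda>ka'. cmod (z ka')) F'))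
     \<longlonglongrightarrow> 2 * c * (L2_set (\<lambda>ka. cmod (w ka)) F * L2_set (\<lambda>ka'. cmod (z ka')) F')"
    by (intro tendsto_mult_right) simp
  qed (auto intro!: opboundD[OF n F])
 qed
qed

text \<open>Schur's test for block matrices: \<open>p\<close> and \<open>q\<close> sort rows and
  columns into blocks, and \<open>bt\<close> majorises the block norms.\<close>

lemma opbound_blocks:
 assumes blk: "\<And>i j. opbound K {ka\<in>S. p ka = i} {ka'\<in>S'. q ka' = j} (bt i j)"
  and nn: "\<And>i j. bt i j \<ge> 0"
  and row: "\<And>i J. finite J ==> (\<Sum>j\<in>J. bt i j) \<le> C"
  and col: "\<And>j I. finite I ==> (\<Sum>i\<in>I. bt i j) \<le> C"
 shows "opbound K S S' C" unfolding opbound_def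
proof (intro allI impI)
 fix F F' w z assume F: "finite F" "F \<subseteq> S" "finite F'" "F' \<subseteq> S'"
 define I J where "I = p ` F" and "J = q ` F'"
 define Fi Fj where "Fi i = {ka\<in>F. p ka = i}" and "Fj j = {ka'\<in>F'. q ka' = j}" for i j
 define W Z where "W i = L2_set (\<lambda>ka. cmod (w ka)) (Fi i)" and "Z j = L2_set (\<lambda>ka'. cmod (z ka')) (Fj j)" for i j
 have fin: "finite I" "finite J" using F by (auto simp: I_def J_def)
 have C: "C \<ge> 0" using row[of "{}"] by simp
 have WW: "(\<Sum>i\<in>I. (W i)\<^sup>2) = (L2_set (\<lambda>ka. cmod (w ka)) F)\<^sup>2"
  using F by (simp add: W_def L2_set_def sum_nonneg I_def Fi_def sum.image_gen[of F _ p])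
 have ZZ: "(\<Sum>j\<in>J. (Z j)\<^sup>2) = (L2_set (\<lambda>ka. cmod (z ka)) F')\<^sup>2"
  using F by (simp add: Z_def L2_set_def sum_nonneg J_def Fj_def sum.image_gen[of F' _ q])
 have "(\<Sum>ka\<in>F. \<Sum>ka'\<in>F'. w ka * K ka ka' * z ka') =
   (\<Sum>i\<in>I. \<Sum>ka\<in>Fi i. \<Sum>j\<in>J. \<Sum>ka'\<in>Fj j. w ka * K ka ka' * z ka')"
  using F unfolding I_def J_def Fi_def Fj_def
  by (subst sum.image_gen[of F _ p], simp, subst sum.image_gen[of F' _ q]) auto
 also have "... = (\<Sum>i\<in>I. \<Sum>j\<in>J. \<Sum>ka\<in>Fi i. \<Sum>ka'\<in>Fj j. w ka * K ka ka' * z ka')"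
  by (intro sum.cong refl sum.swap)
 finally have "cmod (\<Sum>ka\<in>F. \<Sum>ka'\<in>F'. w ka * K ka ka' * z ka')
   \<le> (\<Sum>i\<in>I. \<Sum>j\<in>J. cmod (\<Sum>ka\<in>Fi i. \<Sum>ka'\<in>Fj j. w ka * K ka ka' * z ka'))"
  by (simp only:) (intro order_trans[OF norm_sum] sum_mono order_refl)
 also have "... \<le> (\<Sum>i\<in>I. \<Sum>j\<in>J. bt i j * (W i * Z j))" unfolding W_def Z_def
  using F by (intro sum_mono opboundD[OF blk]) (auto simp: Fi_def Fj_def)
 \<comment> \<open>Each block norm is split into two square roots, so that Cauchy-Schwarz over pairs
   of blocks leaves the row sums with \<open>W\<close> and the column sums with
   \<open>Z\<close>.\<close>
 also have "... = (\<Sum>ij\<in>I \<times> J. \<bar>sqrt (bt (fst ij) (snd ij)) * W (fst ij)\<bar> * \<bar>sqrt (bt (fst ij) (snd ij)) * Z (snd ij)\<bar>)"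
  unfolding sum.cartesian_product
  by (intro sum.cong refl) (auto simp: abs_mult nn W_def Z_def L2_set_nonneg algebra_simps)
 also have "... \<le> L2_set (\<lambda>ij. sqrt (bt (fst ij) (snd ij)) * W (fst ij)) (I \<times> J) *
   L2_set (\<lambda>ij. sqrt (bt (fst ij) (snd ij)) * Z (snd ij)) (I \<times> J)" by (rule L2_set_mult_ineq)
 also have "... \<le> (sqrt C * L2_set (\<lambda>ka. cmod (w ka)) F) * (sqrt C * L2_set (\<lambda>ka. cmod (z ka)) F')"
 proof (intro mult_mono)
  have "(\<Sum>ij\<in>I \<times> J. (sqrt (bt (fst ij) (snd ij)) * W (fst ij))\<^sup>2) = (\<Sum>i\<in>I. (\<Sum>j\<in>J. bt i j) * (W i)\<^sup>2)"
   by (simp add: power_mult_distrib nn sum.cartesian_product' sum_distrib_right)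
  also have "... \<le> (\<Sum>i\<in>I. C * (W i)\<^sup>2)" by (intro sum_mono mult_right_mono row fin) auto
  also have "... = (sqrt C * L2_set (\<lambda>ka. cmod (w ka)) F)\<^sup>2"
   using C by (simp add: WW power_mult_distrib flip: sum_distrib_left)
  finally show "L2_set (\<lambda>ij. sqrt (bt (fst ij) (snd ij)) * W (fst ij)) (I \<times> J) \<le> sqrt C * L2_set (\<lambda>ka. cmod (w ka)) F"
   using C by (subst L2_set_def) (intro real_le_lsqrt, auto intro: sum_nonneg L2_set_nonneg)
  have "(\<Sum>ij\<in>I \<times> J. (sqrt (bt (fst ij) (snd ij)) * Z (snd ij))\<^sup>2) = (\<Sum>j\<in>J. (\<Sum>i\<in>I. bt i j) * (Z j)\<^sup>2)"
   by (simp add: power_mult_distrib nn sum.cartesian_product' sum_distrib_right sum.swap[of _ I J])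
  also have "... \<le> (\<Sum>j\<in>J. C * (Z j)\<^sup>2)" by (intro sum_mono mult_right_mono col fin) auto
  also have "... = (sqrt C * L2_set (\<lambda>ka. cmod (z ka)) F')\<^sup>2"
   using C by (simp add: ZZ power_mult_distrib flip: sum_distrib_left)
  finally show "L2_set (\<lambda>ij. sqrt (bt (fst ij) (snd ij)) * Z (snd ij)) (I \<times> J) \<le> sqrt C * L2_set (\<lambda>ka. cmod (z ka)) F'"
   using C by (subst L2_set_def) (intro real_le_lsqrt, auto intro: sum_nonneg L2_set_nonneg)
 qed (use C in \<open>auto intro!: L2_set_nonneg mult_nonneg_nonneg\<close>)
 also have "... = C * (L2_set (\<lambda>ka. cmod (w ka)) F * L2_set (\<lambda>ka. cmod (z ka)) F')"
  using C by (simp add: algebra_simps flip: real_sqrt_mult)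
 finally show "cmod (\<Sum>ka\<in>F. \<Sum>ka'\<in>F'. w ka * K ka ka' * z ka') \<le>
   C * (L2_set (\<lambda>ka. cmod (w ka)) F * L2_set (\<lambda>ka'. cmod (z ka')) F')" .
qed

section \<open>Localisation of the frequency variable to a cube\<close>

text \<open>Functionals of the form \<open>v \<mapsto> \<Sum>\<^sub>i c\<^sub>i \<bar>\<Sum>\<^bsub>\<kappa> \<in> F\<^sub>i\<^esub> v\<^sub>\<kappa>\<bar>\<close> with \<open>F\<^sub>i \<subseteq> F\<close> and \<open>\<Sum>\<^sub>i c\<^sub>i \<le> C\<close>.\<close>

inductive subsum_functional :: "'a set => real => (('a => complex) => real) => bool" where
 base: "finite F ==> subsum_functional F 1 (\<lambda>v. cmod (\<Sum>ka\<in>F. v ka))"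
| zero: "finite F ==> subsum_functional F 0 (\<lambda>v. 0)"
| subset: "subsum_functional G C Ph ==> 0 \<le> C ==> G \<subseteq> F ==> finite F ==> subsum_functional F C Ph"
| scale: "subsum_functional F C Ph ==> r \<ge> 0 ==> subsum_functional F (r * C) (\<lambda>v. r * Ph v)"
| add: "subsum_functional F C Ph ==> subsum_functional F D Ps ==> subsum_functional F (C + D) (\<lambda>v. Ph v + Ps v)"

lemma subsum_functional_sum:
 assumes "finite J" "finite F" "\<And>j. j \<in> J ==> subsum_functional F (C j) (Ph j)"
 shows "subsum_functional F (\<Sum>j\<in>J. C j) (\<lambda>v. \<Sum>j\<in>J. Ph j v)"
 using assms by (induction J) (auto intro: subsum_functional.intros)

text \<open>Parseval's identity for a trigonometric polynomial; the frequencies are the elements of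
  \<open>F\<close>, hence distinct.\<close>

lemma has_mean_norm_square:
 assumes "finite F"
 shows "has_mean (\<lambda>x::'a::euclidean_space. of_real ((cmod (\<Sum>ka\<in>F. z ka * character ka x))\<^sup>2))
  (of_real (\<Sum>ka\<in>F. (cmod (z ka))\<^sup>2))"
proof -
 let ?f = "\<lambda>x::'a. \<Sum>ka\<in>F. z ka * character ka x"
 have f: "trig_polynomial ?f" using trig_polynomialI[OF assms] .
 have eq: "(\<Sum>ka\<in>F. cnj (z ka) * ap_coeff ?f ka) = of_real (\<Sum>ka\<in>F. (cmod (z ka))\<^sup>2)"
  unfolding ap_coeff_trig_polynomial[OF assms] of_real_sum
  by (intro sum.cong refl) (simp add: complex_norm_square mult.commute del: of_real_power)
 have "has_mean (\<lambda>x. \<Sum>ka\<in>F. cnj (z ka) * (?f x * character (- ka) x)) (\<Sum>ka\<in>F. cnj (z ka) * ap_coeff ?f ka)"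
  unfolding ap_coeff_def
  by (intro has_mean_sum[OF assms] has_mean_cmult almost_periodic_mean almost_periodic_mult_character
    almost_periodic_trig_polynomial f)
 also have "(\<lambda>x. \<Sum>ka\<in>F. cnj (z ka) * (?f x * character (- ka) x)) = (\<lambda>x. of_real ((cmod (?f x))\<^sup>2))"
 proof
  fix x
  have "(\<Sum>ka\<in>F. cnj (z ka) * (?f x * character (- ka) x)) = ?f x * (\<Sum>ka\<in>F. cnj (z ka) * character (- ka) x)"
   by (subst sum_distrib_left) (intro sum.cong refl, simp add: algebra_simps)
  also have "... = ?f x * cnj (?f x)" by (simp add: cnj_character)
  finally show "(\<Sum>ka\<in>F. cnj (z ka) * (?f x * character (- ka) x)) = of_real ((cmod (?f x))\<^sup>2)"
   by (simp add: complex_norm_square del: of_real_power)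
 qed
 finally show ?thesis unfolding eq .
qed

text \<open>The product to be estimated involves absolute values, whose mean is not computed. It is
  dominated by a combination \<open>R\<close> of squares, whose mean Parseval's identity provides;
  only this majorant is carried through the induction over the shape of \<open>Ph\<close>.\<close>

lemma subsum_functional_mean:
 fixes w :: "'a::euclidean_space => complex"
 assumes "subsum_functional F' C Ph" "finite F"
 shows "\<exists>R \<rho>. has_mean (\<lambda>x. of_real (R x)) (of_real \<rho>) \<and>
  \<rho> \<le> C * (L2_set (\<lambda>ka. cmod (w ka)) F * L2_set (\<lambda>ka. cmod (z ka)) F') \<and>
  (\<forall>x. cmod (\<Sum>ka\<in>F. w ka * character (- ka) x) * Ph (\<lambda>ka. z ka * character ka x) \<le> R x)"
 using assms(1)
proof induction
 case (base G)
 let ?w = "L2_set (\<lambda>ka. cmod (w ka)) F" and ?z = "L2_set (\<lambda>ka. cmod (z ka)) G"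
 let ?g = "\<lambda>x. \<Sum>ka\<in>F. w ka * character (- ka) x" and ?f = "\<lambda>x. \<Sum>ka\<in>G. z ka * character ka x"
 show ?case
 \<comment> \<open>The weights of the majorant divide by both norms, so the degenerate case, in
   which one of the polynomials vanishes identically, is treated separately.\<close>
 proof (cases "?w = 0 \<or> ?z = 0")
  case True
  then have "(\<forall>x. ?g x = 0) \<or> (\<forall>x. ?f x = 0)"
   using assms(2) base by (auto simp: L2_set_eq_0_iff)
  then show ?thesis using has_mean_const[of 0] True by (intro exI[of _ "\<lambda>_. 0"] exI[of _ 0]) auto
 next
  case False
  then have pos: "?w > 0" "?z > 0" using L2_set_nonneg by (metis less_eq_real_def)+
  have g2: "has_mean (\<lambda>x. of_real ((cmod (?g x))\<^sup>2)) (of_real (?w\<^sup>2))"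
  proof -
   have "(\<Sum>ka\<in>F. cnj (w ka) * character ka x) = cnj (?g x)" for x by (simp add: cnj_character)
   then have "cmod (\<Sum>ka\<in>F. cnj (w ka) * character ka x) = cmod (?g x)" for x
    by (simp only: complex_mod_cnj)
   then show ?thesis using has_mean_norm_square[OF assms(2), of "\<lambda>ka. cnj (w ka)"]
    by (simp only: complex_mod_cnj) (simp add: L2_set_def sum_nonneg)
  qed
  have f2: "has_mean (\<lambda>x. of_real ((cmod (?f x))\<^sup>2)) (of_real (?z\<^sup>2))"
   using has_mean_norm_square[OF base, of z] by (simp add: L2_set_def sum_nonneg)
  \<comment> \<open>The weights in the inequality of arithmetic and geometric means are chosen so
    that the means of the two terms are equal and add up to exactly \<open>?w * ?z\<close>.\<close>
  let ?R = "\<lambda>x. ?z / (2 * ?w) * (cmod (?g x))\<^sup>2 + ?w / (2 * ?z) * (cmod (?f x))\<^sup>2"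
  let ?\<rho> = "?z / (2 * ?w) * ?w\<^sup>2 + ?w / (2 * ?z) * ?z\<^sup>2"
  have h1: "has_mean (\<lambda>x. of_real (?R x)) (of_real ?\<rho>)"
   unfolding of_real_add of_real_mult[of "?z / (2 * ?w)"] of_real_mult[of "?w / (2 * ?z)"]
   by (intro has_mean_add has_mean_cmult g2 f2)
  have h2: "?\<rho> = 1 * (?w * ?z)" using pos by (simp add: power2_eq_square)
  have h3: "cmod (?g x) * cmod (?f x) \<le> ?R x" for x
  proof -
   define a b where "a = cmod (?g x)" and "b = cmod (?f x)"
   have "0 \<le> (a * ?z - b * ?w)\<^sup>2 / (2 * ?w * ?z)" using pos by (intro divide_nonneg_pos) auto
   also have "... = ?z / (2 * ?w) * a\<^sup>2 + ?w / (2 * ?z) * b\<^sup>2 - a * b"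
    using pos by (simp add: field_simps power2_eq_square)
   finally show ?thesis by (simp add: a_def b_def)
  qed
  show ?thesis by (intro exI[of _ ?R] exI[of _ ?\<rho>] conjI allI) (rule h1 eq_refl[OF h2] h3)+
 qed
next
 case (zero G)
 then show ?case using has_mean_const[of 0] by (intro exI[of _ "\<lambda>_. 0"] exI[of _ 0]) auto
next
 case (subset G C Ph H)
 then obtain R \<rho> where R: "has_mean (\<lambda>x. of_real (R x)) (of_real \<rho>)"
  "\<rho> \<le> C * (L2_set (\<lambda>ka. cmod (w ka)) F * L2_set (\<lambda>ka. cmod (z ka)) G)"
  "\<forall>x. cmod (\<Sum>ka\<in>F. w ka * character (- ka) x) * Ph (\<lambda>ka. z ka * character ka x) \<le> R x" by blast
 have "L2_set (\<lambda>ka. cmod (z ka)) G \<le> L2_set (\<lambda>ka. cmod (z ka)) H"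
  unfolding L2_set_def using subset by (intro real_sqrt_le_mono sum_mono2) auto
 then have "\<rho> \<le> C * (L2_set (\<lambda>ka. cmod (w ka)) F * L2_set (\<lambda>ka. cmod (z ka)) H)"
  using R(2) \<open>0 \<le> C\<close> by (meson L2_set_nonneg mult_left_mono order_trans)
 with R show ?case by blast
next
 case (scale G C Ph r)
 then obtain R \<rho> where R: "has_mean (\<lambda>x. of_real (R x)) (of_real \<rho>)"
  "\<rho> \<le> C * (L2_set (\<lambda>ka. cmod (w ka)) F * L2_set (\<lambda>ka. cmod (z ka)) G)"
  "\<And>x. cmod (\<Sum>ka\<in>F. w ka * character (- ka) x) * Ph (\<lambda>ka. z ka * character ka x) \<le> R x" by blast
 have "has_mean (\<lambda>x. of_real (r * R x)) (of_real (r * \<rho>))" using has_mean_cmult[OF R(1), of r] by simp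
 moreover have "r * \<rho> \<le> r * C * (L2_set (\<lambda>ka. cmod (w ka)) F * L2_set (\<lambda>ka. cmod (z ka)) G)"
  using mult_left_mono[OF R(2) \<open>r \<ge> 0\<close>] by (simp add: algebra_simps)
 moreover have "cmod (\<Sum>ka\<in>F. w ka * character (- ka) x) * (r * Ph (\<lambda>ka. z ka * character ka x)) \<le> r * R x" for x
  using mult_left_mono[OF R(3)[of x] \<open>r \<ge> 0\<close>] by (simp add: algebra_simps)
 ultimately show ?case by (intro exI[of _ "\<lambda>x. r * R x"] exI[of _ "r * \<rho>"]) blast
next
 case (add G C Ph D Ps)
 let ?n = "L2_set (\<lambda>ka. cmod (w ka)) F * L2_set (\<lambda>ka. cmod (z ka)) G"
 let ?g = "\<lambda>x. \<Sum>ka\<in>F. w ka * character (- ka) x"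
 from add obtain R \<rho> where R: "has_mean (\<lambda>x. of_real (R x)) (of_real \<rho>)" "\<rho> \<le> C * ?n"
  "\<And>x. cmod (?g x) * Ph (\<lambda>ka. z ka * character ka x) \<le> R x" by blast
 from add obtain R' \<rho>' where R': "has_mean (\<lambda>x. of_real (R' x)) (of_real \<rho>')" "\<rho>' \<le> D * ?n"
  "\<And>x. cmod (?g x) * Ps (\<lambda>ka. z ka * character ka x) \<le> R' x" by blast
 have "has_mean (\<lambda>x. of_real (R x + R' x)) (of_real (\<rho> + \<rho>'))"
  using has_mean_add[OF R(1) R'(1)] by simp
 moreover have "\<rho> + \<rho>' \<le> (C + D) * ?n" using R(2) R'(2) by (simp add: algebra_simps)
 moreover have "cmod (?g x) * (Ph (\<lambda>ka. z ka * character ka x) + Ps (\<lambda>ka. z ka * character ka x)) \<le> R x + R' x" for x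
  using R(3)[of x] R'(3)[of x] by (simp add: algebra_simps)
 ultimately show ?case by (intro exI[of _ "\<lambda>x. R x + R' x"] exI[of _ "\<rho> + \<rho>'"]) blast
qed


text \<open>\<open>H al\<close> stands for the partial derivative of \<open>H []\<close> along the
  list \<open>al\<close>, the last differentiation being the head. Only derivatives along coordinate
  lines are recorded.\<close>

definition deriv_family :: "('a::euclidean_space list => 'a => complex) => bool" where
 "deriv_family H \<longleftrightarrow> (\<forall>al\<in>lists Basis. \<forall>e\<in>Basis. \<forall>xi.
  ((\<lambda>t. H al (xi + t *\<^sub>R e)) has_vector_derivative H (e # al) xi) (at 0))"

lemma line_deriv_bound:
 fixes f :: "'a::real_vector => 'b::real_normed_vector"
 assumes "\<And>x. ((\<lambda>t. f (x + t *\<^sub>R v)) has_vector_derivative f' x) (at 0)"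
  and "\<And>t. a \<le> t ==> t \<le> b ==> norm (f' (x + t *\<^sub>R v)) \<le> B" and "a \<le> b"
 shows "norm (f (x + b *\<^sub>R v) - f (x + a *\<^sub>R v)) \<le> B * (b - a)"
proof -
 have "norm (f (x + b *\<^sub>R v) - f (x + a *\<^sub>R v)) \<le> B * norm (b - a)"
 proof (rule differentiable_bound[of "{a..b}" "\<lambda>t. f (x + t *\<^sub>R v)" "\<lambda>t h. h *\<^sub>R f' (x + t *\<^sub>R v)"])
  fix t assume t: "t \<in> {a..b}"
  show "((\<lambda>t. f (x + t *\<^sub>R v)) has_derivative (\<lambda>h. h *\<^sub>R f' (x + t *\<^sub>R v))) (at t within {a..b})"
   using line_deriv_shift[OF assms(1)] by (auto simp: has_vector_derivative_def intro: has_derivative_at_withinI)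
  show "onorm (\<lambda>h. h *\<^sub>R f' (x + t *\<^sub>R v)) \<le> B"
   using assms(2)[of t] t by (intro onorm_le) (auto simp: mult.commute[of B] mult_left_mono)
 qed (use assms in auto)
 with \<open>a \<le> b\<close> show ?thesis by simp
qed

lemma deriv_family_difference:
 fixes H :: "'a::euclidean_space list => 'a => complex"
 assumes "deriv_family H"
 shows "deriv_family (\<lambda>al xi. H al (xi + u) - H al (xi + v))" unfolding deriv_family_def
proof (intro ballI allI)
 fix al e xi assume "al \<in> lists (Basis::'a set)" "e \<in> (Basis::'a set)"
 then have "((\<lambda>t. H al (et + t *\<^sub>R e)) has_vector_derivative H (e # al) et) (at 0)" for et
  using assms by (auto simp: deriv_family_def)
 from has_vector_derivative_diff[OF this[of "xi + u"] this[of "xi + v"]]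
 show "((\<lambda>t. H al (xi + t *\<^sub>R e + u) - H al (xi + t *\<^sub>R e + v)) has_vector_derivative
   H (e # al) (xi + u) - H (e # al) (xi + v)) (at 0)" by (simp add: algebra_simps)
qed

text \<open>Part of the cube with corner \<open>c\<close> and side \<open>L\<close>: the directions
  in \<open>B\<close> are free and the others stay at the corner. Induction over \<open>B\<close>
  grows the corner to the whole cube.\<close>

definition face :: "'a::euclidean_space => real => 'a set => 'a set" where
 "face c L B = {xi. \<forall>b\<in>Basis. if b \<in> B then c \<bullet> b \<le> xi \<bullet> b \<and> xi \<bullet> b \<le> c \<bullet> b + L else xi \<bullet> b = c \<bullet> b}"

definition face_proj :: "'a::euclidean_space => 'a set => 'a => 'a" where
 "face_proj c B ka = c + (\<Sum>b\<in>B. ((ka - c) \<bullet> b) *\<^sub>R b)"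

text \<open>The points of the jumps come from \<open>X\<close> alone, and \<open>g\<close> enters
  linearly. In a sum over many \<open>x\<close> with coefficients, a jump of \<open>g\<close>
  therefore multiplies the coefficients of one fixed subset, the points beyond the threshold; such
  subset sums are what \<open>subsum_functional\<close> is made of.\<close>

lemma telescope_sorted:
 fixes g :: "real => 'b::ab_group_add"
 assumes "finite X" "x \<in> X" "m \<in> X" "\<And>y. y \<in> X ==> m \<le> y"
 defines "ss \<equiv> sorted_list_of_set X"
 shows "g x = g m + (\<Sum>j<length ss - 1. if ss ! Suc j \<le> x then g (ss ! Suc j) - g (ss ! j) else 0)"
proof -
 have ss: "sorted_wrt (<) ss" "set ss = X" using assms by (auto simp: ss_def)
 obtain i where i: "i < length ss" "ss ! i = x" using ss(2) \<open>x \<in> X\<close> by (metis in_set_conv_nth)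
 have mono: "ss ! a < ss ! b \<longleftrightarrow> a < b" if "a < length ss" "b < length ss" for a b
  using ss(1) that by (metis linorder_neqE_nat order_less_asym order_less_irrefl sorted_wrt_nth_less)
 have m0: "ss ! 0 = m"
 proof -
  obtain k where k: "k < length ss" "ss ! k = m" using ss(2) \<open>m \<in> X\<close> by (metis in_set_conv_nth)
  have "m \<le> ss ! 0" using assms(4) ss(2) i(1) by (metis nth_mem length_pos_if_in_set ss(2) \<open>x \<in> X\<close>)
  moreover have "ss ! 0 < ss ! k" if "k \<noteq> 0" using mono[OF _ k(1), of 0] k(1) that by linarith
  ultimately show ?thesis using k by (cases "k = 0") auto
 qed
 have "(\<Sum>j<length ss - 1. if ss ! Suc j \<le> x then g (ss ! Suc j) - g (ss ! j) else 0)
   = (\<Sum>j<i. g (ss ! Suc j) - g (ss ! j))"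
 proof (rule sum.mono_neutral_cong_right)
  have above: "\<not> ss ! Suc j \<le> x" if "j < length ss - 1" "\<not> j < i" for j
  proof -
   have "Suc j < length ss" "i < Suc j" using that by linarith+
   then show ?thesis using mono[OF i(1), of "Suc j"] i(2) by simp
  qed
  then show "\<forall>j\<in>{..<length ss - 1} - {..<i}. (if ss ! Suc j \<le> x then g (ss ! Suc j) - g (ss ! j) else 0) = 0"
   by simp
  have below: "ss ! Suc j \<le> x" if "j < i" for j
  proof -
   have "Suc j < length ss" "\<not> i < Suc j" using that i(1) by linarith+
   then show ?thesis using mono[OF i(1), of "Suc j"] i(2) by simp
  qed
  then show "(if ss ! Suc j \<le> x then g (ss ! Suc j) - g (ss ! j) else 0) = g (ss ! Suc j) - g (ss ! j)"
   if "j \<in> {..<i}" for j using that by simp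
 qed (use i in auto)
 also have "... = g x - g m" using sum_lessThan_telescope[of "\<lambda>j. g (ss ! j)" i] i m0 by simp
 finally show ?thesis by simp
qed

lemma sum_sorted_gaps:
 assumes "finite X" "X \<subseteq> {0..L}" "0 \<in> X"
 defines "ss \<equiv> sorted_list_of_set (X::real set)"
 shows "(\<Sum>j<length ss - 1. ss ! Suc j - ss ! j) \<le> L"
proof -
 have "set ss = X" "ss \<noteq> []" using assms by (auto simp: ss_def)
 then have "ss ! 0 \<in> X" "ss ! (length ss - 1) \<in> X" by (auto intro: nth_mem)
 then have "0 \<le> ss ! 0" "ss ! (length ss - 1) \<le> L" using assms(2) by auto
 then show ?thesis unfolding sum_lessThan_telescope by linarith
qed

text \<open>The iterated fundamental theorem of calculus in telescoping form: the functional \<open>\<Phi>\<close> does not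
  depend on the function \<open>H []\<close>, so that it can be used simultaneously for all \<open>x\<close>.\<close>

lemma cube_subsum_functional:
 fixes c :: "'a::euclidean_space"
 assumes "finite B" "B \<subseteq> Basis" "L > 0" "finite F"
  and "\<And>ka b. ka \<in> F ==> b \<in> B ==> c \<bullet> b \<le> ka \<bullet> b \<and> ka \<bullet> b \<le> c \<bullet> b + L"
 shows "\<exists>Ph C. C \<le> 2 ^ card B \<and> 0 \<le> C \<and> subsum_functional F C Ph \<and>
  (\<forall>H M v. deriv_family H \<longrightarrow>
   (\<forall>al\<in>lists Basis. length al \<le> card B \<longrightarrow> (\<forall>xi\<in>face c L B. cmod (H al xi) \<le> M / L ^ length al)) \<longrightarrow>
   cmod (\<Sum>ka\<in>F. H [] (face_proj c B ka) * v ka) \<le> M * Ph v)" using assms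
proof (induction B arbitrary: F rule: finite_induct)
 case empty
 show ?case
 proof (intro exI[of _ "\<lambda>v. cmod (\<Sum>ka\<in>F. v ka)"] exI[of _ 1] conjI allI impI)
  show "subsum_functional F 1 (\<lambda>v. cmod (\<Sum>ka\<in>F. v ka))" by (rule subsum_functional.base) fact
  fix H M and v :: "'a => complex"
  assume *: "\<forall>al\<in>lists Basis. length al \<le> card ({}::'a set) \<longrightarrow> (\<forall>xi\<in>face c L {}. cmod (H al xi) \<le> M / L ^ length al)"
  have "c \<in> face c L {}" by (auto simp: face_def)
  with * have "cmod (H [] c) \<le> M" by force
  then have "cmod (H [] c) * cmod (\<Sum>ka\<in>F. v ka) \<le> M * cmod (\<Sum>ka\<in>F. v ka)" by (intro mult_right_mono) auto
  then show "cmod (\<Sum>ka\<in>F. H [] (face_proj c {} ka) * v ka) \<le> M * cmod (\<Sum>ka\<in>F. v ka)"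
   by (simp add: face_proj_def norm_mult flip: sum_distrib_left)
 qed auto
next
 case (insert e B)
 then have e: "e \<in> Basis" "e \<notin> B" "B \<subseteq> Basis" by auto
 define s where "s ka = (ka - c) \<bullet> e" for ka
 \<comment> \<open>The coordinates along \<open>e\<close> of the finitely many frequencies, measured
   from the corner; \<open>0\<close> is added so that the telescoping starts on the face where
   \<open>e\<close> is frozen.\<close>
 define X where "X = insert 0 (s ` F)"
 define ss where "ss = sorted_list_of_set X"
 have X: "finite X" "X \<subseteq> {0..L}" "0 \<in> X"
  using insert.prems by (force simp: X_def s_def inner_diff_left)+
 have setss: "set ss = X" and sorted: "sorted ss" using X by (auto simp: ss_def)
 define n where "n = length ss - 1"
 have nth: "ss ! j \<in> {0..L}" if "j \<le> n" for j
 proof -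
  have "ss \<noteq> []" using setss X by auto
  then have "j < length ss" using that by (simp add: n_def less_Suc_eq_le[symmetric])
  then show ?thesis using setss X(2) nth_mem by blast
 qed
 have gap: "ss ! j \<le> ss ! Suc j" if "j < n" for j using that sorted by (auto simp: n_def intro!: sorted_nth_mono)
 \<comment> \<open>The increment over the \<open>j\<close>-th gap enters exactly for these
   frequencies.\<close>
 define G where "G j = {ka\<in>F. ss ! Suc j \<le> s ka}" for j
 have fG: "finite (G j)" for j using insert.prems by (auto simp: G_def)
 have IH0: "\<exists>Ph C. C \<le> 2 ^ card B \<and> 0 \<le> C \<and> subsum_functional F' C Ph \<and>
  (\<forall>H M v. deriv_family H \<longrightarrow>
   (\<forall>al\<in>lists Basis. length al \<le> card B \<longrightarrow> (\<forall>xi\<in>face c L B. cmod (H al xi) \<le> M / L ^ length al)) \<longrightarrow>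
   cmod (\<Sum>ka\<in>F'. H [] (face_proj c B ka) * v ka) \<le> M * Ph v)"
  if "F' \<subseteq> F" for F' using insert.prems that finite_subset[OF that] by (intro insert.IH) auto
 obtain Ph0 C0 where C0: "C0 \<le> 2 ^ card B" "0 \<le> C0" "subsum_functional F C0 Ph0"
  and Ph0: "\<And>H M v. deriv_family H ==>
   (\<forall>al\<in>lists Basis. length al \<le> card B \<longrightarrow> (\<forall>xi\<in>face c L B. cmod (H al xi) \<le> M / L ^ length al)) ==>
   cmod (\<Sum>ka\<in>F. H [] (face_proj c B ka) * v ka) \<le> M * Ph0 v" using IH0[of F] by auto
 have "\<forall>j. \<exists>Ph C. C \<le> 2 ^ card B \<and> 0 \<le> C \<and> subsum_functional (G j) C Ph \<and>
  (\<forall>H M v. deriv_family H \<longrightarrow>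
   (\<forall>al\<in>lists Basis. length al \<le> card B \<longrightarrow> (\<forall>xi\<in>face c L B. cmod (H al xi) \<le> M / L ^ length al)) \<longrightarrow>
   cmod (\<Sum>ka\<in>G j. H [] (face_proj c B ka) * v ka) \<le> M * Ph v)" by (intro allI IH0) (auto simp: G_def)
 then obtain Ph C where C: "\<And>j. C j \<le> 2 ^ card B" "\<And>j. 0 \<le> C j" "\<And>j. subsum_functional (G j) (C j) (Ph j)"
  and Ph: "\<And>j H M v. deriv_family H ==>
   (\<forall>al\<in>lists Basis. length al \<le> card B \<longrightarrow> (\<forall>xi\<in>face c L B. cmod (H al xi) \<le> M / L ^ length al)) ==>
   cmod (\<Sum>ka\<in>G j. H [] (face_proj c B ka) * v ka) \<le> M * Ph j v"
  unfolding choice_iff by (elim exE conjE) (auto intro: that)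
 define r where "r j = (ss ! Suc j - ss ! j) / L" for j
 have r: "r j \<ge> 0" if "j < n" for j using gap[OF that] \<open>L > 0\<close> by (simp add: r_def)
 have rsum: "(\<Sum>j<n. r j) \<le> 1"
  using sum_sorted_gaps[OF X] \<open>L > 0\<close> by (simp add: r_def n_def ss_def flip: sum_divide_distrib)
 let ?Ph = "\<lambda>v. Ph0 v + (\<Sum>j<n. r j * Ph j v)" and ?C = "C0 + (\<Sum>j<n. r j * C j)"
 have "?C \<le> 2 ^ card (insert e B)"
 proof -
  have "(\<Sum>j<n. r j * C j) \<le> (\<Sum>j<n. r j) * 2 ^ card B"
   unfolding sum_distrib_right using C r by (intro sum_mono mult_left_mono) auto
  also have "... \<le> 1 * 2 ^ card B" using rsum by (intro mult_right_mono) auto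
  finally show ?thesis using C0 insert.hyps by simp
 qed
 moreover have "0 \<le> ?C" using C0 C r by (auto intro!: add_nonneg_nonneg sum_nonneg)
 moreover have "subsum_functional F ?C ?Ph" using C0 C r insert.prems
  by (intro subsum_functional.add subsum_functional_sum subsum_functional.scale)
   (auto simp: G_def intro: subsum_functional.subset)
 moreover have "cmod (\<Sum>ka\<in>F. H [] (face_proj c (insert e B) ka) * v ka) \<le> M * ?Ph v"
  if H: "deriv_family H" and M: "\<forall>al\<in>lists Basis. length al \<le> card (insert e B) \<longrightarrow>
    (\<forall>xi\<in>face c L (insert e B). cmod (H al xi) \<le> M / L ^ length al)" for H M v
 proof -
  \<comment> \<open>The increment over the \<open>j\<close>-th gap is again a derivative family. By
    the mean value theorem one further derivative, bounded with one more factor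
    \<open>1 / L\<close>, is multiplied by the gap, so the induction hypothesis applies with
    \<open>M * r j\<close> in place of \<open>M\<close>.\<close>
  define D where "D j al xi = H al (xi + (ss ! Suc j) *\<^sub>R e) - H al (xi + (ss ! j) *\<^sub>R e)" for j al xi
  have face: "xi + t *\<^sub>R e \<in> face c L (insert e B)" if "xi \<in> face c L B" "0 \<le> t" "t \<le> L" for xi t
   using that e by (auto simp: face_def inner_add_left inner_Basis split: if_splits)
  have "xi \<in> face c L (insert e B)" if "xi \<in> face c L B" for xi
   using face[OF that, of 0] \<open>L > 0\<close> by simp
  then have b0: "cmod (\<Sum>ka\<in>F. H [] (face_proj c B ka) * v ka) \<le> M * Ph0 v"
   using M insert.hyps by (intro Ph0 H) auto
  have bj: "cmod (\<Sum>ka\<in>G j. D j [] (face_proj c B ka) * v ka) \<le> (M * r j) * Ph j v" if "j < n" for j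
  proof (rule Ph, unfold D_def, rule deriv_family_difference[OF H], intro ballI impI)
   fix al xi assume al: "al \<in> lists (Basis::'a set)" "length al \<le> card B" and xi: "xi \<in> face c L B"
   have "cmod (H al (xi + (ss ! Suc j) *\<^sub>R e) - H al (xi + (ss ! j) *\<^sub>R e))
     \<le> M / L ^ length (e # al) * (ss ! Suc j - ss ! j)"
   proof (rule line_deriv_bound)
    show "((\<lambda>t. H al (x + t *\<^sub>R e)) has_vector_derivative H (e # al) x) (at 0)" for x
     using H al e by (auto simp: deriv_family_def)
    fix t assume "ss ! j \<le> t" "t \<le> ss ! Suc j"
    then have "0 \<le> t" "t \<le> L" using nth[of j] nth[of "Suc j"] that by auto
    moreover have "e # al \<in> lists Basis" "length (e # al) \<le> card (insert e B)"
     using al e insert.hyps by auto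
    ultimately show "cmod (H (e # al) (xi + t *\<^sub>R e)) \<le> M / L ^ length (e # al)"
     using M face[OF xi] by blast
   qed (rule gap[OF that])
   also have "... = M * r j / L ^ length al" by (simp add: r_def)
   finally show "cmod (H al (xi + (ss ! Suc j) *\<^sub>R e) - H al (xi + (ss ! j) *\<^sub>R e)) \<le> M * r j / L ^ length al" .
  qed
  have proj: "face_proj c (insert e B) ka = face_proj c B ka + s ka *\<^sub>R e" for ka
   using insert.hyps by (simp add: face_proj_def s_def algebra_simps)
  have "H [] (face_proj c (insert e B) ka) = H [] (face_proj c B ka) +
    (\<Sum>j<n. if ss ! Suc j \<le> s ka then D j [] (face_proj c B ka) else 0)" if "ka \<in> F" for ka
   using telescope_sorted[of X "s ka" 0 "\<lambda>t. H [] (face_proj c B ka + t *\<^sub>R e)"] X that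
   unfolding proj D_def n_def ss_def by (auto simp: X_def subset_iff cong: if_cong)
  then have "(\<Sum>ka\<in>F. H [] (face_proj c (insert e B) ka) * v ka) =
    (\<Sum>ka\<in>F. H [] (face_proj c B ka) * v ka) +
    (\<Sum>ka\<in>F. \<Sum>j<n. if ss ! Suc j \<le> s ka then D j [] (face_proj c B ka) * v ka else 0)"
   by (simp add: ring_distribs sum.distrib sum_distrib_right if_distrib[of "\<lambda>x. x * _"] cong: if_cong)
  also have "(\<Sum>ka\<in>F. \<Sum>j<n. if ss ! Suc j \<le> s ka then D j [] (face_proj c B ka) * v ka else 0)
    = (\<Sum>j<n. \<Sum>ka\<in>G j. D j [] (face_proj c B ka) * v ka)"
   unfolding G_def using insert.prems by (subst sum.swap) (simp add: sum.inter_filter)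
  finally have "cmod (\<Sum>ka\<in>F. H [] (face_proj c (insert e B) ka) * v ka) \<le>
    cmod (\<Sum>ka\<in>F. H [] (face_proj c B ka) * v ka) +
    (\<Sum>j<n. cmod (\<Sum>ka\<in>G j. D j [] (face_proj c B ka) * v ka))"
   by (simp only:) (intro order_trans[OF norm_triangle_ineq] add_left_mono norm_sum)
  also have "... \<le> M * Ph0 v + (\<Sum>j<n. (M * r j) * Ph j v)" using b0 bj by (intro add_mono sum_mono) auto
  finally show ?thesis by (simp add: algebra_simps sum_distrib_left)
 qed
 ultimately show ?case by (intro exI[of _ ?Ph] exI[of _ ?C]) blast
qed

text \<open>The bilinear form is the mean in x of a product of two sums of characters, the second
  one with coefficients \<open>A [] x ka'\<close>. When the side of the cube matches the derivative
  bounds, the telescoped functional removes these coefficients at the price of \<open>M\<close>,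
  uniformly in x, and the rest is estimated in mean.\<close>

lemma opbound_cube:
 fixes A :: "'a::euclidean_space list => 'a => 'a => complex"
 assumes ap: "\<And>xi. almost_periodic (\<lambda>x. A [] x xi)"
  and fam: "\<And>x. deriv_family (\<lambda>al. A al x)"
  and bnd: "\<And>al x xi. al \<in> lists Basis ==> length al \<le> DIM('a) ==> xi \<in> face c L Basis ==>
   cmod (A al x xi) \<le> M / L ^ length al"
  and "L > 0" and S': "S' \<subseteq> face c L Basis"
 shows "opbound (\<lambda>ka ka'. ap_coeff (\<lambda>x. A [] x ka') (ka - ka')) UNIV S' (2 ^ DIM('a) * M)"
 unfolding opbound_def
proof (intro allI impI)
 fix F F' :: "'a set" and w z :: "'a => complex"
 assume F: "finite F" "finite F'" "F' \<subseteq> S'"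
 let ?n = "L2_set (\<lambda>ka. cmod (w ka)) F * L2_set (\<lambda>ka'. cmod (z ka')) F'"
 have box: "c \<bullet> b \<le> ka \<bullet> b \<and> ka \<bullet> b \<le> c \<bullet> b + L" if "ka \<in> F'" "b \<in> Basis" for ka b
  using that F S' by (force simp: face_def)
 obtain Ph C where C: "C \<le> 2 ^ DIM('a)" "0 \<le> C" "subsum_functional F' C Ph"
  and Ph: "\<And>H M v. deriv_family H ==>
   (\<forall>al\<in>lists Basis. length al \<le> DIM('a) \<longrightarrow> (\<forall>xi\<in>face c L Basis. cmod (H al xi) \<le> M / L ^ length al)) ==>
   cmod (\<Sum>ka\<in>F'. H [] (face_proj c Basis ka) * v ka) \<le> M * Ph v"
  using cube_subsum_functional[OF finite_Basis order_refl \<open>L > 0\<close> F(2), of c] box by blast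
 have proj: "face_proj c Basis ka = ka" for ka by (simp add: face_proj_def euclidean_representation)
 have "c \<in> face c L Basis" using \<open>L > 0\<close> by (auto simp: face_def)
 then have M: "M \<ge> 0" using bnd[of "[]" c 0] by (simp add: order_trans[OF norm_ge_zero])
 obtain R \<rho> where R: "has_mean (\<lambda>x. of_real (R x)) (of_real \<rho>)" "\<rho> \<le> C * ?n"
  "\<And>x. cmod (\<Sum>ka\<in>F. w ka * character (- ka) x) * Ph (\<lambda>ka. z ka * character ka x) \<le> R x"
  using subsum_functional_mean[OF C(3) F(1), of w z] by blast
 define h where "h x = (\<Sum>ka\<in>F. w ka * character (- ka) x) * (\<Sum>ka'\<in>F'. A [] x ka' * (z ka' * character ka' x))" for x
 have h_eq: "h = (\<lambda>x. \<Sum>ka\<in>F. \<Sum>ka'\<in>F'. (w ka * z ka') * (A [] x ka' * character (- (ka - ka')) x))"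
 proof
  fix x :: 'a
  have "character (- ka) x * character ka' x = character (- (ka - ka')) x" for ka ka'
   using character_add[of "- ka" ka' x] by simp
  then show "h x = (\<Sum>ka\<in>F. \<Sum>ka'\<in>F'. (w ka * z ka') * (A [] x ka' * character (- (ka - ka')) x))"
   unfolding h_def sum_product by (intro sum.cong refl) (simp add: algebra_simps)
 qed
 have mean_h: "has_mean h (\<Sum>ka\<in>F. \<Sum>ka'\<in>F'. (w ka * z ka') * ap_coeff (\<lambda>x. A [] x ka') (ka - ka'))"
  unfolding h_eq ap_coeff_def
  by (intro has_mean_sum F has_mean_cmult almost_periodic_mean almost_periodic_mult_character ap)
 have hR: "cmod (h x) \<le> M * R x" for x
 proof -
  have "cmod (h x) \<le> cmod (\<Sum>ka\<in>F. w ka * character (- ka) x) * (M * Ph (\<lambda>ka. z ka * character ka x))"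
   unfolding h_def norm_mult using Ph[OF fam[of x], of M "\<lambda>ka. z ka * character ka x"] bnd
   by (intro mult_left_mono) (auto simp: proj)
  also have "... = M * (cmod (\<Sum>ka\<in>F. w ka * character (- ka) x) * Ph (\<lambda>ka. z ka * character ka x))" by simp
  also have "... \<le> M * R x" using R(3) M by (intro mult_left_mono)
  finally show ?thesis .
 qed
 have "cmod (\<Sum>ka\<in>F. \<Sum>ka'\<in>F'. w ka * ap_coeff (\<lambda>x. A [] x ka') (ka - ka') * z ka')
   = cmod (\<Sum>ka\<in>F. \<Sum>ka'\<in>F'. (w ka * z ka') * ap_coeff (\<lambda>x. A [] x ka') (ka - ka'))"
  by (simp add: mult_ac)
 also have "... \<le> Re (of_real (M * \<rho>))"
  using has_mean_cmult[OF R(1), of M] by (intro has_mean_le[OF mean_h _ hR]) simp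
 also have "... \<le> M * (C * ?n)" using R(2) M by (simp add: mult_left_mono)
 also have "... \<le> M * (2 ^ DIM('a) * ?n)"
  using C M by (intro mult_left_mono mult_right_mono) (auto intro!: mult_nonneg_nonneg L2_set_nonneg)
 finally show "cmod (\<Sum>ka\<in>F. \<Sum>ka'\<in>F'. w ka * ap_coeff (\<lambda>x. A [] x ka') (ka - ka') * z ka') \<le> 2 ^ DIM('a) * M * ?n"
  by (simp add: mult_ac)
qed

section \<open>Symbols of type \<open>\<delta>, \<delta>\<close> act on weighted sequence spaces\<close>

lemma bracket_ge_1: "bracket xi \<ge> 1" by (simp add: bracket_def)

lemma bracket_pos [simp]: "bracket xi > 0" using bracket_ge_1[of xi] by linarith

lemma norm_le_bracket: "norm xi \<le> bracket xi" unfolding bracket_def by (rule real_le_rsqrt) simp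

lemma bracket_le_norm: "bracket xi \<le> 1 + norm xi"
 unfolding bracket_def by (rule real_le_lsqrt) (auto simp: power2_eq_square algebra_simps)

lemma bracket_lipschitz: "bracket (xi::'a::euclidean_space) \<le> bracket et + norm (xi - et)"
proof -
 have eq: "bracket x = norm (1::real, x)" for x :: 'a by (simp add: bracket_def norm_Pair)
 have "norm (1::real, xi) = norm ((1::real, et) + (0, xi - et))" by simp
 also have "... \<le> norm (1::real, et) + norm (0::real, xi - et)" by (rule norm_triangle_ineq)
 finally show ?thesis by (simp add: eq norm_Pair)
qed

lemma opbound_empty: "S = {} \<or> S' = {} ==> opbound K S S' 0" by (auto simp: opbound_def)

lemma opbound_flip:
 assumes "opbound K S S' C"
 shows "opbound (\<lambda>ka' ka. K ka ka') S' S C" unfolding opbound_def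
proof (intro allI impI)
 fix F F' w z assume F: "finite F" "F \<subseteq> S'" "finite F'" "F' \<subseteq> S"
 have "(\<Sum>ka'\<in>F. \<Sum>ka\<in>F'. w ka' * K ka ka' * z ka) = (\<Sum>ka\<in>F'. \<Sum>ka'\<in>F. z ka * K ka ka' * w ka')"
  by (subst sum.swap) (simp add: mult_ac)
 then show "cmod (\<Sum>ka'\<in>F. \<Sum>ka\<in>F'. w ka' * K ka ka' * z ka) \<le>
   C * (L2_set (\<lambda>ka. cmod (w ka)) F * L2_set (\<lambda>ka'. cmod (z ka')) F')"
  using opboundD[OF assms F(3,4,1,2), of z w] by (simp add: mult_ac)
qed

text \<open>A Sylvester equation with separated spectra: up to multiplication operators of small norm, \<open>K'\<close>
  is a multiple of \<open>K\<close>.\<close>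

lemma opbound_separated:
 fixes K :: "'a::euclidean_space => 'a => complex"
 assumes K': "\<And>ka ka'. K' ka ka' = \<i> * of_real (2 * pi * ((ka - ka') \<bullet> e)) * K ka ka'"
  and D0: "opbound K S S' D0" "D0 \<ge> 0" and D': "opbound K' S S' D'" "D' \<ge> 0"
  and S: "\<And>ka. ka \<in> S ==> u \<le> ka \<bullet> e \<and> ka \<bullet> e \<le> u + L"
  and S': "\<And>ka. ka \<in> S' ==> u' \<le> ka \<bullet> e \<and> ka \<bullet> e \<le> u' + L"
  and L: "L > 0" "\<bar>u - u'\<bar> \<ge> 2 * L"
 shows "opbound K S S' (D' / \<bar>u - u'\<bar>)"
proof -
 define r where "r = u - u'"
 have r: "\<bar>r\<bar> \<ge> 2 * L" "\<bar>r\<bar> > 0" "r \<noteq> 0" using L by (auto simp: r_def)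
 \<comment> \<open>The difference of the \<open>e\<close>-coordinates is \<open>r\<close> up to the
   deviations of \<open>ka\<close> and \<open>ka'\<close> from the midlines of their slabs. Each
   deviation is at most \<open>L / 2\<close>, so \<open>g\<close> and \<open>h\<close> are bounded
   by \<open>L / (2 * \<bar>r\<bar>) \<le> 1 / 4\<close>; together they cost half of the current
   bound and are absorbed.\<close>
 define f where "f = 1 / (2 * pi * \<i> * of_real r)"
 define g where "g ka = complex_of_real ((u + L / 2 - ka \<bullet> e) / r)" for ka
 define h where "h ka = complex_of_real ((ka \<bullet> e - (u' + L / 2)) / r)" for ka
 have eq: "K ka ka' = f * K' ka ka' + (g ka * K ka ka' + h ka' * K ka ka')" for ka ka'
 proof -
  have "f * K' ka ka' = complex_of_real ((ka - ka') \<bullet> e / r) * K ka ka'" by (simp add: f_def K' r(3))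
  moreover have "(ka - ka') \<bullet> e / r + ((u + L / 2 - ka \<bullet> e) / r + (ka' \<bullet> e - (u' + L / 2)) / r) = 1"
  proof -
   have "(ka - ka') \<bullet> e + ((u + L / 2 - ka \<bullet> e) + (ka' \<bullet> e - (u' + L / 2))) = r"
    by (simp add: r_def inner_diff_left)
   then show ?thesis using r(3) by (simp only: add_divide_distrib[symmetric]) simp
  qed
  then have "complex_of_real ((ka - ka') \<bullet> e / r) + (g ka + h ka') = 1"
   unfolding g_def h_def of_real_add[symmetric] by simp
  ultimately show ?thesis by (metis distrib_right mult_1)
 qed
 have f: "cmod f = 1 / (2 * pi * \<bar>r\<bar>)" by (simp add: f_def norm_divide norm_mult)
 have g: "cmod (g ka) \<le> L / (2 * \<bar>r\<bar>)" if "ka \<in> S" for ka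
 proof -
  have "\<bar>u + L / 2 - ka \<bullet> e\<bar> \<le> L / 2" using S[OF that] by (intro abs_leI) auto
  then show ?thesis using r unfolding g_def norm_of_real abs_divide
   by (simp add: divide_right_mono flip: divide_divide_eq_left)
 qed
 have h: "cmod (h ka) \<le> L / (2 * \<bar>r\<bar>)" if "ka \<in> S'" for ka
 proof -
  have "\<bar>ka \<bullet> e - (u' + L / 2)\<bar> \<le> L / 2" using S'[OF that] by (intro abs_leI) auto
  then show ?thesis using r unfolding h_def norm_of_real abs_divide
   by (simp add: divide_right_mono flip: divide_divide_eq_left)
 qed
 have "opbound K S S' (2 * (D' / (2 * pi * \<bar>r\<bar>)))"
 proof (rule opbound_absorb[OF D0])
  show "D' / (2 * pi * \<bar>r\<bar>) \<ge> 0" using D' by simp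
  fix D :: real assume D: "D \<ge> 0" "opbound K S S' D"
  have "opbound (\<lambda>ka ka'. f * K' ka ka' + (g ka * K ka ka' + h ka' * K ka ka')) S S'
    (1 / (2 * pi * \<bar>r\<bar>) * D' + (L / (2 * \<bar>r\<bar>) * D + L / (2 * \<bar>r\<bar>) * D))"
   using L(1) f by (intro opbound_add opbound_mult_left opbound_mult_right D D' g h) auto
  then have "opbound K S S' (1 / (2 * pi * \<bar>r\<bar>) * D' + (L / (2 * \<bar>r\<bar>) * D + L / (2 * \<bar>r\<bar>) * D))"
   by (rule opbound_cong) (rule eq)
  then show "opbound K S S' (D / 2 + D' / (2 * pi * \<bar>r\<bar>))"
  proof (rule opbound_mono)
   have "L / \<bar>r\<bar> * D \<le> 1 / 2 * D" using r D by (intro mult_right_mono) (auto simp: field_simps)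
   then show "1 / (2 * pi * \<bar>r\<bar>) * D' + (L / (2 * \<bar>r\<bar>) * D + L / (2 * \<bar>r\<bar>) * D) \<le> D / 2 + D' / (2 * pi * \<bar>r\<bar>)"
    by (simp add: field_simps)
  qed auto
 qed
 then show ?thesis
 proof (rule opbound_mono)
  have "D' / pi \<le> D'" using pi_ge_two D' by (simp add: divide_le_eq mult_le_cancel_left1)
  then have "D' / pi / \<bar>r\<bar> \<le> D' / \<bar>r\<bar>" by (intro divide_right_mono) auto
  then show "2 * (D' / (2 * pi * \<bar>r\<bar>)) \<le> D' / \<bar>u - u'\<bar>" by (simp add: r_def)
 qed auto
qed

text \<open>From \<open>Y e\<close> and \<open>ka' \<bullet> e\<close> the multiplication by
  \<open>ka \<bullet> e\<close> is recovered; the weights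
  \<open>(ka \<bullet> e) / (norm ka)\<^sup>2\<close> recombine these to the identity. The terms
  with \<open>ka' \<bullet> e\<close> have total size \<open>DIM('a) * r / R \<le> 1 / 2\<close> and
  are absorbed. The unit \<open>om\<close> admits both a matrix and its transpose, for which the
  commutator changes sign.\<close>

lemma opbound_far:
 fixes K :: "'a::euclidean_space => 'a => complex" and R r D0 D' :: real
 assumes Y: "\<And>e ka ka'. e \<in> Basis ==> Y e ka ka' = om * of_real (2 * pi * ((ka - ka') \<bullet> e)) * K ka ka'"
  and om: "cmod om = 1"
  and D0: "opbound K S S' D0" "D0 \<ge> 0"
  and D': "\<And>e. e \<in> Basis ==> opbound (Y e) S S' D'" "D' \<ge> 0"
  and S: "\<And>ka. ka \<in> S ==> R \<le> norm ka" and S': "\<And>ka. ka \<in> S' ==> norm ka \<le> r"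
  and R: "R > 0" "r \<ge> 0" "2 * real DIM('a) * r \<le> R"
 shows "opbound K S S' (DIM('a) * D' / (2 * R))"
proof -
 define f where "f e ka = complex_of_real (ka \<bullet> e / (norm ka)\<^sup>2)" for e ka :: 'a
 define c where "c = 1 / (of_real (2 * pi) * om)"
 have eq: "(\<Sum>e\<in>Basis. f e ka * (c * Y e ka ka' + of_real (ka' \<bullet> e) * K ka ka')) = K ka ka'" if "ka \<in> S" for ka ka'
 proof -
  have "c * Y e ka ka' + of_real (ka' \<bullet> e) * K ka ka' = of_real (ka \<bullet> e) * K ka ka'" if "e \<in> Basis" for e
  proof -
   have "om \<noteq> 0" using om by auto
   then have "c * Y e ka ka' = of_real ((ka - ka') \<bullet> e) * K ka ka'" by (simp add: c_def Y[OF that])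
   then show ?thesis by (simp add: inner_diff_left algebra_simps)
  qed
  then have "(\<Sum>e\<in>Basis. f e ka * (c * Y e ka ka' + of_real (ka' \<bullet> e) * K ka ka'))
    = (\<Sum>e\<in>Basis. of_real ((ka \<bullet> e) * (ka \<bullet> e) / (norm ka)\<^sup>2)) * K ka ka'"
   unfolding sum_distrib_right by (intro sum.cong refl) (simp add: f_def)
  also have "(\<Sum>e\<in>Basis. complex_of_real ((ka \<bullet> e) * (ka \<bullet> e) / (norm ka)\<^sup>2)) = of_real ((ka \<bullet> ka) / (norm ka)\<^sup>2)"
   unfolding euclidean_inner[of ka ka] of_real_sum sum_divide_distrib ..
  also have "... = 1" using S[OF that] R by (auto simp: power2_norm_eq_inner[symmetric])
  finally show ?thesis by simp
 qed
 have f: "cmod (f e ka) \<le> 1 / R" if "ka \<in> S" "e \<in> Basis" for e ka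
 proof -
  have n: "norm ka \<ge> R" "norm ka > 0" using S[OF that(1)] R by auto
  have "cmod (f e ka) \<le> norm ka / (norm ka)\<^sup>2"
   unfolding f_def using Basis_le_norm[OF that(2), of ka] by (simp add: norm_divide norm_power divide_right_mono)
  also have "... = 1 / norm ka" using n by (simp add: power2_eq_square)
  also have "... \<le> 1 / R" using n R by (simp add: frac_le)
  finally show ?thesis .
 qed
 have "cmod c \<le> 1 / 4" using om pi_ge_two by (simp add: c_def norm_divide norm_mult field_simps)
 note c = this
 have "opbound K S S' (2 * (DIM('a) * (1 / R * (1 / 4 * D'))))"
 proof (rule opbound_absorb[OF D0])
  show "real DIM('a) * (1 / R * (1 / 4 * D')) \<ge> 0" using R D' by simp
  fix D :: real assume D: "D \<ge> 0" "opbound K S S' D"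
  have "opbound (\<lambda>ka ka'. \<Sum>e\<in>Basis. f e ka * (c * Y e ka ka' + of_real (ka' \<bullet> e) * K ka ka')) S S'
   (\<Sum>e\<in>(Basis::'a set). 1 / R * (1 / 4 * D' + r * D))" using R D D' c f order_trans[OF Basis_le_norm S']
   by (intro opbound_sum opbound_mult_left opbound_add opbound_mult_right) auto
  then have "opbound K S S' (\<Sum>e\<in>(Basis::'a set). 1 / R * (1 / 4 * D' + r * D))"
   by (rule opbound_cong) (simp add: eq)
  then show "opbound K S S' (D / 2 + DIM('a) * (1 / R * (1 / 4 * D')))"
  proof (rule opbound_mono)
   have "DIM('a) * r / R * D \<le> 1 / 2 * D" using R D by (intro mult_right_mono) (auto simp: field_simps)
   moreover have "(\<Sum>e\<in>(Basis::'a set). 1 / R * (1 / 4 * D' + r * D)) = DIM('a) * (1 / R * (1 / 4 * D')) + DIM('a) * r / R * D"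
    by (simp add: algebra_simps)
   ultimately show "(\<Sum>e\<in>(Basis::'a set). 1 / R * (1 / 4 * D' + r * D)) \<le> D / 2 + DIM('a) * (1 / R * (1 / 4 * D'))"
    by linarith
  qed auto
 qed
 then show ?thesis by (simp add: mult_ac)
qed

section \<open>Summable decay over a lattice of cells\<close>

text \<open>Cells at index distance at most 1 lack the separation \<open>2 * L\<close> required by
  the Sylvester argument, so the trivial value 1 remains for them.\<close>

definition cell_decay :: "int => real" where
 "cell_decay k = (if \<bar>k\<bar> \<ge> 2 then 1 / (real_of_int k)\<^sup>2 else 1)"

lemma cell_decay_pos: "cell_decay k > 0" by (auto simp: cell_decay_def)

lemma cell_decay_minus: "cell_decay (a - b) = cell_decay (b - a)"
 by (simp add: cell_decay_def abs_minus_commute power2_commute)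

text \<open>Telescoping with \<open>1 / (N + 1)\<^sup>2 \<le> 1 / N - 1 / (N + 1)\<close>; the three
  central terms give \<open>3 = 5 - 2\<close>.\<close>

lemma sum_cell_decay_interval: "(\<Sum>k\<in>{- int (Suc n)..int (Suc n)}. cell_decay k) \<le> 5 - 2 / real (Suc n)"
proof (induction n)
 case 0
 have "{- 1..1::int} = {-1, 0, 1}" by auto
 then show ?case by (simp add: cell_decay_def)
next
 case (Suc n)
 define N where "N = real (Suc n)"
 have N: "N \<ge> 1" by (simp add: N_def)
 have "{- int (Suc (Suc n))..int (Suc (Suc n))} = insert (- int (Suc (Suc n))) (insert (int (Suc (Suc n))) {- int (Suc n)..int (Suc n)})"
  by auto
 then have "(\<Sum>k\<in>{- int (Suc (Suc n))..int (Suc (Suc n))}. cell_decay k)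
  = 2 / (N + 1)\<^sup>2 + (\<Sum>k\<in>{- int (Suc n)..int (Suc n)}. cell_decay k)"
  by (simp add: cell_decay_def N_def power2_eq_square algebra_simps)
 also have "... \<le> 2 / (N + 1)\<^sup>2 + (5 - 2 / N)" using Suc by (simp add: N_def)
 also have "... \<le> 5 - 2 / (N + 1)"
 proof -
  have "2 / (N + 1)\<^sup>2 \<le> 2 / (N * (N + 1))"
   using N by (intro divide_left_mono) (auto simp: power2_eq_square)
  also have "... = 2 / N - 2 / (N + 1)" using N by (simp add: field_simps)
  finally show ?thesis by simp
 qed
 finally show ?case by (simp add: N_def algebra_simps)
qed

lemma sum_cell_decay:
 assumes "finite J"
 shows "(\<Sum>k\<in>J. cell_decay (k - a)) \<le> 5"
proof -
 let ?J = "(\<lambda>k. k - a) ` J"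
 obtain n where n: "\<And>k. k \<in> ?J ==> \<bar>k\<bar> \<le> int n"
  using assms finite_nat_set_iff_bounded_le[of "(\<lambda>k. nat \<bar>k - a\<bar>) ` J"] by (auto simp: nat_le_iff)
 have "(\<Sum>k\<in>J. cell_decay (k - a)) = (\<Sum>k\<in>?J. cell_decay k)"
  by (subst sum.reindex) (auto simp: inj_on_def)
 also have "... \<le> (\<Sum>k\<in>{- int (Suc n)..int (Suc n)}. cell_decay k)"
  using n by (intro sum_mono2) (force intro: less_imp_le[OF cell_decay_pos])+
 also have "... \<le> 5" using sum_cell_decay_interval[of n] by (simp add: order_trans)
 finally show ?thesis .
qed

text \<open>Cells are indexed by functions on \<open>B\<close>. Extensionality keeps one function
  per cell, so the sum is part of a sum over a product set, which factors.\<close>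

lemma sum_prod_cell_decay:
 assumes "finite I" "finite B"
 shows "(\<Sum>i\<in>I. if i \<in> extensional B then (\<Prod>b\<in>B. cell_decay (i b - j b)) else 0) \<le> 5 ^ card B"
proof -
 let ?X = "\<lambda>b. (\<lambda>i. i b) ` I"
 have "(\<Sum>i\<in>I. if i \<in> extensional B then (\<Prod>b\<in>B. cell_decay (i b - j b)) else 0)
   = (\<Sum>i\<in>{i\<in>I. i \<in> extensional B}. \<Prod>b\<in>B. cell_decay (i b - j b))"
  using assms by (simp add: sum.inter_filter)
 also have "... \<le> (\<Sum>i\<in>PiE B ?X. \<Prod>b\<in>B. cell_decay (i b - j b))"
  using assms by (intro sum_mono2 finite_PiE) (auto simp: PiE_iff extensional_def intro!: prod_nonneg less_imp_le[OF cell_decay_pos])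
 also have "... = (\<Prod>b\<in>B. \<Sum>k\<in>?X b. cell_decay (k - j b))" using assms by (subst prod_sum_PiE) auto
 also have "... \<le> (\<Prod>b\<in>B. 5)"
  using assms by (intro prod_mono) (auto intro!: sum_cell_decay sum_nonneg less_imp_le[OF cell_decay_pos])
 finally show ?thesis by simp
qed

section \<open>The matrix of a symbol, localised to cells\<close>

text \<open>\<open>A al bt x xi\<close> is the derivative of the symbol along \<open>al\<close> in
  the frequency and along \<open>bt\<close> in the position. A frequency derivative gains the same
  power \<delta> of the bracket that a position derivative loses, so both are measured on one
  scale.\<close>

locale ap_symbol =
 fixes A :: "'a::euclidean_space list => 'a list => 'a => 'a => complex" and m \<delta> :: real
 assumes delta: "0 \<le> \<delta>" "\<delta> < 1"
  and ap0: "\<And>xi. almost_periodic (\<lambda>x. A [] [] x xi)"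
  and fam: "\<And>bt x. bt \<in> lists Basis ==> deriv_family (\<lambda>al. A al bt x)"
  and dx: "\<And>bt e x xi. bt \<in> lists Basis ==> e \<in> Basis ==>
   ((\<lambda>t. A [] bt (x + t *\<^sub>R e) xi) has_vector_derivative A [] (e # bt) x xi) (at 0)"
  and bnd: "\<And>al bt. al \<in> lists Basis ==> bt \<in> lists Basis ==>
   \<exists>C. \<forall>x xi. cmod (A al bt x xi) \<le> C * bracket xi powr (m - \<delta> * length al + \<delta> * length bt)"
begin

definition K :: "'a list => 'a => 'a => complex" where
 "K bt ka ka' = ap_coeff (\<lambda>x. A [] bt x ka') (ka - ka')"

lemma ap:
 assumes "bt \<in> lists Basis"
 shows "almost_periodic (\<lambda>x. A [] bt x xi)" using assms
proof (induction bt)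
 case Nil
 show ?case by (rule ap0)
next
 case (Cons e bt)
 then have l: "bt \<in> lists Basis" "e \<in> Basis" "e # e # bt \<in> lists Basis" by auto
 obtain C where "\<forall>x xi. cmod (A [] (e # e # bt) x xi) \<le> C * bracket xi powr (m + \<delta> * length (e # e # bt))"
  using bnd[OF lists.Nil l(3)] by auto
 then obtain B where B: "\<And>x. cmod (A [] (e # e # bt) x xi) \<le> B" by blast
 have "e # bt \<in> lists Basis" using l by simp
 then show ?case by (rule almost_periodic_deriv[OF Cons.IH dx[OF l(1,2)] dx[OF _ l(2)] B])
qed

text \<open>Differentiation in x is, up to a constant, the commutator of the matrix with
  multiplication by the \<open>e\<close>-th coordinate: the Sylvester equation.\<close>

lemma K_deriv:
 assumes "bt \<in> lists Basis" "e \<in> Basis"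
 shows "K (e # bt) ka ka' = \<i> * of_real (2 * pi * ((ka - ka') \<bullet> e)) * K bt ka ka'"
proof -
 have l: "e # e # bt \<in> lists Basis" using assms by auto
 obtain C where "\<forall>x xi. cmod (A [] (e # e # bt) x xi) \<le> C * bracket xi powr (m + \<delta> * length (e # e # bt))"
  using bnd[OF lists.Nil l] by auto
 then show ?thesis unfolding K_def
  by (intro ap_coeff_deriv[of _ e _ "\<lambda>x. A [] (e # e # bt) x ka'"] ap dx) (use assms in auto)
qed

text \<open>Hypothesis \<open>b\<close> allows a factor \<open>1 / L\<close> per frequency
  derivative, so every column cell of side \<open>L\<close> is within reach of
  \<open>opbound_cube\<close>. A separation by k cells in one coordinate is worth
  \<open>1 / (k * L)\<close> per Sylvester equation, and an x-derivative costs \<open>L\<close>;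
  solving twice leaves \<open>1 / k\<^sup>2\<close>. Two derivatives per coordinate explain
  \<open>n + 2 * DIM('a)\<close>, and \<open>10 = 2 * 5\<close> combines the constant of one cube
  with the sums of \<open>cell_decay\<close>.\<close>

lemma near_cells:
 fixes L M :: real
 assumes L: "L > 0" and M: "M \<ge> 0"
  and b: "\<And>ka xi al bt x. ka \<in> S' ==> (\<forall>b\<in>Basis. \<bar>xi \<bullet> b - ka \<bullet> b\<bar> \<le> L) ==> al \<in> lists Basis ==>
   bt \<in> lists Basis ==> length al \<le> DIM('a) ==> length bt \<le> n + 2 * DIM('a) ==>
   cmod (A al bt x xi) \<le> M * L ^ length bt / L ^ length al"
  and bt: "bt \<in> lists Basis" "length bt \<le> n"
 shows "opbound (K bt) UNIV S' (10 ^ DIM('a) * M * L ^ length bt)"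
proof -
 define p where "p ka = restrict (\<lambda>b. \<lfloor>ka \<bullet> b / L\<rfloor>) Basis" for ka :: 'a
 have p_ext: "p ka \<in> extensional Basis" for ka by (simp add: p_def)
 have p_box: "real_of_int (i b) * L \<le> ka \<bullet> b \<and> ka \<bullet> b \<le> real_of_int (i b) * L + L" if "p ka = i" "b \<in> Basis" for ka b i
 proof -
  have i: "i b = \<lfloor>ka \<bullet> b / L\<rfloor>" using that by (auto simp: p_def)
  have "real_of_int (i b) \<le> ka \<bullet> b / L" "ka \<bullet> b / L \<le> real_of_int (i b) + 1"
   unfolding i by linarith+
  then show ?thesis using L by (simp add: field_simps)
 qed
 let ?S = "\<lambda>i. {ka\<in>UNIV. p ka = i}" and ?S' = "\<lambda>j. {ka\<in>S'. p ka = j}"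
 define T where "T bt B i j = 2 ^ DIM('a) * M * L ^ length bt * (\<Prod>b\<in>B. cell_decay (i b - j b))"
  for bt :: "'a list" and B :: "'a set" and i j :: "'a => int"
 have T0: "T bt B i j \<ge> 0" for bt B i j
  using L M by (auto simp: T_def intro!: mult_nonneg_nonneg prod_nonneg less_imp_le[OF cell_decay_pos])
 have base: "opbound (K bt) UNIV (?S' j) (2 ^ DIM('a) * (M * L ^ length bt))"
  if bt: "bt \<in> lists Basis" "length bt \<le> n + 2 * DIM('a)" for bt j
 proof (cases "?S' j = {}")
  case True
  show ?thesis by (rule opbound_mono[OF opbound_empty[of UNIV "?S' j"]]) (use True M L in auto)
 next
  case False
  \<comment> \<open>The bounds in \<open>b\<close> are available only near points of
    \<open>S'\<close>; one such point in the cell provides them on the whole cube.\<close>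
  then obtain ka0 where ka0: "ka0 \<in> S'" "p ka0 = j" by blast
  define c where "c = (\<Sum>b\<in>Basis. (real_of_int (j b) * L) *\<^sub>R b)"
  have c: "c \<bullet> b = real_of_int (j b) * L" if "b \<in> Basis" for b
   using that by (simp add: c_def inner_sum_left inner_Basis if_distrib sum.If_cases cong: if_cong)
  show ?thesis unfolding K_def
  proof (rule opbound_cube[where c = c and L = L])
   show "almost_periodic (\<lambda>x. A [] bt x xi)" for xi by (rule ap) fact
   show "deriv_family (\<lambda>al. A al bt x)" for x by (rule fam) fact
   show "L > 0" by fact
   show "?S' j \<subseteq> face c L Basis" using p_box by (auto simp: face_def c)
   fix al x xi assume al: "al \<in> lists (Basis::'a set)" "length al \<le> DIM('a)" and xi: "xi \<in> face c L Basis"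
   have "\<bar>xi \<bullet> b - ka0 \<bullet> b\<bar> \<le> L" if "b \<in> Basis" for b
   proof -
    have "c \<bullet> b \<le> xi \<bullet> b" "xi \<bullet> b \<le> c \<bullet> b + L" using xi that by (auto simp: face_def)
    moreover have "c \<bullet> b \<le> ka0 \<bullet> b" "ka0 \<bullet> b \<le> c \<bullet> b + L" using p_box[OF ka0(2) that] by (auto simp: c that)
    ultimately show ?thesis by (simp add: abs_le_iff)
   qed
   then show "cmod (A al bt x xi) \<le> M * L ^ length bt / L ^ length al" using ka0 al bt by (intro b) auto
  qed
 qed
 \<comment> \<open>Induction over the set \<open>B\<close> of directions whose decay has been
   extracted. The list \<open>bt\<close> is generalised because the step for \<open>e\<close> calls
   the hypothesis with up to two further derivatives in direction \<open>e\<close>.\<close>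
 have cell: "opbound (K bt) (?S i) (?S' j) (T bt B i j)"
  if "finite B" "B \<subseteq> Basis" "bt \<in> lists Basis" "length bt + 2 * card B \<le> n + 2 * DIM('a)" for bt B i j
  using that
 proof (induction B arbitrary: bt rule: finite_induct)
  case empty
  then show ?case by (intro opbound_mono[OF base[of bt j]]) (auto simp: T_def)
 next
  case (insert e B)
  then have e: "e \<in> Basis" "B \<subseteq> Basis" by auto
  have card: "card (insert e B) = Suc (card B)" using insert.hyps by simp
  have l: "e # bt \<in> lists Basis" "e # e # bt \<in> lists Basis" using insert.prems by auto
  have T_ins: "T bt (insert e B) i j = cell_decay (i e - j e) * T bt B i j" using insert.hyps by (simp add: T_def)
  have IH': "opbound (K ga) (?S i) (?S' j) (T ga B i j)"
   if "ga \<in> lists Basis" "length ga \<le> length bt + 2" for ga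
   using e that insert.prems(3) card by (intro insert.IH) auto
  have IH: "opbound (K bt) (?S i) (?S' j) (T bt B i j)"
   "opbound (K (e # bt)) (?S i) (?S' j) (T (e # bt) B i j)"
   "opbound (K (e # e # bt)) (?S i) (?S' j) (T (e # e # bt) B i j)"
   using IH'[of bt] IH'[of "e # bt"] IH'[of "e # e # bt"] insert.prems l by simp_all
  show ?case
  proof (cases "\<bar>i e - j e\<bar> \<ge> 2")
   case False
   then show ?thesis using IH(1) by (simp add: T_ins cell_decay_def)
  next
   case True
   define u u' where "u = real_of_int (i e) * L" and "u' = real_of_int (j e) * L"
   have uu: "\<bar>u - u'\<bar> = real_of_int \<bar>i e - j e\<bar> * L"
    using L by (simp add: u_def u'_def abs_mult flip: left_diff_distrib)
   have sep: "\<bar>u - u'\<bar> \<ge> 2 * L" unfolding uu using True L by (intro mult_right_mono) auto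
   \<comment> \<open>This equation bounds the matrix with one derivative by that with two, the next
     one the matrix with none by that with one. The hypotheses without decay in \<open>e\<close> are
     the a priori bounds for the absorption.\<close>
   have 1: "opbound (K (e # bt)) (?S i) (?S' j) (T (e # e # bt) B i j / \<bar>u - u'\<bar>)"
    by (rule opbound_separated[OF K_deriv IH(2) T0 IH(3) T0 _ _ L sep])
     (use p_box e l in \<open>auto simp: u_def u'_def\<close>)
   have "opbound (K bt) (?S i) (?S' j) (T (e # e # bt) B i j / \<bar>u - u'\<bar> / \<bar>u - u'\<bar>)"
    by (rule opbound_separated[OF K_deriv IH(1) T0 1 _ _ _ L sep])
     (use p_box e l T0 insert.prems in \<open>auto simp: u_def u'_def\<close>)
   also have "T (e # e # bt) B i j / \<bar>u - u'\<bar> / \<bar>u - u'\<bar> = T bt (insert e B) i j"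
   proof -
    define k where "k = real_of_int \<bar>i e - j e\<bar>"
    have "k > 0" "cell_decay (i e - j e) = 1 / k\<^sup>2" using True by (auto simp: k_def cell_decay_def)
    moreover have "\<bar>u - u'\<bar> = k * L" unfolding uu k_def ..
    moreover have "T (e # e # bt) B i j = L\<^sup>2 * T bt B i j" by (simp add: T_def power2_eq_square)
    ultimately show ?thesis using L by (simp add: T_ins power2_eq_square)
   qed
   finally show ?thesis .
  qed
 qed
 \<comment> \<open>Schur's test ranges over all functions as block labels; those that are not
   extensional label empty blocks and get the bound 0.\<close>
 define th where "th i j = (if i \<in> extensional Basis \<and> j \<in> extensional Basis then T bt Basis i j else 0)" for i j
 have row: "(\<Sum>j\<in>J. th i j) \<le> 10 ^ DIM('a) * M * L ^ length bt" if "finite J" for i J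
 proof -
  let ?c = "2 ^ DIM('a) * M * L ^ length bt"
  have "(\<Sum>j\<in>J. th i j) \<le> (\<Sum>j\<in>J. ?c * (if j \<in> extensional Basis then \<Prod>b\<in>Basis. cell_decay (j b - i b) else 0))"
   using L M by (intro sum_mono) (auto simp: th_def T_def cell_decay_minus[of "i _"]
     intro!: mult_nonneg_nonneg prod_nonneg less_imp_le[OF cell_decay_pos])
  also have "... \<le> ?c * 5 ^ DIM('a)" unfolding sum_distrib_left[symmetric] using L M
   by (intro mult_left_mono sum_prod_cell_decay that) auto
  also have "... = 10 ^ DIM('a) * M * L ^ length bt" by (simp flip: power_mult_distrib)
  finally show ?thesis .
 qed
 have th_sym: "th i j = th j i" for i j by (simp add: th_def T_def cell_decay_minus[of "i _"] conj_commute)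
 show ?thesis
 proof (rule opbound_blocks[where p = p and q = p and bt = th])
  fix i j
  show "th i j \<ge> 0" by (simp add: th_def T0)
  show "opbound (K bt) {ka\<in>UNIV. p ka = i} {ka'\<in>S'. p ka' = j} (th i j)"
  proof (cases "i \<in> extensional Basis \<and> j \<in> extensional Basis")
   case True
   then show ?thesis using cell[of Basis bt i j] bt by (simp add: th_def)
  next
   case False
   then have "{ka\<in>UNIV. p ka = i} = {} \<or> {ka'\<in>S'. p ka' = j} = {}" using p_ext by auto
   then show ?thesis using opbound_empty[of "{ka\<in>UNIV. p ka = i}" "{ka'\<in>S'. p ka' = j}" "K bt"] False by (auto simp: th_def)
  qed
  show "finite J ==> (\<Sum>j\<in>J. th i j) \<le> 10 ^ DIM('a) * M * L ^ length bt" for J by (rule row)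
  show "finite I ==> (\<Sum>i\<in>I. th i j) \<le> 10 ^ DIM('a) * M * L ^ length bt" for I
   using row[of I j] by (simp add: th_sym[of _ j])
 qed
qed


section \<open>Dyadic shells and the weighted bound\<close>

definition shell :: "nat => 'a set" where
 "shell k = {ka. 2 ^ k \<le> bracket ka \<and> bracket ka < 2 ^ Suc k}"

definition shell_index :: "'a => nat" where
 "shell_index ka = nat \<lfloor>log 2 (bracket ka)\<rfloor>"

lemma shell_index: "ka \<in> shell (shell_index ka)"
proof -
 have "log 2 (bracket ka) \<ge> 0" using bracket_ge_1 by simp
 then have "real (shell_index ka) \<le> log 2 (bracket ka)" "log 2 (bracket ka) < real (Suc (shell_index ka))"
  unfolding shell_index_def by linarith+
 then have "2 powr real (shell_index ka) \<le> bracket ka" "bracket ka < 2 powr real (Suc (shell_index ka))"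
  by (simp_all add: le_log_iff log_less_iff del: of_nat_Suc)
 then show ?thesis unfolding shell_def powr_realpow[OF zero_less_numeral] by auto
qed

lemma uniform_bound:
 "\<exists>C\<ge>0. \<forall>al\<in>lists Basis. \<forall>bt\<in>lists Basis. length al \<le> N \<longrightarrow> length bt \<le> N \<longrightarrow>
  (\<forall>x xi. cmod (A al bt x xi) \<le> C * bracket xi powr (m - \<delta> * length al + \<delta> * length bt))"
proof -
 let ?X = "{al. set al \<subseteq> (Basis::'a set) \<and> length al \<le> N}"
 have "\<forall>al bt. \<exists>C. al \<in> lists Basis \<longrightarrow> bt \<in> lists Basis \<longrightarrow>
   (\<forall>x xi. cmod (A al bt x xi) \<le> C * bracket xi powr (m - \<delta> * length al + \<delta> * length bt))"
  using bnd by blast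
 then obtain C where C: "\<And>al bt x xi. al \<in> lists Basis ==> bt \<in> lists Basis ==>
   cmod (A al bt x xi) \<le> C al bt * bracket xi powr (m - \<delta> * length al + \<delta> * length bt)" by metis
 have fin: "finite ?X" by (rule finite_lists_length_le) simp
 let ?C = "\<Sum>al\<in>?X. \<Sum>bt\<in>?X. \<bar>C al bt\<bar>"
 have "cmod (A al bt x xi) \<le> ?C * bracket xi powr (m - \<delta> * length al + \<delta> * length bt)"
  if "al \<in> lists Basis" "bt \<in> lists Basis" "length al \<le> N" "length bt \<le> N" for al bt x xi
 proof -
  have albt: "al \<in> ?X" "bt \<in> ?X" using that by auto
  have "C al bt \<le> \<bar>C al bt\<bar>" by simp
  also have "... \<le> (\<Sum>bt\<in>?X. \<bar>C al bt\<bar>)" by (rule member_le_sum[OF albt(2) _ fin]) auto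
  also have "... \<le> ?C" by (rule member_le_sum[OF albt(1) _ fin]) (auto intro: sum_nonneg)
  finally show ?thesis by (intro order_trans[OF C[OF that(1,2)]] mult_right_mono) auto
 qed
 then show ?thesis by (intro exI[of _ ?C] conjI) (auto intro!: sum_nonneg)
qed

lemma powr_comparable:
 assumes "0 < b" "b / 4 \<le> a" "a \<le> 4 * b"
 shows "a powr t \<le> 4 powr \<bar>t\<bar> * b powr (t::real)"
proof (cases "t \<ge> 0")
 case True
 have "a powr t \<le> (4 * b) powr t" using assms True by (intro powr_mono2) auto
 then show ?thesis using True assms by (simp add: powr_mult)
next
 case False
 have "a powr t \<le> (b / 4) powr t" using assms False by (intro powr_mono2') auto
 also have "... = 4 powr \<bar>t\<bar> * b powr t"
  using False assms by (simp add: powr_divide powr_minus_divide[of 4 t])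
 finally show ?thesis .
qed

text \<open>With cells of side comparable to \<open>2 powr (k * \<delta>)\<close> the symbol bounds
  on the shell have the form required by \<open>near_cells\<close>: a factor \<open>L\<close> per
  x-derivative and \<open>1 / L\<close> per frequency derivative, relative to
  \<open>2 powr (k * m)\<close>.\<close>

lemma near_shell:
 "\<exists>C\<ge>0. \<forall>k. \<forall>bt\<in>lists Basis. length bt \<le> n \<longrightarrow>
  opbound (K bt) UNIV (shell k) (C * 2 powr (k * (m + \<delta> * length bt)))"
proof -
 let ?d = "real DIM('a)"
 define N where "N = n + 2 * DIM('a)"
 obtain C0 where C0: "C0 \<ge> 0" "\<And>al bt x xi. al \<in> lists Basis ==> bt \<in> lists Basis ==> length al \<le> N ==> length bt \<le> N ==>
  cmod (A al bt x xi) \<le> C0 * bracket xi powr (m - \<delta> * length al + \<delta> * length bt)"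
  using uniform_bound[of N] by auto
 define ta where "ta = \<bar>m\<bar> + \<delta> * N + \<delta> * N"
 define C1 where "C1 = C0 * 4 powr ta * (4 * ?d) ^ N"
 have d: "?d \<ge> 1" "4 * ?d \<ge> 1" using DIM_positive[where 'a='a] by linarith+
 have C1: "C1 \<ge> 0" using C0 by (simp add: C1_def)
 have "opbound (K bt) UNIV (shell k) (10 ^ DIM('a) * C1 * 2 powr (k * (m + \<delta> * length bt)))"
  if bt: "bt \<in> lists Basis" "length bt \<le> n" for k bt
 proof -
  define La where "La = (2::real) powr (k * \<delta>)"
  \<comment> \<open>Moving every coordinate by at most \<open>L\<close> moves a point by at most
    \<open>DIM('a) * L = La / 4 \<le> 2 ^ k / 4\<close>. Hence brackets stay comparable to
    \<open>2 ^ k\<close> throughout the cells that meet the shell.\<close>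
  define L where "L = La / (4 * ?d)"
  define M where "M = C1 * 2 powr (k * m)"
  have La: "La > 0" "La \<le> 2 ^ k"
  proof -
   have "La \<le> 2 powr real k" unfolding La_def using delta by (intro powr_mono) (auto simp: mult_left_le)
   then show "La \<le> 2 ^ k" by (simp add: powr_realpow)
  qed (simp add: La_def)
  have "L \<le> La / 1" unfolding L_def using La(1) d by (intro divide_left_mono) auto
  moreover have "?d * L = La / 4" by (simp add: L_def)
  ultimately have L: "L > 0" "L \<le> La" "?d * L \<le> 2 ^ k / 4" "La = 4 * ?d * L" using La by (auto simp: L_def)
  have "opbound (K bt) UNIV (shell k) (10 ^ DIM('a) * M * L ^ length bt)"
  proof (rule near_cells[OF L(1) _ _ bt])
   show "M \<ge> 0" using C1 by (simp add: M_def)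
   fix ka xi al ga x
   assume ka: "ka \<in> shell k" and xi: "\<forall>b\<in>Basis. \<bar>xi \<bullet> b - ka \<bullet> b\<bar> \<le> L"
    and al: "al \<in> lists (Basis::'a set)" "length al \<le> DIM('a)"
    and ga: "ga \<in> lists (Basis::'a set)" "length ga \<le> n + 2 * DIM('a)"
   let ?t = "m - \<delta> * length al + \<delta> * length ga"
   have lN: "length al \<le> N" "length ga \<le> N" using al ga by (auto simp: N_def)
   have "norm (xi - ka) \<le> (\<Sum>b\<in>Basis. \<bar>(xi - ka) \<bullet> b\<bar>)" by (rule norm_le_l1)
   also have "... \<le> (\<Sum>b\<in>(Basis::'a set). L)" using xi by (intro sum_mono) (auto simp: inner_diff_left)
   finally have dist: "norm (xi - ka) \<le> 2 ^ k / 4" using L by simp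
   have "bracket xi \<le> 4 * 2 ^ k" "2 ^ k / 4 \<le> bracket xi"
    using bracket_lipschitz[of xi ka] bracket_lipschitz[of ka xi] dist ka
    by (auto simp: shell_def norm_minus_commute)
   then have "bracket xi powr ?t \<le> 4 powr \<bar>?t\<bar> * (2 ^ k) powr ?t" by (intro powr_comparable) auto
   also have "4 powr \<bar>?t\<bar> \<le> 4 powr ta"
   proof -
    have "\<delta> * length al \<le> \<delta> * N" "\<delta> * length ga \<le> \<delta> * N" "0 \<le> \<delta> * length al" "0 \<le> \<delta> * length ga"
     using lN delta by (auto intro!: mult_left_mono)
    then have "\<bar>?t\<bar> \<le> ta" unfolding ta_def by linarith
    then show ?thesis by simp
   qed
   also have "(2 ^ k) powr ?t = 2 powr (k * m) * La ^ length ga / La ^ length al"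
   proof -
    have "(2 ^ k) powr ?t = 2 powr (k * m + k * \<delta> * length ga - k * \<delta> * length al)"
     by (simp add: powr_powr algebra_simps flip: powr_realpow)
    also have "... = 2 powr (k * m) * 2 powr (k * \<delta> * length ga) / 2 powr (k * \<delta> * length al)"
     by (simp add: powr_add powr_diff)
    finally show ?thesis by (simp add: La_def powr_realpow[symmetric] powr_powr)
   qed
   also have "... \<le> 2 powr (k * m) * ((4 * ?d) ^ N * L ^ length ga) / L ^ length al"
   proof (intro frac_le mult_left_mono)
    show "La ^ length ga \<le> (4 * ?d) ^ N * L ^ length ga"
     unfolding L(4) power_mult_distrib[of "4 * ?d"] using L lN d by (intro mult_right_mono power_increasing) auto
    show "L ^ length al \<le> La ^ length al" using L by (intro power_mono) auto
   qed (use L d in auto)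
   finally have "bracket xi powr ?t \<le> 4 powr ta * (2 powr (k * m) * ((4 * ?d) ^ N * L ^ length ga) / L ^ length al)"
    by (simp add: mult_left_mono mult_right_mono)
   then have "C0 * bracket xi powr ?t \<le> C0 * (4 powr ta * (2 powr (k * m) * ((4 * ?d) ^ N * L ^ length ga) / L ^ length al))"
    using C0(1) by (rule mult_left_mono)
   also have "... = M * L ^ length ga / L ^ length al" by (simp add: M_def C1_def mult_ac)
   finally show "cmod (A al ga x xi) \<le> M * L ^ length ga / L ^ length al"
    using C0(2)[OF al(1) ga(1) lN, of x xi] by linarith
  qed
  then show ?thesis
  proof (rule opbound_mono)
   have "L ^ length bt \<le> La ^ length bt" using L by (intro power_mono) auto
   also have "... = 2 powr (k * \<delta> * length bt)" by (simp add: La_def powr_realpow[symmetric] powr_powr)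
   finally have "M * L ^ length bt \<le> (C1 * 2 powr (k * m)) * 2 powr (k * \<delta> * length bt)"
    unfolding M_def using C1 by (intro mult_left_mono) auto
   also have "... = C1 * 2 powr (k * (m + \<delta> * length bt))" by (simp add: powr_add algebra_simps)
   finally show "10 ^ DIM('a) * M * L ^ length bt \<le> 10 ^ DIM('a) * C1 * 2 powr (k * (m + \<delta> * length bt))"
    by simp
  qed auto
 qed
 then show ?thesis using C1 by (intro exI[of _ "10 ^ DIM('a) * C1"]) auto
qed

lemma shell_norm: "ka \<in> shell k ==> norm ka \<le> 2 ^ Suc k"
 using norm_le_bracket[of ka] by (auto simp: shell_def)

lemma shell_norm_ge:
 assumes "ka \<in> shell k" "k \<ge> 1"
 shows "2 ^ k / 2 \<le> norm ka"
proof -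
 have "(2::real) ^ 1 \<le> 2 ^ k" using assms by (intro power_increasing) auto
 then show ?thesis using assms bracket_le_norm[of ka] by (auto simp: shell_def)
qed

text \<open>Each of the \<open>N\<close> steps exchanges one x-derivative, which costs
  \<open>2 powr (k * \<delta>)\<close>, for a division by the larger of the two radii. The distance
  \<open>c\<close> ensures that \<open>2 * DIM('a)\<close> times the outer radius of the smaller
  shell is at most the inner radius of the larger one, as \<open>opbound_far\<close>
  requires.\<close>

lemma far_shells:
 fixes C :: real
 assumes C: "C \<ge> 0" "\<And>k bt. bt \<in> lists Basis ==> length bt \<le> n ==>
   opbound (K bt) UNIV (shell k) (C * 2 powr (k * (m + \<delta> * length bt)))"
  and c: "8 * DIM('a) \<le> 2 ^ c" and jk: "j \<ge> k + c \<or> k \<ge> j + c"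
  and bt: "bt \<in> lists Basis" "length bt + N \<le> n"
 shows "opbound (K bt) (shell j) (shell k)
  (DIM('a) ^ N * C * 2 powr (k * (m + \<delta> * (length bt + N)) - real (max j k) * N))" using bt
proof (induction N arbitrary: bt)
 case 0
 then have "opbound (K bt) UNIV (shell k) (C * 2 powr (k * (m + \<delta> * length bt)))" by (intro C) auto
 then show ?case by (rule opbound_mono) auto
next
 case (Suc N)
 define D where "D = DIM('a) ^ N * C * 2 powr (k * (m + \<delta> * (length bt + Suc N)) - real (max j k) * N)"
 define J where "J = max j k"
 have c1: "c \<ge> 1" using c DIM_positive[where 'a='a] by (cases c) auto
 have J: "J \<ge> 1" using jk c1 by (auto simp: J_def)
 have D: "D \<ge> 0" using C by (simp add: D_def)
 have Y: "opbound (K (e # bt)) (shell j) (shell k) D" if "e \<in> Basis" for e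
  using Suc.IH[of "e # bt"] Suc.prems that by (simp add: D_def algebra_simps)
 have D0: "opbound (K bt) (shell j) (shell k) (C * 2 powr (k * (m + \<delta> * length bt)))"
  using Suc.prems by (intro opbound_mono[OF C(2)]) auto
 have D0': "C * 2 powr (k * (m + \<delta> * length bt)) \<ge> 0" using C by simp
 have sep: "2 * real DIM('a) * 2 ^ Suc b \<le> 2 ^ a / 2" if "a \<ge> b + c" for a b :: nat
 proof -
  have "real (8 * DIM('a)) \<le> real (2 ^ c)" using c by (rule of_nat_mono)
  then have "8 * real DIM('a) * 2 ^ b \<le> 2 ^ c * 2 ^ b" by (intro mult_right_mono) auto
  also have "... = 2 ^ (b + c)" by (simp add: power_add)
  also have "(2::real) ^ (b + c) \<le> 2 ^ a" using that by (intro power_increasing) auto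
  finally show ?thesis by simp
 qed
 have "opbound (K bt) (shell j) (shell k) (DIM('a) * D / (2 * (2 ^ J / 2)))"
 proof (cases "j \<ge> k + c")
  case True
  then have Jj: "J = j" "j \<ge> 1" using c1 by (auto simp: J_def)
  show ?thesis unfolding Jj
  proof (rule opbound_far[where Y = "\<lambda>e. K (e # bt)" and om = \<i> and r = "2 ^ Suc k", OF _ _ D0 D0' Y D])
   show "2 * real DIM('a) * 2 ^ Suc k \<le> 2 ^ j / 2" using True by (rule sep)
  qed (use K_deriv Suc.prems shell_norm shell_norm_ge Jj in auto)
 next
  case False
  then have kj: "k \<ge> j + c" using jk by simp
  then have Jk: "J = k" "k \<ge> 1" using c1 by (auto simp: J_def)
  \<comment> \<open>Here the column index is the larger one, so \<open>opbound_far\<close> is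
    applied to the transposed matrix; the commutator changes sign, whence
    \<open>om = - \<i>\<close>.\<close>
  have "opbound (\<lambda>ka' ka. K bt ka ka') (shell k) (shell j) (DIM('a) * D / (2 * (2 ^ k / 2)))"
  proof (rule opbound_far[where Y = "\<lambda>e ka' ka. K (e # bt) ka ka'" and om = "- \<i>" and r = "2 ^ Suc j", OF _ _ opbound_flip[OF D0] D0' opbound_flip[OF Y] D])
   show "2 * real DIM('a) * 2 ^ Suc j \<le> 2 ^ k / 2" using kj by (rule sep)
   show "K (e # bt) ka' ka = - \<i> * of_real (2 * pi * ((ka - ka') \<bullet> e)) * K bt ka' ka" if "e \<in> Basis" for e ka ka'
    using K_deriv[OF Suc.prems(1) that, of ka' ka] by (simp add: inner_diff_left algebra_simps)
  qed (use shell_norm shell_norm_ge Jk in auto)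
  from opbound_flip[OF this] show ?thesis by (simp add: Jk)
 qed
 also have "DIM('a) * D / (2 * (2 ^ J / 2)) = DIM('a) ^ Suc N * C * 2 powr (k * (m + \<delta> * (length bt + Suc N)) - real (max j k) * Suc N)"
 proof -
  have "2 powr (k * (m + \<delta> * (length bt + Suc N)) - real (max j k) * Suc N)
   = 2 powr (k * (m + \<delta> * (length bt + Suc N)) - real (max j k) * N) / 2 powr J"
   unfolding powr_diff[symmetric] by (simp add: J_def algebra_simps)
  then show ?thesis by (simp add: D_def powr_realpow)
 qed
 finally show ?case .
qed

lemma sum_half_power_dist:
 assumes "finite J"
 shows "(\<Sum>j\<in>J. 2 powr (- \<bar>real j - real k\<bar>)) \<le> 4"
proof -
 have half: "(\<Sum>i\<in>I. 2 powr (- real i)) \<le> 2" if "finite I" for I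
 proof -
  have "(\<Sum>i\<in>I. 2 powr (- real i)) = (\<Sum>i\<in>I. (1/2) ^ i)"
   by (intro sum.cong refl) (simp add: powr_minus powr_realpow power_one_over inverse_eq_divide)
  also have "... \<le> (\<Sum>i. (1/2::real) ^ i)" using that by (intro sum_le_suminf summable_geometric) auto
  also have "... = 2" by (subst suminf_geometric) auto
  finally show ?thesis .
 qed
 have "(\<Sum>j\<in>J. 2 powr (- \<bar>real j - real k\<bar>)) =
   (\<Sum>j\<in>{j\<in>J. j \<le> k}. 2 powr (- \<bar>real j - real k\<bar>)) + (\<Sum>j\<in>{j\<in>J. \<not> j \<le> k}. 2 powr (- \<bar>real j - real k\<bar>))"
  using assms by (subst sum.union_disjoint[symmetric]) (auto intro!: sum.cong)
 also have "(\<Sum>j\<in>{j\<in>J. j \<le> k}. 2 powr (- \<bar>real j - real k\<bar>)) = (\<Sum>i\<in>(\<lambda>j. k - j) ` {j\<in>J. j \<le> k}. 2 powr (- real i))"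
  by (subst sum.reindex) (auto simp: inj_on_def intro!: sum.cong)
 also have "(\<Sum>j\<in>{j\<in>J. \<not> j \<le> k}. 2 powr (- \<bar>real j - real k\<bar>)) = (\<Sum>i\<in>(\<lambda>j. j - k) ` {j\<in>J. \<not> j \<le> k}. 2 powr (- real i))"
  by (subst sum.reindex) (auto simp: inj_on_def intro!: sum.cong)
 finally show ?thesis
  using half[of "(\<lambda>j. k - j) ` {j\<in>J. j \<le> k}"] half[of "(\<lambda>j. j - k) ` {j\<in>J. \<not> j \<le> k}"] assms by simp
qed

lemma shell_powr:
 assumes "ka \<in> shell k"
 shows "bracket ka powr t \<le> 4 powr \<bar>t\<bar> * 2 powr (k * t)"
proof -
 have "bracket ka powr t \<le> 4 powr \<bar>t\<bar> * (2 ^ k) powr t"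
  using assms by (intro powr_comparable) (auto simp: shell_def)
 then show ?thesis by (simp add: powr_powr flip: powr_realpow)
qed

text \<open>Relative to the natural size of the block, the weights contribute 2 to the power
  \<open>(j - k) * (s - m)\<close> between the shells \<open>j\<close> and \<open>k\<close>. For
  distant shells \<open>far_shells\<close> beats this factor, and for shells at distance less than
  \<open>c\<close> it is bounded.\<close>

theorem weighted_bound:
 "\<exists>C\<ge>0. opbound (\<lambda>ka ka'. of_real (bracket ka powr (s - m)) * K [] ka ka' * of_real (bracket ka' powr (- s))) UNIV UNIV C"
proof -
 \<comment> \<open>The number of exchanged derivatives. The gain is 2 to the power
   \<open>- (1 - \<delta>) * N\<close> times the larger shell index, which is at least the distance
   of the shells; it has to beat the weights and to leave one factor 1/2 per unit of distance for
   Schur's test. Here \<delta> < 1 enters.\<close>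
 define N where "N = nat \<lceil>(\<bar>s - m\<bar> + 1) / (1 - \<delta>)\<rceil>"
 have N: "(1 - \<delta>) * N \<ge> \<bar>s - m\<bar> + 1"
 proof -
  have "real N \<ge> (\<bar>s - m\<bar> + 1) / (1 - \<delta>)" unfolding N_def by linarith
  then show ?thesis using delta by (simp add: divide_le_eq mult.commute)
 qed
 define c where "c = 8 * DIM('a)"
 have c: "8 * DIM('a) \<le> 2 ^ c" using less_exp[of c] by (simp add: c_def)
 obtain C where C: "C \<ge> 0" "\<And>k bt. bt \<in> lists Basis ==> length bt \<le> N ==>
   opbound (K bt) UNIV (shell k) (C * 2 powr (k * (m + \<delta> * length bt)))" using near_shell[of N] by auto
 define W where "W = 4 powr \<bar>s - m\<bar> * 4 powr \<bar>s\<bar>"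
 define E where "E = W * C * (DIM('a) ^ N + 2 powr (c * (\<bar>s - m\<bar> + 1)))"
 have E: "E \<ge> 0" using C by (simp add: E_def W_def)
 let ?K = "\<lambda>ka ka'. of_real (bracket ka powr (s - m)) * K [] ka ka' * of_real (bracket ka' powr (- s))"
 have blk: "opbound ?K (shell j) (shell k) (E * 2 powr (- \<bar>real j - real k\<bar>))" for j k
 proof -
  have weight: "opbound ?K (shell j) (shell k) (W * D * 2 powr (j * (s - m) - k * s))"
   if "opbound (K []) (shell j) (shell k) D" "D \<ge> 0" for D
  proof (rule opbound_mono)
   show "opbound ?K (shell j) (shell k)
     ((4 powr \<bar>s - m\<bar> * 2 powr (j * (s - m))) * (4 powr \<bar>- s\<bar> * 2 powr (k * (- s))) * D)"
    using shell_powr[of _ j "s - m"] shell_powr[of _ k "- s"] by (intro opbound_mult that) auto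
   show "(4 powr \<bar>s - m\<bar> * 2 powr (j * (s - m))) * (4 powr \<bar>- s\<bar> * 2 powr (k * (- s))) * D
     \<le> W * D * 2 powr (j * (s - m) - k * s)" by (simp add: W_def powr_diff powr_minus divide_inverse)
  qed auto
  show ?thesis
  proof (cases "j \<ge> k + c \<or> k \<ge> j + c")
   case True
   let ?D = "DIM('a) ^ N * C * 2 powr (k * (m + \<delta> * N) - real (max j k) * N)"
   have "opbound ?K (shell j) (shell k) (W * ?D * 2 powr (j * (s - m) - k * s))"
    using far_shells[OF C c True, where bt = "[]" and N = N] C(1) by (intro weight) auto
   then show ?thesis
   proof (rule opbound_mono)
    have "real k * (\<delta> * N) \<le> real (max j k) * (\<delta> * N)"
     using delta by (intro mult_right_mono) auto
    then have "k * (m + \<delta> * N) - real (max j k) * N + (j * (s - m) - k * s) \<le>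
      (real j - real k) * (s - m) - real (max j k) * ((1 - \<delta>) * N)" by (simp add: algebra_simps)
    also have "... \<le> \<bar>real j - real k\<bar> * \<bar>s - m\<bar> - \<bar>real j - real k\<bar> * ((1 - \<delta>) * N)"
    proof (intro diff_mono mult_right_mono)
     show "(real j - real k) * (s - m) \<le> \<bar>real j - real k\<bar> * \<bar>s - m\<bar>"
      by (metis abs_ge_self abs_mult)
    qed (use delta in auto)
    also have "... \<le> - \<bar>real j - real k\<bar>"
     using mult_left_mono[OF N, of "\<bar>real j - real k\<bar>"] by (simp add: algebra_simps)
    finally have "2 powr (k * (m + \<delta> * N) - real (max j k) * N + (j * (s - m) - k * s)) \<le> 2 powr (- \<bar>real j - real k\<bar>)"
     by simp
    then have "W * C * DIM('a) ^ N * 2 powr (k * (m + \<delta> * N) - real (max j k) * N + (j * (s - m) - k * s))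
      \<le> E * 2 powr (- \<bar>real j - real k\<bar>)"
     unfolding E_def using C(1) by (intro mult_mono) (auto simp: W_def algebra_simps)
    then show "W * ?D * 2 powr (j * (s - m) - k * s) \<le> E * 2 powr (- \<bar>real j - real k\<bar>)"
     by (simp only: powr_add mult_ac)
   qed auto
  next
   case False
   let ?D = "C * 2 powr (k * m)"
   have "opbound (K []) UNIV (shell k) ?D" using C(2)[of "[]" k] by simp
   then have "opbound ?K (shell j) (shell k) (W * ?D * 2 powr (j * (s - m) - k * s))"
    using C(1) by (intro weight) (auto elim: opbound_mono)
   then show ?thesis
   proof (rule opbound_mono)
    have jk: "\<bar>real j - real k\<bar> \<le> c" using False by auto
    have "k * m + (j * (s - m) - k * s) + \<bar>real j - real k\<bar> = (real j - real k) * (s - m) + \<bar>real j - real k\<bar>"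
     by (simp add: algebra_simps)
    also have "... \<le> \<bar>real j - real k\<bar> * \<bar>s - m\<bar> + \<bar>real j - real k\<bar>"
     by (metis abs_ge_self abs_mult add_right_mono)
    also have "... \<le> c * (\<bar>s - m\<bar> + 1)"
     using mult_right_mono[OF jk, of "\<bar>s - m\<bar> + 1"] by (simp add: algebra_simps)
    finally have "2 powr (k * m + (j * (s - m) - k * s)) \<le> 2 powr (c * (\<bar>s - m\<bar> + 1) - \<bar>real j - real k\<bar>)"
     by (intro powr_mono) auto
    also have "... = 2 powr (c * (\<bar>s - m\<bar> + 1)) * 2 powr (- \<bar>real j - real k\<bar>)"
     by (simp flip: powr_add)
    finally have "W * C * 2 powr (k * m + (j * (s - m) - k * s)) \<le> W * C * (2 powr (c * (\<bar>s - m\<bar> + 1)) * 2 powr (- \<bar>real j - real k\<bar>))"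
     using C(1) by (intro mult_left_mono) (auto simp: W_def)
    also have "... \<le> E * 2 powr (- \<bar>real j - real k\<bar>)"
     unfolding E_def mult.assoc[symmetric] using C(1) by (intro mult_right_mono) (auto simp: W_def algebra_simps)
    finally show "W * ?D * 2 powr (j * (s - m) - k * s) \<le> E * 2 powr (- \<bar>real j - real k\<bar>)"
     by (simp only: powr_add mult_ac)
   qed auto
  qed
 qed
 have "opbound ?K UNIV UNIV (E * 4)"
 proof (rule opbound_blocks[where p = shell_index and q = shell_index])
  fix i j :: nat
  show "opbound ?K {ka\<in>UNIV. shell_index ka = i} {ka'\<in>UNIV. shell_index ka' = j} (E * 2 powr (- \<bar>real i - real j\<bar>))"
   by (rule opbound_mono[OF blk[of i j]]) (use shell_index in auto)
  show "E * 2 powr (- \<bar>real i - real j\<bar>) \<ge> 0" using E by simp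
  show "(\<Sum>j\<in>J. E * 2 powr (- \<bar>real i - real j\<bar>)) \<le> E * 4" if "finite J" for J
   unfolding sum_distrib_left[symmetric]
   using sum_half_power_dist[OF that, of i] E by (intro mult_left_mono) (auto simp: abs_minus_commute)
  show "(\<Sum>i\<in>I. E * 2 powr (- \<bar>real i - real j\<bar>)) \<le> E * 4" if "finite I" for I
   unfolding sum_distrib_left[symmetric] using sum_half_power_dist[OF that, of j] E by (intro mult_left_mono) auto
 qed
 then show ?thesis using E by (intro exI[of _ "E * 4"]) auto
qed

end

lemma bracket_neq_0 [simp]: "bracket xi \<noteq> 0" by (rule less_imp_neq[OF bracket_pos, symmetric])

lemma powr_minus_cancel: "c > 0 ==> c powr (- s) * (c powr s * x) = (x::real)"
 unfolding mult.assoc[symmetric] powr_add[symmetric] by simp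

context ap_symbol
begin

section \<open>Dependence of the coefficients on the frequency\<close>

text \<open>One coordinate is changed at a time, so only line derivatives enter; all intermediate
  points stay in the box on which \<open>M\<close> is a bound.\<close>

lemma coordinate_lipschitz:
 assumes M: "\<And>e ze. e \<in> Basis ==> (\<forall>b\<in>Basis. \<bar>(ze - et) \<bullet> b\<bar> \<le> 1) ==> cmod (A [e] [] x ze) \<le> M"
  and "finite B" "B \<subseteq> Basis" "\<And>b. b \<in> B ==> \<bar>t b\<bar> \<le> 1"
 shows "cmod (A [] [] x (et + (\<Sum>b\<in>B. t b *\<^sub>R b)) - A [] [] x et) \<le> (\<Sum>b\<in>B. M * \<bar>t b\<bar>)"
 using assms(2-4)
proof (induction B rule: finite_induct)
 case empty
 then show ?case by simp
next
 case (insert e B)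
 define ze where "ze = et + (\<Sum>b\<in>B. t b *\<^sub>R b)"
 have e: "e \<in> Basis" "e \<notin> B" using insert by auto
 have d: "((\<lambda>t. A [] [] x (xi + t *\<^sub>R e)) has_vector_derivative A [e] [] x xi) (at 0)" for xi
  using fam[of "[]" x] e by (auto simp: deriv_family_def)
 have coord: "\<bar>(ze + r *\<^sub>R e - et) \<bullet> b\<bar> \<le> 1" if "b \<in> Basis" "\<bar>r\<bar> \<le> 1" for r b
 proof -
  have "(\<Sum>b'\<in>B. t b' *\<^sub>R b') \<bullet> b = (\<Sum>b'\<in>B. if b' = b then t b' else 0)"
   unfolding inner_sum_left using insert.prems that by (intro sum.cong) (auto simp: inner_Basis)
  also have "... = (if b \<in> B then t b else 0)" using insert.hyps by simp
  finally show ?thesis using that e insert.prems by (auto simp: ze_def inner_add_left inner_Basis)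
 qed
 have te: "\<bar>t e\<bar> \<le> 1" using insert.prems by auto
 have Mb: "cmod (A [e] [] x (ze + r *\<^sub>R e)) \<le> M" if "\<bar>r\<bar> \<le> 1" for r
  using that coord e by (intro M) auto
 have "cmod (A [] [] x (ze + t e *\<^sub>R e) - A [] [] x ze) \<le> M * \<bar>t e\<bar>"
 proof (cases "t e \<ge> 0")
  case True
  have "cmod (A [] [] x (ze + t e *\<^sub>R e) - A [] [] x (ze + 0 *\<^sub>R e)) \<le> M * (t e - 0)"
   by (rule line_deriv_bound[OF d], rule Mb) (use True te in linarith)+
  then show ?thesis using True by simp
 next
  case False
  have "cmod (A [] [] x (ze + 0 *\<^sub>R e) - A [] [] x (ze + t e *\<^sub>R e)) \<le> M * (0 - t e)"
   by (rule line_deriv_bound[OF d], rule Mb) (use False te in linarith)+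
  then show ?thesis using False by (simp add: norm_minus_commute)
 qed
 moreover have "cmod (A [] [] x ze - A [] [] x et) \<le> (\<Sum>b\<in>B. M * \<bar>t b\<bar>)"
  unfolding ze_def using insert by (intro insert.IH) auto
 moreover have eq: "et + (\<Sum>b\<in>insert e B. t b *\<^sub>R b) = ze + t e *\<^sub>R e"
  using insert.hyps by (simp add: ze_def)
 ultimately show ?case
  unfolding eq using norm_triangle_ineq[of "A [] [] x (ze + t e *\<^sub>R e) - A [] [] x ze" "A [] [] x ze - A [] [] x et"] insert.hyps
  by simp
qed

text \<open>First frequency derivatives are bounded uniformly in x and near every frequency, and
  taking coefficients contracts the supremum norm in x; so the Lipschitz bound of the symbol passes
  to its coefficients.\<close>

lemma continuous_ap_coeff: "continuous_on UNIV (\<lambda>xi. ap_coeff (\<lambda>x. A [] [] x xi) mu)"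
proof -
 have "isCont (\<lambda>xi. ap_coeff (\<lambda>x. A [] [] x xi) mu) et" for et
 proof -
  have "\<exists>M\<ge>0. \<forall>e\<in>Basis. \<forall>x ze. (\<forall>b\<in>Basis. \<bar>(ze - et) \<bullet> b\<bar> \<le> 1) \<longrightarrow> cmod (A [e] [] x ze) \<le> M"
  proof -
   obtain C where C0: "C \<ge> 0" "\<And>al bt x xi. al \<in> lists Basis ==> bt \<in> lists Basis ==> length al \<le> 1 ==> length bt \<le> 1 ==>
     cmod (A al bt x xi) \<le> C * bracket xi powr (m - \<delta> * length al + \<delta> * length bt)"
    using uniform_bound[of 1] by auto
   have C: "C \<ge> 0" "\<And>e x xi. e \<in> Basis ==> cmod (A [e] [] x xi) \<le> C * bracket xi powr (m - \<delta>)"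
    using C0(1) C0(2)[of "[_]" "[]"] by auto
   have "cmod (A [e] [] x ze) \<le> C * (bracket et + DIM('a)) powr \<bar>m - \<delta>\<bar>"
    if "e \<in> Basis" "\<forall>b\<in>Basis. \<bar>(ze - et) \<bullet> b\<bar> \<le> 1" for e x ze
   proof -
    have "norm (ze - et) \<le> (\<Sum>b\<in>(Basis::'a set). 1)"
     by (rule order_trans[OF norm_le_l1]) (use that in \<open>intro sum_mono, auto\<close>)
    then have le: "bracket ze \<le> bracket et + DIM('a)" using bracket_lipschitz[of ze et] by simp
    have "bracket ze powr (m - \<delta>) \<le> bracket ze powr \<bar>m - \<delta>\<bar>"
     by (rule powr_mono) (auto simp: bracket_ge_1)
    also have "... \<le> (bracket et + DIM('a)) powr \<bar>m - \<delta>\<bar>"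
     using le by (intro powr_mono2) (auto intro: less_imp_le)
    finally show ?thesis using C(2)[OF that(1), of x ze] C(1) by (meson mult_left_mono order_trans)
   qed
   then show ?thesis using C(1) by (intro exI[of _ "C * (bracket et + DIM('a)) powr \<bar>m - \<delta>\<bar>"]) auto
  qed
  then obtain M where M: "M \<ge> 0" "\<And>e x ze. e \<in> Basis ==> (\<forall>b\<in>Basis. \<bar>(ze - et) \<bullet> b\<bar> \<le> 1) ==> cmod (A [e] [] x ze) \<le> M"
   by blast
  have lip: "cmod (ap_coeff (\<lambda>x. A [] [] x xi) mu - ap_coeff (\<lambda>x. A [] [] x et) mu) \<le> (\<Sum>b\<in>Basis. M * \<bar>(xi - et) \<bullet> b\<bar>)"
   if "norm (xi - et) \<le> 1" for xi
  proof (intro ap_coeff_diff_bound ap0)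
   fix x
   have "\<bar>(xi - et) \<bullet> b\<bar> \<le> 1" if "b \<in> Basis" for b
    using Basis_le_norm[OF that, of "xi - et"] \<open>norm (xi - et) \<le> 1\<close> by linarith
   then show "cmod (A [] [] x xi - A [] [] x et) \<le> (\<Sum>b\<in>Basis. M * \<bar>(xi - et) \<bullet> b\<bar>)"
    using coordinate_lipschitz[of et x M Basis "\<lambda>b. (xi - et) \<bullet> b"] M(2) by (simp add: euclidean_representation)
  qed
  show ?thesis unfolding isCont_def
  proof (rule LIM_zero_cancel, rule Lim_null_comparison)
   show "\<forall>\<^sub>F xi in at et. cmod (ap_coeff (\<lambda>x. A [] [] x xi) mu - ap_coeff (\<lambda>x. A [] [] x et) mu) \<le> (\<Sum>b\<in>Basis. M * \<bar>(xi - et) \<bullet> b\<bar>)"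
    unfolding eventually_at by (intro exI[of _ 1]) (auto simp: dist_norm intro!: lip)
   show "((\<lambda>xi. \<Sum>b\<in>Basis. M * \<bar>(xi - et) \<bullet> b\<bar>) \<longlongrightarrow> 0) (at et)"
   proof -
    have "((\<lambda>xi. \<Sum>b\<in>Basis. M * \<bar>(xi - et) \<bullet> b\<bar>) \<longlongrightarrow> (\<Sum>b\<in>Basis. M * \<bar>(et - et) \<bullet> b\<bar>)) (at et)"
     by (intro tendsto_intros)
    then show ?thesis by simp
   qed
  qed
 qed
 then show ?thesis by (simp add: continuous_on_eq_continuous_at)
qed

text \<open>The frequencies at which one given coefficient does not vanish form an open set, so a
  countable dense set of frequencies detects the whole spectrum. This gives one countable index set
  for all \<xi>, as the strong measurability of U(a)(\<xi>)G(\<xi>) demands.\<close>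

lemma countable_spectrum: "countable {mu. \<exists>xi. ap_coeff (\<lambda>x. A [] [] x xi) mu \<noteq> 0}"
proof -
 obtain X :: "'a set" where X: "countable X" "\<And>U. open U ==> U \<noteq> {} ==> \<exists>x\<in>X. x \<in> U"
  using countable_dense_setE by blast
 have "{mu. \<exists>xi. ap_coeff (\<lambda>x. A [] [] x xi) mu \<noteq> 0} \<subseteq> (\<Union>xi\<in>X. {mu. ap_coeff (\<lambda>x. A [] [] x xi) mu \<noteq> 0})"
 proof
  fix mu assume "mu \<in> {mu. \<exists>xi. ap_coeff (\<lambda>x. A [] [] x xi) mu \<noteq> 0}"
  moreover have "open {xi. ap_coeff (\<lambda>x. A [] [] x xi) mu \<noteq> 0}"
   by (intro open_Collect_neq continuous_ap_coeff continuous_on_const)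
  ultimately obtain xi where "xi \<in> X" "ap_coeff (\<lambda>x. A [] [] x xi) mu \<noteq> 0"
   using X(2)[of "{xi. ap_coeff (\<lambda>x. A [] [] x xi) mu \<noteq> 0}"] by blast
  then show "mu \<in> (\<Union>xi\<in>X. {mu. ap_coeff (\<lambda>x. A [] [] x xi) mu \<noteq> 0})" by blast
 qed
 then show ?thesis by (rule countable_subset) (intro countable_UN X countable_ap_spectrum ap0)
qed

end

lemma partial_derivs_append: "partial_derivs (al @ bt) f = partial_derivs al (partial_derivs bt f)"
 by (simp add: partial_derivs_def)

lemma partial_derivs_Nil [simp]: "partial_derivs [] f = f" by (simp add: partial_derivs_def)

lemma partial_derivs_Cons [simp]: "partial_derivs (v # al) f = dir_deriv v (partial_derivs al f)"
 by (simp add: partial_derivs_def)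

lemma smooth_has_vector_derivative:
 assumes "smooth f" "al \<in> lists Basis" "v \<in> Basis"
 shows "((\<lambda>t. partial_derivs al f (x + t *\<^sub>R v)) has_vector_derivative partial_derivs (v # al) f x) (at 0)"
proof -
 have "(\<lambda>t. partial_derivs al f (x + t *\<^sub>R v)) differentiable at 0"
  using assms by (auto simp: smooth_def)
 then show ?thesis by (simp add: vector_derivative_works dir_deriv_def)
qed

text \<open>Brackets are at least 1 and \<delta> \<le> \<rho>, so the gain \<rho> per frequency
  derivative may be weakened to \<delta>. Within the basis of the product space
  \<open>(v, 0)\<close> is a direction of the position and \<open>(0, v)\<close> one of the
  frequency.\<close>

lemma APS_ap_symbol:
 fixes a :: "'a::euclidean_space \<times> 'a => complex"
 assumes "0 \<le> \<delta>" "\<delta> < 1" "\<delta> \<le> \<rho>" and a: "a \<in> APS m \<rho> \<delta>"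
 shows "ap_symbol (\<lambda>al bt x xi. partial_derivs (map (\<lambda>v. (0, v)) al) (partial_derivs (map (\<lambda>v. (v, 0)) bt) a) (x, xi)) m \<delta>"
proof
 have smooth: "smooth a" using a by (simp add: APS_def)
 have lists: "map (\<lambda>v. (0, v)) al @ map (\<lambda>v. (v, 0)) bt \<in> lists (Basis :: ('a \<times> 'a) set)"
  if "al \<in> lists Basis" "bt \<in> lists Basis" for al bt using that by (auto simp: Basis_prod_def)
 show "0 \<le> \<delta>" "\<delta> < 1" by fact+
 show "almost_periodic (\<lambda>x. partial_derivs (map (\<lambda>v. (0, v)) []) (partial_derivs (map (\<lambda>v. (v, 0)) []) a) (x, xi))" for xi
  using a by (simp add: APS_def)
 show "deriv_family (\<lambda>al. (\<lambda>xi. partial_derivs (map (\<lambda>v. (0, v)) al) (partial_derivs (map (\<lambda>v. (v, 0)) bt) a) (x, xi)))"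
  if "bt \<in> lists Basis" for bt x unfolding deriv_family_def
 proof (intro ballI allI)
  fix al e xi assume "al \<in> lists (Basis::'a set)" "e \<in> (Basis::'a set)"
  then show "((\<lambda>t. partial_derivs (map (\<lambda>v. (0, v)) al) (partial_derivs (map (\<lambda>v. (v, 0)) bt) a) (x, xi + t *\<^sub>R e))
    has_vector_derivative partial_derivs (map (\<lambda>v. (0, v)) (e # al)) (partial_derivs (map (\<lambda>v. (v, 0)) bt) a) (x, xi)) (at 0)"
   using smooth_has_vector_derivative[OF smooth lists[OF _ that], of al "(0, e)" "(x, xi)"]
   by (simp add: partial_derivs_append Basis_prod_def)
 qed
 show "((\<lambda>t. partial_derivs (map (\<lambda>v. (0, v)) []) (partial_derivs (map (\<lambda>v. (v, 0)) bt) a) (x + t *\<^sub>R e, xi))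
   has_vector_derivative partial_derivs (map (\<lambda>v. (0, v)) []) (partial_derivs (map (\<lambda>v. (v, 0)) (e # bt)) a) (x, xi)) (at 0)"
  if "bt \<in> lists Basis" "e \<in> Basis" for bt e x xi
  using smooth_has_vector_derivative[OF smooth lists[OF _ that(1)], of "[]" "(e, 0)" "(x, xi)"] that
  by (simp add: Basis_prod_def)
 show "\<exists>C. \<forall>x xi. cmod (partial_derivs (map (\<lambda>v. (0, v)) al) (partial_derivs (map (\<lambda>v. (v, 0)) bt) a) (x, xi))
   \<le> C * bracket xi powr (m - \<delta> * real (length al) + \<delta> * real (length bt))"
  if albt: "al \<in> lists Basis" "bt \<in> lists Basis" for al bt
 proof -
  let ?f = "\<lambda>x xi. cmod (partial_derivs (map (\<lambda>v. (0, v)) al) (partial_derivs (map (\<lambda>v. (v, 0)) bt) a) (x, xi))"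
  have "bdd_above (range (\<lambda>(x, xi). bracket xi powr (- m + \<rho> * real (length al) - \<delta> * real (length bt)) * ?f x xi))"
   using a albt by (simp add: APS_def)
  then obtain C where C: "\<And>x xi. bracket xi powr (- m + \<rho> * real (length al) - \<delta> * real (length bt)) * ?f x xi \<le> C"
   unfolding bdd_above_def by auto
  have "?f x xi \<le> C * bracket xi powr (m - \<delta> * real (length al) + \<delta> * real (length bt))" for x xi
  proof -
   define p where "p = - m + \<rho> * real (length al) - \<delta> * real (length bt)"
   have C': "bracket xi powr p * ?f x xi \<le> C" using C by (simp add: p_def)
   then have "C \<ge> 0" by (meson mult_nonneg_nonneg norm_ge_zero order_trans powr_ge_zero)
   have "?f x xi = bracket xi powr (- p) * (bracket xi powr p * ?f x xi)"
    by (simp add: powr_minus less_imp_neq[OF bracket_pos, symmetric])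
   also have "... \<le> bracket xi powr (- p) * C" using C' by (intro mult_left_mono) auto
   also have "... \<le> bracket xi powr (m - \<delta> * real (length al) + \<delta> * real (length bt)) * C"
    using \<open>C \<ge> 0\<close> \<open>\<delta> \<le> \<rho>\<close> bracket_ge_1[of xi]
    by (intro mult_right_mono powr_mono) (auto simp: p_def intro!: mult_right_mono)
   finally show ?thesis by (simp add: mult.commute)
  qed
  then show ?thesis by blast
 qed
qed

section \<open>The spaces \<open>l\<^sup>2\<^sub>s\<close>\<close>

text \<open>The norm of a finite section. Estimates in \<open>l2 s\<close> are proved for sections,
  uniformly in \<open>F\<close>, and passed on by \<open>l2I\<close> and
  \<open>l2_norm_leI\<close>.\<close>

definition wsec :: "real => ('a::euclidean_space => complex) => 'a set => real" where
 "wsec s z F = L2_set (\<lambda>mu. bracket mu powr s * cmod (z mu)) F"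

lemma wsec_square: "(wsec s z F)\<^sup>2 = (\<Sum>mu\<in>F. bracket mu powr (2 * s) * (cmod (z mu))\<^sup>2)"
proof -
 have "(bracket mu powr s * cmod (z mu))\<^sup>2 = bracket mu powr (2 * s) * (cmod (z mu))\<^sup>2" for mu
  by (simp add: power_mult_distrib powr_power mult.commute less_imp_neq[OF bracket_pos, symmetric])
 then show ?thesis by (simp add: wsec_def L2_set_def sum_nonneg)
qed

lemma wsec_nonneg [simp]: "wsec s z F \<ge> 0" by (simp add: wsec_def L2_set_nonneg)

lemma l2_norm_nonneg [simp]: "l2_norm s z \<ge> 0"
 unfolding l2_norm_def by (intro real_sqrt_ge_zero infsum_nonneg) auto

lemma l2_norm_square: "(l2_norm s z)\<^sup>2 = (\<Sum>\<^sub>\<infinity>mu\<in>UNIV. bracket mu powr (2 * s) * (cmod (z mu))\<^sup>2)"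
 unfolding l2_norm_def by (intro real_sqrt_pow2 infsum_nonneg) auto

lemma wsec_le_l2_norm:
 assumes "z \<in> l2 s" "finite F"
 shows "wsec s z F \<le> l2_norm s z"
proof -
 have "(wsec s z F)\<^sup>2 \<le> (l2_norm s z)\<^sup>2" unfolding wsec_square l2_norm_square using assms
  by (intro finite_sum_le_infsum) (auto simp: l2_def)
 then show ?thesis by (rule power2_le_imp_le) simp
qed

text \<open>Bounded sections make the series of nonnegative terms summable, and a summable family
  has only countably many nonzero entries, which supplies the countable support demanded by
  \<open>l2\<close>.\<close>

lemma
 assumes "\<And>F. finite F ==> wsec s z F \<le> B"
 shows l2I: "z \<in> l2 s" and l2_norm_leI: "l2_norm s z \<le> B"
proof -
 have "B \<ge> 0" using assms[of "{}"] by (simp add: wsec_def)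
 have sq: "(\<Sum>mu\<in>F. bracket mu powr (2 * s) * (cmod (z mu))\<^sup>2) \<le> B\<^sup>2" if "finite F" for F
  unfolding wsec_square[symmetric] using assms[OF that] by (intro power_mono) auto
 have sum: "(\<lambda>mu. bracket mu powr (2 * s) * (cmod (z mu))\<^sup>2) summable_on UNIV"
  by (rule nonneg_bdd_above_summable_on) (auto intro!: bdd_aboveI[of _ "B\<^sup>2"] sq)
 have "countable {mu\<in>UNIV. bracket mu powr (2 * s) * (cmod (z mu))\<^sup>2 \<noteq> 0}"
  by (rule summable_countable_real[OF sum])
 then have "countable {mu. z mu \<noteq> 0}"
  by (rule countable_subset[rotated]) (auto simp: less_imp_neq[OF bracket_pos, symmetric])
 with sum show "z \<in> l2 s" by (simp add: l2_def)
 have "(l2_norm s z)\<^sup>2 \<le> B\<^sup>2"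
  unfolding l2_norm_square by (rule infsum_le_finite_sums[OF sum]) (rule sq)
 then show "l2_norm s z \<le> B" using \<open>B \<ge> 0\<close> by (rule power2_le_imp_le)
qed

lemma wsec_triangle: "wsec s (\<lambda>mu. z mu + y mu) F \<le> wsec s z F + wsec s y F"
proof -
 have "wsec s (\<lambda>mu. z mu + y mu) F \<le> L2_set (\<lambda>mu. bracket mu powr s * cmod (z mu) + bracket mu powr s * cmod (y mu)) F"
  unfolding wsec_def by (intro L2_set_mono) (auto simp: mult_left_mono norm_triangle_ineq simp flip: distrib_left)
 also have "... \<le> wsec s z F + wsec s y F" unfolding wsec_def by (rule L2_set_triangle_ineq)
 finally show ?thesis .
qed

lemma wsec_cmult: "wsec s (\<lambda>mu. c * z mu) F = cmod c * wsec s z F"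
 unfolding wsec_def by (simp add: norm_mult L2_set_right_distrib mult_ac)

lemma wsec_member_le:
 assumes "finite F" "mu \<in> F"
 shows "bracket mu powr s * cmod (z mu) \<le> wsec s z F"
 unfolding wsec_def using member_le_L2_set[OF assms, of "\<lambda>mu. bracket mu powr s * cmod (z mu)"] by simp

lemma
 assumes "z \<in> l2 s" "y \<in> l2 s"
 shows l2_add: "(\<lambda>mu. z mu + y mu) \<in> l2 s"
  and l2_norm_triangle: "l2_norm s (\<lambda>mu. z mu + y mu) \<le> l2_norm s z + l2_norm s y"
proof -
 have "wsec s (\<lambda>mu. z mu + y mu) F \<le> l2_norm s z + l2_norm s y" if "finite F" for F
  by (intro order_trans[OF wsec_triangle add_mono] wsec_le_l2_norm assms that)
 note * = this
 show "(\<lambda>mu. z mu + y mu) \<in> l2 s" using * by (rule l2I)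
 show "l2_norm s (\<lambda>mu. z mu + y mu) \<le> l2_norm s z + l2_norm s y" using * by (rule l2_norm_leI)
qed

lemma l2_cmult:
 assumes "z \<in> l2 s"
 shows "(\<lambda>mu. c * z mu) \<in> l2 s"
proof (rule l2I)
 show "wsec s (\<lambda>mu. c * z mu) F \<le> cmod c * l2_norm s z" if "finite F" for F
  unfolding wsec_cmult by (intro mult_left_mono wsec_le_l2_norm assms that) auto
qed

lemma l2_norm_cmult: "l2_norm s (\<lambda>mu. c * z mu) = cmod c * l2_norm s z"
proof -
 have "(\<Sum>\<^sub>\<infinity>mu\<in>UNIV. bracket mu powr (2 * s) * (cmod (c * z mu))\<^sup>2)
   = (\<Sum>\<^sub>\<infinity>mu\<in>UNIV. (cmod c)\<^sup>2 * (bracket mu powr (2 * s) * (cmod (z mu))\<^sup>2))"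
  by (simp add: norm_mult power_mult_distrib mult_ac)
 then show ?thesis by (simp add: l2_norm_def infsum_cmult_right' real_sqrt_mult)
qed

lemma l2_diff:
 assumes "z \<in> l2 s" "y \<in> l2 s"
 shows "(\<lambda>mu. z mu - y mu) \<in> l2 s" using l2_add[OF assms(1) l2_cmult[OF assms(2), of "-1"]] by simp

lemma l2_norm_diff_triangle:
 assumes "z \<in> l2 s" "y \<in> l2 s"
 shows "l2_norm s (\<lambda>mu. z mu - y mu) \<le> l2_norm s z + l2_norm s y"
 using l2_norm_triangle[OF assms(1) l2_cmult[OF assms(2), of "-1"]] l2_norm_cmult[of s "-1" y] by simp

lemma l2_zero [simp]: "(\<lambda>_. 0) \<in> l2 s" by (rule l2I[where B = 0]) (simp add: wsec_def L2_set_def)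

lemma l2_norm_zero [simp]: "l2_norm s (\<lambda>_. 0) = 0" by (simp add: l2_norm_def)

lemma l2_finite_support:
 assumes "finite F" "\<And>mu. mu \<notin> F ==> z mu = 0"
 shows "z \<in> l2 s"
proof (rule l2I)
 show "wsec s z G \<le> wsec s z F" if "finite G" for G unfolding wsec_def L2_set_def
  by (intro real_sqrt_le_mono, subst sum.mono_neutral_right[of "F \<union> G" F, symmetric])
   (use assms that in \<open>auto intro!: sum_mono2\<close>)
qed

lemma l2_coord:
 assumes "z \<in> l2 s"
 shows "cmod (z mu) \<le> bracket mu powr (- s) * l2_norm s z"
proof -
 have "bracket mu powr s * cmod (z mu) \<le> l2_norm s z"
  using wsec_member_le[of "{mu}" mu s z] wsec_le_l2_norm[OF assms, of "{mu}"] by simp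
 then have "bracket mu powr (- s) * (bracket mu powr s * cmod (z mu)) \<le> bracket mu powr (- s) * l2_norm s z"
  by (intro mult_left_mono) auto
 then show ?thesis by (simp only: powr_minus_cancel[OF bracket_pos])
qed

lemma l2_norm_eq_0: "z \<in> l2 s ==> l2_norm s z = 0 ==> z = (\<lambda>_. 0)" using l2_coord[of z s] by fastforce

section \<open>Matrices acting between the spaces \<open>l\<^sup>2\<^sub>s\<close>\<close>

definition kernel_apply :: "('a => 'a => complex) => ('a => complex) => 'a => complex" where
 "kernel_apply R z = (\<lambda>mu. \<Sum>\<^sub>\<infinity>mu'\<in>UNIV. R mu mu' * z mu')"

text \<open>Boundedness from \<open>l2 s\<close> to \<open>l2 t\<close>, written as an unweighted
  bound for the conjugated matrix.\<close>

definition weighted_opbound :: "real => real => ('a::euclidean_space => 'a => complex) => real => bool" where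
 "weighted_opbound s t R C \<longleftrightarrow>
  opbound (\<lambda>mu mu'. of_real (bracket mu powr t) * R mu mu' * of_real (bracket mu' powr (- s))) UNIV UNIV C"

lemma weighted_opboundD:
 assumes "weighted_opbound s t R C" "finite F" "finite F'"
 shows "cmod (\<Sum>mu\<in>F. \<Sum>mu'\<in>F'. w mu * of_real (bracket mu powr t) * R mu mu' * z mu') \<le>
  C * (L2_set (\<lambda>mu. cmod (w mu)) F * wsec s z F')"
proof -
 have "cmod (\<Sum>mu\<in>F. \<Sum>mu'\<in>F'. w mu * (of_real (bracket mu powr t) * R mu mu' * of_real (bracket mu' powr (- s)))
   * (of_real (bracket mu' powr s) * z mu')) \<le>
  C * (L2_set (\<lambda>mu. cmod (w mu)) F * L2_set (\<lambda>mu'. cmod (of_real (bracket mu' powr s) * z mu')) F')"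
  using assms unfolding weighted_opbound_def by (intro opboundD) auto
 moreover have "w mu * (of_real (bracket mu powr t) * R mu mu' * of_real (bracket mu' powr (- s))) * (of_real (bracket mu' powr s) * z mu')
   = w mu * of_real (bracket mu powr t) * R mu mu' * z mu'" for mu mu'
 proof -
  have "complex_of_real (bracket mu' powr (- s)) * of_real (bracket mu' powr s) = 1"
   unfolding of_real_mult[symmetric] powr_add[symmetric] by (simp add: less_imp_neq[OF bracket_pos, symmetric])
  then show ?thesis by (simp add: mult.assoc)
 qed
 ultimately show ?thesis by (simp add: wsec_def norm_mult)
qed

lemma kernel_apply_abs_summable:
 assumes R: "weighted_opbound s t R C" and z: "z \<in> l2 s" and "C \<ge> 0"
 shows "(\<lambda>mu'. norm (R mu mu' * z mu')) summable_on UNIV"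
proof (rule nonneg_bdd_above_summable_on)
 show "bdd_above (sum (\<lambda>mu'. norm (R mu mu' * z mu')) ` {F. F \<subseteq> UNIV \<and> finite F})"
 proof (rule bdd_aboveI)
  fix r assume "r \<in> sum (\<lambda>mu'. norm (R mu mu' * z mu')) ` {F. F \<subseteq> UNIV \<and> finite F}"
  then obtain F where F: "finite F" "r = (\<Sum>mu'\<in>F. cmod (R mu mu' * z mu'))" by auto
  \<comment> \<open>The phases are chosen so that the row times \<open>y\<close> consists of
    absolute values. Testing the form with a single row and this vector bounds the absolute partial
    sums.\<close>
  define y where "y mu' = z mu' * cnj (sgn (R mu mu' * z mu'))" for mu'
  have y: "R mu mu' * y mu' = of_real (cmod (R mu mu' * z mu'))" for mu'
  proof -
   have "u * cnj (sgn u) = of_real (cmod u)" for u :: complex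
    by (cases "u = 0") (simp_all add: sgn_eq complex_norm_square[symmetric] power2_eq_square)
   from this[of "R mu mu' * z mu'"] show ?thesis by (simp add: y_def mult_ac)
  qed
  have "cmod (y mu') \<le> cmod (z mu')" for mu' by (simp add: y_def norm_mult norm_sgn)
  then have "wsec s y F \<le> wsec s z F" unfolding wsec_def by (intro L2_set_mono mult_left_mono) auto
  also have "... \<le> l2_norm s z" by (rule wsec_le_l2_norm[OF z F(1)])
  finally have wy: "wsec s y F \<le> l2_norm s z" .
  have "cmod (\<Sum>mu\<in>{mu}. \<Sum>mu'\<in>F. 1 * of_real (bracket mu powr t) * R mu mu' * y mu') \<le> C * (L2_set (\<lambda>mu. cmod 1) {mu} * wsec s y F)"
   by (rule weighted_opboundD[OF R _ F(1)]) simp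
  then have "cmod (of_real (bracket mu powr t) * (\<Sum>mu'\<in>F. R mu mu' * y mu')) \<le> C * wsec s y F"
   by (simp add: sum_distrib_left mult.assoc)
  also have "(\<Sum>mu'\<in>F. R mu mu' * y mu') = of_real r" unfolding F(2) of_real_sum y ..
  finally have "bracket mu powr t * \<bar>r\<bar> \<le> C * wsec s y F" by (simp add: norm_mult)
  moreover have "r \<ge> 0" unfolding F(2) by (intro sum_nonneg) auto
  ultimately have "bracket mu powr t * r \<le> C * wsec s y F" by simp
  also have "... \<le> C * l2_norm s z" using wy \<open>C \<ge> 0\<close> by (rule mult_left_mono)
  finally have "bracket mu powr (- t) * (bracket mu powr t * r) \<le> bracket mu powr (- t) * (C * l2_norm s z)"
   by (intro mult_left_mono) auto
  then show "r \<le> bracket mu powr (- t) * (C * l2_norm s z)" by (simp only: powr_minus_cancel[OF bracket_pos])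
 qed
qed auto

text \<open>For a fixed finite set \<open>F\<close> of rows the bound holds for every finite set of
  columns by duality; the limit over the column sets then needs only coordinatewise convergence in
  finitely many rows.\<close>

lemma
 assumes R: "weighted_opbound s t R C" and z: "z \<in> l2 s" and C: "C \<ge> 0"
 shows kernel_apply_l2: "kernel_apply R z \<in> l2 t"
  and kernel_apply_norm: "l2_norm t (kernel_apply R z) \<le> C * l2_norm s z"
proof -
 have "wsec t (kernel_apply R z) F \<le> C * l2_norm s z" if F: "finite F" for F
 proof (rule tendsto_upperbound)
  define P where "P F' mu = (\<Sum>mu'\<in>F'. R mu mu' * z mu')" for F' mu
  have lim: "((\<lambda>F'. P F' mu) \<longlongrightarrow> kernel_apply R z mu) (finite_subsets_at_top UNIV)" for mu
   using has_sum_infsum[OF abs_summable_summable[OF kernel_apply_abs_summable[OF R z C, of mu]]]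
   by (simp add: has_sum_def P_def kernel_apply_def)
  show "((\<lambda>F'. wsec t (P F') F) \<longlongrightarrow> wsec t (kernel_apply R z) F) (finite_subsets_at_top UNIV)"
   unfolding wsec_def L2_set_def by (intro tendsto_intros lim)
  show "\<forall>\<^sub>F F' in finite_subsets_at_top UNIV. wsec t (P F') F \<le> C * l2_norm s z"
  proof (rule eventually_finite_subsets_at_top_weakI)
   fix F' :: "'a set" assume F': "finite F'"
   \<comment> \<open>The dual vector of the weighted output: pairing with it gives the square of the
     section norm, of which one factor cancels.\<close>
   define w where "w mu = cnj (of_real (bracket mu powr t) * P F' mu)" for mu
   have "(\<Sum>mu\<in>F. \<Sum>mu'\<in>F'. w mu * of_real (bracket mu powr t) * R mu mu' * z mu')
     = (\<Sum>mu\<in>F. w mu * (of_real (bracket mu powr t) * P F' mu))"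
    unfolding P_def by (simp add: sum_distrib_left mult.assoc)
   also have "... = (\<Sum>mu\<in>F. of_real ((bracket mu powr t * cmod (P F' mu))\<^sup>2))" unfolding w_def
    by (intro sum.cong refl, subst mult.commute, subst complex_norm_square[symmetric])
     (simp add: norm_mult)
   also have "... = of_real ((wsec t (P F') F)\<^sup>2)" by (simp add: wsec_def L2_set_def sum_nonneg)
   finally have "(wsec t (P F') F)\<^sup>2 \<le> C * (L2_set (\<lambda>mu. cmod (w mu)) F * wsec s z F')"
    using weighted_opboundD[OF R F F', of w z] by (simp only:) (simp add: norm_power)
   also have "L2_set (\<lambda>mu. cmod (w mu)) F = wsec t (P F') F" by (simp add: w_def wsec_def norm_mult)
   also have "C * (wsec t (P F') F * wsec s z F') \<le> C * (wsec t (P F') F * l2_norm s z)"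
    using C by (intro mult_left_mono wsec_le_l2_norm z F') auto
   finally have "wsec t (P F') F * wsec t (P F') F \<le> wsec t (P F') F * (C * l2_norm s z)"
    by (simp add: power2_eq_square mult_ac)
   then show "wsec t (P F') F \<le> C * l2_norm s z"
    using C by (cases "wsec t (P F') F = 0") (auto simp: mult_le_cancel_left less_le)
  qed
 qed simp
 note * = this
 show "kernel_apply R z \<in> l2 t" using * by (rule l2I)
 show "l2_norm t (kernel_apply R z) \<le> C * l2_norm s z" using * by (rule l2_norm_leI)
qed

lemma kernel_apply_linear:
 assumes R: "weighted_opbound s t R C" "C \<ge> 0" and "z \<in> l2 s" "y \<in> l2 s"
 shows "kernel_apply R (\<lambda>mu. c * z mu + y mu) = (\<lambda>mu. c * kernel_apply R z mu + kernel_apply R y mu)"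
proof
 fix mu
 have s: "(\<lambda>mu'. R mu mu' * z mu') summable_on UNIV" "(\<lambda>mu'. R mu mu' * y mu') summable_on UNIV"
  using assms by (auto intro: abs_summable_summable kernel_apply_abs_summable)
 have "kernel_apply R (\<lambda>mu. c * z mu + y mu) mu = (\<Sum>\<^sub>\<infinity>mu'\<in>UNIV. c * (R mu mu' * z mu') + R mu mu' * y mu')"
  by (simp add: kernel_apply_def algebra_simps)
 also have "... = c * kernel_apply R z mu + kernel_apply R y mu"
  unfolding kernel_apply_def using s by (subst infsum_add) (auto simp: infsum_cmult_right intro: summable_on_cmult_right)
 finally show "kernel_apply R (\<lambda>mu. c * z mu + y mu) mu = c * kernel_apply R z mu + kernel_apply R y mu" .
qed

section \<open>The norm of U(a)(\<xi>)\<close>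

definition U_kernel :: "('a::euclidean_space \<times> 'a => complex) => 'a => 'a => 'a => complex" where
 "U_kernel a xi mu mu' = fourier_coeff a (mu' - mu) (xi - mu')"

lemma U_symbol_eq: "U_symbol a xi = kernel_apply (U_kernel a xi)"
 by (simp add: fun_eq_iff U_symbol_def kernel_apply_def U_kernel_def)

lemma peetre: "bracket (ka::'a::euclidean_space) powr t \<le> (2 * bracket xi) powr \<bar>t\<bar> * bracket (xi - ka) powr t"
proof -
 have le: "bracket et \<le> 2 * bracket xi * bracket (xi - et)" for et :: 'a
 proof -
  have "bracket et \<le> bracket (xi - et) + norm xi"
   using bracket_lipschitz[of et "et - xi"] by (simp add: bracket_def norm_minus_commute)
  also have "... \<le> bracket (xi - et) + bracket xi" using norm_le_bracket[of xi] by simp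
  also have "... \<le> bracket xi * bracket (xi - et) + bracket xi * bracket (xi - et)"
   using bracket_ge_1[of xi] bracket_ge_1[of "xi - et"] by (intro add_mono) (auto simp: mult_le_cancel_left1 mult_le_cancel_right1)
  finally show ?thesis by simp
 qed
 show ?thesis
 proof (cases "t \<ge> 0")
  case True
  have "bracket ka powr t \<le> (2 * bracket xi * bracket (xi - ka)) powr t"
   using le True by (intro powr_mono2) (auto intro: less_imp_le)
  then show ?thesis using True by (simp add: powr_mult less_imp_le mult_ac)
 next
  case False
  \<comment> \<open>For negative exponents the basic inequality is used with \<open>ka\<close> and
    \<open>xi - ka\<close> exchanged.\<close>
  have "(2 * bracket xi * bracket ka) powr t \<le> bracket (xi - ka) powr t"
   using le[of "xi - ka"] False by (intro powr_mono2') auto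
  then have *: "(2 * bracket xi) powr (- t) * ((2 * bracket xi) powr t * bracket ka powr t) \<le> (2 * bracket xi) powr (- t) * bracket (xi - ka) powr t"
   by (intro mult_left_mono) (auto simp: powr_mult less_imp_le)
  have "(2 * bracket xi) powr (- t) * ((2 * bracket xi) powr t * bracket ka powr t) = bracket ka powr t"
   by (rule powr_minus_cancel) simp
  with * have "bracket ka powr t \<le> (2 * bracket xi) powr (- t) * bracket (xi - ka) powr t" by (simp only:)
  then show ?thesis using False by simp
 qed
qed

lemma opbound_reindex:
 fixes f :: "'a => 'c" and g :: "'b => 'd"
 assumes "opbound K UNIV UNIV C" "inj f" "inj g"
 shows "opbound (\<lambda>mu mu'. K (f mu) (g mu')) UNIV UNIV C" unfolding opbound_def
proof (intro allI impI)
 fix F :: "'a set" and F' :: "'b set" and w z assume F: "finite F" "finite F'"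
 have inj: "inj_on f F" "inj_on g F'" using assms by (auto intro: inj_on_subset)
 have "cmod (\<Sum>ka\<in>f ` F. \<Sum>ka'\<in>g ` F'. w (inv f ka) * K ka ka' * z (inv g ka')) \<le>
  C * (L2_set (\<lambda>ka. cmod (w (inv f ka))) (f ` F) * L2_set (\<lambda>ka'. cmod (z (inv g ka'))) (g ` F'))"
  using F by (intro opboundD[OF assms(1)]) auto
 then show "cmod (\<Sum>mu\<in>F. \<Sum>mu'\<in>F'. w mu * K (f mu) (g mu') * z mu') \<le>
   C * (L2_set (\<lambda>ka. cmod (w ka)) F * L2_set (\<lambda>ka'. cmod (z ka')) F')"
  using assms(2,3) by (simp add: L2_set_def sum.reindex[OF inj(1)] sum.reindex[OF inj(2)] inv_f_f)
qed

lemma U_kernel_bound: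
 fixes a :: "'a::euclidean_space \<times> 'a => complex"
 assumes "0 \<le> \<delta>" "\<delta> < 1" "\<delta> \<le> \<rho>" and a: "a \<in> APS m \<rho> \<delta>"
 shows "\<exists>C\<ge>0. \<forall>xi. weighted_opbound s (s - m) (U_kernel a xi) (C * bracket xi powr (\<bar>s\<bar> + \<bar>m - s\<bar>))"
  and "m \<le> 0 ==> \<exists>C\<ge>0. \<forall>xi. weighted_opbound 0 0 (U_kernel a xi) C"
proof -
 interpret ap_symbol "\<lambda>al bt x xi. partial_derivs (map (\<lambda>v. (0, v)) al) (partial_derivs (map (\<lambda>v. (v, 0)) bt) a) (x, xi)" m \<delta>
  by (rule APS_ap_symbol) fact+
 have K: "U_kernel a xi mu mu' = K [] (xi - mu) (xi - mu')" for xi mu mu'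
  by (simp add: U_kernel_def K_def fourier_coeff_eq)
 have inj: "inj (\<lambda>mu. xi - mu)" for xi :: 'a by (auto simp: inj_def)
 have b0: "bracket ka \<noteq> 0" for ka :: 'a by (simp add: less_imp_neq[OF bracket_pos, symmetric])
 have shifted: "\<exists>C\<ge>0. \<forall>xi. opbound (\<lambda>mu mu'. of_real (bracket (xi - mu) powr (s - m)) * U_kernel a xi mu mu'
   * of_real (bracket (xi - mu') powr (- s))) UNIV UNIV C" for s
 proof -
  obtain C where C: "C \<ge> 0" "opbound (\<lambda>ka ka'. of_real (bracket ka powr (s - m)) * K [] ka ka' * of_real (bracket ka' powr (- s))) UNIV UNIV C"
   using weighted_bound[of s] by auto
  show ?thesis using C(1) opbound_reindex[OF C(2) inj inj] unfolding K by blast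
 qed
 show "\<exists>C\<ge>0. \<forall>xi. weighted_opbound s (s - m) (U_kernel a xi) (C * bracket xi powr (\<bar>s\<bar> + \<bar>m - s\<bar>))"
 proof -
  obtain C where C: "C \<ge> 0" "\<And>xi. opbound (\<lambda>mu mu'. of_real (bracket (xi - mu) powr (s - m)) * U_kernel a xi mu mu'
   * of_real (bracket (xi - mu') powr (- s))) UNIV UNIV C" using shifted[of s] by auto
  define f where "f xi mu = bracket mu powr (s - m) * bracket (xi - mu) powr (m - s)" for xi mu :: 'a
  define g where "g xi mu = bracket (xi - mu) powr s * bracket mu powr (- s)" for xi mu :: 'a
  have f0: "f xi mu \<ge> 0" and g0: "g xi mu \<ge> 0" for xi mu by (auto simp: f_def g_def)
  have f: "f xi mu \<le> (2 * bracket xi) powr \<bar>s - m\<bar>" for xi mu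
   using mult_right_mono[OF peetre[of mu "s - m" xi], of "bracket (xi - mu) powr (m - s)"]
   by (simp add: f_def mult.assoc b0 flip: powr_add)
  have g: "g xi mu \<le> (2 * bracket xi) powr \<bar>s\<bar>" for xi mu
   using mult_right_mono[OF peetre[of "xi - mu" s xi], of "bracket mu powr (- s)"]
   by (simp add: g_def mult.assoc b0 flip: powr_add)
  have "weighted_opbound s (s - m) (U_kernel a xi) (2 powr \<bar>s - m\<bar> * 2 powr \<bar>s\<bar> * C * bracket xi powr (\<bar>s\<bar> + \<bar>m - s\<bar>))" for xi
  proof -
   have "opbound (\<lambda>mu mu'. of_real (f xi mu) * (of_real (bracket (xi - mu) powr (s - m)) * U_kernel a xi mu mu'
     * of_real (bracket (xi - mu') powr (- s))) * of_real (g xi mu')) UNIV UNIV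
     ((2 * bracket xi) powr \<bar>s - m\<bar> * (2 * bracket xi) powr \<bar>s\<bar> * C)"
    using f g f0 g0 by (intro opbound_mult C) auto
   then have "opbound (\<lambda>mu mu'. of_real (bracket mu powr (s - m)) * U_kernel a xi mu mu' * of_real (bracket mu' powr (- s))) UNIV UNIV
     ((2 * bracket xi) powr \<bar>s - m\<bar> * (2 * bracket xi) powr \<bar>s\<bar> * C)"
   proof (rule opbound_cong)
    fix mu mu'
    have "f xi mu * bracket (xi - mu) powr (s - m) = bracket mu powr (s - m)"
     "bracket (xi - mu') powr (- s) * g xi mu' = bracket mu' powr (- s)"
     by (simp_all add: f_def g_def mult.assoc b0 flip: powr_add)
    then have "of_real (bracket mu powr (s - m)) = complex_of_real (f xi mu) * of_real (bracket (xi - mu) powr (s - m))"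
     "of_real (bracket mu' powr (- s)) = complex_of_real (bracket (xi - mu') powr (- s)) * of_real (g xi mu')"
     by (simp_all flip: of_real_mult)
    then show "of_real (bracket mu powr (s - m)) * U_kernel a xi mu mu' * of_real (bracket mu' powr (- s)) =
     of_real (f xi mu) * (of_real (bracket (xi - mu) powr (s - m)) * U_kernel a xi mu mu'
     * of_real (bracket (xi - mu') powr (- s))) * of_real (g xi mu')" by (simp only: mult.assoc)
   qed
   moreover have "(2 * bracket xi) powr \<bar>s - m\<bar> * (2 * bracket xi) powr \<bar>s\<bar> * C
     = 2 powr \<bar>s - m\<bar> * 2 powr \<bar>s\<bar> * C * bracket xi powr (\<bar>s\<bar> + \<bar>m - s\<bar>)"
    by (simp add: powr_mult less_imp_le powr_add abs_minus_commute)
   ultimately show ?thesis by (simp add: weighted_opbound_def)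
  qed
  then show ?thesis using C(1) by (intro exI[of _ "2 powr \<bar>s - m\<bar> * 2 powr \<bar>s\<bar> * C"]) auto
 qed
 show "\<exists>C\<ge>0. \<forall>xi. weighted_opbound 0 0 (U_kernel a xi) C" if "m \<le> 0"
 proof -
  obtain C where C: "C \<ge> 0" "\<And>xi. opbound (\<lambda>mu mu'. of_real (bracket (xi - mu) powr (0 - m)) * U_kernel a xi mu mu'
   * of_real (bracket (xi - mu') powr (- 0))) UNIV UNIV C" using shifted[of 0] by auto
  have "weighted_opbound 0 0 (U_kernel a xi) C" for xi
  proof -
   have "bracket ka powr m \<le> 1" for ka :: 'a using powr_mono[OF that bracket_ge_1[of ka]] by (simp add: b0)
   then have "opbound (\<lambda>mu mu'. of_real (bracket (xi - mu) powr m) * (of_real (bracket (xi - mu) powr (0 - m)) * U_kernel a xi mu mu'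
     * of_real (bracket (xi - mu') powr (- 0)))) UNIV UNIV (1 * C)" by (intro opbound_mult_left C) auto
   moreover have "complex_of_real (bracket (xi - mu) powr m) * (of_real (bracket (xi - mu) powr (- m)) * z) = z" for mu z
    unfolding mult.assoc[symmetric] of_real_mult[symmetric] powr_add[symmetric] by (simp add: b0)
   ultimately show ?thesis by (simp add: weighted_opbound_def b0)
  qed
  then show ?thesis using C(1) by blast
 qed
qed

section \<open>Bochner integration in \<open>l\<^sup>2\<^sub>s\<close> by coordinates\<close>

lemma countable_exhaust:
 assumes "countable La"
 obtains E :: "nat => 'a set" where "\<And>n. finite (E n)" "\<And>n. E n \<subseteq> La" "incseq E" "(\<Union>n. E n) = La"
proof (cases "La = {}")
 case True
 then show thesis by (intro that[of "\<lambda>_. {}"]) (auto simp: incseq_def)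
next
 case False
 have range: "range (from_nat_into La) = La" by (rule range_from_nat_into[OF False assms])
 show thesis
 proof (rule that[of "\<lambda>n. from_nat_into La ` {..n}"])
  show "incseq (\<lambda>n. from_nat_into La ` {..n})" by (auto simp: incseq_def)
  have "(\<Union>n. {..n}) = (UNIV::nat set)" by auto
  then show "(\<Union>n. from_nat_into La ` {..n}) = La" using range by (simp flip: image_UN)
 qed (use range in auto)
qed

text \<open>Unordered sums over a countable support become limits of sequences, which preserve
  measurability.\<close>

lemma has_sum_exhaust:
 fixes f :: "'a => 'b::{comm_monoid_add, topological_space}"
 assumes "(f has_sum S) UNIV" "\<And>x. x \<notin> La ==> f x = 0"
  and E: "\<And>n. finite (E n)" "\<And>n. E n \<subseteq> La" "incseq E" "(\<Union>n. E n) = La"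
 shows "(\<lambda>n. sum f (E n)) \<longlonglongrightarrow> S"
proof -
 have "(f has_sum S) La" using assms(1) by (rule has_sum_cong_neutral[THEN iffD1, rotated 3]) (use assms(2) in auto)
 moreover have "filterlim E (finite_subsets_at_top La) sequentially" unfolding filterlim_finite_subsets_at_top
 proof (intro allI impI)
  fix X assume X: "finite X \<and> X \<subseteq> La"
  then have "\<forall>x\<in>X. \<exists>n. x \<in> E n" using E(4) by auto
  then obtain k where k: "\<And>x. x \<in> X ==> x \<in> E (k x)" by metis
  define N where "N = Max (insert 0 (k ` X))"
  have "X \<subseteq> E n" if "n \<ge> N" for n
  proof
   fix x assume x: "x \<in> X"
   then have "k x \<le> n" using X that unfolding N_def by (meson Max_ge finite_imageI finite_insert image_eqI insertCI order_trans)
   then show "x \<in> E n" using k[OF x] E(3) by (auto simp: incseq_def)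
  qed
  then show "\<forall>\<^sub>F n in sequentially. finite (E n) \<and> X \<subseteq> E n \<and> E n \<subseteq> La"
   using E by (auto simp: eventually_sequentially)
 qed
 ultimately show ?thesis unfolding has_sum_def by (rule filterlim_compose)
qed

lemma wsec_exhaust:
 assumes "z \<in> l2 s" "\<And>mu. mu \<notin> La ==> z mu = 0"
  and E: "\<And>n. finite (E n)" "\<And>n. E n \<subseteq> La" "incseq E" "(\<Union>n. E n) = La"
 shows "(\<lambda>n. wsec s z (E n)) \<longlonglongrightarrow> l2_norm s z"
proof -
 have "((\<lambda>mu. bracket mu powr (2 * s) * (cmod (z mu))\<^sup>2) has_sum (l2_norm s z)\<^sup>2) UNIV"
  unfolding l2_norm_square using assms(1) by (intro has_sum_infsum) (simp add: l2_def)
 then have "(\<lambda>n. (wsec s z (E n))\<^sup>2) \<longlonglongrightarrow> (l2_norm s z)\<^sup>2"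
  unfolding wsec_square by (rule has_sum_exhaust) (use assms in auto)
 then have "(\<lambda>n. sqrt ((wsec s z (E n))\<^sup>2)) \<longlonglongrightarrow> sqrt ((l2_norm s z)\<^sup>2)"
  by (rule tendsto_real_sqrt)
 then show ?thesis by simp
qed

lemma l2_mono:
 assumes "z \<in> l2 s" "\<And>mu. cmod (y mu) \<le> C * cmod (z mu)" "C \<ge> 0"
 shows l2_monoI: "y \<in> l2 s" and l2_norm_mono: "l2_norm s y \<le> C * l2_norm s z"
proof -
 have *: "wsec s y F \<le> C * l2_norm s z" if "finite F" for F
 proof -
  have "wsec s y F \<le> wsec s (\<lambda>mu. of_real C * z mu) F"
   unfolding wsec_def using assms by (intro L2_set_mono mult_left_mono) (auto simp: norm_mult)
  also have "... = C * wsec s z F" using assms by (simp add: wsec_cmult)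
  also have "... \<le> C * l2_norm s z" by (intro mult_left_mono wsec_le_l2_norm assms that)
  finally show ?thesis .
 qed
 show "y \<in> l2 s" using * by (rule l2I)
 show "l2_norm s y \<le> C * l2_norm s z" using * by (rule l2_norm_leI)
qed

lemma l2_count_space:
 assumes "z \<in> l2 s"
 shows "integrable (count_space UNIV) (\<lambda>mu. bracket mu powr (2 * s) * (cmod (z mu))\<^sup>2)"
  and "(l2_norm s z)\<^sup>2 = (LINT mu|count_space UNIV. bracket mu powr (2 * s) * (cmod (z mu))\<^sup>2)"
proof -
 let ?g = "\<lambda>mu. bracket mu powr (2 * s) * (cmod (z mu))\<^sup>2"
 have "Infinite_Sum.abs_summable_on ?g UNIV" using assms by (simp add: l2_def)
 then have "Infinite_Set_Sum.abs_summable_on ?g UNIV" by (simp only: abs_summable_equivalent)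
 then show "integrable (count_space UNIV) ?g" "(l2_norm s z)\<^sup>2 = (LINT mu|count_space UNIV. ?g mu)"
  unfolding l2_norm_square by (simp_all add: infsetsum_infsum[symmetric] infsetsum_def abs_summable_on_def)
qed

text \<open>Dominated convergence for the counting measure; it lets dominated coordinatewise
  convergence stand in for convergence in norm.\<close>

lemma l2_dominated:
 assumes z: "z \<in> l2 s" and y: "\<And>n mu. cmod (y n mu) \<le> C * cmod (z mu)" "C \<ge> 0"
  and lim: "\<And>mu. (\<lambda>n. y n mu) \<longlonglongrightarrow> 0"
 shows "(\<lambda>n. l2_norm s (y n)) \<longlonglongrightarrow> 0"
proof -
 have yl: "y n \<in> l2 s" for n by (rule l2_monoI[OF z y])
 let ?g = "\<lambda>z mu. bracket mu powr (2 * s) * (cmod (z mu))\<^sup>2"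
 have "(\<lambda>n. LINT mu|count_space UNIV. ?g (y n) mu) \<longlonglongrightarrow> (LINT mu|count_space (UNIV::'a set). 0)"
 proof (rule integral_dominated_convergence[where w = "\<lambda>mu. C\<^sup>2 * ?g z mu"])
  show "integrable (count_space UNIV) (\<lambda>mu. C\<^sup>2 * ?g z mu)" using l2_count_space(1)[OF z] by simp
  show "AE mu in count_space UNIV. (\<lambda>n. ?g (y n) mu) \<longlonglongrightarrow> 0"
  proof (intro AE_I2)
   fix mu
   have "(\<lambda>n. ?g (y n) mu) \<longlonglongrightarrow> bracket mu powr (2 * s) * (cmod 0)\<^sup>2"
    by (intro tendsto_intros lim)
   then show "(\<lambda>n. ?g (y n) mu) \<longlonglongrightarrow> 0" by simp
  qed
  show "AE mu in count_space UNIV. norm (?g (y n) mu) \<le> C\<^sup>2 * ?g z mu" for n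
  proof (intro AE_I2)
   fix mu
   have "(cmod (y n mu))\<^sup>2 \<le> (C * cmod (z mu))\<^sup>2" using y by (intro power_mono) auto
   then have "bracket mu powr (2 * s) * (cmod (y n mu))\<^sup>2 \<le> bracket mu powr (2 * s) * (C * cmod (z mu))\<^sup>2"
    by (intro mult_left_mono) auto
   then show "norm (?g (y n) mu) \<le> C\<^sup>2 * ?g z mu" by (simp add: power_mult_distrib mult_ac)
  qed
 qed auto
 then have "(\<lambda>n. (l2_norm s (y n))\<^sup>2) \<longlonglongrightarrow> 0"
  using l2_count_space(2)[OF yl] by simp
 then have "(\<lambda>n. sqrt ((l2_norm s (y n))\<^sup>2)) \<longlonglongrightarrow> sqrt 0" by (rule tendsto_real_sqrt)
 then show ?thesis by simp
qed

section \<open>Strong measurability in terms of coordinates\<close>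

lemma lebesgue_borel_representative:
 fixes f :: "'a::euclidean_space => complex"
 assumes "f \<in> borel_measurable lebesgue"
 shows "\<exists>g\<in>borel_measurable borel. AE x in lborel. f x = g x"
proof -
 have "(\<lambda>x. Re (f x)) \<in> borel_measurable lebesgue" "(\<lambda>x. Im (f x)) \<in> borel_measurable lebesgue"
  using assms by measurable
 then obtain g h where gh: "g \<in> borel_measurable lborel" "AE x in lborel. Re (f x) = g x"
  "h \<in> borel_measurable lborel" "AE x in lborel. Im (f x) = h x"
  using completion_ex_borel_measurable_real by metis
 show ?thesis
 proof
  show "(\<lambda>x. Complex (g x) (h x)) \<in> borel_measurable borel"
   unfolding Complex_eq using gh by (auto intro!: borel_measurable_add borel_measurable_times borel_measurable_const measurable_compose[OF _ borel_measurable_of_real])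
  show "AE x in lborel. f x = Complex (g x) (h x)" using gh(2,4) by eventually_elim (simp add: complex_eq_iff)
 qed
qed

text \<open>Pettis' criterion in coordinates: a countable set that supports almost all values
  replaces separability, and the coordinates replace the functionals. Lebesgue rather than Borel
  measurability appears because \<open>l2_measurable\<close> asks for limits almost everywhere
  only.\<close>

definition coord_measurable :: "('a::euclidean_space => 'b => complex) => bool" where
 "coord_measurable F \<longleftrightarrow> (\<exists>La. countable La \<and> (AE x in lborel. \<forall>mu. mu \<notin> La \<longrightarrow> F x mu = 0)) \<and>
  (\<forall>mu. (\<lambda>x. F x mu) \<in> borel_measurable lebesgue)"

lemma coord_measurable_representative:
 assumes "coord_measurable F"
 shows "\<exists>F' La. countable La \<and> (\<forall>mu. (\<lambda>x. F' x mu) \<in> borel_measurable borel) \<and>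
  (\<forall>x mu. mu \<notin> La \<longrightarrow> F' x mu = 0) \<and> (AE x in lborel. F x = F' x)"
proof -
 obtain La where La: "countable La" "AE x in lborel. \<forall>mu. mu \<notin> La \<longrightarrow> F x mu = 0"
  and m: "\<And>mu. (\<lambda>x. F x mu) \<in> borel_measurable lebesgue"
  using assms unfolding coord_measurable_def by blast
 have "\<forall>mu. \<exists>g\<in>borel_measurable borel. AE x in lborel. F x mu = g x"
  using lebesgue_borel_representative[OF m] by blast
 then obtain g where g: "\<And>mu. g mu \<in> borel_measurable borel" "\<And>mu. AE x in lborel. F x mu = g mu x"
  by metis
 show ?thesis
 proof (intro exI[of _ "\<lambda>x mu. if mu \<in> La then g mu x else 0"] exI[of _ La] conjI)
  have "AE x in lborel. \<forall>mu\<in>La. F x mu = g mu x" using La(1) g(2) by (auto simp: AE_ball_countable)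
  with La(2) show "AE x in lborel. F x = (\<lambda>mu. if mu \<in> La then g mu x else 0)" by eventually_elim auto
 qed (use La g in auto)
qed

lemma coord_measurable_cong_AE:
 assumes "coord_measurable F" "AE x in lborel. F x = G x"
 shows "coord_measurable G" unfolding coord_measurable_def
proof (intro conjI allI)
 obtain La where La: "countable La" "AE x in lborel. \<forall>mu. mu \<notin> La \<longrightarrow> F x mu = 0"
  using assms(1) unfolding coord_measurable_def by blast
 have "AE x in lborel. \<forall>mu. mu \<notin> La \<longrightarrow> G x mu = 0"
  using La(2) assms(2) by eventually_elim auto
 with La(1) show "\<exists>La. countable La \<and> (AE x in lborel. \<forall>mu. mu \<notin> La \<longrightarrow> G x mu = 0)" by blast
 fix mu
 show "(\<lambda>x. G x mu) \<in> borel_measurable lebesgue"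
 proof (rule borel_measurable_AE)
  show "(\<lambda>x. F x mu) \<in> borel_measurable lebesgue" using assms(1) by (simp add: coord_measurable_def)
  show "AE x in lebesgue. F x mu = G x mu" using assms(2) by (intro AE_completion) (auto elim: eventually_mono)
 qed
qed

lemma coord_measurableI:
 assumes "countable La" "\<And>mu. (\<lambda>x. F x mu) \<in> borel_measurable borel" "\<And>x mu. mu \<notin> La ==> F x mu = 0"
 shows "coord_measurable F" unfolding coord_measurable_def using assms
 by (intro conjI allI exI[of _ La] measurable_completion) auto

text \<open>Domination together with coordinatewise convergence gives approximation in norm in each
  \<open>l2 s\<close> that contains the values of \<open>F\<close>, by \<open>l2_dominated\<close>.
  The factor 2 is that of the scalar approximation theorem for simple functions.\<close>

definition simple_approximants ::
 "('a::euclidean_space => 'b => complex) => (nat => 'a => 'b => complex) => bool" where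
 "simple_approximants F S \<longleftrightarrow> (\<forall>n. simple_function lborel (S n)) \<and>
  (\<forall>n x. finite {mu. S n x mu \<noteq> 0}) \<and> (\<forall>n x mu. cmod (S n x mu) \<le> 2 * cmod (F x mu)) \<and>
  (\<forall>x mu. (\<lambda>n. S n x mu) \<longlonglongrightarrow> F x mu)"

lemma simple_approximantsD:
 assumes "simple_approximants F S"
 shows "simple_function lborel (S n)" "finite {mu. S n x mu \<noteq> 0}"
  "cmod (S n x mu) \<le> 2 * cmod (F x mu)" "(\<lambda>n. S n x mu) \<longlonglongrightarrow> F x mu"
 using assms by (simp_all add: simple_approximants_def)

lemma simple_approximation:
 fixes F :: "'a::euclidean_space => 'b => complex"
 assumes La: "countable La" and m: "\<And>mu. (\<lambda>x. F x mu) \<in> borel_measurable borel"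
  and 0: "\<And>x mu. mu \<notin> La ==> F x mu = 0"
 shows "\<exists>S. simple_approximants F S"
proof -
 obtain E where E: "\<And>n. finite (E n)" "\<And>n. E n \<subseteq> La" "incseq E" "(\<Union>n. E n) = La"
  by (rule countable_exhaust[OF La]) (rule that; simp)
 have "\<forall>mu. \<exists>s. (\<forall>n. simple_function lborel (s n)) \<and> (\<forall>x. (\<lambda>n. s n x) \<longlonglongrightarrow> F x mu) \<and>
   (\<forall>n x. cmod (s n x) \<le> 2 * cmod (F x mu))"
  using borel_measurable_implies_sequence_metric[of "\<lambda>x. F x _" lborel 0] m by (simp add: dist_norm)
 then obtain s where s: "\<And>mu n. simple_function lborel (s mu n)" "\<And>mu x. (\<lambda>n. s mu n x) \<longlonglongrightarrow> F x mu"
  "\<And>mu n x. cmod (s mu n x) \<le> 2 * cmod (F x mu)" by metis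
 \<comment> \<open>At stage \<open>n\<close> only the coordinates in the finite set
   \<open>E n\<close> are approximated. Hence the values have finite support, and \<open>S n\<close>
   is simple as an iterated update by finitely many scalar simple functions.\<close>
 define S where "S n x mu = (if mu \<in> E n then s mu n x else 0)" for n x mu
 show ?thesis unfolding simple_approximants_def
 proof (intro exI[of _ S] conjI allI)
  show "simple_function lborel (S n)" for n
  proof -
   have "simple_function lborel (\<lambda>x mu. if mu \<in> G then s mu n x else 0)" if "finite G" for G using that
   proof induction
    case empty
    show ?case by simp
   next
    case (insert nu G)
    have "simple_function lborel (\<lambda>x. (\<lambda>f v. f(nu := v)) (\<lambda>mu. if mu \<in> G then s mu n x else 0) (s nu n x))"
     by (rule simple_function_compose2[OF insert.IH s(1)])
    also have "(\<lambda>x. (\<lambda>f v. f(nu := v)) (\<lambda>mu. if mu \<in> G then s mu n x else 0) (s nu n x))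
      = (\<lambda>x mu. if mu \<in> insert nu G then s mu n x else 0)" by (auto simp: fun_eq_iff)
    finally show ?case .
   qed
   from this[OF E(1)] show ?thesis by (simp add: S_def[abs_def])
  qed
  show "finite {mu. S n x mu \<noteq> 0}" for n x by (rule finite_subset[OF _ E(1)[of n]]) (auto simp: S_def)
  show "cmod (S n x mu) \<le> 2 * cmod (F x mu)" for n x mu using s(3) by (simp add: S_def)
  show "(\<lambda>n. S n x mu) \<longlonglongrightarrow> F x mu" for x mu
  proof (cases "mu \<in> La")
   case True
   then obtain N where "mu \<in> E N" using E(4) by blast
   then have "\<forall>\<^sub>F n in sequentially. s mu n x = S n x mu"
    using E(3) unfolding eventually_sequentially by (intro exI[of _ N]) (auto simp: S_def incseq_def)
   then show ?thesis by (rule Lim_transform_eventually[OF s(2)])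
  next
   case False
   then have "S n x mu = 0" for n using E(2) by (auto simp: S_def)
   then show ?thesis using 0[OF False] by simp
  qed
 qed
qed

text \<open>Coordinates are continuous functionals, and the approximating simple functions have
  countably many values altogether, with countable supports; this gives one direction. Conversely,
  the coordinatewise approximants of a Borel representative converge in norm by domination.\<close>

lemma l2_measurable_iff:
 "l2_measurable s F \<longleftrightarrow> range F \<subseteq> l2 s \<and> coord_measurable F"
proof (intro iffI conjI)
 assume F: "l2_measurable s F"
 then show r: "range F \<subseteq> l2 s" by (simp add: l2_measurable_def)
 obtain S where S: "\<And>n. l2_simple s (S n)"
  "AE x in lborel. (\<lambda>n. l2_norm s (\<lambda>mu. F x mu - S n x mu)) \<longlonglongrightarrow> 0"
  using F by (auto simp: l2_measurable_def)
 have Sl2: "S n x \<in> l2 s" for n x using S(1)[of n] by (auto simp: l2_simple_def)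
 have lim: "AE x in lborel. \<forall>mu. (\<lambda>n. S n x mu) \<longlonglongrightarrow> F x mu" using S(2)
 proof eventually_elim
  case (elim x)
  show ?case
  proof
   fix mu
   have "(\<lambda>n. F x mu - S n x mu) \<longlonglongrightarrow> 0"
   proof (rule Lim_null_comparison)
    show "\<forall>\<^sub>F n in sequentially. norm (F x mu - S n x mu) \<le> bracket mu powr (- s) * l2_norm s (\<lambda>mu. F x mu - S n x mu)"
     using r Sl2 by (intro always_eventually allI l2_coord[of "\<lambda>mu. F x mu - S _ x mu"] l2_diff) auto
    show "(\<lambda>n. bracket mu powr (- s) * l2_norm s (\<lambda>mu. F x mu - S n x mu)) \<longlonglongrightarrow> 0"
     using elim by (auto intro!: tendsto_eq_intros)
   qed
   then show "(\<lambda>n. S n x mu) \<longlonglongrightarrow> F x mu"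
    using tendsto_diff[of "\<lambda>_. F x mu" "F x mu" sequentially "\<lambda>n. F x mu - S n x mu" 0] by simp
  qed
 qed
 define La where "La = (\<Union>n. \<Union>z\<in>range (S n). {mu. z mu \<noteq> 0})"
 show "coord_measurable F" unfolding coord_measurable_def
 proof (intro conjI allI exI[of _ La])
  show "countable La" unfolding La_def
  proof (intro countable_UN)
   show "countable (range (S n))" for n
    using simple_functionD(1)[of lborel "S n"] S(1)[of n] by (intro countable_finite) (auto simp: l2_simple_def)
   show "countable {mu. z mu \<noteq> 0}" if "z \<in> range (S n)" for z n using that Sl2 by (auto simp: l2_def)
  qed auto
  show "AE x in lborel. \<forall>mu. mu \<notin> La \<longrightarrow> F x mu = 0" using lim
  proof eventually_elim
   case (elim x)
   show ?case
   proof (intro allI impI)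
    fix mu assume "mu \<notin> La"
    then have "S n x mu = 0" for n by (auto simp: La_def)
    moreover have "(\<lambda>n. S n x mu) \<longlonglongrightarrow> F x mu" using elim by blast
    ultimately show "F x mu = 0" by (simp add: LIMSEQ_const_iff)
   qed
  qed
  fix mu
  have "(\<lambda>x. S n x mu) \<in> borel_measurable lborel" for n
  proof -
   have "simple_function lborel (S n)" using S(1)[of n] by (simp add: l2_simple_def)
   from borel_measurable_simple_function[OF simple_function_compose1[OF this, of "\<lambda>z. z mu"]]
   show ?thesis by simp
  qed
  then have "(\<lambda>x. lim (\<lambda>n. S n x mu)) \<in> borel_measurable lborel"
   by (rule borel_measurable_lim_metric)
  then have "(\<lambda>x. lim (\<lambda>n. S n x mu)) \<in> borel_measurable lebesgue" by (rule measurable_completion)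
  then show "(\<lambda>x. F x mu) \<in> borel_measurable lebesgue"
  proof (rule borel_measurable_AE)
   show "AE x in lebesgue. lim (\<lambda>n. S n x mu) = F x mu"
    using AE_completion[OF lim] by eventually_elim (auto intro: limI)
  qed
 qed
next
 assume F: "range F \<subseteq> l2 s \<and> coord_measurable F"
 obtain F' La where F': "countable La" "\<And>mu. (\<lambda>x. F' x mu) \<in> borel_measurable borel"
  "\<And>x mu. mu \<notin> La ==> F' x mu = 0" "AE x in lborel. F x = F' x"
  using coord_measurable_representative[of F] F by blast
 obtain S where "simple_approximants F' S" using simple_approximation[where F = F', OF F'(1-3)] by blast
 note S = simple_approximantsD[OF this]
 show "l2_measurable s F" unfolding l2_measurable_def
 proof (intro conjI exI[of _ S] allI)
  show "l2_simple s (S n)" for n unfolding l2_simple_def using S(1,2) by (auto intro: l2_finite_support)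
  show "AE x in lborel. (\<lambda>n. l2_norm s (\<lambda>mu. F x mu - S n x mu)) \<longlonglongrightarrow> 0"
   using F'(4)
  proof eventually_elim
   case (elim x)
   show ?case
   proof (rule l2_dominated[where z = "F x" and C = 3])
    show "F x \<in> l2 s" using F by auto
    show "cmod (F x mu - S n x mu) \<le> 3 * cmod (F x mu)" for n mu
     using norm_triangle_ineq4[of "F x mu" "S n x mu"] S(3)[of n x mu] elim by simp
    show "(\<lambda>n. F x mu - S n x mu) \<longlonglongrightarrow> 0" for mu
     using tendsto_diff[OF tendsto_const S(4), of "F x mu" x mu] elim by simp
   qed simp
  qed
 qed (use F in auto)
qed

text \<open>A limit of norms of finite sections, taken along an exhaustion of the countable support
  of a representative.\<close>

lemma l2_norm_measurable:
 assumes "l2_measurable s F"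
 shows "(\<lambda>x. l2_norm s (F x)) \<in> borel_measurable lebesgue"
proof -
 have r: "range F \<subseteq> l2 s" and m: "coord_measurable F" using assms by (auto simp: l2_measurable_iff)
 obtain F' La where F': "countable La" "\<And>mu. (\<lambda>x. F' x mu) \<in> borel_measurable borel"
  "\<And>x mu. mu \<notin> La ==> F' x mu = 0" "AE x in lborel. F x = F' x"
  using coord_measurable_representative[OF m] by blast
 obtain E where E: "\<And>n. finite (E n)" "\<And>n. E n \<subseteq> La" "incseq E" "(\<Union>n. E n) = La"
  by (rule countable_exhaust[OF F'(1)]) (rule that; simp)
 have "(\<lambda>x. wsec s (F' x) (E n)) \<in> borel_measurable lborel" for n
  unfolding wsec_def L2_set_def using F'(2) by (auto intro!: borel_measurable_sqrt borel_measurable_sum)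
 then have "(\<lambda>x. lim (\<lambda>n. wsec s (F' x) (E n))) \<in> borel_measurable lborel"
  by (rule borel_measurable_lim_metric)
 then have "(\<lambda>x. lim (\<lambda>n. wsec s (F' x) (E n))) \<in> borel_measurable lebesgue" by (rule measurable_completion)
 then show ?thesis
 proof (rule borel_measurable_AE)
  have "AE x in lborel. lim (\<lambda>n. wsec s (F' x) (E n)) = l2_norm s (F x)" using F'(4)
  proof eventually_elim
   case (elim x)
   have "F x \<in> l2 s" using r by auto
   then have "(\<lambda>n. wsec s (F' x) (E n)) \<longlonglongrightarrow> l2_norm s (F' x)"
    using F'(3) elim by (intro wsec_exhaust[OF _ _ E]) auto
   then show ?case using elim by (simp add: limI)
  qed
  then show "AE x in lebesgue. lim (\<lambda>n. wsec s (F' x) (E n)) = l2_norm s (F x)" by (rule AE_completion)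
 qed
qed

section \<open>The Bochner integral as a coordinatewise integral\<close>

text \<open>No exponent \<open>s\<close> occurs, so Bochner integrals in different spaces
  \<open>l2 s\<close> agree whenever both exist.\<close>

definition coord_integral :: "('a::euclidean_space => 'b => complex) => 'b => complex" where
 "coord_integral F mu = (LINT x|lebesgue. F x mu)"

definition l2_integrable :: "real => ('a::euclidean_space => 'a => complex) => bool" where
 "l2_integrable s F \<longleftrightarrow> l2_measurable s F \<and> (\<integral>\<^sup>+x. ennreal (l2_norm s (F x)) \<partial>lborel) < \<infinity>"

lemma l2_measurable_range: "l2_measurable s F ==> F x \<in> l2 s" by (auto simp: l2_measurable_def)

lemma l2_measurable_coord: "l2_measurable s F ==> (\<lambda>x. F x mu) \<in> borel_measurable lebesgue"
 by (simp add: l2_measurable_iff coord_measurable_def)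

lemma integrable_lebesgueI:
 fixes f :: "'a::euclidean_space => 'b::{banach, second_countable_topology}"
 assumes "f \<in> borel_measurable lebesgue" "(\<integral>\<^sup>+x. ennreal (norm (f x)) \<partial>lborel) < \<infinity>"
 shows "integrable lebesgue f" using assms by (intro integrableI_bounded) (simp_all add: nn_integral_completion)

lemma l2_integrable_norm:
 "l2_integrable s F ==> integrable lebesgue (\<lambda>x. l2_norm s (F x))"
 unfolding l2_integrable_def by (intro integrable_lebesgueI l2_norm_measurable) auto

lemma l2_integrable_coord:
 assumes "l2_integrable s F"
 shows "integrable lebesgue (\<lambda>x. F x mu)"
proof (rule Bochner_Integration.integrable_bound)
 show "integrable lebesgue (\<lambda>x. bracket mu powr (- s) * l2_norm s (F x))"
  using l2_integrable_norm[OF assms] by simp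
 show "(\<lambda>x. F x mu) \<in> borel_measurable lebesgue" using assms l2_measurable_coord unfolding l2_integrable_def by blast
 show "AE x in lebesgue. norm (F x mu) \<le> norm (bracket mu powr (- s) * l2_norm s (F x))"
 proof (intro AE_I2)
  fix x
  have "F x \<in> l2 s" using assms unfolding l2_integrable_def by (blast intro: l2_measurable_range)
  then show "norm (F x mu) \<le> norm (bracket mu powr (- s) * l2_norm s (F x))" using l2_coord by auto
 qed
qed

text \<open>Minkowski's integral inequality, by duality on finite sections.\<close>

lemma
 assumes "l2_integrable s F"
 shows coord_integral_l2: "coord_integral F \<in> l2 s"
  and coord_integral_norm: "l2_norm s (coord_integral F) \<le> (LINT x|lebesgue. l2_norm s (F x))"
proof -
 let ?B = "LINT x|lebesgue. l2_norm s (F x)"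
 have *: "wsec s (coord_integral F) G \<le> ?B" if G: "finite G" for G
 proof -
  let ?I = "coord_integral F" and ?W = "wsec s (coord_integral F) G"
  \<comment> \<open>The exponent \<open>2 * s\<close> makes the pairing with the integral equal to
    the squared section norm; Cauchy-Schwarz shares it equally between the two factors.\<close>
  define c where "c mu = of_real (bracket mu powr (2 * s)) * cnj (?I mu)" for mu
  have "of_real (?W\<^sup>2) = (\<Sum>mu\<in>G. c mu * ?I mu)"
   unfolding wsec_square c_def of_real_sum of_real_mult complex_norm_square
   by (intro sum.cong refl) (simp add: mult_ac)
  also have "... = (\<Sum>mu\<in>G. LINT x|lebesgue. c mu * F x mu)" by (simp add: coord_integral_def)
  also have "... = (LINT x|lebesgue. (\<Sum>mu\<in>G. c mu * F x mu))"
   using l2_integrable_coord[OF assms] by (subst Bochner_Integration.integral_sum) auto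
  finally have "?W\<^sup>2 = cmod (LINT x|lebesgue. (\<Sum>mu\<in>G. c mu * F x mu))"
   by (metis norm_of_real abs_of_nonneg zero_le_power2)
  also have "... \<le> (LINT x|lebesgue. cmod (\<Sum>mu\<in>G. c mu * F x mu))" by (rule integral_norm_bound)
  also have "... \<le> (LINT x|lebesgue. ?W * l2_norm s (F x))"
  proof (rule integral_mono)
   show "integrable lebesgue (\<lambda>x. cmod (\<Sum>mu\<in>G. c mu * F x mu))"
    using l2_integrable_coord[OF assms] by auto
   show "integrable lebesgue (\<lambda>x. ?W * l2_norm s (F x))" using l2_integrable_norm[OF assms] by simp
   fix x
   have "cmod (\<Sum>mu\<in>G. c mu * F x mu) \<le> (\<Sum>mu\<in>G. \<bar>bracket mu powr s * cmod (?I mu)\<bar> * \<bar>bracket mu powr s * cmod (F x mu)\<bar>)"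
    by (rule order_trans[OF norm_sum])
     (auto simp: c_def norm_mult abs_mult powr_add[symmetric] mult_ac mult_2[symmetric] intro!: sum_mono)
   also have "... \<le> ?W * wsec s (F x) G" unfolding wsec_def by (rule L2_set_mult_ineq)
   also have "... \<le> ?W * l2_norm s (F x)"
    using assms by (intro mult_left_mono wsec_le_l2_norm G) (auto simp: l2_integrable_def l2_measurable_range)
   finally show "cmod (\<Sum>mu\<in>G. c mu * F x mu) \<le> ?W * l2_norm s (F x)" .
  qed
  also have "... = ?W * ?B" by simp
  finally have le: "?W * ?W \<le> ?W * ?B" by (simp add: power2_eq_square)
  show ?thesis
  proof (cases "?W = 0")
   case True
   then show ?thesis by simp
  next
   case False
   then show ?thesis using le by (simp add: mult_le_cancel_left less_le)
  qed
 qed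
 show "coord_integral F \<in> l2 s" using * by (rule l2I)
 show "l2_norm s (coord_integral F) \<le> ?B" using * by (rule l2_norm_leI)
qed

lemma l2_simple_integral_coord:
 fixes S :: "'a::euclidean_space => 'a => complex"
 assumes "l2_simple_integrable s S"
 shows "integrable lborel (\<lambda>x. S x mu)" and "(LINT x|lborel. S x mu) = l2_simple_integral S mu"
proof -
 have S: "simple_function lborel S" and fin: "emeasure lborel {x. S x \<noteq> (\<lambda>_. 0)} < \<infinity>"
  using assms by (auto simp: l2_simple_integrable_def l2_simple_def less_top)
 have range: "finite (range S)" and sets: "{x. S x = z} \<in> sets lborel" for z
  using simple_functionD(1)[OF S] simple_functionD(2)[OF S, of "{z}"] by (auto simp: vimage_def)
 have eq: "S x mu = (\<Sum>z\<in>range S. indicator {x. S x = z} x *\<^sub>R z mu)" for x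
 proof -
  have "(\<Sum>z\<in>range S. indicator {x. S x = z} x *\<^sub>R z mu) = (\<Sum>z\<in>{S x}. indicator {x. S x = z} x *\<^sub>R z mu)"
   using range by (intro sum.mono_neutral_right) (auto simp: indicator_def)
  then show ?thesis by simp
 qed
 have int: "integrable lborel (\<lambda>x. indicator {x. S x = z} x *\<^sub>R z mu)" for z
 proof (cases "z mu = 0")
  case False
  then have "emeasure lborel {x. S x = z} \<le> emeasure lborel {x. S x \<noteq> (\<lambda>_. 0)}"
  proof (intro emeasure_mono)
   have "{x. S x \<noteq> (\<lambda>_. 0)} = space lborel - {x. S x = (\<lambda>_. 0)}" by auto
   then show "{x. S x \<noteq> (\<lambda>_. 0)} \<in> sets lborel" using sets by (metis sets.compl_sets)
  qed auto
  then have "emeasure lborel {x. S x = z} < \<infinity>" using fin by (rule le_less_trans)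
  then have "integrable lborel (indicator {x. S x = z} :: 'a => real)" using sets by simp
  then show ?thesis by (rule integrable_scaleR_left)
 qed simp
 show "integrable lborel (\<lambda>x. S x mu)" unfolding eq by (intro Bochner_Integration.integrable_sum int)
 have "(LINT x|lborel. S x mu) = (\<Sum>z\<in>range S. LINT x|lborel. indicator {x. S x = z} x *\<^sub>R z mu)"
  unfolding eq by (intro Bochner_Integration.integral_sum int)
 also have "... = l2_simple_integral S mu"
  unfolding l2_simple_integral_def by (intro sum.cong refl) (simp add: scaleR_conv_of_real)
 finally show "(LINT x|lborel. S x mu) = l2_simple_integral S mu" .
qed

lemma coord_measurable_linear:
 assumes "coord_measurable F" "coord_measurable G"
 shows "coord_measurable (\<lambda>x mu. c * F x mu + G x mu)"
proof -
 obtain A B where A: "countable A" "AE x in lborel. \<forall>mu. mu \<notin> A \<longrightarrow> F x mu = 0"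
  and B: "countable B" "AE x in lborel. \<forall>mu. mu \<notin> B \<longrightarrow> G x mu = 0"
  using assms unfolding coord_measurable_def by blast
 have "AE x in lborel. \<forall>mu. mu \<notin> A \<union> B \<longrightarrow> c * F x mu + G x mu = 0"
  using A(2) B(2) by eventually_elim auto
 then show ?thesis using assms A(1) B(1) unfolding coord_measurable_def
  by (intro conjI exI[of _ "A \<union> B"] allI borel_measurable_add borel_measurable_times) auto
qed

lemma l2_measurable_linear:
 "l2_measurable s F ==> l2_measurable s G ==> l2_measurable s (\<lambda>x mu. c * F x mu + G x mu)"
 unfolding l2_measurable_iff by (auto intro!: coord_measurable_linear l2_add l2_cmult)

lemma l2_measurable_diff:
 "l2_measurable s F ==> l2_measurable s G ==> l2_measurable s (\<lambda>x mu. F x mu - G x mu)"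
 using l2_measurable_linear[of s G F "- 1"] by simp

lemma l2_simple_measurable:
 fixes S :: "'a::euclidean_space => 'a => complex"
 shows "l2_simple s S ==> l2_measurable s S"
 unfolding l2_measurable_def by (intro conjI exI[of _ "\<lambda>_. S"]) (simp_all add: l2_simple_def)

text \<open>Approximation in mean forces the norm of \<open>F\<close> to be integrable, and
  Minkowski's inequality makes the simple integrals converge in every coordinate to the scalar
  integrals. Conversely, the dominated simple approximants converge in mean with majorant
  \<open>3 * l2_norm s (F x)\<close>.\<close>

lemma l2_has_integral_iff:
 fixes F :: "'a::euclidean_space => 'a => complex"
 shows "l2_has_integral s F I \<longleftrightarrow> l2_integrable s F \<and> I = coord_integral F"
proof (intro iffI)
 assume h: "l2_has_integral s F I"
 then obtain S where S: "\<And>n. l2_simple_integrable s (S n)"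
  "(\<lambda>n. \<integral>\<^sup>+x. ennreal (l2_norm s (\<lambda>mu. F x mu - S n x mu)) \<partial>lborel) \<longlonglongrightarrow> 0"
  "(\<lambda>n. l2_norm s (\<lambda>mu. l2_simple_integral (S n) mu - I mu)) \<longlonglongrightarrow> 0"
  and m: "l2_measurable s F" and I: "I \<in> l2 s" by (auto simp: l2_has_integral_def)
 let ?d = "\<lambda>n x. l2_norm s (\<lambda>mu. F x mu - S n x mu)"
 have mS: "l2_measurable s (S n)" for n using S(1)[of n] by (intro l2_simple_measurable) (simp add: l2_simple_integrable_def)
 have mD: "l2_measurable s (\<lambda>x mu. F x mu - S n x mu)" for n by (intro l2_measurable_diff m mS)
 have S_int: "l2_integrable s (S n)" for n unfolding l2_integrable_def
 proof (intro conjI mS)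
  have ss: "simple_function lborel (S n)" and em: "emeasure lborel {x. S n x \<noteq> (\<lambda>_. 0)} \<noteq> \<infinity>"
   using S(1)[of n] by (auto simp: l2_simple_integrable_def l2_simple_def)
  have "integrable lborel (\<lambda>x. l2_norm s (S n x))"
  proof (rule integrable.intros, rule has_bochner_integral_simple_bochner_integrable, rule simple_bochner_integrable.intros)
   show "simple_function lborel (\<lambda>x. l2_norm s (S n x))" by (rule simple_function_compose1[OF ss])
   have "emeasure lborel {y \<in> space lborel. l2_norm s (S n y) \<noteq> 0} \<le> emeasure lborel {x. S n x \<noteq> (\<lambda>_. 0)}"
   proof (intro emeasure_mono)
    have "{x. S n x \<noteq> (\<lambda>_. 0)} = S n -` (- {\<lambda>_. 0}) \<inter> space lborel" by auto
    then show "{x. S n x \<noteq> (\<lambda>_. 0)} \<in> sets lborel" using simple_functionD(2)[OF ss] by metis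
   qed auto
   then show "emeasure lborel {y \<in> space lborel. l2_norm s (S n y) \<noteq> 0} \<noteq> \<infinity>"
    using em by (metis infinity_ennreal_def neq_top_trans)
  qed
  then show "(\<integral>\<^sup>+x. ennreal (l2_norm s (S n x)) \<partial>lborel) < \<infinity>"
   by (simp add: integrable_iff_bounded)
 qed
 \<comment> \<open>Convergence to 0 in the extended reals makes the distances in mean finite from
   some \<open>N\<close> on; \<open>F\<close> is then integrable as the sum of \<open>S N\<close>
   and an integrable difference.\<close>
 obtain N where "\<And>n. n \<ge> N ==> (\<integral>\<^sup>+x. ennreal (?d n x) \<partial>lborel) < \<infinity>"
  using order_tendstoD(2)[OF S(2), of \<infinity>] by (auto simp: eventually_sequentially)
 then have fin: "l2_integrable s (\<lambda>x mu. F x mu - S n x mu)" if "n \<ge> N" for n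
  using mD that by (simp add: l2_integrable_def)
 have F_int: "l2_integrable s F" unfolding l2_integrable_def
 proof (intro conjI m)
  have "l2_norm s (F x) \<le> ?d N x + l2_norm s (S N x)" for x
   using l2_norm_triangle[of "\<lambda>mu. F x mu - S N x mu" s "S N x"] l2_measurable_range[OF mD] l2_measurable_range[OF mS] by simp
  then have "(\<integral>\<^sup>+x. ennreal (l2_norm s (F x)) \<partial>lebesgue) \<le>
    (\<integral>\<^sup>+x. ennreal (?d N x) + ennreal (l2_norm s (S N x)) \<partial>lebesgue)"
   by (intro nn_integral_mono) (simp flip: ennreal_plus)
  also have "... = (\<integral>\<^sup>+x. ennreal (?d N x) \<partial>lebesgue) + (\<integral>\<^sup>+x. ennreal (l2_norm s (S N x)) \<partial>lebesgue)"
   using l2_norm_measurable[OF mD] l2_norm_measurable[OF mS] by (intro nn_integral_add) auto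
  also have "... < \<infinity>" using fin[of N] S_int[of N] by (simp add: l2_integrable_def nn_integral_completion)
  finally show "(\<integral>\<^sup>+x. ennreal (l2_norm s (F x)) \<partial>lborel) < \<infinity>" by (simp add: nn_integral_completion)
 qed
 have "I mu = coord_integral F mu" for mu
 proof -
  have 1: "(\<lambda>n. l2_simple_integral (S n) mu) \<longlonglongrightarrow> I mu"
  proof (rule LIM_zero_cancel, rule Lim_null_comparison)
   have sl2: "l2_simple_integral (S n) \<in> l2 s" for n
   proof -
    have "l2_simple_integral (S n) = coord_integral (S n)" using l2_simple_integral_coord[OF S(1)[of n]]
     by (auto simp: fun_eq_iff coord_integral_def integral_completion borel_measurable_integrable)
    then show ?thesis using coord_integral_l2[OF S_int] by simp
   qed
   show "\<forall>\<^sub>F n in sequentially. norm (l2_simple_integral (S n) mu - I mu) \<le>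
     bracket mu powr (- s) * l2_norm s (\<lambda>mu. l2_simple_integral (S n) mu - I mu)"
    by (intro always_eventually allI l2_coord[of "\<lambda>mu. l2_simple_integral (S _) mu - I mu"] l2_diff sl2 I)
   show "(\<lambda>n. bracket mu powr (- s) * l2_norm s (\<lambda>mu. l2_simple_integral (S n) mu - I mu)) \<longlonglongrightarrow> 0"
    using S(3) by (auto intro!: tendsto_eq_intros)
  qed
  have 2: "(\<lambda>n. l2_simple_integral (S n) mu) \<longlonglongrightarrow> coord_integral F mu"
  proof (rule LIM_zero_cancel, rule Lim_null_comparison)
   show "\<forall>\<^sub>F n in sequentially. norm (l2_simple_integral (S n) mu - coord_integral F mu) \<le>
     bracket mu powr (- s) * enn2real (\<integral>\<^sup>+x. ennreal (?d n x) \<partial>lborel)"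
    using eventually_ge_at_top[of N]
   proof eventually_elim
    case (elim n)
    have "l2_simple_integral (S n) mu - coord_integral F mu = - (LINT x|lebesgue. F x mu - S n x mu)"
     using l2_simple_integral_coord[OF S(1)[of n], of mu] l2_integrable_coord[OF F_int, of mu] l2_integrable_coord[OF S_int, of n mu]
     by (simp add: coord_integral_def integral_completion borel_measurable_integrable)
    also have "norm ... = cmod (coord_integral (\<lambda>x mu. F x mu - S n x mu) mu)" by (simp add: coord_integral_def)
    also have "... \<le> bracket mu powr (- s) * l2_norm s (coord_integral (\<lambda>x mu. F x mu - S n x mu))"
     by (rule l2_coord[OF coord_integral_l2[OF fin[OF elim]]])
    also have "... \<le> bracket mu powr (- s) * (LINT x|lebesgue. ?d n x)"
     by (intro mult_left_mono coord_integral_norm[OF fin[OF elim]]) auto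
    also have "(LINT x|lebesgue. ?d n x) = enn2real (\<integral>\<^sup>+x. ennreal (?d n x) \<partial>lborel)"
     using l2_norm_measurable[OF mD] by (subst integral_eq_nn_integral) (auto simp: nn_integral_completion)
    finally show ?case .
   qed
   show "(\<lambda>n. bracket mu powr (- s) * enn2real (\<integral>\<^sup>+x. ennreal (?d n x) \<partial>lborel)) \<longlonglongrightarrow> 0"
    using tendsto_enn2real[OF S(2)[folded ennreal_0]] by (auto intro!: tendsto_eq_intros)
  qed
  show ?thesis by (rule LIMSEQ_unique[OF 1 2])
 qed
 then show "l2_integrable s F \<and> I = coord_integral F" using F_int by auto
next
 assume "l2_integrable s F \<and> I = coord_integral F"
 then have F: "l2_integrable s F" and I: "I = coord_integral F" by auto
 then have m: "l2_measurable s F" and r: "\<And>x. F x \<in> l2 s" by (auto simp: l2_integrable_def l2_measurable_range)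
 obtain F' La where F': "countable La" "\<And>mu. (\<lambda>x. F' x mu) \<in> borel_measurable borel"
  "\<And>x mu. mu \<notin> La ==> F' x mu = 0" "AE x in lborel. F x = F' x"
  using coord_measurable_representative[of F] m unfolding l2_measurable_iff by blast
 obtain S where "simple_approximants F' S" using simple_approximation[where F = F', OF F'(1-3)] by blast
 note S = simple_approximantsD[OF this]
 let ?d = "\<lambda>n x. l2_norm s (\<lambda>mu. F x mu - S n x mu)"
 have S_simple: "l2_simple s (S n)" for n unfolding l2_simple_def using S(1,2) by (auto intro: l2_finite_support)
 have mS: "l2_measurable s (S n)" for n by (rule l2_simple_measurable[OF S_simple])
 have mD: "l2_measurable s (\<lambda>x mu. F x mu - S n x mu)" for n by (intro l2_measurable_diff m mS)
 have S_le: "AE x in lborel. l2_norm s (S n x) \<le> 2 * l2_norm s (F x)" for n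
  using F'(4) by eventually_elim (rule l2_norm_mono[OF r], use S(3) in simp_all)
 have S_fin: "(\<integral>\<^sup>+x. ennreal (l2_norm s (S n x)) \<partial>lborel) < \<infinity>" for n
 proof -
  have "(\<integral>\<^sup>+x. ennreal (l2_norm s (S n x)) \<partial>lebesgue) \<le> (\<integral>\<^sup>+x. 2 * ennreal (l2_norm s (F x)) \<partial>lebesgue)"
  proof (intro nn_integral_mono_AE)
   show "AE x in lebesgue. ennreal (l2_norm s (S n x)) \<le> 2 * ennreal (l2_norm s (F x))"
    using AE_completion[OF S_le[of n]]
   proof eventually_elim
    case (elim x)
    from ennreal_leI[OF this] show ?case by (simp add: ennreal_mult')
   qed
  qed
  also have "... = 2 * (\<integral>\<^sup>+x. ennreal (l2_norm s (F x)) \<partial>lebesgue)"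
   using l2_norm_measurable[OF m] by (intro nn_integral_cmult) auto
  also have "... < \<infinity>" using F by (simp add: l2_integrable_def nn_integral_completion ennreal_mult_less_top)
  finally show ?thesis by (simp add: nn_integral_completion)
 qed
 have S_int: "l2_simple_integrable s (S n)" for n unfolding l2_simple_integrable_def
 proof (intro conjI S_simple)
  have bm: "(\<lambda>x. l2_norm s (S n x)) \<in> borel_measurable lborel"
   by (rule borel_measurable_simple_function[OF simple_function_compose1[OF S(1)]])
  \<comment> \<open>A simple function with integrable norm is nonzero only on a set of finite
    measure, which is what \<open>l2_simple_integrable\<close> asks for.\<close>
  have "integrable lborel (\<lambda>x. l2_norm s (S n x))"
   using S_fin[of n] bm by (simp add: integrable_iff_bounded)
  then have "Bochner_Integration.simple_bochner_integrable lborel (\<lambda>x. l2_norm s (S n x))"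
   using simple_bochner_integrableI_bounded[OF simple_function_compose1[OF S(1)[of n], of "l2_norm s"]]
   by (simp add: integrable_iff_bounded)
  then have "emeasure lborel {y \<in> space lborel. l2_norm s (S n y) \<noteq> 0} \<noteq> \<infinity>"
   by (rule Bochner_Integration.simple_bochner_integrable.cases)
  moreover have "l2_norm s (S n y) \<noteq> 0 \<longleftrightarrow> S n y \<noteq> (\<lambda>_. 0)" for y
   using l2_norm_eq_0[OF l2_measurable_range[OF mS[of n], of y]] by auto
  ultimately show "emeasure lborel {x. S n x \<noteq> (\<lambda>_. 0)} \<noteq> \<infinity>" by simp
 qed
 have lim: "(\<lambda>n. \<integral>\<^sup>+x. ennreal (?d n x) \<partial>lebesgue) \<longlonglongrightarrow> 0"
 proof -
  have "(\<lambda>n. \<integral>\<^sup>+x. ennreal (?d n x) \<partial>lebesgue) \<longlonglongrightarrow> (\<integral>\<^sup>+x. 0 \<partial>(lebesgue::'a measure))"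
  proof (rule nn_integral_dominated_convergence[where w = "\<lambda>x. 3 * ennreal (l2_norm s (F x))"])
   show "(\<lambda>x. ennreal (?d n x)) \<in> borel_measurable lebesgue" for n
    using l2_norm_measurable[OF mD] by simp
   show "(\<lambda>x. 3 * ennreal (l2_norm s (F x))) \<in> borel_measurable lebesgue"
    using l2_norm_measurable[OF m] by simp
   have "AE x in lborel. ennreal (?d n x) \<le> 3 * ennreal (l2_norm s (F x))" for n using S_le[of n]
   proof eventually_elim
    case (elim x)
    have "?d n x \<le> 3 * l2_norm s (F x)"
     using l2_norm_diff_triangle[OF r[of x] l2_measurable_range[OF mS[of n], of x]] elim by simp
    then have "ennreal (?d n x) \<le> ennreal (3 * l2_norm s (F x))" by (rule ennreal_leI)
    then show ?case by (simp add: ennreal_mult')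
   qed
   then show "AE x in lebesgue. ennreal (?d n x) \<le> 3 * ennreal (l2_norm s (F x))" for n by (rule AE_completion)
   have "AE x in lborel. (\<lambda>n. ennreal (?d n x)) \<longlonglongrightarrow> 0" using F'(4)
   proof eventually_elim
    case (elim x)
    have "(\<lambda>n. ?d n x) \<longlonglongrightarrow> 0"
    proof (rule l2_dominated[where z = "F x" and C = 3])
     show "cmod (F x mu - S n x mu) \<le> 3 * cmod (F x mu)" for n mu
      using norm_triangle_ineq4[of "F x mu" "S n x mu"] S(3)[of n x mu] elim by simp
     show "(\<lambda>n. F x mu - S n x mu) \<longlonglongrightarrow> 0" for mu
      using tendsto_diff[OF tendsto_const S(4), of "F x mu" x mu] elim by simp
    qed (use r in auto)
    from tendsto_ennrealI[OF this] show ?case by simp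
   qed
   then show "AE x in lebesgue. (\<lambda>n. ennreal (?d n x)) \<longlonglongrightarrow> 0" by (rule AE_completion)
   show "(\<integral>\<^sup>+x. 3 * ennreal (l2_norm s (F x)) \<partial>lebesgue) < \<infinity>"
    using l2_norm_measurable[OF m] F
    by (subst nn_integral_cmult) (auto simp: l2_integrable_def nn_integral_completion ennreal_mult_less_top)
  qed auto
  then show ?thesis by simp
 qed
 show "l2_has_integral s F I" unfolding l2_has_integral_def
 proof (intro conjI m exI[of _ S] allI S_int)
  show "I \<in> l2 s" unfolding I by (rule coord_integral_l2[OF F])
  show "(\<lambda>n. \<integral>\<^sup>+x. ennreal (?d n x) \<partial>lborel) \<longlonglongrightarrow> 0"
   using lim by (simp add: nn_integral_completion)
  have Sl2: "l2_integrable s (S n)" for n using mS S_fin by (simp add: l2_integrable_def)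
  have D_int: "l2_integrable s (\<lambda>x mu. F x mu - S n x mu)" for n unfolding l2_integrable_def
  proof (intro conjI mD)
   have "(\<integral>\<^sup>+x. ennreal (?d n x) \<partial>lebesgue) \<le>
     (\<integral>\<^sup>+x. ennreal (l2_norm s (F x)) + ennreal (l2_norm s (S n x)) \<partial>lebesgue)"
    using l2_norm_diff_triangle[OF r l2_measurable_range[OF mS]]
    by (intro nn_integral_mono) (simp flip: ennreal_plus)
   also have "... = (\<integral>\<^sup>+x. ennreal (l2_norm s (F x)) \<partial>lebesgue) + (\<integral>\<^sup>+x. ennreal (l2_norm s (S n x)) \<partial>lebesgue)"
    using l2_norm_measurable[OF m] l2_norm_measurable[OF mS] by (intro nn_integral_add) auto
   also have "... < \<infinity>" using F S_fin by (simp add: l2_integrable_def nn_integral_completion)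
   finally show "(\<integral>\<^sup>+x. ennreal (?d n x) \<partial>lborel) < \<infinity>"
    by (simp add: nn_integral_completion)
  qed
  have eq: "l2_norm s (\<lambda>mu. l2_simple_integral (S n) mu - I mu) = l2_norm s (coord_integral (\<lambda>x mu. F x mu - S n x mu))" for n
  proof -
   have "l2_simple_integral (S n) mu - I mu = (-1) * coord_integral (\<lambda>x mu. F x mu - S n x mu) mu" for mu
    using l2_simple_integral_coord[OF S_int[of n], of mu] l2_integrable_coord[OF F, of mu] l2_integrable_coord[OF Sl2, of n mu]
    by (simp add: I coord_integral_def integral_completion borel_measurable_integrable)
   then show ?thesis by (simp only: l2_norm_cmult) simp
  qed
  show "(\<lambda>n. l2_norm s (\<lambda>mu. l2_simple_integral (S n) mu - I mu)) \<longlonglongrightarrow> 0"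
   unfolding eq
  proof (rule Lim_null_comparison)
   show "\<forall>\<^sub>F n in sequentially. norm (l2_norm s (coord_integral (\<lambda>x mu. F x mu - S n x mu))) \<le>
     enn2real (\<integral>\<^sup>+x. ennreal (?d n x) \<partial>lebesgue)"
    using coord_integral_norm[OF D_int] l2_norm_measurable[OF mD]
    by (intro always_eventually allI) (simp add: integral_eq_nn_integral)
   show "(\<lambda>n. enn2real (\<integral>\<^sup>+x. ennreal (?d n x) \<partial>lebesgue)) \<longlonglongrightarrow> 0"
    using tendsto_enn2real[OF lim[folded ennreal_0]] by simp
  qed
 qed
qed

lemma l2_integral_eq: "l2_integrable s F ==> l2_integral s F = coord_integral F"
 unfolding l2_integral_def by (auto simp: l2_has_integral_iff)

section \<open>The Fourier transform of integrable functions\<close>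

lemma integral_affine:
 fixes f :: "'a::euclidean_space => 'b::{banach, second_countable_topology}"
 assumes f: "f \<in> borel_measurable borel" and c: "c \<noteq> 0"
 shows "(LINT x|lborel. f x) = \<bar>c\<bar> ^ DIM('a) *\<^sub>R (LINT x|lborel. f (t + c *\<^sub>R x))"
 by (subst lborel_affine[OF c, of t], subst integral_density)
  (use f in \<open>auto simp: integral_distr\<close>)

lemma nn_integral_affine:
 fixes f :: "'a::euclidean_space => ennreal"
 assumes f: "f \<in> borel_measurable borel" and c: "c \<noteq> 0"
 shows "(\<integral>\<^sup>+x. f x \<partial>lborel) = ennreal (\<bar>c\<bar> ^ DIM('a)) * (\<integral>\<^sup>+x. f (t + c *\<^sub>R x) \<partial>lborel)"
 by (subst lborel_affine[OF c, of t], subst nn_integral_density)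
  (use f in \<open>auto simp: nn_integral_distr nn_integral_cmult\<close>)

lemma integrable_affine:
 fixes f :: "'a::euclidean_space => 'b::{banach, second_countable_topology}"
 assumes "integrable lborel f" "c \<noteq> 0"
 shows "integrable lborel (\<lambda>x. f (t + c *\<^sub>R x))"
proof -
 have m: "f \<in> borel_measurable borel" using assms by auto
 have "(\<integral>\<^sup>+x. norm (f x) \<partial>lborel) < \<infinity>" using assms by (simp add: integrable_iff_bounded)
 then have "(\<integral>\<^sup>+x. norm (f (t + c *\<^sub>R x)) \<partial>lborel) < \<infinity>"
  using nn_integral_affine[of "\<lambda>x. ennreal (norm (f x))" c t] m assms(2)
  by (auto simp: ennreal_mult_less_top top_unique less_top[symmetric])
 moreover have "(\<lambda>x. f (t + c *\<^sub>R x)) \<in> borel_measurable borel" using m by measurable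
 ultimately show ?thesis by (simp add: integrable_iff_bounded)
qed

lemma integral_translate:
 fixes f :: "'a::euclidean_space => 'b::{banach, second_countable_topology}"
 assumes "f \<in> borel_measurable borel"
 shows "(LINT x|lborel. f (x + t)) = (LINT x|lborel. f x)"
 using integral_affine[OF assms, of 1 t] by (simp add: add.commute)

lemma integral_reflect:
 fixes f :: "'a::euclidean_space => 'b::{banach, second_countable_topology}"
 assumes "f \<in> borel_measurable borel"
 shows "(LINT x|lborel. f (- x)) = (LINT x|lborel. f x)" using integral_affine[OF assms, of "-1" 0] by simp

lemma integrable_product_lborel:
 fixes f :: "'a::euclidean_space => complex" and g :: "'b::euclidean_space => complex"
 assumes f: "integrable lborel f" and g: "integrable lborel g"
 shows "integrable (lborel \<Otimes>\<^sub>M lborel) (\<lambda>(x, y). f x * g y)"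
proof (rule lborel_pair.Fubini_integrable)
 have "f \<in> borel_measurable borel" "g \<in> borel_measurable borel" using f g by auto
 then show "(\<lambda>(x, y). f x * g y) \<in> borel_measurable (lborel \<Otimes>\<^sub>M lborel)" by measurable
 show "integrable lborel (\<lambda>x. LINT y|lborel. norm (case (x, y) of (x, y) => f x * g y))"
  using f by (simp add: norm_mult)
 show "AE x in lborel. integrable lborel (\<lambda>y. case (x, y) of (x, y) => f x * g y)" using g by simp
qed

lemma integrable_mult_bounded:
 fixes f g :: "'a::euclidean_space => complex"
 assumes "integrable lborel f" "g \<in> borel_measurable borel" "\<And>x. cmod (g x) \<le> B"
 shows "integrable lborel (\<lambda>x. f x * g x)" "integrable lborel (\<lambda>x. g x * f x)"
proof -
 show *: "integrable lborel (\<lambda>x. f x * g x)"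
 proof (rule Bochner_Integration.integrable_bound)
  show "integrable lborel (\<lambda>x. B * cmod (f x))" using assms(1) by simp
  show "(\<lambda>x. f x * g x) \<in> borel_measurable lborel" using assms by (intro borel_measurable_times) auto
  show "AE x in lborel. norm (f x * g x) \<le> norm (B * cmod (f x))"
  proof (intro AE_I2)
   fix x
   have "0 \<le> B" using assms(3)[of x] norm_ge_zero order_trans by blast
   then show "norm (f x * g x) \<le> norm (B * cmod (f x))"
    using mult_right_mono[OF assms(3)[of x], of "cmod (f x)"] by (simp add: norm_mult abs_mult mult.commute)
  qed
 qed
 then show "integrable lborel (\<lambda>x. g x * f x)" by (simp add: mult.commute)
qed

lemma measurable_cis [measurable]: "cis \<in> borel_measurable borel"
 by (intro borel_measurable_continuous_onI) (simp add: cis_conv_exp continuous_intros)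

lemma measurable_cnj [measurable]: "cnj \<in> borel_measurable borel"
 by (intro borel_measurable_continuous_onI continuous_on_cnj continuous_on_id)

lemma fourier_kernel_measurable [measurable]:
 "(\<lambda>x::'a::euclidean_space. cis (c * (x \<bullet> xi))) \<in> borel_measurable borel" by measurable

lemma integrable_fourier_kernel:
 fixes f :: "'a::euclidean_space => complex"
 assumes "integrable lborel f"
 shows "integrable lborel (\<lambda>x. f x * cis (c * (x \<bullet> xi)))"
 by (rule integrable_mult_bounded[OF assms, where B = 1]) auto

lemma fourier_bound:
 fixes f :: "'a::euclidean_space => complex"
 assumes "integrable lborel f"
 shows "cmod (fourier f xi) \<le> (LINT x|lborel. cmod (f x))"
proof -
 have "cmod (fourier f xi) \<le> (LINT x|lborel. cmod (f x * cis (- 2 * pi * (x \<bullet> xi))))"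
  unfolding fourier_def by (rule integral_norm_bound)
 then show ?thesis by (simp add: norm_mult)
qed

lemma fourier_continuous:
 fixes f :: "'a::euclidean_space => complex"
 assumes "integrable lborel f"
 shows "continuous_on UNIV (fourier f)" unfolding continuous_on_sequentially
proof (intro ballI allI impI)
 fix et and xi :: "nat => 'a"
 assume *: "(\<forall>n. xi n \<in> UNIV) \<and> xi \<longlonglongrightarrow> et"
 have "(\<lambda>n. LINT x|lborel. f x * cis (- 2 * pi * (x \<bullet> xi n))) \<longlonglongrightarrow> (LINT x|lborel. f x * cis (- 2 * pi * (x \<bullet> et)))"
 proof (rule integral_dominated_convergence[where w = "\<lambda>x. cmod (f x)"])
  show "AE x in lborel. (\<lambda>n. f x * cis (- 2 * pi * (x \<bullet> xi n))) \<longlonglongrightarrow> f x * cis (- 2 * pi * (x \<bullet> et))"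
   using * unfolding cis_conv_exp by (auto intro!: tendsto_intros)
 qed (use assms in \<open>auto simp: norm_mult\<close>)
 then show "(fourier f \<circ> xi) \<longlonglongrightarrow> fourier f et" by (simp add: o_def fourier_def)
qed

lemma fourier_measurable:
 fixes f :: "'a::euclidean_space => complex"
 shows "integrable lborel f ==> fourier f \<in> borel_measurable borel"
 by (intro borel_measurable_continuous_onI fourier_continuous)

lemma fourier_linear:
 fixes f g :: "'a::euclidean_space => complex"
 assumes "integrable lborel f" "integrable lborel g"
 shows "fourier (\<lambda>x. c * f x + g x) xi = c * fourier f xi + fourier g xi"
proof -
 have "fourier (\<lambda>x. c * f x + g x) xi = (LINT x|lborel. c * (f x * cis (- 2 * pi * (x \<bullet> xi))) + g x * cis (- 2 * pi * (x \<bullet> xi)))"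
  by (simp add: fourier_def algebra_simps)
 also have "... = c * fourier f xi + fourier g xi" unfolding fourier_def by (subst Bochner_Integration.integral_add)
   (auto intro!: integrable_fourier_kernel[where c = "- 2 * pi", simplified] assms)
 finally show ?thesis .
qed

lemma fourier_multiplication_formula:
 fixes f g :: "'a::euclidean_space => complex"
 assumes f: "integrable lborel f" and g: "integrable lborel g"
 shows "(LINT xi|lborel. fourier f xi * g xi) = (LINT x|lborel. f x * fourier g x)"
proof -
 have int: "integrable (lborel \<Otimes>\<^sub>M lborel) (\<lambda>(x, xi). f x * g xi * cis (- 2 * pi * (x \<bullet> xi)))"
 proof (rule Bochner_Integration.integrable_bound[OF integrable_product_lborel[OF f g]])
  have [measurable]: "f \<in> borel_measurable borel" "g \<in> borel_measurable borel" using f g by auto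
  show "(\<lambda>(x, xi). f x * g xi * cis (- 2 * pi * (x \<bullet> xi))) \<in> borel_measurable (lborel \<Otimes>\<^sub>M lborel)"
   by measurable
 qed (auto simp: norm_mult)
 have "(LINT xi|lborel. fourier f xi * g xi) = (LINT xi|lborel. LINT x|lborel. f x * g xi * cis (- 2 * pi * (x \<bullet> xi)))"
  unfolding fourier_def by (subst integral_mult_left_zero[symmetric]) (simp add: mult_ac)
 also have "... = (LINT x|lborel. LINT xi|lborel. f x * g xi * cis (- 2 * pi * (x \<bullet> xi)))"
  using int by (rule lborel_pair.Fubini_integral)
 also have "... = (LINT x|lborel. f x * fourier g x)"
  unfolding fourier_def by (subst integral_mult_right_zero[symmetric]) (simp add: mult_ac inner_commute)
 finally show ?thesis .
qed

section \<open>Gaussians, Fourier inversion and the L2 bound\<close>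

definition gauss :: "real => 'a::euclidean_space => real" where
 "gauss sg x = exp (- (sg * norm x)\<^sup>2 / 2)"

lemma gauss_prod: "gauss sg (x::'a::euclidean_space) = (\<Prod>b\<in>Basis. exp (- (sg * (x \<bullet> b))\<^sup>2 / 2))"
proof -
 have "(sg * norm x)\<^sup>2 = (\<Sum>b\<in>Basis. (sg * (x \<bullet> b))\<^sup>2)"
  unfolding power_mult_distrib power2_norm_eq_inner euclidean_inner[of x x]
  by (simp add: sum_distrib_left power2_eq_square)
 then show ?thesis by (simp add: gauss_def exp_sum[symmetric] sum_negf sum_divide_distrib)
qed

lemma gauss_pos: "gauss sg x > 0" and gauss_le_1: "gauss sg x \<le> 1" by (simp_all add: gauss_def)

lemma abs_gauss_le_1: "\<bar>gauss sg x\<bar> \<le> 1" by (simp add: gauss_def)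

lemma gauss_scale: "gauss sg (c *\<^sub>R x) = gauss (sg * c) x" by (simp add: gauss_def power_mult_distrib mult_ac)

lemma gauss_measurable [measurable]: "gauss sg \<in> borel_measurable borel"
 unfolding gauss_def[abs_def] by measurable

text \<open>The characteristic function of the standard normal distribution, rescaled by
  \<open>sg\<close>.\<close>

lemma gaussian_real_fourier:
 assumes "sg > 0"
 shows "integrable lborel (\<lambda>u::real. complex_of_real (exp (- (sg * u)\<^sup>2 / 2)))"
  and "(LINT u|lborel. complex_of_real (exp (- (sg * u)\<^sup>2 / 2)) * cis (t * u)) =
   of_real (sqrt (2 * pi) / sg * exp (- (t / sg)\<^sup>2 / 2))"
proof -
 have d: "std_normal_density u = exp (- u\<^sup>2 / 2) / sqrt (2 * pi)" for u by (simp add: normal_density_def)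
 have i1: "integrable lborel (\<lambda>u. exp (- u\<^sup>2 / 2) :: real)"
  using integrable_mult_right[OF integrable_normal_density[of 1 0], of "sqrt (2 * pi)"] by (simp add: d)
 then have "integrable lborel (\<lambda>u. exp (- (0 + sg * u)\<^sup>2 / 2))"
  using assms by (intro lborel_integrable_real_affine[of "\<lambda>u. exp (- u\<^sup>2 / 2)"]) auto
 then show i2: "integrable lborel (\<lambda>u::real. complex_of_real (exp (- (sg * u)\<^sup>2 / 2)))"
  by (intro integrable_of_real) simp
 have "char std_normal_distribution r = (LINT u|lborel. std_normal_density u *\<^sub>R cis (r * u))" for r
  unfolding char_def by (subst integral_density) (auto simp: cis_conv_exp normal_density_nonneg)
 then have c: "(LINT u|lborel. std_normal_density u *\<^sub>R cis (r * u)) = of_real (exp (- r\<^sup>2 / 2))" for r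
  by (simp add: char_std_normal_distribution)
 have e: "(LINT u|lborel. complex_of_real (exp (- u\<^sup>2 / 2)) * cis (r * u)) = of_real (sqrt (2 * pi) * exp (- r\<^sup>2 / 2))" for r
 proof -
  have "(LINT u|lborel. complex_of_real (exp (- u\<^sup>2 / 2)) * cis (r * u))
    = (LINT u|lborel. of_real (sqrt (2 * pi)) * (std_normal_density u *\<^sub>R cis (r * u)))"
   by (simp add: d scaleR_conv_of_real field_simps)
  also have "... = of_real (sqrt (2 * pi)) * (LINT u|lborel. std_normal_density u *\<^sub>R cis (r * u))"
   by (rule integral_mult_right_zero)
  finally show ?thesis unfolding c by simp
 qed
 have "(LINT u|lborel. complex_of_real (exp (- u\<^sup>2 / 2)) * cis (t / sg * u))
   = sg *\<^sub>R (LINT u|lborel. complex_of_real (exp (- (sg * u)\<^sup>2 / 2)) * cis (t / sg * (sg * u)))"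
  using lborel_integral_real_affine[of sg "\<lambda>u. complex_of_real (exp (- u\<^sup>2 / 2)) * cis (t / sg * u)" 0] assms by simp
 then have "of_real (sqrt (2 * pi) * exp (- (t / sg)\<^sup>2 / 2))
   = sg *\<^sub>R (LINT u|lborel. complex_of_real (exp (- (sg * u)\<^sup>2 / 2)) * cis (t * u))"
  unfolding e using assms by simp
 then show "(LINT u|lborel. complex_of_real (exp (- (sg * u)\<^sup>2 / 2)) * cis (t * u)) =
   of_real (sqrt (2 * pi) / sg * exp (- (t / sg)\<^sup>2 / 2))"
  using assms by (simp add: scaleR_conv_of_real field_simps)
qed

text \<open>The Fourier transform of \<open>gauss sg\<close>: a Gaussian of total mass 1 that
  concentrates at 0 as \<open>sg\<close> tends to 0.\<close>

definition gauss_kernel :: "real => 'a::euclidean_space => real" where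
 "gauss_kernel sg x = (sqrt (2 * pi) / sg) ^ DIM('a) * gauss (2 * pi / sg) x"

lemma
 assumes "sg > 0"
 shows gauss_integrable: "integrable lborel (\<lambda>x::'a::euclidean_space. complex_of_real (gauss sg x))"
  and fourier_gauss: "fourier (\<lambda>x::'a. complex_of_real (gauss sg x)) xi = of_real (gauss_kernel sg xi)"
proof -
 show i: "integrable lborel (\<lambda>x::'a. complex_of_real (gauss sg x))"
  using integrable_lborel_prod[of "\<lambda>_::'a. \<lambda>u. complex_of_real (exp (- (sg * u)\<^sup>2 / 2))"]
  by (simp add: gauss_prod gaussian_real_fourier(1)[OF assms, simplified])
 have int: "integrable lborel (\<lambda>u::real. complex_of_real (exp (- (sg * u)\<^sup>2 / 2)) * cis (r * u))" for r
  using integrable_fourier_kernel[OF gaussian_real_fourier(1)[OF assms], of 1 r] by (simp add: mult.commute)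
 have "fourier (\<lambda>x::'a. complex_of_real (gauss sg x)) xi =
   (LINT x|lborel. (\<Prod>b\<in>Basis. complex_of_real (exp (- (sg * (x \<bullet> b))\<^sup>2 / 2)) * cis ((- 2 * pi * (xi \<bullet> b)) * (x \<bullet> b))))"
 proof -
  have "cis (- 2 * pi * (x \<bullet> xi)) = (\<Prod>b\<in>Basis. cis ((- 2 * pi * (xi \<bullet> b)) * (x \<bullet> b)))" for x
   using character_prod[of "- xi" x] by (simp add: character_def inner_commute)
  then show ?thesis by (simp add: fourier_def gauss_prod prod.distrib)
 qed
 also have "... = (\<Prod>b\<in>Basis. LINT u|lborel. complex_of_real (exp (- (sg * u)\<^sup>2 / 2)) * cis ((- 2 * pi * (xi \<bullet> b)) * u))"
  by (rule integral_lborel_prod[OF int])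
 also have "... = (\<Prod>b\<in>Basis. of_real (sqrt (2 * pi) / sg * exp (- (2 * pi / sg * (xi \<bullet> b))\<^sup>2 / 2)))"
  unfolding gaussian_real_fourier(2)[OF assms] by (intro prod.cong refl) (simp add: power_mult_distrib power_divide)
 also have "... = of_real (gauss_kernel sg xi)"
  by (simp only: gauss_kernel_def gauss_prod of_real_prod[symmetric] prod.distrib prod_constant)
 finally show "fourier (\<lambda>x::'a. complex_of_real (gauss sg x)) xi = of_real (gauss_kernel sg xi)" .
qed

lemma gauss_kernel_nonneg: "sg > 0 ==> gauss_kernel sg x \<ge> 0"
 by (simp add: gauss_kernel_def less_imp_le[OF gauss_pos])

lemma abs_gauss_kernel_le:
 assumes "sg > 0"
 shows "\<bar>gauss_kernel sg (x::'a::euclidean_space)\<bar> \<le> (sqrt (2 * pi) / sg) ^ DIM('a)"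
 using assms by (simp add: gauss_kernel_def abs_mult power_abs mult_left_le abs_gauss_le_1)

lemma gauss_kernel_scale:
 assumes "sg > 0"
 shows "sg ^ DIM('a) * gauss_kernel sg (sg *\<^sub>R (x::'a::euclidean_space)) = gauss_kernel 1 x"
proof -
 have "sg ^ DIM('a) * (sqrt (2 * pi) / sg) ^ DIM('a) = sqrt (2 * pi) ^ DIM('a)"
  using assms by (simp flip: power_mult_distrib)
 then show ?thesis using assms by (simp add: gauss_kernel_def gauss_scale mult.assoc[symmetric])
qed

lemma gauss_kernel_measurable [measurable]: "gauss_kernel sg \<in> borel_measurable borel"
 unfolding gauss_kernel_def[abs_def] by measurable

lemma gauss_kernel_integrable:
 "sg > 0 ==> integrable lborel (\<lambda>x::'a::euclidean_space. complex_of_real (gauss_kernel sg x))"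
 using gauss_integrable[of "2 * pi / sg", where 'a = 'a] by (simp add: gauss_kernel_def)

lemma gauss_kernel_integral:
 assumes "sg > 0"
 shows "(LINT x|lborel. gauss_kernel sg (x::'a::euclidean_space)) = 1"
proof -
 let ?c = "(sqrt (2 * pi) / sg) ^ DIM('a)"
 have "(LINT x|lborel. complex_of_real (gauss (2 * pi / sg) (x::'a))) = fourier (\<lambda>x::'a. complex_of_real (gauss (2 * pi / sg) x)) 0"
  by (simp add: fourier_def)
 also have "... = of_real ((sqrt (2 * pi) / (2 * pi / sg)) ^ DIM('a))"
  using assms by (subst fourier_gauss) (simp_all add: gauss_kernel_def gauss_def)
 finally have "(LINT x|lborel. gauss (2 * pi / sg) (x::'a)) = (sqrt (2 * pi) / (2 * pi / sg)) ^ DIM('a)"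
  by (simp only: integral_complex_of_real of_real_eq_iff)
 then have "(LINT x|lborel. gauss_kernel sg (x::'a)) = ?c * (sqrt (2 * pi) / (2 * pi / sg)) ^ DIM('a)"
  by (simp only: gauss_kernel_def integral_mult_right_zero)
 also have "... = (sqrt (2 * pi) / sg * (sqrt (2 * pi) / (2 * pi / sg))) ^ DIM('a)"
  by (simp only: power_mult_distrib)
 also have "sqrt (2 * pi) / sg * (sqrt (2 * pi) / (2 * pi / sg)) = 1" using assms by (simp add: field_simps)
 finally show ?thesis by simp
qed

lemma nn_integral_gauss_kernel:
 assumes "sg > 0"
 shows "(\<integral>\<^sup>+x. ennreal (gauss_kernel sg (y + x :: 'a::euclidean_space)) \<partial>lborel) = 1"
proof -
 have int: "integrable lborel (gauss_kernel sg :: 'a => real)"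
  using gauss_kernel_integrable[OF assms, where 'a = 'a] by (simp only: complex_of_real_integrable_eq)
 have "(\<integral>\<^sup>+x. ennreal (gauss_kernel sg (y + x)) \<partial>lborel) = (\<integral>\<^sup>+x. ennreal (gauss_kernel sg (x::'a)) \<partial>lborel)"
  using nn_integral_affine[of "\<lambda>x::'a. ennreal (gauss_kernel sg x)" 1 y] by simp
 also have "... = ennreal (LINT x|lborel. gauss_kernel sg (x::'a))"
  by (intro nn_integral_eq_integral int AE_I2 gauss_kernel_nonneg assms)
 finally show ?thesis by (simp add: gauss_kernel_integral[OF assms])
qed

lemma fourier_modulated_gauss:
 assumes "sg > 0"
 shows "fourier (\<lambda>xi. cis (2 * pi * (x \<bullet> xi)) * complex_of_real (gauss sg xi)) y = of_real (gauss_kernel sg (y - x))"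
proof -
 have "fourier (\<lambda>xi. cis (2 * pi * (x \<bullet> xi)) * complex_of_real (gauss sg xi)) y = fourier (\<lambda>xi. complex_of_real (gauss sg xi)) (y - x)"
  unfolding fourier_def by (intro Bochner_Integration.integral_cong refl)
   (simp add: inner_diff_right inner_commute algebra_simps cis_mult flip: cis_divide)
 then show ?thesis using fourier_gauss[OF assms] by simp
qed

text \<open>Gaussian summation: by the multiplication formula the damped inversion integral is an
  average of \<open>f\<close> around \<open>x\<close> against a kernel of mass 1. The averages tend
  to \<open>f x\<close> by continuity, and the damping disappears by dominated convergence.\<close>

theorem fourier_inversion:
 fixes f :: "'a::euclidean_space => complex"
 assumes f: "integrable lborel f" and ff: "integrable lborel (fourier f)"
  and cont: "continuous_on UNIV f" and bd: "\<And>x. cmod (f x) \<le> B"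
 shows "fourier (fourier f) (- x) = f x"
proof -
 have [measurable]: "f \<in> borel_measurable borel" using f by auto
 define sg where "sg n = inverse (real (Suc n))" for n
 have sg: "sg n > 0" "sg \<longlonglongrightarrow> 0" for n
  using LIMSEQ_inverse_real_of_nat by (auto simp: sg_def[abs_def])
 define g where "g n xi = cis (2 * pi * (x \<bullet> xi)) * complex_of_real (gauss (sg n) xi)" for n xi
 have "(\<lambda>n. LINT xi|lborel. fourier f xi * g n xi) \<longlonglongrightarrow> (LINT xi|lborel. fourier f xi * cis (2 * pi * (x \<bullet> xi)))"
 proof (rule integral_dominated_convergence[where w = "\<lambda>xi. cmod (fourier f xi)"])
  have [measurable]: "fourier f \<in> borel_measurable borel" by (rule fourier_measurable[OF f])
  show "(\<lambda>xi. fourier f xi * cis (2 * pi * (x \<bullet> xi))) \<in> borel_measurable lborel"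
   "(\<lambda>xi. fourier f xi * g n xi) \<in> borel_measurable lborel" for n unfolding g_def by measurable
  show "AE xi in lborel. norm (fourier f xi * g n xi) \<le> cmod (fourier f xi)" for n
   by (intro AE_I2) (simp add: g_def norm_mult mult_left_le abs_gauss_le_1)
  have "(\<lambda>n. gauss (sg n) xi) \<longlonglongrightarrow> 1" for xi :: 'a
  proof -
   have "(\<lambda>n. exp (- (sg n * norm xi)\<^sup>2 / 2)) \<longlonglongrightarrow> exp (- (0 * norm xi)\<^sup>2 / 2)"
    by (intro tendsto_intros sg) simp
   then show ?thesis by (simp add: gauss_def)
  qed
  note lim = tendsto_of_real[OF this, where 'a = complex]
  have "(\<lambda>n. fourier f xi * g n xi) \<longlonglongrightarrow> fourier f xi * (cis (2 * pi * (x \<bullet> xi)) * complex_of_real 1)" for xi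
   unfolding g_def by (intro tendsto_mult tendsto_const lim)
  then show "AE xi in lborel. (\<lambda>n. fourier f xi * g n xi) \<longlonglongrightarrow> fourier f xi * cis (2 * pi * (x \<bullet> xi))" by simp
 qed (use ff in auto)
 also have "(LINT xi|lborel. fourier f xi * cis (2 * pi * (x \<bullet> xi))) = fourier (fourier f) (- x)"
  by (simp add: fourier_def[of "fourier f"] inner_commute)
 finally have 1: "(\<lambda>n. LINT xi|lborel. fourier f xi * g n xi) \<longlonglongrightarrow> fourier (fourier f) (- x)" .
 \<comment> \<open>Scaling the variable around \<open>x\<close> by \<open>sg n\<close> makes the
   kernel independent of \<open>n\<close>, so that dominated convergence applies with the fixed
   majorant \<open>B * gauss_kernel 1 u\<close>.\<close>
 have eq: "(LINT xi|lborel. fourier f xi * g n xi) = (LINT u|lborel. f (x + sg n *\<^sub>R u) * of_real (gauss_kernel 1 u))" for n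
 proof -
  have "integrable lborel (g n)"
   unfolding g_def using integrable_fourier_kernel[OF gauss_integrable[OF sg(1)[of n]], of "2 * pi" x]
   by (simp add: mult.commute inner_commute)
  then have "(LINT xi|lborel. fourier f xi * g n xi) = (LINT y|lborel. f y * fourier (g n) y)"
   by (rule fourier_multiplication_formula[OF f])
  also have "... = (LINT y|lborel. f y * of_real (gauss_kernel (sg n) (y - x)))"
   unfolding g_def fourier_modulated_gauss[OF sg(1)] ..
  also have "... = \<bar>sg n\<bar> ^ DIM('a) *\<^sub>R (LINT u|lborel. f (x + sg n *\<^sub>R u) * of_real (gauss_kernel (sg n) ((x + sg n *\<^sub>R u) - x)))"
   using sg(1)[of n] by (intro integral_affine) auto
  also have "... = (LINT u|lborel. f (x + sg n *\<^sub>R u) * of_real (sg n ^ DIM('a) * gauss_kernel (sg n) (sg n *\<^sub>R u)))"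
   using sg(1)[of n] by (subst integral_scaleR_right[symmetric]) (simp add: scaleR_conv_of_real mult_ac)
  finally show ?thesis by (simp only: gauss_kernel_scale[OF sg(1)])
 qed
 have "(\<lambda>n. LINT u|lborel. f (x + sg n *\<^sub>R u) * of_real (gauss_kernel 1 u)) \<longlonglongrightarrow> (LINT u|lborel. f x * of_real (gauss_kernel 1 (u::'a)))"
 proof (rule integral_dominated_convergence[where w = "\<lambda>u. B * gauss_kernel 1 u"])
  show "integrable lborel (\<lambda>u::'a. B * gauss_kernel 1 u)"
   using gauss_kernel_integrable[of 1, where 'a = 'a] by (simp only: complex_of_real_integrable_eq) simp
  show "AE u in lborel. (\<lambda>n. f (x + sg n *\<^sub>R u) * complex_of_real (gauss_kernel 1 u)) \<longlonglongrightarrow> f x * of_real (gauss_kernel 1 u)"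
  proof (intro AE_I2 tendsto_mult tendsto_const)
   fix u
   have "(\<lambda>n. x + sg n *\<^sub>R u) \<longlonglongrightarrow> x + 0 *\<^sub>R u" by (intro tendsto_intros sg)
   then show "(\<lambda>n. f (x + sg n *\<^sub>R u)) \<longlonglongrightarrow> f x"
    using cont by (auto intro: continuous_on_tendsto_compose[of UNIV f])
  qed
  show "AE u in lborel. norm (f (x + sg n *\<^sub>R u) * complex_of_real (gauss_kernel 1 u)) \<le> B * gauss_kernel 1 u" for n
   using bd by (intro AE_I2) (simp add: norm_mult abs_of_nonneg gauss_kernel_nonneg mult_right_mono)
 qed measurable
 also have "(LINT u|lborel. f x * of_real (gauss_kernel 1 (u::'a))) = f x"
  using gauss_kernel_integral[of 1, where 'a = 'a] by simp
 finally have "(\<lambda>n. LINT xi|lborel. fourier f xi * g n xi) \<longlonglongrightarrow> f x" unfolding eq .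
 with 1 show ?thesis by (rule LIMSEQ_unique)
qed

text \<open>The half of Plancherel's theorem that boundedness needs. Damped by a Gaussian, the
  left-hand side becomes a double integral of \<open>g x * g' y\<close> against the kernel at
  \<open>y + x\<close>. Arithmetic and geometric means and the mass 1 of the kernel in either
  variable bound it by the right-hand side, and Fatou's lemma removes the damping.\<close>

theorem fourier_L2_bound:
 fixes g :: "'a::euclidean_space => complex"
 assumes g: "integrable lborel g"
 shows "(\<integral>\<^sup>+xi. ennreal ((cmod (fourier g xi))\<^sup>2) \<partial>lborel) \<le> (\<integral>\<^sup>+x. ennreal ((cmod (g x))\<^sup>2) \<partial>lborel)"
proof -
 have [measurable]: "g \<in> borel_measurable borel" "fourier g \<in> borel_measurable borel"
  using g by (auto intro: fourier_measurable)
 let ?N = "\<integral>\<^sup>+x. ennreal ((cmod (g x))\<^sup>2) \<partial>lborel"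
 \<comment> \<open>The transform of the reflected conjugate is the conjugate of the transform of
   \<open>g\<close>, so the squared modulus is a product of two transforms.\<close>
 define g' where "g' y = cnj (g (- y))" for y
 have g': "integrable lborel g'"
  using integrable_affine[OF g, of "-1" 0] unfolding g'_def by (intro integrable_cnj) simp
 have [measurable]: "g' \<in> borel_measurable borel" using g' by auto
 have fg': "fourier g' xi = cnj (fourier g xi)" for xi
 proof -
  have "cnj (fourier g xi) = (LINT y|lborel. cnj (g y * cis (- 2 * pi * (y \<bullet> xi))))"
   unfolding fourier_def by (rule Bochner_Integration.integral_cnj[symmetric])
  also have "... = (LINT y|lborel. cnj (g y) * cis (2 * pi * (y \<bullet> xi)))"
   by (intro Bochner_Integration.integral_cong refl) (simp add: cis_cnj)
  also have "... = (LINT y|lborel. cnj (g (- y)) * cis (2 * pi * ((- y) \<bullet> xi)))"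
   by (rule integral_reflect[symmetric]) measurable
  finally show ?thesis by (simp add: fourier_def g'_def)
 qed
 have reg: "(\<integral>\<^sup>+xi. ennreal ((cmod (fourier g xi))\<^sup>2 * gauss sg xi) \<partial>lborel) \<le> ?N" if sg: "sg > 0" for sg
 proof (cases "?N = \<infinity>")
  case False
  let ?u = "\<lambda>x. (cmod (g x))\<^sup>2 / 2" and ?v = "\<lambda>y. (cmod (g' y))\<^sup>2 / 2"
  let ?k = "\<lambda>x y :: 'a. gauss_kernel sg (y + x)"
  define l where "l x xi = cis (- 2 * pi * (x \<bullet> xi)) * complex_of_real (gauss sg xi)" for x xi :: 'a
  have l: "integrable lborel (l x)" for x
   unfolding l_def using integrable_fourier_kernel[OF gauss_integrable[OF sg], of "- 2 * pi" x]
   by (simp add: mult.commute inner_commute)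
  have fl: "fourier (l x) y = of_real (?k x y)" for x y
   using fourier_modulated_gauss[OF sg, of "- x" y] by (simp add: l_def[abs_def])
  define h where "h xi = fourier g' xi * complex_of_real (gauss sg xi)" for xi
  have h: "integrable lborel h" unfolding h_def using fourier_bound[OF g'] fourier_measurable[OF g']
   by (intro integrable_mult_bounded(2)[OF gauss_integrable[OF sg]]) auto
  have fh: "fourier h x = (LINT y|lborel. g' y * of_real (?k x y))" for x
  proof -
   have "fourier h x = (LINT xi|lborel. fourier g' xi * l x xi)"
    by (simp add: fourier_def[of h] h_def l_def mult_ac inner_commute)
   then show ?thesis by (simp add: fourier_multiplication_formula[OF g' l] fl)
  qed
  have main: "(LINT xi|lborel. fourier g xi * h xi) = (LINT x|lborel. g x * fourier h x)"
   by (rule fourier_multiplication_formula[OF g h])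
  have eq: "fourier g xi * h xi = of_real ((cmod (fourier g xi))\<^sup>2 * gauss sg xi)" for xi
   unfolding h_def fg' of_real_mult complex_norm_square by simp
  have int: "integrable lborel (\<lambda>xi. (cmod (fourier g xi))\<^sup>2 * gauss sg xi)"
   using integrable_mult_bounded(2)[OF h fourier_measurable[OF g] fourier_bound[OF g]]
   unfolding eq by (simp only: complex_of_real_integrable_eq)
  have "(\<integral>\<^sup>+xi. ennreal ((cmod (fourier g xi))\<^sup>2 * gauss sg xi) \<partial>lborel) = ennreal (LINT xi|lborel. (cmod (fourier g xi))\<^sup>2 * gauss sg xi)"
   using int by (intro nn_integral_eq_integral) (auto simp: less_imp_le[OF gauss_pos])
  also have "(LINT xi|lborel. (cmod (fourier g xi))\<^sup>2 * gauss sg xi) = cmod (LINT x|lborel. g x * fourier h x)"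
  proof -
   have "complex_of_real (LINT xi|lborel. (cmod (fourier g xi))\<^sup>2 * gauss sg xi) = (LINT x|lborel. g x * fourier h x)"
    unfolding main[symmetric] eq by (rule integral_complex_of_real[symmetric])
   moreover have "(LINT xi|lborel. (cmod (fourier g xi))\<^sup>2 * gauss sg xi) \<ge> 0"
    by (intro Bochner_Integration.integral_nonneg) (simp add: less_imp_le[OF gauss_pos])
   ultimately show ?thesis by (metis norm_of_real abs_of_nonneg)
  qed
  also have "ennreal (cmod (LINT x|lborel. g x * fourier h x)) \<le> (\<integral>\<^sup>+x. ennreal (cmod (g x * fourier h x)) \<partial>lborel)"
   by (rule integral_norm_bound_ennreal, rule integrable_mult_bounded(1)[OF g fourier_measurable[OF h] fourier_bound[OF h]])
  also have "... \<le> (\<integral>\<^sup>+x. (\<integral>\<^sup>+y. ennreal ((?u x + ?v y) * ?k x y) \<partial>lborel) \<partial>lborel)"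
  proof (rule nn_integral_mono)
   fix x
   have gk: "integrable lborel (\<lambda>y. g' y * of_real (?k x y))"
   proof (rule integrable_mult_bounded(1)[OF g'])
    show "(\<lambda>y. complex_of_real (?k x y)) \<in> borel_measurable borel" by measurable
    show "cmod (complex_of_real (?k x y)) \<le> (sqrt (2 * pi) / sg) ^ DIM('a)" for y
     unfolding norm_of_real by (rule abs_gauss_kernel_le[OF sg])
   qed
   have "ennreal (cmod (g x * fourier h x)) = ennreal (cmod (LINT y|lborel. g x * (g' y * of_real (?k x y))))"
    unfolding fh by simp
   also have "... \<le> (\<integral>\<^sup>+y. ennreal (cmod (g x * (g' y * of_real (?k x y)))) \<partial>lborel)"
    using gk by (intro integral_norm_bound_ennreal) simp
   also have "... \<le> (\<integral>\<^sup>+y. ennreal ((?u x + ?v y) * ?k x y) \<partial>lborel)"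
   proof (intro nn_integral_mono ennreal_leI)
    fix y
    have "cmod (g x) * cmod (g' y) \<le> ?u x + ?v y"
     using sum_squares_bound[of "cmod (g x)" "cmod (g' y)"] by simp
    then show "cmod (g x * (g' y * of_real (?k x y))) \<le> (?u x + ?v y) * ?k x y"
     using gauss_kernel_nonneg[OF sg, of "y + x"] by (simp add: norm_mult mult.assoc[symmetric] mult_right_mono)
   qed
   finally show "ennreal (cmod (g x * fourier h x)) \<le> (\<integral>\<^sup>+y. ennreal ((?u x + ?v y) * ?k x y) \<partial>lborel)" .
  qed
  also have "... = (\<integral>\<^sup>+x. (\<integral>\<^sup>+y. ennreal (?u x) * ennreal (?k x y) \<partial>lborel) \<partial>lborel) +
    (\<integral>\<^sup>+x. (\<integral>\<^sup>+y. ennreal (?v y) * ennreal (?k x y) \<partial>lborel) \<partial>lborel)"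
  proof -
   have "ennreal ((?u x + ?v y) * ?k x y)
    = ennreal (?u x) * ennreal (?k x y) + ennreal (?v y) * ennreal (?k x y)" for x y
   proof -
    have "ennreal ((a + b) * k) = ennreal a * ennreal k + ennreal b * ennreal k" if "0 \<le> a" "0 \<le> b" "0 \<le> k" for a b k
     using that by (simp add: distrib_right ennreal_mult)
    then show ?thesis by (simp add: gauss_kernel_nonneg[OF sg])
   qed
   then show ?thesis
    by (simp only:) (subst nn_integral_add[symmetric], measurable, intro nn_integral_cong nn_integral_add, measurable)
  qed
  also have "(\<integral>\<^sup>+x. (\<integral>\<^sup>+y. ennreal (?v y) * ennreal (?k x y) \<partial>lborel) \<partial>lborel)
    = (\<integral>\<^sup>+y. (\<integral>\<^sup>+x. ennreal (?v y) * ennreal (?k x y) \<partial>lborel) \<partial>lborel)"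
   by (rule lborel_pair.Fubini') measurable
  also have "(\<integral>\<^sup>+y. (\<integral>\<^sup>+x. ennreal (?v y) * ennreal (?k x y) \<partial>lborel) \<partial>lborel) = ?N / 2"
  proof -
   have "(\<integral>\<^sup>+y. (\<integral>\<^sup>+x. ennreal (?v y) * ennreal (?k x y) \<partial>lborel) \<partial>lborel)
     = (\<integral>\<^sup>+y. ennreal (?v y) \<partial>lborel)"
    by (subst nn_integral_cmult) (auto simp: nn_integral_gauss_kernel[OF sg])
   also have "... = (\<integral>\<^sup>+y. ennreal ((cmod (g y))\<^sup>2 / 2) \<partial>lborel)"
    using nn_integral_affine[of "\<lambda>y. ennreal ((cmod (g y))\<^sup>2 / 2)" "-1" 0] by (simp add: g'_def)
   also have "... = ?N / 2" by (simp add: nn_integral_divide flip: divide_ennreal ennreal_numeral)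
   finally show ?thesis .
  qed
  also have "(\<integral>\<^sup>+x. (\<integral>\<^sup>+y. ennreal (?u x) * ennreal (?k x y) \<partial>lborel) \<partial>lborel) = ?N / 2"
  proof -
   have "(\<integral>\<^sup>+x. (\<integral>\<^sup>+y. ennreal (?u x) * ennreal (?k x y) \<partial>lborel) \<partial>lborel)
     = (\<integral>\<^sup>+x. ennreal (?u x) \<partial>lborel)"
    by (subst nn_integral_cmult) (auto simp: nn_integral_gauss_kernel[OF sg] add.commute[of _ "_::'a"])
   also have "... = ?N / 2" by (simp add: nn_integral_divide flip: divide_ennreal ennreal_numeral)
   finally show ?thesis .
  qed
  also have "?N / 2 + ?N / 2 = ?N" 
   using False by (cases ?N) (auto simp flip: ennreal_numeral ennreal_plus simp: divide_ennreal)
  finally show ?thesis .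
 qed simp
 have lim: "(\<lambda>n. ennreal ((cmod (fourier g xi))\<^sup>2 * gauss (inverse (real (Suc n))) xi)) \<longlonglongrightarrow> ennreal ((cmod (fourier g xi))\<^sup>2)" for xi
 proof -
  have "(\<lambda>n. (cmod (fourier g xi))\<^sup>2 * exp (- (inverse (real (Suc n)) * norm xi)\<^sup>2 / 2)) \<longlonglongrightarrow> (cmod (fourier g xi))\<^sup>2 * exp (- (0 * norm xi)\<^sup>2 / 2)"
   by (intro tendsto_intros LIMSEQ_inverse_real_of_nat) simp
  then show ?thesis by (intro tendsto_ennrealI) (simp add: gauss_def)
 qed
 have "(\<integral>\<^sup>+xi. ennreal ((cmod (fourier g xi))\<^sup>2) \<partial>lborel)
   = (\<integral>\<^sup>+xi. liminf (\<lambda>n. ennreal ((cmod (fourier g xi))\<^sup>2 * gauss (inverse (real (Suc n))) xi)) \<partial>lborel)"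
  using lim_imp_Liminf[OF trivial_limit_sequentially lim] by simp
 also have "... \<le> liminf (\<lambda>n. \<integral>\<^sup>+xi. ennreal ((cmod (fourier g xi))\<^sup>2 * gauss (inverse (real (Suc n))) xi) \<partial>lborel)"
  by (rule nn_integral_liminf) measurable
 also have "... \<le> liminf (\<lambda>n. ?N)" by (intro Liminf_mono always_eventually allI reg) auto
 also have "... = ?N" by (simp add: Liminf_const)
 finally show ?thesis .
qed


section \<open>Schwartz functions\<close>

lemma has_vector_derivative_at_0_iff:
 fixes f :: "real => complex"
 shows "(f has_vector_derivative D) (at 0) \<longleftrightarrow> ((\<lambda>h. (f h - f 0) / of_real h) \<longlongrightarrow> D) (at 0)"
proof -
 have "(f has_vector_derivative D) (at 0) \<longleftrightarrow> ((\<lambda>h. norm (f h - f 0 - h *\<^sub>R D) / norm h) \<longlongrightarrow> 0) (at 0)"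
  by (simp add: has_vector_derivative_def has_derivative_at bounded_linear_scaleR_left)
 also have "... \<longleftrightarrow> ((\<lambda>h. norm ((f h - f 0) / of_real h - D)) \<longlongrightarrow> 0) (at 0)"
 proof (intro filterlim_cong refl)
  show "\<forall>\<^sub>F h in at 0. norm (f h - f 0 - h *\<^sub>R D) / norm h = norm ((f h - f 0) / of_real h - D)"
   unfolding eventually_at
  proof (intro exI[of _ 1] conjI ballI impI)
   fix h :: real assume "h \<noteq> 0 \<and> dist h 0 < 1"
   then have "(f h - f 0) / of_real h - D = (f h - f 0 - h *\<^sub>R D) / of_real h"
    by (simp add: scaleR_conv_of_real diff_divide_distrib)
   then show "norm (f h - f 0 - h *\<^sub>R D) / norm h = norm ((f h - f 0) / of_real h - D)"
    by (simp add: norm_divide)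
  qed simp
 qed
 also have "... \<longleftrightarrow> ((\<lambda>h. (f h - f 0) / of_real h) \<longlongrightarrow> D) (at 0)"
  by (simp add: tendsto_norm_zero_iff LIM_zero_iff)
 finally show ?thesis .
qed

lemma dir_deriv_eq:
 "((\<lambda>t. f (x + t *\<^sub>R v)) has_vector_derivative D) (at 0) ==> dir_deriv v f x = D"
 unfolding dir_deriv_def by (rule vector_derivative_at)

text \<open>Induction over the list of derivatives never leaves \<open>X\<close>. With a family that
  is closed under differentiation no Leibniz rule for iterated derivatives has to be written
  down.\<close>

lemma schwartz_coinduct:
 fixes ph :: "'a::euclidean_space => complex"
 assumes "ph \<in> X"
  and cont: "\<And>f. f \<in> X ==> continuous_on UNIV f"
  and decay: "\<And>f k. f \<in> X ==> \<exists>C. \<forall>x. bracket x ^ k * cmod (f x) \<le> C"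
  and deriv: "\<And>f b. f \<in> X ==> b \<in> Basis ==>
   \<exists>f'\<in>X. \<forall>x. ((\<lambda>t. f (x + t *\<^sub>R b)) has_vector_derivative f' x) (at 0)"
 shows "ph \<in> schwartz"
proof -
 have pd: "partial_derivs al ph \<in> X" if "al \<in> lists Basis" for al using that
 proof (induction al)
  case Nil
  show ?case using assms(1) by simp
 next
  case (Cons b al)
  then obtain f' where f': "f' \<in> X" "\<And>x. ((\<lambda>t. partial_derivs al ph (x + t *\<^sub>R b)) has_vector_derivative f' x) (at 0)"
   using deriv[of "partial_derivs al ph" b] by auto
  then have "partial_derivs (b # al) ph = f'" by (auto simp: fun_eq_iff intro!: dir_deriv_eq)
  then show ?case using f'(1) by simp
 qed
 have "smooth ph" unfolding smooth_def
 proof (intro ballI conjI allI)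
  fix al :: "'a list" assume "al \<in> lists Basis"
  then show "continuous_on UNIV (partial_derivs al ph)" by (intro cont pd)
  fix v x assume "v \<in> (Basis::'a set)"
  with deriv[OF pd[OF \<open>al \<in> lists Basis\<close>]]
  show "(\<lambda>t. partial_derivs al ph (x + t *\<^sub>R v)) differentiable at 0"
   by (meson differentiableI_vector)
 qed
 moreover have "bdd_above (range (\<lambda>x. bracket x ^ k * cmod (partial_derivs al ph x)))" if "al \<in> lists Basis" for k al
  using decay[OF pd[OF that], of k] unfolding bdd_above_def by auto
 ultimately show ?thesis by (auto simp: schwartz_def)
qed

lemma schwartz_smooth: "ph \<in> schwartz ==> smooth ph" by (simp add: schwartz_def)

lemma schwartz_continuous: "ph \<in> schwartz ==> continuous_on UNIV ph"
 using schwartz_smooth[of ph] unfolding smooth_def by (metis lists.Nil partial_derivs_Nil)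

lemma schwartz_measurable: "ph \<in> schwartz ==> ph \<in> borel_measurable borel"
 by (intro borel_measurable_continuous_onI schwartz_continuous)

lemma schwartz_seminorm_bound:
 assumes "ph \<in> schwartz" "al \<in> lists Basis"
 shows "bracket x ^ k * cmod (partial_derivs al ph x) \<le> schwartz_seminorm k al ph"
 unfolding schwartz_seminorm_def using assms by (intro cSUP_upper) (auto simp: schwartz_def)

lemma schwartz_decay: "ph \<in> schwartz ==> bracket x ^ k * cmod (ph x) \<le> schwartz_seminorm k [] ph"
 using schwartz_seminorm_bound[of ph "[]" x k] by simp

lemma schwartz_has_deriv:
 assumes "ph \<in> schwartz" "b \<in> Basis"
 shows "((\<lambda>t. ph (x + t *\<^sub>R b)) has_vector_derivative dir_deriv b ph x) (at 0)"
 using smooth_has_vector_derivative[OF schwartz_smooth[OF assms(1)], of "[]" b x] assms by simp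

lemma schwartz_dir_deriv:
 assumes "ph \<in> schwartz" "b \<in> Basis"
 shows "dir_deriv b ph \<in> schwartz"
proof -
 have snoc: "partial_derivs al (dir_deriv b ph) = partial_derivs (al @ [b]) ph" for al
  by (simp add: partial_derivs_append)
 have app: "al @ [b] \<in> lists Basis" if "al \<in> lists Basis" for al using that assms by auto
 have "smooth (dir_deriv b ph)"
  unfolding smooth_def snoc using schwartz_smooth[OF assms(1), unfolded smooth_def] app by simp
 moreover have "bdd_above (range (\<lambda>x. bracket x ^ k * cmod (partial_derivs al (dir_deriv b ph) x)))"
  if "al \<in> lists Basis" for k al
 proof -
  have "\<forall>k. \<forall>al\<in>lists Basis. bdd_above (range (\<lambda>x. bracket x ^ k * cmod (partial_derivs al ph x)))"
   using assms(1) by (simp add: schwartz_def)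
  from this[rule_format, OF app[OF that]] show ?thesis by (simp only: snoc)
 qed
 ultimately show ?thesis by (simp add: schwartz_def)
qed

lemma schwartz_linear:
 fixes ph ps :: "'a::euclidean_space => complex"
 assumes "ph \<in> schwartz" "ps \<in> schwartz"
 shows "(\<lambda>x. c * ph x + ps x) \<in> schwartz"
proof (rule schwartz_coinduct[where X = "{\<lambda>x. c * ph x + ps x | ph ps. ph \<in> schwartz \<and> ps \<in> schwartz}"])
 fix f :: "'a => complex" assume "f \<in> {\<lambda>x. c * ph x + ps x | ph ps. ph \<in> schwartz \<and> ps \<in> schwartz}"
 then obtain ph ps where f: "f = (\<lambda>x. c * ph x + ps x)" and S: "ph \<in> schwartz" "ps \<in> schwartz" by auto
 show "continuous_on UNIV f" unfolding f using S by (intro continuous_intros schwartz_continuous)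
 show "\<exists>C. \<forall>x. bracket x ^ k * cmod (f x) \<le> C" for k
 proof (intro exI allI)
  fix x
  have "bracket x ^ k * cmod (f x) \<le> bracket x ^ k * (cmod c * cmod (ph x) + cmod (ps x))"
   unfolding f by (intro mult_left_mono) (auto simp: less_imp_le simp flip: norm_mult intro: norm_triangle_ineq)
  also have "... = cmod c * (bracket x ^ k * cmod (ph x)) + bracket x ^ k * cmod (ps x)" by (simp add: algebra_simps)
  also have "... \<le> cmod c * schwartz_seminorm k [] ph + schwartz_seminorm k [] ps"
   by (intro add_mono mult_left_mono schwartz_decay S) auto
  finally show "bracket x ^ k * cmod (f x) \<le> cmod c * schwartz_seminorm k [] ph + schwartz_seminorm k [] ps" .
 qed
 fix b :: 'a assume b: "b \<in> Basis"
 show "\<exists>f'\<in>{\<lambda>x. c * ph x + ps x | ph ps. ph \<in> schwartz \<and> ps \<in> schwartz}.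
   \<forall>x. ((\<lambda>t. f (x + t *\<^sub>R b)) has_vector_derivative f' x) (at 0)"
 proof (intro bexI[of _ "\<lambda>x. c * dir_deriv b ph x + dir_deriv b ps x"] allI)
  fix x
  show "((\<lambda>t. f (x + t *\<^sub>R b)) has_vector_derivative c * dir_deriv b ph x + dir_deriv b ps x) (at 0)"
   unfolding f by (intro has_vector_derivative_add has_vector_derivative_mult_right schwartz_has_deriv S b)
 next
  show "(\<lambda>x. c * dir_deriv b ph x + dir_deriv b ps x) \<in> {\<lambda>x. c * ph x + ps x | ph ps. ph \<in> schwartz \<and> ps \<in> schwartz}"
   using schwartz_dir_deriv[OF S(1) b] schwartz_dir_deriv[OF S(2) b] by blast
 qed
qed (use assms in blast)

lemma schwartz_zero: "(\<lambda>x. 0) \<in> schwartz"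
proof (rule schwartz_coinduct[where X = "{\<lambda>x. 0}"])
 fix f :: "'a => complex" and b assume "f \<in> {\<lambda>x. 0}"
 then show "\<exists>f'\<in>{\<lambda>x. 0}. \<forall>x. ((\<lambda>t. f (x + t *\<^sub>R b)) has_vector_derivative f' x) (at 0)"
  by simp
qed auto

lemma schwartz_cmult: "ph \<in> schwartz ==> (\<lambda>x. c * ph x) \<in> schwartz"
 using schwartz_linear[OF _ schwartz_zero, of ph c] by simp

lemma schwartz_sum:
 assumes "finite I" "\<And>i. i \<in> I ==> ph i \<in> schwartz"
 shows "(\<lambda>x. \<Sum>i\<in>I. ph i x) \<in> schwartz" using assms
proof (induction I)
 case empty
 show ?case using schwartz_zero by simp
next
 case (insert i I)
 then show ?case using schwartz_linear[of "ph i" "\<lambda>x. \<Sum>i\<in>I. ph i x" 1] by simp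
qed

lemma schwartz_reflect:
 assumes "ph \<in> schwartz"
 shows "(\<lambda>x. ph (- x)) \<in> schwartz"
proof (rule schwartz_coinduct[where X = "{\<lambda>x. ph (- x) | ph. ph \<in> schwartz}"])
 fix f :: "'a => complex" assume "f \<in> {\<lambda>x. ph (- x) | ph. ph \<in> schwartz}"
 then obtain ph where f: "f = (\<lambda>x. ph (- x))" and S: "ph \<in> schwartz" by auto
 show "continuous_on UNIV f"
  unfolding f by (intro continuous_on_compose2[OF schwartz_continuous[OF S]] continuous_intros) auto
 show "\<exists>C. \<forall>x. bracket x ^ k * cmod (f x) \<le> C" for k
 proof (intro exI allI)
  fix x
  show "bracket x ^ k * cmod (f x) \<le> schwartz_seminorm k [] ph"
   using schwartz_decay[OF S, of "- x" k] by (simp add: f bracket_def)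
 qed
 fix b :: 'a assume b: "b \<in> Basis"
 show "\<exists>f'\<in>{\<lambda>x. ph (- x) | ph. ph \<in> schwartz}. \<forall>x. ((\<lambda>t. f (x + t *\<^sub>R b)) has_vector_derivative f' x) (at 0)"
 proof (intro bexI[of _ "\<lambda>x. (-1) * dir_deriv b ph (- x)"] allI)
  fix x
  have "((\<lambda>t::real. - t) has_vector_derivative - 1) (at 0)" by (auto intro!: derivative_eq_intros)
  moreover have "((\<lambda>t. ph (- x + t *\<^sub>R b)) has_vector_derivative dir_deriv b ph (- x)) (at (- 0))"
   using schwartz_has_deriv[OF S b, of "- x"] by simp
  ultimately have "((\<lambda>t. ph (- x + t *\<^sub>R b)) \<circ> (\<lambda>t. - t) has_vector_derivative (- 1) *\<^sub>R dir_deriv b ph (- x)) (at 0)"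
   by (rule vector_diff_chain_at)
  moreover have "(\<lambda>t. f (x + t *\<^sub>R b)) = (\<lambda>t. ph (- x + t *\<^sub>R b)) \<circ> (\<lambda>t. - t)"
   by (simp add: f fun_eq_iff minus_diff_commute)
  ultimately show "((\<lambda>t. f (x + t *\<^sub>R b)) has_vector_derivative (-1) * dir_deriv b ph (- x)) (at 0)"
   by simp
 next
  show "(\<lambda>x. (-1) * dir_deriv b ph (- x)) \<in> {\<lambda>x. ph (- x) | ph. ph \<in> schwartz}"
   unfolding mem_Collect_eq
   by (intro exI[of _ "\<lambda>x. (-1) * dir_deriv b ph x"] conjI refl schwartz_cmult schwartz_dir_deriv S b)
 qed
qed (use assms in blast)

lemma schwartz_mult_coord:
 assumes "ph \<in> schwartz" "b \<in> Basis"
 shows "(\<lambda>x. of_real (x \<bullet> b) * ph x) \<in> schwartz"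
proof -
 \<comment> \<open>The extra summand \<open>ps\<close> provides closure: differentiating a product
   with a coordinate leaves a term without that coordinate.\<close>
 let ?X = "{\<lambda>x. of_real (x \<bullet> b) * ph x + ps x | ph ps. ph \<in> schwartz \<and> ps \<in> schwartz}"
 have "(\<lambda>x. of_real (x \<bullet> b) * ph x + 0) \<in> schwartz"
 proof (rule schwartz_coinduct[where X = ?X])
  fix f assume "f \<in> ?X"
  then obtain ph ps where f: "f = (\<lambda>x. of_real (x \<bullet> b) * ph x + ps x)" and S: "ph \<in> schwartz" "ps \<in> schwartz" by auto
  show "continuous_on UNIV f" unfolding f using S by (intro continuous_intros schwartz_continuous)
  show "\<exists>C. \<forall>x. bracket x ^ k * cmod (f x) \<le> C" for k
  proof (intro exI allI)
   fix x
   have "\<bar>x \<bullet> b\<bar> \<le> bracket x"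
    using Basis_le_norm[OF assms(2), of x] norm_le_bracket[of x] by linarith
   then have "cmod (f x) \<le> bracket x * cmod (ph x) + cmod (ps x)"
    unfolding f by (intro order_trans[OF norm_triangle_ineq add_right_mono]) (simp add: norm_mult mult_right_mono)
   then have "bracket x ^ k * cmod (f x) \<le> bracket x ^ k * (bracket x * cmod (ph x) + cmod (ps x))"
    by (intro mult_left_mono) (auto simp: less_imp_le)
   also have "... = bracket x ^ Suc k * cmod (ph x) + bracket x ^ k * cmod (ps x)" by (simp add: algebra_simps)
   also have "... \<le> schwartz_seminorm (Suc k) [] ph + schwartz_seminorm k [] ps"
    by (intro add_mono schwartz_decay S)
   finally show "bracket x ^ k * cmod (f x) \<le> schwartz_seminorm (Suc k) [] ph + schwartz_seminorm k [] ps" .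
  qed
  fix e :: 'a assume e: "e \<in> Basis"
  show "\<exists>f'\<in>?X. \<forall>x. ((\<lambda>t. f (x + t *\<^sub>R e)) has_vector_derivative f' x) (at 0)"
  proof (intro bexI[of _ "\<lambda>x. of_real (x \<bullet> b) * dir_deriv e ph x + (of_real (e \<bullet> b) * ph x + dir_deriv e ps x)"] allI)
   fix x
   have "((\<lambda>t. of_real ((x + t *\<^sub>R e) \<bullet> b) :: complex) has_vector_derivative of_real (e \<bullet> b)) (at 0)"
    unfolding inner_add_left inner_scaleR_left
    by (intro has_vector_derivative_of_real) (auto intro!: derivative_eq_intros simp: has_real_derivative_iff_has_vector_derivative[symmetric])
   from has_vector_derivative_mult[OF this schwartz_has_deriv[OF S(1) e, of x]]
   have "((\<lambda>t. of_real ((x + t *\<^sub>R e) \<bullet> b) * ph (x + t *\<^sub>R e)) has_vector_derivative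
     of_real (x \<bullet> b) * dir_deriv e ph x + of_real (e \<bullet> b) * ph x) (at 0)" by simp
   from has_vector_derivative_add[OF this schwartz_has_deriv[OF S(2) e, of x]]
   show "((\<lambda>t. f (x + t *\<^sub>R e)) has_vector_derivative of_real (x \<bullet> b) * dir_deriv e ph x + (of_real (e \<bullet> b) * ph x + dir_deriv e ps x)) (at 0)"
    by (simp add: f add.assoc)
  next
   show "(\<lambda>x. of_real (x \<bullet> b) * dir_deriv e ph x + (of_real (e \<bullet> b) * ph x + dir_deriv e ps x)) \<in> ?X"
    unfolding mem_Collect_eq
    by (intro exI[of _ "dir_deriv e ph"] exI[of _ "\<lambda>x. of_real (e \<bullet> b) * ph x + dir_deriv e ps x"] conjI refl schwartz_dir_deriv schwartz_linear S e)
  qed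
 next
  show "(\<lambda>x. of_real (x \<bullet> b) * ph x + 0) \<in> ?X"
   unfolding mem_Collect_eq by (intro exI[of _ ph] exI[of _ "\<lambda>x. 0"] conjI refl assms(1) schwartz_zero)
 qed
 then show ?thesis by simp
qed

text \<open>Every \<open>1 + (x \<bullet> b)\<^sup>2\<close> is at most the squared bracket, so the
  weight is dominated by a product of one-dimensional integrable functions.\<close>

lemma integrable_bracket: "integrable lborel (\<lambda>x::'a::euclidean_space. inverse (bracket x ^ (2 * DIM('a))))"
proof (rule Bochner_Integration.integrable_bound)
 have "einterval (- \<infinity>) \<infinity> = (UNIV::real set)" by (auto simp: einterval_def)
 then have i: "integrable lborel (\<lambda>u::real. inverse (1 + u\<^sup>2))"
  using integrable_inverse_1_plus_square by (simp add: set_integrable_def)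
 show "integrable lborel (\<lambda>x::'a. \<Prod>b\<in>Basis. inverse (1 + (x \<bullet> b)\<^sup>2))"
  by (rule integrable_lborel_prod[OF i])
 show "(\<lambda>x::'a. inverse (bracket x ^ (2 * DIM('a)))) \<in> borel_measurable lborel"
  unfolding bracket_def by measurable
 have le: "norm (inverse (bracket x ^ (2 * DIM('a)))) \<le> norm (\<Prod>b\<in>Basis. inverse (1 + (x \<bullet> b)\<^sup>2))" for x :: 'a
 proof -
  have "(\<Prod>b\<in>Basis. 1 + (x \<bullet> b)\<^sup>2) \<le> (\<Prod>b\<in>(Basis::'a set). (bracket x)\<^sup>2)"
  proof (intro prod_mono conjI)
   fix b :: 'a assume b: "b \<in> Basis"
   have "(x \<bullet> b)\<^sup>2 \<le> (norm x)\<^sup>2" using Basis_le_norm[OF b, of x] by (metis abs_ge_zero power2_abs power_mono)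
   then show "1 + (x \<bullet> b)\<^sup>2 \<le> (bracket x)\<^sup>2" by (simp add: bracket_def)
  qed simp
  also have "... = bracket x ^ (2 * DIM('a))" by (simp add: power_mult)
  finally have "inverse (bracket x ^ (2 * DIM('a))) \<le> inverse (\<Prod>b\<in>Basis. 1 + (x \<bullet> b)\<^sup>2)"
   by (intro le_imp_inverse_le) (auto intro!: prod_pos add_pos_nonneg)
  then show ?thesis by (simp add: prod_inversef[symmetric] abs_of_pos prod_nonneg prod_pos add_pos_nonneg)
 qed
 show "AE x in lborel. norm (inverse (bracket (x::'a) ^ (2 * DIM('a)))) \<le> norm (\<Prod>b\<in>Basis. inverse (1 + (x \<bullet> b)\<^sup>2))"
  by (intro AE_I2 le)
qed

definition bracket_integral :: "'a::euclidean_space itself => real" where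
 "bracket_integral _ = (LINT x|lborel. inverse (bracket (x::'a) ^ (2 * DIM('a))))"

lemma rapid_decay_integrable:
 fixes f :: "'a::euclidean_space => complex"
 assumes f: "f \<in> borel_measurable borel" and b: "\<And>x. bracket x ^ (2 * DIM('a)) * cmod (f x) \<le> C"
 shows "integrable lborel f" and "(LINT x|lborel. cmod (f x)) \<le> C * bracket_integral TYPE('a)"
proof -
 have le: "cmod (f x) \<le> C * inverse (bracket x ^ (2 * DIM('a)))" for x
  using b[of x] by (simp add: divide_inverse[symmetric] pos_le_divide_eq mult.commute)
 have i: "integrable lborel (\<lambda>x::'a. C * inverse (bracket x ^ (2 * DIM('a))))"
  using integrable_bracket[where 'a = 'a] by simp
 show int: "integrable lborel f" by (rule Bochner_Integration.integrable_bound[OF i])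
   (use f le in \<open>auto intro!: AE_I2 order_trans[OF le abs_ge_self]\<close>)
 have "(LINT x|lborel. cmod (f x)) \<le> (LINT x|lborel. C * inverse (bracket (x::'a) ^ (2 * DIM('a))))"
  using int i le by (intro integral_mono) auto
 then show "(LINT x|lborel. cmod (f x)) \<le> C * bracket_integral TYPE('a)" by (simp add: bracket_integral_def)
qed

lemma schwartz_integrable: "ph \<in> schwartz ==> integrable lborel ph"
 by (rule rapid_decay_integrable(1)[OF schwartz_measurable schwartz_decay])

lemma cis_difference_quotient:
 assumes "filterlim t (at 0) sequentially"
 shows "(\<lambda>n. (cis (c * t n) - 1) / of_real (t n)) \<longlonglongrightarrow> \<i> * of_real c"
proof -
 have "((\<lambda>t. cis (c * t)) has_vector_derivative \<i> * of_real c) (at 0)"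
  unfolding cis_conv_exp by (auto intro!: derivative_eq_intros has_vector_derivative_real_field)
 then have "((\<lambda>h. (cis (c * h) - cis (c * 0)) / of_real h) \<longlongrightarrow> \<i> * of_real c) (at 0)"
  unfolding has_vector_derivative_at_0_iff .
 from filterlim_compose[OF this assms] show ?thesis by simp
qed

text \<open>Difference quotients replace integration by parts: by translation invariance the
  transform of a quotient is an explicit factor times the transform of \<open>ph\<close>. The
  quotients are dominated because a shift by at most 1 changes brackets by at most the factor
  2.\<close>

lemma fourier_dir_deriv:
 fixes ph :: "'a::euclidean_space => complex"
 assumes S: "ph \<in> schwartz" and b: "b \<in> Basis"
 shows "fourier (dir_deriv b ph) xi = 2 * pi * \<i> * (xi \<bullet> b) * fourier ph xi"
proof -
 have [measurable]: "ph \<in> borel_measurable borel" "dir_deriv b ph \<in> borel_measurable borel"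
  using schwartz_measurable S schwartz_dir_deriv[OF S b] by auto
 define t where "t n = inverse (real (Suc n))" for n
 have t: "t \<longlonglongrightarrow> 0" "\<And>n. t n \<noteq> 0" "\<And>n. 0 < t n" "\<And>n. t n \<le> 1"
  using LIMSEQ_inverse_real_of_nat unfolding t_def by (auto simp: field_simps)
 have t0: "filterlim t (at 0) sequentially" using t by (auto simp: filterlim_at)
 define q where "q n x = (ph (x + t n *\<^sub>R b) - ph x) / of_real (t n) * cis (- 2 * pi * (x \<bullet> xi))" for n x
 let ?K = "2 * DIM('a)"
 have q_eq: "(LINT x|lborel. q n x) = (cis (2 * pi * (xi \<bullet> b) * t n) - 1) / of_real (t n) * fourier ph xi" for n
 proof -
  let ?g = "\<lambda>x. ph x * cis (- 2 * pi * (x \<bullet> xi))"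
  have g: "integrable lborel ?g" using integrable_fourier_kernel[OF schwartz_integrable[OF S], of "- 2 * pi" xi] by simp
  have g': "integrable lborel (\<lambda>x. ?g (x + t n *\<^sub>R b))"
   using integrable_affine[OF g, of 1 "t n *\<^sub>R b"] by (simp add: add.commute)
  have "q n x = cis (2 * pi * (xi \<bullet> b) * t n) / of_real (t n) * ?g (x + t n *\<^sub>R b) - 1 / of_real (t n) * ?g x" for x
  proof -
   have "cis (2 * pi * (xi \<bullet> b) * t n) * cis (- 2 * pi * ((x + t n *\<^sub>R b) \<bullet> xi)) = cis (- 2 * pi * (x \<bullet> xi))"
    unfolding cis_mult by (simp add: inner_add_left inner_commute algebra_simps)
   moreover have "cis (2 * pi * (xi \<bullet> b) * t n) / of_real (t n) * ?g (x + t n *\<^sub>R b)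
     = ph (x + t n *\<^sub>R b) / of_real (t n) * (cis (2 * pi * (xi \<bullet> b) * t n) * cis (- 2 * pi * ((x + t n *\<^sub>R b) \<bullet> xi)))"
    by (simp only: times_divide_eq_left times_divide_eq_right mult_ac)
   ultimately show ?thesis by (simp add: q_def diff_divide_distrib left_diff_distrib)
  qed
  then have "(LINT x|lborel. q n x) = cis (2 * pi * (xi \<bullet> b) * t n) / of_real (t n) * (LINT x|lborel. ?g (x + t n *\<^sub>R b))
    - 1 / of_real (t n) * (LINT x|lborel. ?g x)"
   using g g' by (simp only:) (subst Bochner_Integration.integral_diff, auto)
  also have "(LINT x|lborel. ?g (x + t n *\<^sub>R b)) = (LINT x|lborel. ?g x)"
   by (rule integral_translate) measurable
  finally show ?thesis by (simp add: fourier_def diff_divide_distrib left_diff_distrib)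
 qed
 have "(\<lambda>n. LINT x|lborel. q n x) \<longlonglongrightarrow> fourier (dir_deriv b ph) xi"
  unfolding fourier_def
 proof (rule integral_dominated_convergence[where w = "\<lambda>x. schwartz_seminorm ?K [b] ph * 2 ^ ?K * inverse (bracket x ^ ?K)"])
  show "integrable lborel (\<lambda>x. schwartz_seminorm ?K [b] ph * 2 ^ ?K * inverse (bracket (x::'a) ^ ?K))"
   using integrable_bracket[where 'a = 'a] by simp
  show "AE x in lborel. (\<lambda>n. q n x) \<longlonglongrightarrow> dir_deriv b ph x * cis (- 2 * pi * (x \<bullet> xi))"
  proof (intro AE_I2)
   fix x :: 'a
   have "((\<lambda>h. (ph (x + h *\<^sub>R b) - ph (x + 0 *\<^sub>R b)) / of_real h) \<longlongrightarrow> dir_deriv b ph x) (at 0)"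
    using schwartz_has_deriv[OF S b, of x] unfolding has_vector_derivative_at_0_iff .
   from filterlim_compose[OF this t0] have "(\<lambda>n. (ph (x + t n *\<^sub>R b) - ph (x + 0 *\<^sub>R b)) / of_real (t n)) \<longlonglongrightarrow> dir_deriv b ph x"
    by simp
   then show "(\<lambda>n. q n x) \<longlonglongrightarrow> dir_deriv b ph x * cis (- 2 * pi * (x \<bullet> xi))"
    unfolding q_def by (intro tendsto_mult tendsto_const) simp
  qed
  show "AE x in lborel. norm (q n x) \<le> schwartz_seminorm ?K [b] ph * 2 ^ ?K * inverse (bracket x ^ ?K)" for n
  proof (intro AE_I2)
   fix x :: 'a
   let ?B = "schwartz_seminorm ?K [b] ph * 2 ^ ?K * inverse (bracket x ^ ?K)"
   have "cmod (ph (x + t n *\<^sub>R b) - ph (x + 0 *\<^sub>R b)) \<le> ?B * (t n - 0)"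
   proof (rule line_deriv_bound[OF schwartz_has_deriv[OF S b]])
    fix r assume r: "0 \<le> r" "r \<le> t n"
    then have "r \<le> 1" using t(4)[of n] by linarith
    have "bracket x \<le> bracket (x + r *\<^sub>R b) + norm (x - (x + r *\<^sub>R b))" by (rule bracket_lipschitz)
    also have "... \<le> 2 * bracket (x + r *\<^sub>R b)"
     using bracket_ge_1[of "x + r *\<^sub>R b"] r \<open>r \<le> 1\<close> b by simp
    finally have "bracket x ^ ?K \<le> (2 * bracket (x + r *\<^sub>R b)) ^ ?K"
     by (intro power_mono) (auto simp: less_imp_le)
    then have "bracket x ^ ?K * cmod (dir_deriv b ph (x + r *\<^sub>R b))
      \<le> 2 ^ ?K * (bracket (x + r *\<^sub>R b) ^ ?K * cmod (dir_deriv b ph (x + r *\<^sub>R b)))"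
     using mult_right_mono[OF _ norm_ge_zero[of "dir_deriv b ph (x + r *\<^sub>R b)"]]
     unfolding power_mult_distrib mult.assoc[symmetric] by blast
    also have "... \<le> 2 ^ ?K * schwartz_seminorm ?K [b] ph"
     using schwartz_seminorm_bound[OF S, of "[b]" "x + r *\<^sub>R b" ?K] b by (intro mult_left_mono) auto
    finally show "cmod (dir_deriv b ph (x + r *\<^sub>R b)) \<le> ?B" by (simp add: field_simps)
   qed (use t(3) in \<open>auto simp: less_imp_le\<close>)
   then show "norm (q n x) \<le> ?B" using t(3)[of n] by (simp add: q_def norm_mult norm_divide pos_divide_le_eq)
  qed
 qed (unfold q_def, measurable)
 moreover have "(\<lambda>n. LINT x|lborel. q n x) \<longlonglongrightarrow> 2 * pi * \<i> * (xi \<bullet> b) * fourier ph xi"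
  unfolding q_eq using cis_difference_quotient[OF t0, of "2 * pi * (xi \<bullet> b)"]
  by (intro tendsto_mult tendsto_const) (simp add: mult_ac)
 ultimately show ?thesis by (rule LIMSEQ_unique)
qed

text \<open>Differentiation under the integral. The quotients of \<open>cis\<close> are bounded by
  the modulus of their frequency, so \<open>ph\<close> times a coordinate is an integrable majorant
  up to a constant.\<close>

lemma fourier_has_deriv:
 assumes S: "ph \<in> schwartz" and b: "b \<in> Basis"
 shows "((\<lambda>t. fourier ph (xi + t *\<^sub>R b)) has_vector_derivative fourier (\<lambda>x. (- 2 * pi * \<i>) * (of_real (x \<bullet> b) * ph x)) xi) (at 0)"
 unfolding has_vector_derivative_at_0_iff tendsto_at_iff_sequentially comp_def
proof (intro allI impI)
 fix t :: "nat => real" assume t0: "\<forall>n. t n \<in> UNIV - {0}" and t: "t \<longlonglongrightarrow> 0"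
 have [measurable]: "ph \<in> borel_measurable borel" by (rule schwartz_measurable[OF S])
 have "filterlim t (at 0) sequentially" using t t0 by (auto simp: filterlim_at)
 note lim = cis_difference_quotient[OF this]
 have bound: "cmod ((cis (c * r) - 1) / of_real r) \<le> \<bar>c\<bar>" if "r \<noteq> 0" for c r :: real
 proof -
  have "cmod (cis (c * r) - 1) \<le> \<bar>c * r\<bar>" using iexp_approx1[of "c * r" 0] by (simp add: cis_conv_exp)
  then show ?thesis using that by (simp add: norm_divide abs_mult pos_divide_le_eq)
 qed
 let ?w = "\<lambda>x. ph x * cis (- 2 * pi * (x \<bullet> xi))"
 have int: "integrable lborel (\<lambda>x. ph x * cis (- 2 * pi * (x \<bullet> et)))" for et
  using integrable_fourier_kernel[OF schwartz_integrable[OF S], of "- 2 * pi" et] by simp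
 have eq: "(fourier ph (xi + t n *\<^sub>R b) - fourier ph (xi + 0 *\<^sub>R b)) / of_real (t n)
   = (LINT x|lborel. (cis ((- 2 * pi * (x \<bullet> b)) * t n) - 1) / of_real (t n) * ?w x)" for n
 proof -
  have "cis (- 2 * pi * (x \<bullet> (xi + t n *\<^sub>R b))) = cis ((- 2 * pi * (x \<bullet> b)) * t n) * cis (- 2 * pi * (x \<bullet> xi))" for x
   unfolding cis_mult by (simp add: inner_add_right algebra_simps)
  then have "(cis ((- 2 * pi * (x \<bullet> b)) * t n) - 1) / of_real (t n) * ?w x
    = inverse (of_real (t n)) * (ph x * cis (- 2 * pi * (x \<bullet> (xi + t n *\<^sub>R b))) - ?w x)" for x
   by (simp add: divide_inverse algebra_simps)
  then have "(LINT x|lborel. (cis ((- 2 * pi * (x \<bullet> b)) * t n) - 1) / of_real (t n) * ?w x)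
    = inverse (of_real (t n)) * ((LINT x|lborel. ph x * cis (- 2 * pi * (x \<bullet> (xi + t n *\<^sub>R b)))) - (LINT x|lborel. ?w x))"
   by (simp only: integral_mult_right_zero Bochner_Integration.integral_diff[OF int int])
  then show ?thesis by (simp add: fourier_def divide_inverse mult.commute)
 qed
 have "(\<lambda>n. LINT x|lborel. (cis ((- 2 * pi * (x \<bullet> b)) * t n) - 1) / of_real (t n) * ?w x)
   \<longlonglongrightarrow> (LINT x|lborel. \<i> * of_real (- 2 * pi * (x \<bullet> b)) * ?w x)"
 proof (rule integral_dominated_convergence[where w = "\<lambda>x. 2 * pi * cmod (of_real (x \<bullet> b) * ph x)"])
  show "integrable lborel (\<lambda>x. 2 * pi * cmod (of_real (x \<bullet> b) * ph x))"
   using schwartz_integrable[OF schwartz_mult_coord[OF S b]] by simp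
  show "AE x in lborel. (\<lambda>n. (cis ((- 2 * pi * (x \<bullet> b)) * t n) - 1) / of_real (t n) * ?w x) \<longlonglongrightarrow> \<i> * of_real (- 2 * pi * (x \<bullet> b)) * ?w x"
   by (intro AE_I2 tendsto_mult tendsto_const lim)
  show "AE x in lborel. norm ((cis ((- 2 * pi * (x \<bullet> b)) * t n) - 1) / of_real (t n) * ?w x) \<le> 2 * pi * cmod (of_real (x \<bullet> b) * ph x)" for n
  proof (intro AE_I2)
   fix x
   have "cmod ((cis ((- 2 * pi * (x \<bullet> b)) * t n) - 1) / of_real (t n)) * cmod (ph x) \<le> \<bar>- 2 * pi * (x \<bullet> b)\<bar> * cmod (ph x)"
    using t0 by (intro mult_right_mono bound) auto
   also have "... = 2 * pi * cmod (of_real (x \<bullet> b) * ph x)" by (simp add: norm_mult abs_mult)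
   finally show "norm ((cis ((- 2 * pi * (x \<bullet> b)) * t n) - 1) / of_real (t n) * ?w x) \<le> 2 * pi * cmod (of_real (x \<bullet> b) * ph x)"
    by (simp only: norm_mult norm_cis mult_1_right)
  qed
 qed measurable
 then show "(\<lambda>n. (fourier ph (xi + t n *\<^sub>R b) - fourier ph (xi + 0 *\<^sub>R b)) / of_real (t n))
   \<longlonglongrightarrow> fourier (\<lambda>x. (- 2 * pi * \<i>) * (of_real (x \<bullet> b) * ph x)) xi"
  unfolding eq by (simp add: fourier_def mult_ac)
qed


definition seminorm_sum :: "nat => ('a::euclidean_space => complex) => real" where
 "seminorm_sum N ph = (\<Sum>al\<in>{al. set al \<subseteq> Basis \<and> length al \<le> N}. schwartz_seminorm N al ph)"

lemma schwartz_partial_derivs: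
 fixes ph :: "'a::euclidean_space => complex"
 assumes "ph \<in> schwartz" "al \<in> lists Basis"
 shows "partial_derivs al ph \<in> schwartz"
 using assms(2) by (induction al) (auto simp: assms(1) schwartz_dir_deriv)

lemma schwartz_seminorm_nonneg:
 fixes ph :: "'a::euclidean_space => complex"
 assumes "ph \<in> schwartz" "al \<in> lists Basis"
 shows "schwartz_seminorm k al ph \<ge> 0"
 by (rule order_trans[OF _ schwartz_seminorm_bound[OF assms, of 0]]) (simp add: less_imp_le)

lemma schwartz_seminorm_le_sum:
 fixes ph :: "'a::euclidean_space => complex"
 assumes S: "ph \<in> schwartz" and al: "al \<in> lists Basis" and "length al \<le> n" "k \<le> n"
 shows "schwartz_seminorm k al ph \<le> seminorm_sum n ph"
proof -
 have "bracket x ^ k * cmod (partial_derivs al ph x) \<le> schwartz_seminorm n al ph" for x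
  using \<open>k \<le> n\<close> bracket_ge_1
  by (intro order_trans[OF mult_right_mono schwartz_seminorm_bound[OF S al]] power_increasing) auto
 then have "schwartz_seminorm k al ph \<le> schwartz_seminorm n al ph"
  unfolding schwartz_seminorm_def[of k] by (intro cSUP_least) auto
 also have "... \<le> seminorm_sum n ph" unfolding seminorm_sum_def
  by (rule member_le_sum) (use assms finite_lists_length_le[OF finite_Basis] in \<open>auto intro: schwartz_seminorm_nonneg\<close>)
 finally show ?thesis .
qed

lemma fourier_partial_derivs:
 fixes ph :: "'a::euclidean_space => complex"
 assumes S: "ph \<in> schwartz" and b: "b \<in> Basis"
 shows "fourier (partial_derivs (replicate k b) ph) xi = (2 * pi * \<i> * (xi \<bullet> b)) ^ k * fourier ph xi"
proof (induction k)
 case (Suc k)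
 have "replicate k b \<in> lists Basis" using b by auto
 then show ?case using fourier_dir_deriv[OF schwartz_partial_derivs[OF S] b] Suc by (simp add: mult.assoc)
qed simp

lemma bracket_power_le:
 fixes xi :: "'a::euclidean_space"
 shows "bracket xi ^ (2 * N) \<le> (real DIM('a) + 1) ^ N * (1 + (\<Sum>b\<in>Basis. \<bar>xi \<bullet> b\<bar> ^ (2 * N)))"
proof -
 let ?X = "insert 1 ((\<lambda>b. (xi \<bullet> b)\<^sup>2) ` Basis)"
 \<comment> \<open>\<open>M\<close> controls the squared bracket up to the factor
   \<open>DIM('a) + 1\<close>, and the \<open>N\<close>-th power of each candidate for
   \<open>M\<close> is a term on the right-hand side.\<close>
 define M where "M = Max ?X"
 have M: "M \<in> ?X" "1 \<le> M" "\<And>b. b \<in> Basis ==> (xi \<bullet> b)\<^sup>2 \<le> M"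
  unfolding M_def by (rule Max_in, simp, simp, (rule Max_ge, simp, simp)+)
 have "(bracket xi)\<^sup>2 = 1 + (\<Sum>b\<in>Basis. (xi \<bullet> b)\<^sup>2)"
  unfolding bracket_def power2_norm_eq_inner euclidean_inner[of xi xi] by (simp add: power2_eq_square sum_nonneg add_nonneg_nonneg)
 also have "... \<le> M + (\<Sum>b\<in>(Basis::'a set). M)" by (intro add_mono sum_mono M)
 finally have "((bracket xi)\<^sup>2) ^ N \<le> ((real DIM('a) + 1) * M) ^ N" by (intro power_mono) (auto simp: algebra_simps)
 moreover have "M ^ N \<le> 1 + (\<Sum>b\<in>Basis. \<bar>xi \<bullet> b\<bar> ^ (2 * N))"
 proof (cases "M = 1")
  case False
  then obtain b where b: "b \<in> Basis" "M = (xi \<bullet> b)\<^sup>2" using M(1) by auto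
  have "M ^ N = \<bar>xi \<bullet> b\<bar> ^ (2 * N)" by (simp add: b(2) power_mult)
  also have "... \<le> (\<Sum>b\<in>Basis. \<bar>xi \<bullet> b\<bar> ^ (2 * N))" by (rule member_le_sum[OF b(1)]) auto
  finally show ?thesis by simp
 qed (simp add: sum_nonneg)
 ultimately show ?thesis unfolding power_mult power_mult_distrib by (rule order_trans[OF _ mult_left_mono]) simp
qed

text \<open>Powers of a coordinate times the transform are transforms of repeated derivatives. The
  constants do not depend on \<open>ph\<close>; this uniformity becomes the continuity of the
  distributions given by densities.\<close>

lemma fourier_decay:
 "\<exists>C\<ge>0. \<exists>n. \<forall>ph\<in>schwartz. \<forall>xi::'a::euclidean_space. bracket xi ^ (2 * N) * cmod (fourier ph xi) \<le> C * seminorm_sum n ph"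
proof -
 define n B D where "n = max (2 * DIM('a)) (2 * N)" and "B = bracket_integral TYPE('a)" and "D = real DIM('a) + 1"
 have B: "B \<ge> 0" unfolding B_def bracket_integral_def by (intro Bochner_Integration.integral_nonneg) (simp add: less_imp_le)
 have "bracket xi ^ (2 * N) * cmod (fourier ph xi) \<le> (D ^ N * (D * B)) * seminorm_sum n ph" if S: "ph \<in> schwartz" for ph and xi :: 'a
 proof -
  have deriv: "cmod (fourier (partial_derivs al ph) xi) \<le> B * seminorm_sum n ph" if al: "al \<in> lists Basis" "length al \<le> n" for al
  proof -
   note Sal = schwartz_partial_derivs[OF S al(1)]
   have "cmod (fourier (partial_derivs al ph) xi) \<le> (LINT x|lborel. cmod (partial_derivs al ph x))"
    by (rule fourier_bound[OF schwartz_integrable[OF Sal]])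
   also have "... \<le> schwartz_seminorm (2 * DIM('a)) al ph * B"
    unfolding B_def by (rule rapid_decay_integrable(2)[OF schwartz_measurable[OF Sal] schwartz_seminorm_bound[OF S al(1)]])
   also have "... \<le> seminorm_sum n ph * B"
    using B al by (intro mult_right_mono schwartz_seminorm_le_sum S) (auto simp: n_def)
   finally show ?thesis by (simp add: mult.commute)
  qed
  have "\<bar>xi \<bullet> b\<bar> ^ (2 * N) * cmod (fourier ph xi) \<le> B * seminorm_sum n ph" if b: "b \<in> Basis" for b
  proof -
   have "1 * \<bar>xi \<bullet> b\<bar> \<le> 2 * pi * \<bar>xi \<bullet> b\<bar>" using pi_ge_two by (intro mult_right_mono) auto
   then have "\<bar>xi \<bullet> b\<bar> ^ (2 * N) * cmod (fourier ph xi) \<le> (2 * pi * \<bar>xi \<bullet> b\<bar>) ^ (2 * N) * cmod (fourier ph xi)"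
    by (intro mult_right_mono power_mono) auto
   also have "... = cmod (fourier (partial_derivs (replicate (2 * N) b) ph) xi)"
    unfolding fourier_partial_derivs[OF S b] by (simp add: norm_mult norm_power)
   also have "... \<le> B * seminorm_sum n ph" using b by (intro deriv) (auto simp: n_def)
   finally show ?thesis .
  qed
  then have "(\<Sum>b\<in>Basis. \<bar>xi \<bullet> b\<bar> ^ (2 * N) * cmod (fourier ph xi)) \<le> DIM('a) * (B * seminorm_sum n ph)"
   by (intro sum_bounded_above)
  then have "(1 + (\<Sum>b\<in>Basis. \<bar>xi \<bullet> b\<bar> ^ (2 * N))) * cmod (fourier ph xi) \<le> D * (B * seminorm_sum n ph)"
   using deriv[of "[]"] by (simp add: D_def distrib_right sum_distrib_right)
  then have "D ^ N * ((1 + (\<Sum>b\<in>Basis. \<bar>xi \<bullet> b\<bar> ^ (2 * N))) * cmod (fourier ph xi)) \<le> D ^ N * (D * (B * seminorm_sum n ph))"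
   by (intro mult_left_mono) (auto simp: D_def)
  moreover have "bracket xi ^ (2 * N) * cmod (fourier ph xi) \<le> (D ^ N * (1 + (\<Sum>b\<in>Basis. \<bar>xi \<bullet> b\<bar> ^ (2 * N)))) * cmod (fourier ph xi)"
   unfolding D_def by (intro mult_right_mono bracket_power_le) simp
  ultimately show ?thesis by (simp only: mult.assoc)
 qed
 moreover have "D ^ N * (D * B) \<ge> 0" using B by (simp add: D_def)
 ultimately show ?thesis by blast
qed

lemma schwartz_fourier:
 assumes "ph \<in> schwartz"
 shows "fourier ph \<in> schwartz"
proof (rule schwartz_coinduct[where X = "fourier ` schwartz"])
 fix f :: "'a => complex" assume "f \<in> fourier ` schwartz"
 then obtain ph where f: "f = fourier ph" and S: "ph \<in> schwartz" by auto
 show "continuous_on UNIV f" unfolding f by (rule fourier_continuous[OF schwartz_integrable[OF S]])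
 show "\<exists>C. \<forall>x. bracket x ^ k * cmod (f x) \<le> C" for k
 proof -
  obtain C n where C: "\<And>xi::'a. bracket xi ^ (2 * k) * cmod (fourier ph xi) \<le> C * seminorm_sum n ph"
   using fourier_decay[of k] S by blast
  have "bracket x ^ k * cmod (f x) \<le> C * seminorm_sum n ph" for x
   unfolding f using bracket_ge_1 by (intro order_trans[OF mult_right_mono C] power_increasing) auto
  then show ?thesis by blast
 qed
 show "\<exists>f'\<in>fourier ` schwartz. \<forall>x. ((\<lambda>t. f (x + t *\<^sub>R b)) has_vector_derivative f' x) (at 0)" if b: "b \<in> Basis" for b
  unfolding f using fourier_has_deriv[OF S b] schwartz_cmult[OF schwartz_mult_coord[OF S b]] by blast
qed (use assms in blast)

lemma schwartz_fourier_inversion: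
 assumes S: "ph \<in> schwartz"
 shows "fourier (fourier ph) (- x) = ph x" using schwartz_decay[OF S, of _ 0]
 by (intro fourier_inversion schwartz_integrable schwartz_fourier schwartz_continuous S) simp

section \<open>Bump functions on boxes\<close>

text \<open>With S the quadratic in the exponential and \<open>p = (r, k)\<close>, the functions r
  S^-k exp(-1/S) form a class closed under differentiation. For \<open>p = (1, 0)\<close> and
  growing \<open>n\<close> they increase to the indicator of the interval.\<close>

definition bump :: "real => real => real => real poly \<times> nat => real => real" where
 "bump n a b p t = (if a < t \<and> t < b
  then poly (fst p) t * inverse (n * (t - a) * (b - t)) ^ snd p * exp (- inverse (n * (t - a) * (b - t))) else 0)"

text \<open>The terms r' S^-k, - k r S' S^(-k-1) and r S' S^(-k-2) of the derivative, over the
  common denominator S^(k+2).\<close>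

definition bump_deriv :: "real => real => real => real poly \<times> nat => real poly \<times> nat" where
 "bump_deriv n a b p = (let S = smult n ([:- a, 1:] * [:b, - 1:]) in
  (pderiv (fst p) * S\<^sup>2 - smult (real (snd p)) (fst p * pderiv S * S) + fst p * pderiv S, snd p + 2))"

text \<open>The term of order \<open>k + 2\<close> of the exponential series at
  \<open>inverse s\<close> beats the power and leaves \<open>s\<^sup>2\<close>.\<close>

lemma power_inverse_exp_le:
 fixes s :: real
 assumes "s > 0"
 shows "inverse s ^ k * exp (- inverse s) \<le> fact (k + 2) * s\<^sup>2"
proof -
 have "(\<Sum>i\<in>{k + 2}. inverse s ^ i /\<^sub>R fact i) \<le> exp (inverse s)"
  unfolding sums_unique[OF exp_converges] using assms sums_summable[OF exp_converges[of "inverse s"]]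
  by (intro sum_le_suminf) auto
 then have "inverse s ^ (k + 2) \<le> fact (k + 2) * exp (inverse s)"
  using mult_left_mono[of "inverse s ^ (k + 2) /\<^sub>R fact (k + 2)" "exp (inverse s)" "fact (k + 2)"]
  by (simp add: mult.assoc[symmetric] del: fact_Suc power_Suc add_2_eq_Suc')
 then have le: "inverse s ^ (k + 2) * exp (- inverse s) \<le> fact (k + 2)"
  by (simp add: exp_minus divide_inverse[symmetric] pos_divide_le_eq del: fact_Suc power_Suc add_2_eq_Suc')
 have "inverse s ^ k = inverse s ^ (k + 2) * s\<^sup>2"
  using assms by (simp add: power_add power2_eq_square field_simps)
 then have "inverse s ^ k * exp (- inverse s) = (inverse s ^ (k + 2) * exp (- inverse s)) * s\<^sup>2"
  by (simp only: mult_ac)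
 also have "... \<le> fact (k + 2) * s\<^sup>2" using le by (rule mult_right_mono) simp
 finally show ?thesis .
qed

text \<open>Quadratic vanishing at each point off the open interval forces a zero derivative there.
  As the class is closed under differentiation, this yields smoothness of every order at the end
  points.\<close>

lemma bump_quadratic:
 assumes "n > 0"
 shows "\<exists>C. \<forall>t t0. \<not> (a < t0 \<and> t0 < b) \<longrightarrow> \<bar>bump n a b p t\<bar> \<le> C * (t - t0)\<^sup>2"
proof -
 have "compact (poly (fst p) ` {a..b})" by (intro compact_continuous_image continuous_intros compact_Icc)
 then obtain M where M: "\<And>t. t \<in> {a..b} ==> \<bar>poly (fst p) t\<bar> \<le> M"
  using compact_imp_bounded bounded_real by (metis (no_types, lifting) image_eqI)
 define C where "C = \<bar>M\<bar> * fact (snd p + 2) * (n * (b - a))\<^sup>2"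
 have "\<bar>bump n a b p t\<bar> \<le> C * (t - t0)\<^sup>2" if t0: "\<not> (a < t0 \<and> t0 < b)" for t t0
 proof (cases "a < t \<and> t < b")
  case True
  let ?s = "n * (t - a) * (b - t)"
  have s: "?s > 0" using True assms by simp
  have s2: "?s \<le> n * (b - a) * \<bar>t - t0\<bar>"
  proof (cases "t0 \<le> a")
   case True': True
   have "n * (t - a) * (b - t) \<le> n * \<bar>t - t0\<bar> * (b - a)"
    using True True' assms by (intro mult_mono) auto
   then show ?thesis by (simp add: algebra_simps)
  next
   case False
   then have "n * (t - a) * (b - t) \<le> n * (b - a) * \<bar>t - t0\<bar>"
    using True t0 assms by (intro mult_mono) auto
   then show ?thesis .
  qed
  have "\<bar>bump n a b p t\<bar> = \<bar>poly (fst p) t\<bar> * (inverse ?s ^ snd p * exp (- inverse ?s))"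
   using True less_imp_le[OF s] by (simp add: bump_def abs_mult del: inverse_mult_distrib)
  also have "... \<le> \<bar>M\<bar> * (fact (snd p + 2) * ?s\<^sup>2)"
   by (rule mult_mono[OF _ power_inverse_exp_le[OF s]]) (use M[of t] True less_imp_le[OF s] in \<open>auto simp del: inverse_mult_distrib\<close>)
  also have "... \<le> \<bar>M\<bar> * (fact (snd p + 2) * (n * (b - a) * \<bar>t - t0\<bar>)\<^sup>2)"
   using s s2 by (intro mult_left_mono power_mono) auto
  finally show ?thesis by (simp add: C_def power_mult_distrib mult_ac)
 next
  case False
  then show ?thesis by (auto simp: bump_def C_def)
 qed
 then show ?thesis by blast
qed

lemma has_real_derivative_quadratic:
 fixes f :: "real => real"
 assumes "f x = 0" "\<And>t. \<bar>f t\<bar> \<le> C * (t - x)\<^sup>2"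
 shows "(f has_real_derivative 0) (at x)" unfolding has_field_derivative_iff
proof (rule Lim_null_comparison[where g = "\<lambda>t. C * \<bar>t - x\<bar>"])
 have "norm ((f t - f x) / (t - x)) \<le> C * \<bar>t - x\<bar>" if "t \<noteq> x" for t
 proof -
  have "\<bar>f t\<bar> \<le> (C * \<bar>t - x\<bar>) * \<bar>t - x\<bar>"
   using assms(2)[of t] by (simp only: power2_eq_square mult.assoc abs_mult_self_eq)
  then show ?thesis using that by (simp add: assms(1) pos_divide_le_eq)
 qed
 then show "\<forall>\<^sub>F t in at x. norm ((f t - f x) / (t - x)) \<le> C * \<bar>t - x\<bar>"
  by (auto simp: eventually_at_filter)
 show "((\<lambda>t. C * \<bar>t - x\<bar>) \<longlongrightarrow> 0) (at x)" by (auto intro!: tendsto_eq_intros)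
qed

lemma bump_has_derivative:
 assumes n: "n > 0"
 shows "(bump n a b p has_real_derivative bump n a b (bump_deriv n a b p) t) (at t)"
proof (cases "a < t \<and> t < b")
 case True
 define S where "S = smult n ([:- a, 1:] * [:b, - 1:])"
 have S: "poly S t = n * (t - a) * (b - t)" for t by (simp add: S_def algebra_simps)
 have pos: "poly S t > 0" using True n by (simp add: S)
 obtain r k where p: "p = (r, k)" by force
 let ?i = "inverse (poly S t)"
 have i: "?i * poly S t = 1" using pos by simp
 \<comment> \<open>The power rule produces the exponent \<open>k - 1\<close>, which is truncated at
   \<open>k = 0\<close>; the factor \<open>real k\<close> makes the identity hold there as
   well.\<close>
 have k: "real k * ?i ^ (k - 1) * ?i\<^sup>2 = real k * ?i ^ k * ?i"
  using pos by (cases k) (auto simp: power2_eq_square)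
 have "((\<lambda>t. poly r t * inverse (poly S t) ^ k * exp (- inverse (poly S t))) has_real_derivative
   (poly (pderiv r) t * ?i ^ k + poly r t * (real k * ?i ^ (k - 1) * - (?i\<^sup>2 * poly (pderiv S) t))) * exp (- ?i)
   + poly r t * ?i ^ k * (exp (- ?i) * (?i\<^sup>2 * poly (pderiv S) t))) (at t)" (is "(_ has_real_derivative ?D) _")
  using pos by (auto intro!: derivative_eq_intros simp: power2_eq_square algebra_simps)
 moreover have "?D = bump n a b (bump_deriv n a b p) t"
 proof -
  have "bump n a b (bump_deriv n a b p) t = (poly (pderiv r) t * ?i ^ k * (?i * poly S t)\<^sup>2
    - real k * poly r t * poly (pderiv S) t * ?i * ?i ^ k * (?i * poly S t) + poly r t * poly (pderiv S) t * ?i\<^sup>2 * ?i ^ k) * exp (- ?i)"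
   using True unfolding bump_def bump_deriv_def S_def[symmetric] Let_def p S[symmetric]
   by (simp add: algebra_simps power2_eq_square)
  also have "... = (poly (pderiv r) t * ?i ^ k
    - poly r t * poly (pderiv S) t * (real k * ?i ^ k * ?i) + poly r t * poly (pderiv S) t * ?i\<^sup>2 * ?i ^ k) * exp (- ?i)"
   unfolding i by (simp only: power_one mult_1_right mult_1_left mult_ac)
  also have "... = ?D" unfolding k[symmetric] by (simp only: algebra_simps) simp
  finally show ?thesis by simp
 qed
 ultimately have "((\<lambda>t. poly r t * inverse (poly S t) ^ k * exp (- inverse (poly S t))) has_real_derivative
   bump n a b (bump_deriv n a b p) t) (at t)" by (simp only:)
 moreover have "\<forall>\<^sub>F u in nhds t. bump n a b p u = poly r u * inverse (poly S u) ^ k * exp (- inverse (poly S u))"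
  using eventually_nhds_in_open[of "{a<..<b}" t] True by (auto elim!: eventually_mono simp: bump_def p S)
 ultimately show ?thesis by (simp add: DERIV_cong_ev[OF refl _ refl])
next
 case False
 obtain C where "\<And>t t0. \<not> (a < t0 \<and> t0 < b) ==> \<bar>bump n a b p t\<bar> \<le> C * (t - t0)\<^sup>2"
  using bump_quadratic[OF n] by blast
 then have "(bump n a b p has_real_derivative 0) (at t)"
  using False by (intro has_real_derivative_quadratic[where C = C]) (auto simp: bump_def)
 moreover have "bump n a b (bump_deriv n a b p) t = 0" using False by (auto simp: bump_def)
 ultimately show ?thesis by simp
qed

definition box_bump :: "real => 'a::euclidean_space => 'a => ('a => real poly \<times> nat) => 'a => complex" where
 "box_bump n a b P x = (\<Prod>e\<in>Basis. of_real (bump n (a \<bullet> e) (b \<bullet> e) (P e) (x \<bullet> e)))"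

lemma box_bump_support: "x \<notin> box a b ==> box_bump n a b P x = 0" by (auto simp: box_bump_def bump_def mem_box)

lemma box_bump_continuous:
 assumes "n > 0"
 shows "continuous_on UNIV (box_bump n a b P)"
proof -
 have "continuous_on UNIV (bump n c d p)" for c d p by (rule DERIV_continuous_on[OF bump_has_derivative[OF assms]])
 then show ?thesis unfolding box_bump_def by (intro continuous_on_prod continuous_on_of_real)
   (rule continuous_on_compose2[OF _ continuous_on_inner[OF continuous_on_id continuous_on_const] subset_UNIV])
qed

lemma box_bump_schwartz:
 fixes a b :: "'a::euclidean_space"
 assumes n: "n > 0"
 shows "box_bump n a b P \<in> schwartz"
proof (rule schwartz_coinduct[where X = "range (box_bump n a b)"])
 show "box_bump n a b P \<in> range (box_bump n a b)" by simp
next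
 fix f assume "f \<in> range (box_bump n a b)"
 then obtain P where f: "f = box_bump n a b P" by auto
 show c: "continuous_on UNIV f" unfolding f by (rule box_bump_continuous[OF n])
 show "\<exists>C. \<forall>x. bracket x ^ k * cmod (f x) \<le> C" for k
 proof -
  have "compact ((\<lambda>x. bracket x ^ k * cmod (f x)) ` cbox a b)"
   by (intro compact_continuous_image compact_cbox continuous_intros continuous_on_subset[OF c])
    (auto simp: bracket_def intro!: continuous_intros)
  then obtain C where C: "\<And>x. x \<in> cbox a b ==> \<bar>bracket x ^ k * cmod (f x)\<bar> \<le> C"
   using compact_imp_bounded bounded_real by (metis (no_types, lifting) image_eqI)
  have "bracket x ^ k * cmod (f x) \<le> \<bar>C\<bar>" for x
  proof (cases "x \<in> cbox a b")
   case True
   then show ?thesis using C[of x] by linarith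
  next
   case False
   then have "f x = 0" using box_subset_cbox[of a b] unfolding f by (intro box_bump_support) auto
   then show ?thesis by simp
  qed
  then show ?thesis by blast
 qed
 fix e :: 'a assume e: "e \<in> Basis"
 let ?P = "P(e := bump_deriv n (a \<bullet> e) (b \<bullet> e) (P e))"
 show "\<exists>f'\<in>range (box_bump n a b). \<forall>x. ((\<lambda>t. f (x + t *\<^sub>R e)) has_vector_derivative f' x) (at 0)"
 proof (intro bexI[of _ "box_bump n a b ?P"] allI)
  fix x
  define R where "R = (\<Prod>e'\<in>Basis - {e}. complex_of_real (bump n (a \<bullet> e') (b \<bullet> e') (P e') (x \<bullet> e')))"
  have "box_bump n a b Q (x + t *\<^sub>R e) = of_real (bump n (a \<bullet> e) (b \<bullet> e) (Q e) (x \<bullet> e + t)) * R"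
   if "\<And>e'. e' \<noteq> e ==> Q e' = P e'" for Q t
  proof -
   have "(\<Prod>e'\<in>Basis - {e}. complex_of_real (bump n (a \<bullet> e') (b \<bullet> e') (Q e') ((x + t *\<^sub>R e) \<bullet> e'))) = R"
    unfolding R_def using e that by (intro prod.cong refl) (auto simp: inner_add_left inner_Basis)
   then show ?thesis using e unfolding box_bump_def prod.remove[OF finite_Basis e] by (simp add: inner_add_left)
  qed
  from this[of P] this[of ?P 0]
  have eq: "f (x + t *\<^sub>R e) = of_real (bump n (a \<bullet> e) (b \<bullet> e) (P e) (x \<bullet> e + t)) * R"
   "box_bump n a b ?P x = of_real (bump n (a \<bullet> e) (b \<bullet> e) (bump_deriv n (a \<bullet> e) (b \<bullet> e) (P e)) (x \<bullet> e)) * R" for t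
   by (auto simp: f)
  have "((\<lambda>t. bump n (a \<bullet> e) (b \<bullet> e) (P e) (x \<bullet> e + t)) has_real_derivative
    bump n (a \<bullet> e) (b \<bullet> e) (bump_deriv n (a \<bullet> e) (b \<bullet> e) (P e)) (x \<bullet> e)) (at 0)"
   using bump_has_derivative[OF n, of "a \<bullet> e" "b \<bullet> e" "P e" "0 + x \<bullet> e"] unfolding DERIV_shift by (simp add: add.commute)
  then show "((\<lambda>t. f (x + t *\<^sub>R e)) has_vector_derivative box_bump n a b ?P x) (at 0)" unfolding eq
   by (intro has_vector_derivative_mult_left has_vector_derivative_of_real)
    (simp add: has_real_derivative_iff_has_vector_derivative)
 qed auto
qed

lemma box_test_functions:
 fixes a b :: "'a::euclidean_space"
 obtains Ph :: "nat => 'a => complex" where "\<And>n. test_function (Ph n)"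
  "\<And>n x. cmod (Ph n x) \<le> indicator (cbox a b) x" "\<And>x. (\<lambda>n. Ph n x) \<longlonglongrightarrow> indicator (box a b) x"
proof
 \<comment> \<open>At a fixed interior point every factor is \<open>exp\<close> of a fixed negative
   number divided by \<open>real (Suc n)\<close>, so it tends to 1.\<close>
 let ?Ph = "\<lambda>n. box_bump (real (Suc n)) a b (\<lambda>_. (1, 0))"
 show "test_function (?Ph n)" for n unfolding test_function_def
 proof (intro conjI schwartz_smooth box_bump_schwartz)
  have "closure {x. ?Ph n x \<noteq> 0} \<subseteq> cbox a b"
   using box_bump_support[of _ a b] box_subset_cbox[of a b] by (intro closure_minimal closed_cbox) blast
  then show "compact (closure {x. ?Ph n x \<noteq> 0})"
   using compact_Int_closed[OF compact_cbox closed_closure] by (metis Int_absorb1)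
 qed simp
 show "cmod (?Ph n x) \<le> indicator (cbox a b) x" for n x
 proof (cases "x \<in> box a b")
  case True
  then have "cmod (?Ph n x) \<le> 1"
   unfolding box_bump_def prod_norm[symmetric] by (intro prod_le_1) (auto simp: bump_def)
  then show ?thesis using True box_subset_cbox[of a b] by (auto simp: indicator_def)
 qed (simp add: box_bump_support)
 show "(\<lambda>n. ?Ph n x) \<longlonglongrightarrow> indicator (box a b) x" for x
 proof (cases "x \<in> box a b")
  case True
  have "(\<lambda>n. complex_of_real (bump (real (Suc n)) (a \<bullet> e) (b \<bullet> e) (1, 0) (x \<bullet> e))) \<longlonglongrightarrow> of_real 1" if "e \<in> Basis" for e
  proof (rule tendsto_of_real)
   let ?c = "(x \<bullet> e - a \<bullet> e) * (b \<bullet> e - x \<bullet> e)"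
   have "(\<lambda>n. exp (- (inverse ?c * inverse (real (Suc n))))) \<longlonglongrightarrow> exp (- (inverse ?c * 0))"
    by (intro tendsto_intros LIMSEQ_inverse_real_of_nat)
   then show "(\<lambda>n. bump (real (Suc n)) (a \<bullet> e) (b \<bullet> e) (1, 0) (x \<bullet> e)) \<longlonglongrightarrow> 1"
    using True that by (simp add: bump_def mem_box mult_ac)
  qed
  then have "(\<lambda>n. ?Ph n x) \<longlonglongrightarrow> (\<Prod>e\<in>(Basis::'a set). of_real 1)"
   unfolding box_bump_def by (intro tendsto_prod) auto
  then show ?thesis using True by simp
 qed (simp add: box_bump_support)
qed

section \<open>Functions determined by their integrals against test functions\<close>

text \<open>The positive and the negative part are densities of two measures that agree and are
  finite on boxes. Boxes form an intersection-stable generator, and densities are unique almost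
  everywhere.\<close>

lemma AE_0_if_box_integrals_0_real:
 fixes g :: "'a::euclidean_space => real"
 assumes m [measurable]: "g \<in> borel_measurable borel"
  and int: "\<And>l u. set_integrable lborel (box l u) g" and 0: "\<And>l u. (LINT x:box l u|lborel. g x) = 0"
 shows "AE x in lborel. g x = 0"
proof -
 let ?p = "\<lambda>x. ennreal (max 0 (g x))" and ?n = "\<lambda>x. ennreal (max 0 (- g x))"
 have eq: "emeasure (density lborel ?p) (box l u) = emeasure (density lborel ?n) (box l u)"
  and fin: "emeasure (density lborel ?p) (box l u) \<noteq> \<infinity>" for l u
 proof -
  let ?h = "\<lambda>x. indicator (box l u) x * g x"
  have h: "integrable lborel ?h" "(LINT x|lborel. ?h x) = 0"
   using int[of l u] 0[of l u] by (simp_all add: set_integrable_def set_lebesgue_integral_def)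
  have i: "integrable lborel (\<lambda>x. max 0 (?h x))" "integrable lborel (\<lambda>x. max 0 (- ?h x))" using h by auto
  have "(LINT x|lborel. max 0 (?h x)) - (LINT x|lborel. max 0 (- ?h x)) = (LINT x|lborel. ?h x)"
   unfolding Bochner_Integration.integral_diff[OF i, symmetric] by (intro Bochner_Integration.integral_cong) auto
  then have "(LINT x|lborel. max 0 (?h x)) = (LINT x|lborel. max 0 (- ?h x))" using h by simp
  moreover have "emeasure (density lborel ?p) (box l u) = (\<integral>\<^sup>+x. ennreal (max 0 (?h x)) \<partial>lborel)"
   by (simp add: emeasure_density) (intro nn_integral_cong, auto simp: indicator_def)
  moreover have "emeasure (density lborel ?n) (box l u) = (\<integral>\<^sup>+x. ennreal (max 0 (- ?h x)) \<partial>lborel)"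
   by (simp add: emeasure_density) (intro nn_integral_cong, auto simp: indicator_def)
  ultimately show "emeasure (density lborel ?p) (box l u) = emeasure (density lborel ?n) (box l u)"
   "emeasure (density lborel ?p) (box l u) \<noteq> \<infinity>" using i by (simp_all add: nn_integral_eq_integral)
 qed
 have "density lborel ?p = density lborel ?n"
 proof (rule measure_eqI_generator_eq[where \<Omega> = UNIV and E = "range (\<lambda>(l, u). box l u :: 'a set)"
    and A = "\<lambda>n. box (- (real n *\<^sub>R One)) (real n *\<^sub>R One)"])
  show "Int_stable (range (\<lambda>(l, u). box l u :: 'a set))" unfolding Int_stable_def
   by (auto simp: Int_interval box_Int_box)
  show "sets (density lborel ?p) = sigma_sets UNIV (range (\<lambda>(l, u). box l u))"
   "sets (density lborel ?n) = sigma_sets UNIV (range (\<lambda>(l, u). box l u))" by (simp_all add: borel_eq_box)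
  show "(\<Union>n. box (- (real n *\<^sub>R One)) (real n *\<^sub>R One)) = (UNIV :: 'a set)"
   by (rule UN_box_eq_UNIV)
  show "emeasure (density lborel ?p) (box (- (real i *\<^sub>R One)) (real i *\<^sub>R One)) \<noteq> \<infinity>" for i by (rule fin)
 qed (auto simp: eq)
 then have "AE x in lborel. ?p x = ?n x" by (intro sigma_finite_measure.density_unique[OF sigma_finite_lborel]) auto
 then show ?thesis by eventually_elim (auto simp: max_def split: if_splits)
qed

text \<open>The lemma of du Bois-Reymond: test functions approximate indicators of boxes under a
  common bound, which reduces the claim to integrals over boxes.\<close>

lemma AE_0_if_test_integrals_0:
 fixes g :: "'a::euclidean_space => complex"
 assumes m: "g \<in> borel_measurable lebesgue"
  and loc: "\<And>l u. (\<integral>\<^sup>+x. ennreal (cmod (g x)) * indicator (cbox l u) x \<partial>lborel) < \<infinity>"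
  and 0: "\<And>ph. test_function ph ==> (LINT x|lebesgue. ph x * g x) = 0"
 shows "AE x in lborel. g x = 0"
proof -
 obtain g' where g': "g' \<in> borel_measurable borel" "AE x in lborel. g x = g' x"
  using lebesgue_borel_representative[OF m] by blast
 note [measurable] = g'(1)
 have int: "integrable lborel (\<lambda>x. indicator (cbox l u) x *\<^sub>R g' x)" for l u
 proof (rule integrableI_bounded)
  have "(\<integral>\<^sup>+x. ennreal (norm (indicator (cbox l u) x *\<^sub>R g' x)) \<partial>lborel)
    = (\<integral>\<^sup>+x. ennreal (cmod (g x)) * indicator (cbox l u) x \<partial>lborel)"
   by (intro nn_integral_cong_AE) (use g'(2) in \<open>eventually_elim, auto simp: indicator_def\<close>)
  then show "(\<integral>\<^sup>+x. ennreal (norm (indicator (cbox l u) x *\<^sub>R g' x)) \<partial>lborel) < \<infinity>" using loc by simp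
 qed measurable
 have int_box: "integrable lborel (\<lambda>x. indicator (box l u) x *\<^sub>R g' x)" for l u
  by (rule Bochner_Integration.integrable_bound[OF int[of l u]])
   (use box_subset_cbox[of l u] in \<open>auto simp: indicator_def intro!: AE_I2\<close>)
 have box: "(LINT x|lborel. indicator (box l u) x *\<^sub>R g' x) = 0" for l u
 proof -
  obtain Ph :: "nat => 'a => complex" where Ph: "\<And>n. test_function (Ph n)"
   "\<And>n x. cmod (Ph n x) \<le> indicator (cbox l u) x" "\<And>x. (\<lambda>n. Ph n x) \<longlonglongrightarrow> indicator (box l u) x"
   using box_test_functions[of l u] by blast
  have [measurable]: "Ph n \<in> borel_measurable borel" for n
   using Ph(1)[of n] unfolding test_function_def smooth_def
   by (intro borel_measurable_continuous_onI) (metis partial_derivs_Nil lists.Nil)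
  have "(\<lambda>n. LINT x|lborel. Ph n x * g' x) \<longlonglongrightarrow> (LINT x|lborel. indicator (box l u) x *\<^sub>R g' x)"
  proof (rule integral_dominated_convergence[where w = "\<lambda>x. norm (indicator (cbox l u) x *\<^sub>R g' x)"])
   show "integrable lborel (\<lambda>x. norm (indicator (cbox l u) x *\<^sub>R g' x))" using int by (rule integrable_norm)
   show "AE x in lborel. (\<lambda>n. Ph n x * g' x) \<longlonglongrightarrow> indicator (box l u) x *\<^sub>R g' x"
   proof (intro AE_I2)
    fix x
    have "(\<lambda>n. Ph n x * g' x) \<longlonglongrightarrow> indicator (box l u) x * g' x" by (intro tendsto_intros Ph)
    then show "(\<lambda>n. Ph n x * g' x) \<longlonglongrightarrow> indicator (box l u) x *\<^sub>R g' x" by (cases "x \<in> box l u") auto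
   qed
   show "AE x in lborel. norm (Ph n x * g' x) \<le> norm (indicator (cbox l u) x *\<^sub>R g' x)" for n
    using Ph(2)[of n] by (auto simp: norm_mult intro!: mult_right_mono)
  qed measurable
  moreover have "(LINT x|lborel. Ph n x * g' x) = 0" for n
  proof -
   have "(LINT x|lborel. Ph n x * g' x) = (LINT x|lebesgue. Ph n x * g' x)"
    by (rule integral_completion[symmetric]) measurable
   also have "... = (LINT x|lebesgue. Ph n x * g x)"
   proof (rule integral_cong_AE)
    have c: "Ph n \<in> borel_measurable lebesgue" "g' \<in> borel_measurable lebesgue" by (rule measurable_completion; measurable)+
    show "(\<lambda>x. Ph n x * g' x) \<in> borel_measurable lebesgue" "(\<lambda>x. Ph n x * g x) \<in> borel_measurable lebesgue"
     by (rule borel_measurable_times[OF c(1) c(2)], rule borel_measurable_times[OF c(1) m])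
    show "AE x in lebesgue. Ph n x * g' x = Ph n x * g x"
     by (rule AE_completion) (use g'(2) in \<open>eventually_elim, simp\<close>)
   qed
   finally show ?thesis using 0[OF Ph(1)] by simp
  qed
  ultimately show ?thesis by (simp add: LIMSEQ_const_iff)
 qed
 have "AE x in lborel. Re (g' x) = 0"
 proof (rule AE_0_if_box_integrals_0_real)
  fix l u :: 'a
  show "set_integrable lborel (box l u) (\<lambda>x. Re (g' x))" using integrable_Re[OF int_box[of l u]] by (simp add: set_integrable_def)
  show "(LINT x:box l u|lborel. Re (g' x)) = 0"
   using integral_Re[OF int_box[of l u]] by (simp add: set_lebesgue_integral_def box)
 qed measurable
 moreover have "AE x in lborel. Im (g' x) = 0"
 proof (rule AE_0_if_box_integrals_0_real)
  fix l u :: 'a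
  show "set_integrable lborel (box l u) (\<lambda>x. Im (g' x))" using integrable_Im[OF int_box[of l u]] by (simp add: set_integrable_def)
  show "(LINT x:box l u|lborel. Im (g' x)) = 0"
   using integral_Im[OF int_box[of l u]] by (simp add: set_lebesgue_integral_def box)
 qed measurable
 ultimately show ?thesis using g'(2) by eventually_elim (simp add: complex_eq_iff)
qed

lemma l2_measurable_mult:
 assumes h: "h \<in> borel_measurable borel" and F: "l2_measurable s F"
 shows "l2_measurable s (\<lambda>x mu. h x * F x mu)" unfolding l2_measurable_iff
proof (intro conjI)
 show "range (\<lambda>x mu. h x * F x mu) \<subseteq> l2 s" using l2_measurable_range[OF F] by (auto intro: l2_cmult)
 obtain A where A: "countable A" "AE x in lborel. \<forall>mu. mu \<notin> A \<longrightarrow> F x mu = 0"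
  using F unfolding l2_measurable_iff coord_measurable_def by blast
 have "AE x in lborel. \<forall>mu. mu \<notin> A \<longrightarrow> h x * F x mu = 0" using A(2) by eventually_elim auto
 moreover have "h \<in> borel_measurable lebesgue" using h by (intro measurable_completion) simp
 ultimately show "coord_measurable (\<lambda>x mu. h x * F x mu)"
  using A(1) l2_measurable_coord[OF F] unfolding coord_measurable_def
  by (intro conjI exI[of _ A] allI borel_measurable_times) auto
qed

text \<open>The exceptional null sets depend on \<open>mu\<close>, but only countably many of them
  matter, since both functions vanish off a countable set for almost all x.\<close>

lemma coord_measurable_AE_eq:
 assumes "coord_measurable F" "coord_measurable G" "\<And>mu. AE x in lborel. F x mu = G x mu"
 shows "AE x in lborel. F x = G x"
proof -
 obtain A B where A: "countable A" "AE x in lborel. \<forall>mu. mu \<notin> A \<longrightarrow> F x mu = 0"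
  and B: "countable B" "AE x in lborel. \<forall>mu. mu \<notin> B \<longrightarrow> G x mu = 0"
  using assms(1,2) unfolding coord_measurable_def by blast
 have "AE x in lborel. \<forall>mu\<in>A \<union> B. F x mu = G x mu"
  using A(1) B(1) assms(3) by (simp add: AE_ball_countable)
 then show ?thesis using A(2) B(2)
 proof eventually_elim
  case (elim x)
  show ?case
  proof
   fix mu
   show "F x mu = G x mu" using elim by (cases "mu \<in> A \<union> B") auto
  qed
 qed
qed

lemma coord_integral_cong_AE:
 assumes "coord_measurable F" "AE x in lborel. F x = G x"
 shows "coord_integral F = coord_integral G"
proof
 fix mu
 have "AE x in lborel. F x mu = G x mu" using assms(2) by eventually_elim simp
 then show "coord_integral F mu = coord_integral G mu" using assms coord_measurable_cong_AE[OF assms]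
  unfolding coord_integral_def coord_measurable_def by (intro integral_cong_AE AE_completion) auto
qed

lemma coord_integral_linear:
 assumes "l2_integrable s F" "l2_integrable s G"
 shows "coord_integral (\<lambda>x mu. c * F x mu + G x mu) = (\<lambda>mu. c * coord_integral F mu + coord_integral G mu)"
 using l2_integrable_coord[OF assms(1)] l2_integrable_coord[OF assms(2)] by (simp add: coord_integral_def fun_eq_iff)

lemma l2_norm_linear:
 assumes "z \<in> l2 s" "y \<in> l2 s"
 shows "l2_norm s (\<lambda>mu. c * z mu + y mu) \<le> cmod c * l2_norm s z + l2_norm s y"
 using l2_norm_triangle[OF l2_cmult[OF assms(1), of c] assms(2)] by (simp add: l2_norm_cmult)

lemma l2_integrable_linear:
 assumes F: "l2_integrable s F" and G: "l2_integrable s G"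
 shows "l2_integrable s (\<lambda>x mu. c * F x mu + G x mu)"
proof -
 have m: "l2_measurable s F" "l2_measurable s G" using F G by (auto simp: l2_integrable_def)
 have int: "integrable lebesgue (\<lambda>x. cmod c * l2_norm s (F x) + l2_norm s (G x))"
  using l2_integrable_norm[OF F] l2_integrable_norm[OF G] by auto
 have "(\<integral>\<^sup>+x. ennreal (l2_norm s (\<lambda>mu. c * F x mu + G x mu)) \<partial>lborel)
   \<le> (\<integral>\<^sup>+x. ennreal (cmod c * l2_norm s (F x) + l2_norm s (G x)) \<partial>lborel)"
  by (intro nn_integral_mono ennreal_leI l2_norm_linear l2_measurable_range m)
 also have "... < \<infinity>" using nn_integral_eq_integral[OF int] by (simp add: nn_integral_completion)
 finally show ?thesis using l2_measurable_linear[OF m] by (simp add: l2_integrable_def)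
qed

section \<open>Densities of finite weighted energy\<close>

text \<open>The Fourier side of \<open>Sobolev t s\<close>, where the operator acts as
  multiplication by a matrix.\<close>

definition sobolev_density :: "real => real => ('a::euclidean_space => 'a => complex) => bool" where
 "sobolev_density t s G \<longleftrightarrow> l2_measurable s G \<and> weighted_energy t s G < \<infinity>"

lemma bracket_measurable [measurable]: "bracket \<in> borel_measurable borel" unfolding bracket_def by measurable

lemma energy_measurable:
 assumes "l2_measurable s G"
 shows "(\<lambda>xi. (l2_norm s (G xi))\<^sup>2 * bracket xi powr t) \<in> borel_measurable lebesgue"
proof -
 have "(\<lambda>xi::'a. bracket xi powr t) \<in> borel_measurable lebesgue" by (rule measurable_completion) measurable
 then show ?thesis using l2_norm_measurable[OF assms] by measurable
qed

lemma sobolev_density_mono: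
 assumes F: "l2_measurable s' F" and G: "sobolev_density t s G"
  and le: "\<And>xi. (l2_norm s' (F xi))\<^sup>2 * bracket xi powr (2 * t') \<le> C * ((l2_norm s (G xi))\<^sup>2 * bracket xi powr (2 * t))"
  and "C \<ge> 0"
 shows "sobolev_density t' s' F" and "enn2real (weighted_energy t' s' F) \<le> C * enn2real (weighted_energy t s G)"
proof -
 have "weighted_energy t' s' F \<le> (\<integral>\<^sup>+xi. ennreal C * ennreal ((l2_norm s (G xi))\<^sup>2 * bracket xi powr (2 * t)) \<partial>lebesgue)"
  unfolding weighted_energy_def using le \<open>C \<ge> 0\<close>
  by (simp add: nn_integral_completion ennreal_mult'[symmetric] nn_integral_mono ennreal_leI)
 also have "... = ennreal C * weighted_energy t s G"
  using energy_measurable G unfolding weighted_energy_def sobolev_density_def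
  by (subst nn_integral_cmult) (auto simp: nn_integral_completion)
 finally have *: "weighted_energy t' s' F \<le> ennreal C * weighted_energy t s G" .
 have fin: "ennreal C * weighted_energy t s G < \<infinity>" using G by (simp add: sobolev_density_def ennreal_mult_less_top)
 show "sobolev_density t' s' F" using F le_less_trans[OF * fin] by (simp add: sobolev_density_def)
 have "enn2real (weighted_energy t' s' F) \<le> enn2real (ennreal C * weighted_energy t s G)"
  using * fin by (intro enn2real_mono) auto
 then show "enn2real (weighted_energy t' s' F) \<le> C * enn2real (weighted_energy t s G)"
  using \<open>C \<ge> 0\<close> by (simp add: enn2real_mult)
qed

lemma sobolev_density_linear:
 assumes F: "sobolev_density t s F" and G: "sobolev_density t s G"
 shows "sobolev_density t s (\<lambda>x mu. c * F x mu + G x mu)" unfolding sobolev_density_def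
proof
 have m: "l2_measurable s F" "l2_measurable s G" using F G by (auto simp: sobolev_density_def)
 show "l2_measurable s (\<lambda>x mu. c * F x mu + G x mu)" using m by (rule l2_measurable_linear)
 let ?e = "\<lambda>G xi. (l2_norm s (G xi))\<^sup>2 * bracket xi powr (2 * t)"
 have int: "integrable lebesgue (?e H)" if "sobolev_density t s H" for H :: "'a => 'a => complex"
  using that energy_measurable unfolding sobolev_density_def weighted_energy_def
  by (intro integrable_lebesgueI) auto
 have le: "?e (\<lambda>x mu. c * F x mu + G x mu) xi \<le> 2 * (cmod c)\<^sup>2 * ?e F xi + 2 * ?e G xi" for xi
 proof -
  let ?f = "cmod c * l2_norm s (F xi)" and ?g = "l2_norm s (G xi)"
  have "(l2_norm s (\<lambda>mu. c * F xi mu + G xi mu))\<^sup>2 \<le> (?f + ?g)\<^sup>2"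
   by (intro power_mono l2_norm_linear l2_measurable_range m) simp
  also have "... \<le> 2 * ?f\<^sup>2 + 2 * ?g\<^sup>2"
   using zero_le_power2[of "?f - ?g"] unfolding power2_sum power2_diff by linarith
  finally have "?e (\<lambda>x mu. c * F x mu + G x mu) xi \<le> (2 * ?f\<^sup>2 + 2 * ?g\<^sup>2) * bracket xi powr (2 * t)"
   by (intro mult_right_mono) auto
  then show ?thesis by (simp add: power_mult_distrib algebra_simps)
 qed
 have "weighted_energy t s (\<lambda>x mu. c * F x mu + G x mu)
   \<le> (\<integral>\<^sup>+xi. ennreal (2 * (cmod c)\<^sup>2 * ?e F xi + 2 * ?e G xi) \<partial>lebesgue)"
  unfolding weighted_energy_def nn_integral_completion by (intro nn_integral_mono ennreal_leI le)
 also have "... < \<infinity>" using int[OF F] int[OF G] by (subst nn_integral_eq_integral) auto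
 finally show "weighted_energy t s (\<lambda>x mu. c * F x mu + G x mu) < \<infinity>" .
qed

lemma sobolev_density_L2_loc:
 assumes G: "sobolev_density t s G"
 shows "G \<in> L2_loc s" unfolding L2_loc_def
proof (intro CollectI conjI allI impI)
 show "l2_measurable s G" using G by (simp add: sobolev_density_def)
 fix K :: "'a set" assume "compact K"
 then have "compact ((\<lambda>xi. bracket xi powr (- 2 * t)) ` K)"
 proof (intro compact_continuous_image continuous_on_powr continuous_on_const)
  show "continuous_on K bracket" unfolding bracket_def[abs_def] by (intro continuous_intros)
 qed simp_all
 then obtain C where C: "\<And>xi. xi \<in> K ==> \<bar>bracket xi powr (- 2 * t)\<bar> \<le> C"
  using compact_imp_bounded bounded_real by (metis (no_types, lifting) image_eqI)
 have "(\<integral>\<^sup>+xi\<in>K. ennreal ((l2_norm s (G xi))\<^sup>2) \<partial>lborel)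
   \<le> (\<integral>\<^sup>+xi. ennreal \<bar>C\<bar> * ennreal ((l2_norm s (G xi))\<^sup>2 * bracket xi powr (2 * t)) \<partial>lebesgue)"
  unfolding nn_integral_completion
 proof (intro nn_integral_mono)
  fix xi
  show "ennreal ((l2_norm s (G xi))\<^sup>2) * indicator K xi \<le> ennreal \<bar>C\<bar> * ennreal ((l2_norm s (G xi))\<^sup>2 * bracket xi powr (2 * t))"
  proof (cases "xi \<in> K")
   case True
   have "(l2_norm s (G xi))\<^sup>2 = bracket xi powr (- 2 * t) * ((l2_norm s (G xi))\<^sup>2 * bracket xi powr (2 * t))"
    by (simp add: powr_add[symmetric] mult_ac)
   also have "... \<le> \<bar>C\<bar> * ((l2_norm s (G xi))\<^sup>2 * bracket xi powr (2 * t))"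
    using C[OF True] by (intro mult_right_mono) auto
   finally show ?thesis using True by (simp add: ennreal_mult'[symmetric] ennreal_leI)
  qed simp
 qed
 also have "... = ennreal \<bar>C\<bar> * weighted_energy t s G"
  using energy_measurable G unfolding weighted_energy_def sobolev_density_def
  by (subst nn_integral_cmult) (auto simp: nn_integral_completion)
 also have "... < \<infinity>" using G by (simp add: sobolev_density_def ennreal_mult_less_top)
 finally show "(\<integral>\<^sup>+xi\<in>K. ennreal ((l2_norm s (G xi))\<^sup>2) \<partial>lborel) < \<infinity>" .
qed

text \<open>By arithmetic and geometric means, a density times a decaying factor is dominated by its
  energy density plus the integrable power of the bracket. \<open>N\<close> and \<open>M\<close> do
  not depend on \<open>h\<close>, and the bound is linear in \<open>K\<close>; this later gives
  continuity on the Schwartz space.\<close>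

lemma sobolev_density_integrable:
 fixes G :: "'a::euclidean_space => 'a => complex"
 assumes G: "sobolev_density t s G"
 shows "\<exists>N M. \<forall>h\<in>borel_measurable borel. \<forall>K. (\<forall>xi. bracket xi ^ (2 * N) * cmod (h xi) \<le> K)
  \<longrightarrow> l2_integrable s (\<lambda>xi mu. h xi * G xi mu) \<and> l2_norm s (coord_integral (\<lambda>xi mu. h xi * G xi mu)) \<le> K * M"
proof -
 define N where "N = nat \<lceil>real DIM('a) + \<bar>t\<bar>\<rceil>"
 have N: "real DIM('a) + \<bar>t\<bar> \<le> real N" unfolding N_def by linarith
 have m: "l2_measurable s G" using G by (simp add: sobolev_density_def)
 define w where "w xi = (l2_norm s (G xi))\<^sup>2 * bracket xi powr (2 * t) + inverse (bracket xi ^ (2 * DIM('a)))" for xi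
 have "integrable lebesgue (\<lambda>xi. (l2_norm s (G xi))\<^sup>2 * bracket xi powr (2 * t))"
  using G energy_measurable unfolding sobolev_density_def weighted_energy_def by (intro integrable_lebesgueI) auto
 moreover have "integrable lebesgue (\<lambda>xi::'a. inverse (bracket xi ^ (2 * DIM('a))))"
  using integrable_bracket[where 'a = 'a] by (simp add: integrable_completion)
 ultimately have w: "integrable lebesgue w" unfolding w_def by (rule Bochner_Integration.integrable_add)
 have le: "l2_norm s (\<lambda>mu. c * G xi mu) \<le> K * w xi" if c: "bracket xi ^ (2 * N) * cmod c \<le> K" for c K xi
 proof -
  let ?g = "l2_norm s (G xi)"
  have K: "0 \<le> K" using c by (rule order_trans[rotated]) simp
  have cc: "cmod c \<le> K * bracket xi powr (- (2 * N))"
   using c powr_realpow[of "bracket xi" "2 * N"] by (simp add: powr_minus field_simps)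
  have "?g * bracket xi powr (- (2 * N)) = (?g * bracket xi powr t) * bracket xi powr (- (2 * N) - t)"
   by (simp add: powr_add[symmetric] mult.assoc)
  also have "... \<le> (?g * bracket xi powr t)\<^sup>2 + (bracket xi powr (- (2 * N) - t))\<^sup>2"
   using zero_le_power2[of "?g * bracket xi powr t - bracket xi powr (- (2 * N) - t)"]
    zero_le_power2[of "?g * bracket xi powr t"] zero_le_power2[of "bracket xi powr (- (2 * N) - t)"]
   unfolding power2_diff by linarith
  also have "... = ?g\<^sup>2 * bracket xi powr (2 * t) + bracket xi powr (2 * (- (2 * N) - t))"
   by (simp add: power_mult_distrib powr_power mult.commute)
  also have "... \<le> ?g\<^sup>2 * bracket xi powr (2 * t) + bracket xi powr (- (2 * DIM('a)))"
   using N bracket_ge_1[of xi] by (intro add_left_mono powr_mono) auto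
  also have "... = w xi" using powr_realpow[of "bracket xi" "2 * DIM('a)"] by (simp add: w_def powr_minus)
  finally have "K * (?g * bracket xi powr (- (2 * N))) \<le> K * w xi" using K by (rule mult_left_mono)
  moreover have "cmod c * ?g \<le> K * bracket xi powr (- (2 * N)) * ?g" using cc by (rule mult_right_mono) simp
  ultimately show ?thesis by (simp add: l2_norm_cmult mult_ac)
 qed
 show ?thesis
 proof (intro exI[of _ N] exI[of _ "LINT xi|lebesgue. w xi"] ballI allI impI)
  fix h :: "'a => complex" and K :: real
  assume h: "h \<in> borel_measurable borel" and K': "\<forall>xi. bracket xi ^ (2 * N) * cmod (h xi) \<le> K"
  have K: "bracket xi ^ (2 * N) * cmod (h xi) \<le> K" for xi using K' by blast
  let ?F = "\<lambda>xi mu. h xi * G xi mu"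
  have Kw: "integrable lebesgue (\<lambda>xi. K * w xi)" using w by simp
  have nn: "0 \<le> K * w xi" for xi using le[OF K, of xi] l2_norm_nonneg order_trans by blast
  have "(\<integral>\<^sup>+xi. ennreal (l2_norm s (?F xi)) \<partial>lborel) \<le> (\<integral>\<^sup>+xi. ennreal (K * w xi) \<partial>lebesgue)"
   unfolding nn_integral_completion by (intro nn_integral_mono ennreal_leI le K)
  also have "... < \<infinity>" using nn by (subst nn_integral_eq_integral[OF Kw]) auto
  finally have int: "l2_integrable s ?F" using l2_measurable_mult[OF h m] by (simp add: l2_integrable_def)
  have "l2_norm s (coord_integral ?F) \<le> (LINT xi|lebesgue. l2_norm s (?F xi))" by (rule coord_integral_norm[OF int])
  also have "... \<le> (LINT xi|lebesgue. K * w xi)" by (intro integral_mono l2_integrable_norm[OF int] Kw le K)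
  finally show "l2_integrable s ?F \<and> l2_norm s (coord_integral ?F) \<le> K * (LINT xi|lebesgue. w xi)" using int by simp
 qed
qed

lemma test_function_schwartz:
 assumes "test_function ph"
 shows "ph \<in> schwartz" unfolding schwartz_def
proof (intro CollectI conjI allI ballI)
 show sm: "smooth ph" using assms by (simp add: test_function_def)
 fix k al assume al: "al \<in> lists (Basis :: 'a set)"
 let ?K = "closure {x. ph x \<noteq> 0}"
 have 0: "partial_derivs al ph x = 0" if "x \<notin> ?K" for x using al that
 proof (induction al arbitrary: x)
  case Nil
  then show ?case using closure_subset[of "{x. ph x \<noteq> 0}"] by auto
 next
  case (Cons v al)
  have "open ((\<lambda>t::real. x + t *\<^sub>R v) -` (- ?K))"
   by (intro open_vimage open_Compl closed_closure continuous_intros)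
  then have "\<forall>\<^sub>F t in nhds (0::real). x + t *\<^sub>R v \<notin> ?K"
   using Cons.prems eventually_nhds_in_open[of "(\<lambda>t::real. x + t *\<^sub>R v) -` (- ?K)" 0] by auto
  then have ev: "\<forall>\<^sub>F t in nhds (0::real). partial_derivs al ph (x + t *\<^sub>R v) = 0"
   using Cons by (auto elim!: eventually_mono)
  then obtain S where S: "open S" "0 \<in> S" "\<And>t. t \<in> S ==> partial_derivs al ph (x + t *\<^sub>R v) = 0"
   unfolding eventually_nhds by blast
  have "((\<lambda>t. partial_derivs al ph (x + t *\<^sub>R v)) has_vector_derivative 0) (at 0)"
  proof (rule has_vector_derivative_transform_within_open)
   show "((\<lambda>t. 0) has_vector_derivative 0) (at 0)" by simp
   show "open S" "0 \<in> S" by fact+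
   show "0 = partial_derivs al ph (x + t *\<^sub>R v)" if "t \<in> S" for t using S(3)[OF that] by simp
  qed
  then show ?case by (simp add: dir_deriv_eq)
 qed
 have "compact ((\<lambda>x. bracket x ^ k * cmod (partial_derivs al ph x)) ` ?K)"
  using sm al assms unfolding smooth_def test_function_def
  by (intro compact_continuous_image continuous_intros) (auto simp: bracket_def intro!: continuous_intros intro: continuous_on_subset)
 then obtain C where C: "\<And>x. x \<in> ?K ==> \<bar>bracket x ^ k * cmod (partial_derivs al ph x)\<bar> \<le> C"
  using compact_imp_bounded bounded_real by (metis (no_types, lifting) image_eqI)
 show "bdd_above (range (\<lambda>x. bracket x ^ k * cmod (partial_derivs al ph x)))"
 proof (intro bdd_aboveI2)
  show "bracket x ^ k * cmod (partial_derivs al ph x) \<le> \<bar>C\<bar>" for x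
   using C[of x] 0[of x] by (cases "x \<in> ?K") auto
 qed
qed

lemma L2_loc_coord:
 assumes "G \<in> L2_loc s"
 shows "(\<integral>\<^sup>+xi. ennreal (cmod (G xi mu)) * indicator (cbox l u) xi \<partial>lborel) < \<infinity>"
proof -
 let ?b = "bracket mu powr (- s)" and ?I = "indicator (cbox l u) :: 'a => ennreal"
 have m: "l2_measurable s G" and fin: "(\<integral>\<^sup>+xi. ennreal ((l2_norm s (G xi))\<^sup>2) * ?I xi \<partial>lborel) < \<infinity>"
  using assms compact_cbox unfolding L2_loc_def by auto
 have [measurable]: "(\<lambda>xi. l2_norm s (G xi)) \<in> borel_measurable lebesgue" by (rule l2_norm_measurable[OF m])
 have le: "ennreal (cmod (G xi mu)) \<le> ennreal ?b * (1 + ennreal ((l2_norm s (G xi))\<^sup>2))" for xi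
 proof -
  let ?g = "l2_norm s (G xi)"
  have "?g \<le> 1 + ?g\<^sup>2" using zero_le_power2[of "?g - 1"] l2_norm_nonneg[of s "G xi"] unfolding power2_diff power_one by linarith
  then have "?b * ?g \<le> ?b * (1 + ?g\<^sup>2)" by (rule mult_left_mono) simp
  then have "cmod (G xi mu) \<le> ?b * (1 + ?g\<^sup>2)"
   using l2_coord[OF l2_measurable_range[OF m], of xi mu] by linarith
  then have "ennreal (cmod (G xi mu)) \<le> ennreal (?b * (1 + ?g\<^sup>2))" by (rule ennreal_leI)
  then show ?thesis by (simp add: ennreal_mult')
 qed
 have "(\<integral>\<^sup>+xi. ennreal (cmod (G xi mu)) * ?I xi \<partial>lborel)
   \<le> (\<integral>\<^sup>+xi. ennreal ?b * (?I xi + ennreal ((l2_norm s (G xi))\<^sup>2) * ?I xi) \<partial>lebesgue)"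
  unfolding nn_integral_completion
 proof (rule nn_integral_mono)
  fix xi
  show "ennreal (cmod (G xi mu)) * ?I xi \<le> ennreal ?b * (?I xi + ennreal ((l2_norm s (G xi))\<^sup>2) * ?I xi)"
   using le[of xi] by (auto simp: indicator_def)
 qed
 also have "... = ennreal ?b * (emeasure lebesgue (cbox l u) + (\<integral>\<^sup>+xi. ennreal ((l2_norm s (G xi))\<^sup>2) * ?I xi \<partial>lebesgue))"
 proof -
  have [measurable]: "cbox l u \<in> sets lebesgue" by simp
  show ?thesis by (subst nn_integral_cmult, measurable, subst nn_integral_add) auto
 qed
 also have "... < \<infinity>"
  using fin emeasure_lborel_cbox_finite[of l u] by (simp add: nn_integral_completion ennreal_mult_less_top)
 finally show ?thesis .
qed

text \<open>Every coordinate of the difference is annihilated by all test functions, and the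
  countable supports unite the null sets. It makes the choices in \<open>Sobolev_norm\<close> and
  \<open>some_density\<close> harmless.\<close>

lemma fourier_density_unique:
 assumes G: "fourier_density s u G" and H: "fourier_density s u H"
 shows "AE xi in lborel. G xi = H xi"
proof (rule coord_measurable_AE_eq)
 have L: "G \<in> L2_loc s" "H \<in> L2_loc s" using G H by (auto simp: fourier_density_def)
 then have m: "l2_measurable s G" "l2_measurable s H" by (auto simp: L2_loc_def)
 then show "coord_measurable G" "coord_measurable H" by (auto simp: l2_measurable_iff)
 fix mu
 note gm [measurable] = l2_measurable_coord[OF m(1), of mu] l2_measurable_coord[OF m(2), of mu]
 have "AE xi in lborel. G xi mu - H xi mu = 0"
 proof (rule AE_0_if_test_integrals_0)
  show "(\<lambda>xi. G xi mu - H xi mu) \<in> borel_measurable lebesgue" using gm by measurable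
  show "(\<integral>\<^sup>+xi. ennreal (cmod (G xi mu - H xi mu)) * indicator (cbox l u) xi \<partial>lborel) < \<infinity>" for l u
  proof -
   have [measurable]: "cbox l u \<in> sets lebesgue" by simp
   have "(\<integral>\<^sup>+xi. ennreal (cmod (G xi mu - H xi mu)) * indicator (cbox l u) xi \<partial>lborel)
     \<le> (\<integral>\<^sup>+xi. ennreal (cmod (G xi mu)) * indicator (cbox l u) xi + ennreal (cmod (H xi mu)) * indicator (cbox l u) xi \<partial>lebesgue)"
    unfolding nn_integral_completion
    by (intro nn_integral_mono) (auto simp: indicator_def ennreal_plus[symmetric] norm_triangle_ineq4 simp del: ennreal_plus intro!: ennreal_leI)
   also have "... < \<infinity>" using L2_loc_coord[OF L(1), of mu l u] L2_loc_coord[OF L(2), of mu l u] gm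
    by (subst nn_integral_add, measurable) (auto simp: nn_integral_completion)
   finally show ?thesis .
  qed
  fix ph :: "'a => complex" assume ph: "test_function ph"
  have i: "l2_has_integral s (\<lambda>xi mu. ph xi * G xi mu) (dist_fourier u ph)" "l2_has_integral s (\<lambda>xi mu. ph xi * H xi mu) (dist_fourier u ph)"
   using G H ph by (auto simp: fourier_density_def)
  then have "(LINT xi|lebesgue. ph xi * G xi mu) = (LINT xi|lebesgue. ph xi * H xi mu)"
   unfolding l2_has_integral_iff coord_integral_def fun_eq_iff by metis
  then show "(LINT xi|lebesgue. ph xi * (G xi mu - H xi mu)) = 0"
   using i l2_integrable_coord[of s "\<lambda>xi mu. ph xi * G xi mu" mu] l2_integrable_coord[of s "\<lambda>xi mu. ph xi * H xi mu" mu]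
   unfolding l2_has_integral_iff right_diff_distrib by (subst Bochner_Integration.integral_diff) auto
 qed
 then show "AE xi in lborel. G xi mu = H xi mu" by eventually_elim simp
qed

lemma weighted_energy_cong_AE:
 "AE xi in lborel. G xi = H xi ==> weighted_energy t s G = weighted_energy t s H"
 unfolding weighted_energy_def by (intro nn_integral_cong_AE) (auto elim!: eventually_mono)

lemma Sobolev_norm_eq:
 assumes "fourier_density s u G"
 shows "Sobolev_norm t s u = sqrt (enn2real (weighted_energy t s G))" unfolding Sobolev_norm_def
 using weighted_energy_cong_AE[OF fourier_density_unique[OF someI[of "fourier_density s u", OF assms] assms]] by simp

definition some_density where "some_density s u = (SOME G. fourier_density s u G)"

lemma some_density:
 assumes "u \<in> Sobolev t s"
 shows "fourier_density s u (some_density s u)" and "sobolev_density t s (some_density s u)"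
proof -
 obtain G where G: "fourier_density s u G" "weighted_energy t s G < \<infinity>" using assms by (auto simp: Sobolev_def)
 show *: "fourier_density s u (some_density s u)" unfolding some_density_def by (rule someI[of "fourier_density s u", OF G(1)])
 show "sobolev_density t s (some_density s u)"
  using * G(2) weighted_energy_cong_AE[OF fourier_density_unique[OF * G(1)]]
  by (auto simp: sobolev_density_def fourier_density_def L2_loc_def)
qed

section \<open>Distributions given by their Fourier densities\<close>

text \<open>The inverse Fourier transform of \<open>G\<close> by duality: reflecting the transform
  of \<open>ps\<close> gives its inverse transform, so that testing against
  \<open>fourier ph\<close> returns the pairing of \<open>ph\<close> with \<open>G\<close>.\<close>

definition dist_of_density :: "('a::euclidean_space => 'a => complex) => ('a => complex) => 'a => complex" where
 "dist_of_density G ps = (if ps \<in> schwartz then coord_integral (\<lambda>xi mu. fourier ps (- xi) * G xi mu) else (\<lambda>_. 0))"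

lemma schwartz_density_integrable:
 assumes G: "sobolev_density t s G" and "ps \<in> schwartz"
 shows "l2_integrable s (\<lambda>xi mu. ps xi * G xi mu)"
 using sobolev_density_integrable[OF G] schwartz_measurable[OF assms(2)] schwartz_decay[OF assms(2)] by blast

lemma dist_of_density_tempered:
 fixes G :: "'a::euclidean_space => 'a => complex"
 assumes G: "sobolev_density t s G"
 shows "tempered_dist s (dist_of_density G)" unfolding tempered_dist_def
proof (intro conjI allI impI ballI)
 have S: "(\<lambda>xi. fourier ps (- xi)) \<in> schwartz" if "ps \<in> schwartz" for ps :: "'a => complex"
  using schwartz_reflect[OF schwartz_fourier[OF that]] .
 note int = schwartz_density_integrable[OF G S]
 show "dist_of_density G ph = (\<lambda>_. 0)" if "ph \<notin> schwartz" for ph using that by (simp add: dist_of_density_def)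
 show "dist_of_density G ph \<in> l2 s" if "ph \<in> schwartz" for ph
  using that coord_integral_l2[OF int[OF that]] by (simp add: dist_of_density_def)
 show "dist_of_density G (\<lambda>x. c * ph x + ps x) = (\<lambda>mu. c * dist_of_density G ph mu + dist_of_density G ps mu)"
  if ph: "ph \<in> schwartz" and ps: "ps \<in> schwartz" for ph ps c
 proof -
  have "fourier (\<lambda>x. c * ph x + ps x) (- xi) * G xi mu = c * (fourier ph (- xi) * G xi mu) + fourier ps (- xi) * G xi mu" for xi mu
   unfolding fourier_linear[OF schwartz_integrable[OF ph] schwartz_integrable[OF ps]] by (simp add: distrib_right mult.assoc)
  then show ?thesis
   using ph ps schwartz_linear[OF ph ps, of c] coord_integral_linear[OF int[OF ph] int[OF ps], of c]
   by (simp add: dist_of_density_def)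
 qed
 obtain N M where NM: "\<forall>h\<in>borel_measurable borel. \<forall>K. (\<forall>xi. bracket xi ^ (2 * N) * cmod (h xi) \<le> K)
  \<longrightarrow> l2_integrable s (\<lambda>xi mu. h xi * G xi mu) \<and> l2_norm s (coord_integral (\<lambda>xi mu. h xi * G xi mu)) \<le> K * M"
  using sobolev_density_integrable[OF G] by blast
 obtain C n where C: "\<And>ph xi. ph \<in> schwartz ==> bracket (xi::'a) ^ (2 * N) * cmod (fourier ph xi) \<le> C * seminorm_sum n ph"
  using fourier_decay[of N] by blast
 have "l2_norm s (dist_of_density G ph) \<le> (C * M) * seminorm_sum n ph" if ph: "ph \<in> schwartz" for ph
 proof -
  have "bracket xi ^ (2 * N) * cmod (fourier ph (- xi)) \<le> C * seminorm_sum n ph" for xi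
   using C[OF ph, of "- xi"] by (simp add: bracket_def)
  with NM[rule_format, OF schwartz_measurable[OF S[OF ph]], of "C * seminorm_sum n ph"] show ?thesis using ph by (simp add: dist_of_density_def mult_ac)
 qed
 then show "\<exists>C N. \<forall>ph\<in>schwartz. l2_norm s (dist_of_density G ph)
   \<le> C * (\<Sum>al\<in>{al. set al \<subseteq> Basis \<and> length al \<le> N}. schwartz_seminorm N al ph)"
  unfolding seminorm_sum_def by blast
qed

lemma dist_of_density_fourier_density:
 assumes G: "sobolev_density t s G"
 shows "fourier_density s (dist_of_density G) G" unfolding fourier_density_def
proof (intro conjI allI impI)
 show "G \<in> L2_loc s" by (rule sobolev_density_L2_loc[OF G])
 fix ph :: "'a => complex" assume "test_function ph"
 then have ph: "ph \<in> schwartz" by (rule test_function_schwartz)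
 then show "l2_has_integral s (\<lambda>xi mu. ph xi * G xi mu) (dist_fourier (dist_of_density G) ph)"
  unfolding l2_has_integral_iff using schwartz_density_integrable[OF G ph]
  by (simp add: dist_fourier_def dist_of_density_def schwartz_fourier schwartz_fourier_inversion)
qed

lemma dist_of_density_Sobolev: "sobolev_density t s G ==> dist_of_density G \<in> Sobolev t s"
 using dist_of_density_tempered[of t s G] dist_of_density_fourier_density[of t s G]
 by (auto simp: Sobolev_def sobolev_density_def)

lemma fourier_density_linear:
 assumes G: "fourier_density s u G" "sobolev_density t s G" and H: "fourier_density s v H" "sobolev_density t s H"
 shows "fourier_density s (\<lambda>ph mu. c * u ph mu + v ph mu) (\<lambda>xi mu. c * G xi mu + H xi mu)"
 unfolding fourier_density_def
proof (intro conjI allI impI)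
 show "(\<lambda>xi mu. c * G xi mu + H xi mu) \<in> L2_loc s"
  by (rule sobolev_density_L2_loc[OF sobolev_density_linear[OF G(2) H(2)]])
 fix ph :: "'a => complex" assume ph: "test_function ph"
 then have i: "l2_has_integral s (\<lambda>xi mu. ph xi * G xi mu) (dist_fourier u ph)" "l2_has_integral s (\<lambda>xi mu. ph xi * H xi mu) (dist_fourier v ph)"
  using G H by (auto simp: fourier_density_def)
 have "l2_has_integral s (\<lambda>xi mu. c * (ph xi * G xi mu) + ph xi * H xi mu) (\<lambda>mu. c * dist_fourier u ph mu + dist_fourier v ph mu)"
  using i l2_integrable_linear[OF conjunct1[OF i(1)[unfolded l2_has_integral_iff]] conjunct1[OF i(2)[unfolded l2_has_integral_iff]]]
   coord_integral_linear[OF conjunct1[OF i(1)[unfolded l2_has_integral_iff]] conjunct1[OF i(2)[unfolded l2_has_integral_iff]], of c]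
  unfolding l2_has_integral_iff by simp
 moreover have "(\<lambda>mu. c * dist_fourier u ph mu + dist_fourier v ph mu) = dist_fourier (\<lambda>ph mu. c * u ph mu + v ph mu) ph"
  using test_function_schwartz[OF ph] by (simp add: dist_fourier_def)
 ultimately show "l2_has_integral s (\<lambda>xi mu. ph xi * (c * G xi mu + H xi mu)) (dist_fourier (\<lambda>ph mu. c * u ph mu + v ph mu) ph)"
  by (simp add: algebra_simps)
qed

section \<open>Completeness of L2 for scalar functions\<close>

lemma tendsto_0_le_ennreal:
 fixes f g :: "nat => ennreal"
 assumes "\<And>n. f n \<le> g n" "g \<longlonglongrightarrow> 0"
 shows "f \<longlonglongrightarrow> 0"
 by (rule tendsto_sandwich[OF _ _ tendsto_const assms(2)]) (use assms(1) in auto)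

text \<open>The squared L2 distance with values in the extended reals, so that no finiteness has to
  be assumed; the price is the factor 2 in the triangle inequality.\<close>

definition sq_dist :: "('a::euclidean_space => complex) => ('a => complex) => ennreal" where
 "sq_dist f g = (\<integral>\<^sup>+x. ennreal ((cmod (f x - g x))\<^sup>2) \<partial>lborel)"

lemma sq_dist_commute: "sq_dist f g = sq_dist g f" by (simp add: sq_dist_def norm_minus_commute)

lemma sq_norm_add: "(cmod (x + y))\<^sup>2 \<le> 2 * (cmod x)\<^sup>2 + 2 * (cmod y)\<^sup>2"
proof -
 have "(cmod (x + y))\<^sup>2 \<le> (cmod x + cmod y)\<^sup>2" by (intro power_mono norm_triangle_ineq) simp
 also have "... \<le> 2 * (cmod x)\<^sup>2 + 2 * (cmod y)\<^sup>2"
  using zero_le_power2[of "cmod x - cmod y"] unfolding power2_sum power2_diff by linarith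
 finally show ?thesis .
qed

lemma sq_dist_triangle:
 assumes [measurable]: "f \<in> borel_measurable borel" "g \<in> borel_measurable borel" "h \<in> borel_measurable borel"
 shows "sq_dist f h \<le> 2 * sq_dist f g + 2 * sq_dist g h"
proof -
 have le: "(cmod (f x - h x))\<^sup>2 \<le> 2 * (cmod (f x - g x))\<^sup>2 + 2 * (cmod (g x - h x))\<^sup>2" for x
  using sq_norm_add[of "f x - g x" "g x - h x"] by simp
 have "sq_dist f h \<le> (\<integral>\<^sup>+x. 2 * ennreal ((cmod (f x - g x))\<^sup>2) + 2 * ennreal ((cmod (g x - h x))\<^sup>2) \<partial>lborel)"
  unfolding sq_dist_def
  by (intro nn_integral_mono) (use le in \<open>auto simp: ennreal_plus[symmetric] ennreal_mult'[symmetric] ennreal_leI simp del: ennreal_plus simp flip: ennreal_numeral\<close>)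
 also have "... = 2 * sq_dist f g + 2 * sq_dist g h" by (simp add: sq_dist_def nn_integral_add nn_integral_cmult)
 finally show ?thesis .
qed

lemma sq_dist_limit_unique:
 assumes m: "\<And>n. h n \<in> borel_measurable borel" "g \<in> borel_measurable borel" "g' \<in> borel_measurable borel"
  and lim: "(\<lambda>n. sq_dist (h n) g) \<longlonglongrightarrow> 0" "(\<lambda>n. sq_dist (h n) g') \<longlonglongrightarrow> 0"
 shows "AE x in lborel. g x = g' x"
proof -
 note [measurable] = m
 have "(\<lambda>n. 2 * sq_dist (h n) g + 2 * sq_dist (h n) g') \<longlonglongrightarrow> 2 * 0 + 2 * 0"
  by (intro tendsto_add ennreal_tendsto_cmult lim) auto
 moreover have "sq_dist g g' \<le> 2 * sq_dist (h n) g + 2 * sq_dist (h n) g'" for n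
  using sq_dist_triangle[OF m(2) m(1) m(3), of n] by (simp add: sq_dist_commute)
 ultimately have "sq_dist g g' \<le> 0" by (intro LIMSEQ_le_const) auto
 then have "AE x in lborel. ennreal ((cmod (g x - g' x))\<^sup>2) = 0"
  unfolding sq_dist_def by (subst nn_integral_0_iff_AE[symmetric]) auto
 then show ?thesis by eventually_elim simp
qed

text \<open>A fast subsequence converges almost everywhere, and Fatou's lemma transfers the error
  \<open>e n\<close> to its limit, so that the limit comes with the rate of the sequence.\<close>

lemma Riesz_Fischer:
 fixes h :: "nat => 'a::euclidean_space => complex"
 assumes m: "\<And>n. h n \<in> borel_measurable borel"
  and e: "\<And>n k. n \<le> k ==> sq_dist (h n) (h k) \<le> e n" "e \<longlonglongrightarrow> 0"
 obtains g where "g \<in> borel_measurable borel" "\<And>n. sq_dist (h n) g \<le> e n"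
proof -
 note [measurable] = m
 have ev: "\<forall>\<^sub>F n in sequentially. e n < ennreal ((1 / 4) ^ k)" for k :: nat
  using e(2) by (rule order_tendstoD(2)) simp
 \<comment> \<open>The errors \<open>4 ^ -k\<close> leave room for weights \<open>2 ^ k\<close> on
   the squared increments, which are needed to sum the increments themselves. The choice need not be
   increasing, so consecutive members are compared in either order.\<close>
 define r where "r k = (SOME n. n \<ge> k \<and> e n < ennreal ((1 / 4) ^ k))" for k
 have r: "r k \<ge> k" "e (r k) < ennreal ((1 / 4) ^ k)" for k
 proof -
  have "\<exists>n. n \<ge> k \<and> e n < ennreal ((1 / 4) ^ k)"
   using eventually_happens'[OF _ eventually_conj[OF eventually_ge_at_top[of k] ev[of k]]] by auto
  from someI_ex[OF this] show "r k \<ge> k" "e (r k) < ennreal ((1 / 4) ^ k)" unfolding r_def by auto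
 qed
 let ?d = "\<lambda>k x. cmod (h (r k) x - h (r (Suc k)) x)"
 have dist: "sq_dist (h (r k)) (h (r (Suc k))) \<le> 2 * ennreal ((1 / 4) ^ k)" for k
 proof -
  have "sq_dist (h (r i)) (h (r j)) \<le> ennreal ((1 / 4) ^ k)" if "r i \<le> r j" "i = k \<or> i = Suc k" for i j
  proof -
   have "sq_dist (h (r i)) (h (r j)) \<le> ennreal ((1 / 4) ^ i)" using e(1)[OF that(1)] r(2)[of i] by auto
   also have "... \<le> ennreal ((1 / 4) ^ k)" using that(2) by (intro ennreal_leI) auto
   finally show ?thesis .
  qed
  from this[of k "Suc k"] this[of "Suc k" k]
  have "sq_dist (h (r k)) (h (r (Suc k))) \<le> ennreal ((1 / 4) ^ k)"
   by (cases "r k \<le> r (Suc k)") (auto simp: sq_dist_commute[of "h (r (Suc k))"])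
  also have "... \<le> 2 * ..." by (simp add: mult_2)
  finally show ?thesis .
 qed
 have "(\<integral>\<^sup>+x. (\<Sum>k. ennreal (2 ^ k * (?d k x)\<^sup>2)) \<partial>lborel) = (\<Sum>k. \<integral>\<^sup>+x. ennreal (2 ^ k * (?d k x)\<^sup>2) \<partial>lborel)"
  by (intro nn_integral_suminf) measurable
 also have "... = (\<Sum>k. ennreal (2 ^ k) * sq_dist (h (r k)) (h (r (Suc k))))"
  unfolding sq_dist_def by (intro suminf_cong) (subst nn_integral_cmult[symmetric], auto simp: ennreal_mult')
 also have "... \<le> (\<Sum>k. ennreal (2 * (1 / 2) ^ k))"
 proof (intro suminf_le)
  fix k
  have "ennreal (2 ^ k) * sq_dist (h (r k)) (h (r (Suc k))) \<le> ennreal (2 ^ k) * (2 * ennreal ((1 / 4) ^ k))"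
   using dist by (intro mult_left_mono) auto
  also have "... = ennreal (2 ^ k * (2 * (1 / 4) ^ k))" by (simp add: ennreal_mult' del: ennreal_numeral flip: ennreal_numeral)
  also have "(2::real) ^ k * (2 * (1 / 4) ^ k) = 2 * (1 / 2) ^ k" by (simp add: power_divide field_simps flip: power_mult_distrib)
  finally show "ennreal (2 ^ k) * sq_dist (h (r k)) (h (r (Suc k))) \<le> ennreal (2 * (1 / 2) ^ k)" .
 qed auto
 also have "... < \<infinity>" by (subst suminf_ennreal2) (auto intro!: summable_mult)
 finally have "AE x in lborel. (\<Sum>k. ennreal (2 ^ k * (?d k x)\<^sup>2)) \<noteq> \<infinity>"
  by (intro nn_integral_PInf_AE) auto
 then have conv: "AE x in lborel. convergent (\<lambda>k. h (r k) x)"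
 proof eventually_elim
  case (elim x)
  have "summable (\<lambda>k. 2 ^ k * (?d k x)\<^sup>2)"
   by (rule summable_suminf_not_top) (use elim in \<open>auto simp: top_unique\<close>)
  then have "summable (\<lambda>k. (1 / 2) ^ k + 2 ^ k * (?d k x)\<^sup>2)" by (intro summable_add summable_geometric) auto
  moreover have "norm (h (r (Suc k)) x - h (r k) x) \<le> (1 / 2) ^ k + 2 ^ k * (?d k x)\<^sup>2" for k
  proof -
   let ?p = "(2::real) ^ k" and ?D = "?d k x"
   \<comment> \<open>Expanding the square gives
     \<open>2 * ?D \<le> (1 / 2) ^ k + ?p * ?D\<^sup>2\<close>, which turns summable weighted
     squares into summable increments.\<close>
   have "0 \<le> (1 - ?p * ?D)\<^sup>2 / ?p" by simp
   also have "... = (1 / 2) ^ k - 2 * ?D + ?p * ?D\<^sup>2"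
    by (simp add: power2_diff power_mult_distrib power_divide field_simps power2_eq_square)
   finally show ?thesis using norm_ge_zero[of "h (r k) x - h (r (Suc k)) x"]
    unfolding norm_minus_commute[of "h (r (Suc k)) x"] by linarith
  qed
  ultimately have "summable (\<lambda>k. h (r (Suc k)) x - h (r k) x)" by (rule summable_comparison_test'[where N = 0])
  then have "convergent (\<lambda>n. (h (r n) x - h (r 0) x) + h (r 0) x)"
   unfolding summable_iff_convergent sum_lessThan_telescope[of "\<lambda>k. h (r k) x"] by (intro convergent_add convergent_const)
  then show ?case by simp
 qed
 define g where "g x = lim (\<lambda>k. h (r k) x)" for x
 have gm: "g \<in> borel_measurable borel" unfolding g_def by measurable
 moreover have "sq_dist (h n) g \<le> e n" for n
 proof -
  have "sq_dist (h n) g \<le> (\<integral>\<^sup>+x. liminf (\<lambda>k. ennreal ((cmod (h n x - h (r k) x))\<^sup>2)) \<partial>lborel)"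
   unfolding sq_dist_def
  proof (rule nn_integral_mono_AE)
   show "AE x in lborel. ennreal ((cmod (h n x - g x))\<^sup>2) \<le> liminf (\<lambda>k. ennreal ((cmod (h n x - h (r k) x))\<^sup>2))"
    using conv
   proof eventually_elim
    case (elim x)
    then have "(\<lambda>k. h (r k) x) \<longlonglongrightarrow> g x" by (simp add: g_def convergent_LIMSEQ_iff)
    then have "(\<lambda>k. ennreal ((cmod (h n x - h (r k) x))\<^sup>2)) \<longlonglongrightarrow> ennreal ((cmod (h n x - g x))\<^sup>2)"
     by (intro tendsto_ennrealI tendsto_intros)
    from lim_imp_Liminf[OF _ this] show ?case by simp
   qed
  qed
  also have "... \<le> liminf (\<lambda>k. sq_dist (h n) (h (r k)))"
   unfolding sq_dist_def by (intro nn_integral_liminf) measurable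
  also have "... \<le> e n"
  proof (rule Liminf_le)
   show "\<forall>\<^sub>F k in sequentially. sq_dist (h n) (h (r k)) \<le> e n"
    using eventually_ge_at_top[of n] by eventually_elim (use r(1) e(1) le_trans in blast)
  qed simp
  finally show ?thesis .
 qed
 ultimately show thesis by (rule that)
qed

section \<open>The Fourier transform on \<open>L\<^sup>2\<close>\<close>

definition truncate :: "nat => ('a::euclidean_space => complex) => 'a => complex" where
 "truncate n f x = indicator (cball 0 (real n)) x * f x"

definition square_integrable :: "('a::euclidean_space => complex) => bool" where
 "square_integrable f \<longleftrightarrow> f \<in> borel_measurable borel \<and> (\<integral>\<^sup>+x. ennreal ((cmod (f x))\<^sup>2) \<partial>lborel) < \<infinity>"

text \<open>The limit in square mean of the transforms of truncations to growing balls, which are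
  integrable. The choice fixes one Borel representative of a limit that is determined up to null
  sets.\<close>

definition L2_fourier :: "('a::euclidean_space => complex) => 'a => complex" where
 "L2_fourier f = (SOME g. g \<in> borel_measurable borel \<and> (\<lambda>n. sq_dist (fourier (truncate n f)) g) \<longlonglongrightarrow> 0)"

lemma truncate_measurable [measurable]: "f \<in> borel_measurable borel ==> truncate n f \<in> borel_measurable borel"
 unfolding truncate_def[abs_def] by (intro borel_measurable_times borel_measurable_indicator) auto

lemma truncate_integrable:
 assumes "square_integrable f"
 shows "integrable lborel (truncate n f)"
proof (rule integrableI_bounded)
 have [measurable]: "f \<in> borel_measurable borel" using assms by (simp add: square_integrable_def)
 then show "truncate n f \<in> borel_measurable lborel" by simp
 have "(\<integral>\<^sup>+x. ennreal (norm (truncate n f x)) \<partial>lborel)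
   \<le> (\<integral>\<^sup>+x. indicator (cball 0 (real n)) x + ennreal ((cmod (f x))\<^sup>2) \<partial>lborel)"
 proof (rule nn_integral_mono)
  fix x
  have "cmod (f x) \<le> 1 + (cmod (f x))\<^sup>2"
   using zero_le_power2[of "cmod (f x) - 1"] norm_ge_zero[of "f x"] unfolding power2_diff power_one by linarith
  then have "ennreal (cmod (f x)) \<le> ennreal (1 + (cmod (f x))\<^sup>2)" by (rule ennreal_leI)
  then show "ennreal (norm (truncate n f x)) \<le> indicator (cball 0 (real n)) x + ennreal ((cmod (f x))\<^sup>2)"
   by (auto simp: truncate_def indicator_def)
 qed
 also have "... < \<infinity>" using assms emeasure_lborel_cball_finite[of "0::'a" "real n"]
  by (subst nn_integral_add) (auto simp: square_integrable_def intro!: borel_measurable_indicator)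
 finally show "(\<integral>\<^sup>+x. ennreal (norm (truncate n f x)) \<partial>lborel) < \<infinity>" .
qed

lemma truncate_tail:
 assumes f: "square_integrable f"
 shows "(\<lambda>n. sq_dist (truncate n f) f) \<longlonglongrightarrow> 0"
proof -
 have [measurable]: "f \<in> borel_measurable borel" using f by (simp add: square_integrable_def)
 have "(\<lambda>n. \<integral>\<^sup>+x. ennreal ((cmod (truncate n f x - f x))\<^sup>2) \<partial>lborel) \<longlonglongrightarrow> (\<integral>\<^sup>+x. 0 \<partial>(lborel :: 'a measure))"
 proof (rule nn_integral_dominated_convergence[where w = "\<lambda>x. ennreal ((cmod (f x))\<^sup>2)"])
  show "AE x in lborel. ennreal ((cmod (truncate n f x - f x))\<^sup>2) \<le> ennreal ((cmod (f x))\<^sup>2)" for n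
   by (intro AE_I2) (auto simp: truncate_def indicator_def)
  show "AE x in lborel. (\<lambda>n. ennreal ((cmod (truncate n f x - f x))\<^sup>2)) \<longlonglongrightarrow> 0"
  proof (intro AE_I2 tendsto_eventually)
   fix x :: 'a
   have "\<forall>\<^sub>F n in sequentially. norm x \<le> real n" using filterlim_real_sequentially unfolding filterlim_at_top by blast
   then show "\<forall>\<^sub>F n in sequentially. ennreal ((cmod (truncate n f x - f x))\<^sup>2) = 0"
    by eventually_elim (simp add: truncate_def)
  qed
 qed (use f in \<open>auto simp: square_integrable_def\<close>)
 then show ?thesis by (simp add: sq_dist_def)
qed

lemma sq_dist_fourier_le:
 assumes "integrable lborel f" "integrable lborel g"
 shows "sq_dist (fourier f) (fourier g) \<le> sq_dist f g"
proof -
 have "fourier f xi - fourier g xi = fourier (\<lambda>x. f x - g x) xi" for xi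
  using fourier_linear[OF assms(2,1), of "-1" xi] by simp
 then show ?thesis using fourier_L2_bound[of "\<lambda>x. f x - g x"] assms by (simp add: sq_dist_def)
qed

lemma L2_fourier_limit:
 assumes f: "square_integrable f"
 shows "L2_fourier f \<in> borel_measurable borel" and "(\<lambda>n. sq_dist (fourier (truncate n f)) (L2_fourier f)) \<longlonglongrightarrow> 0"
proof -
 have le: "sq_dist (fourier (truncate n f)) (fourier (truncate k f)) \<le> sq_dist (truncate n f) f" if "n \<le> k" for n k
 proof -
  have "sq_dist (fourier (truncate n f)) (fourier (truncate k f)) \<le> sq_dist (truncate n f) (truncate k f)"
   by (intro sq_dist_fourier_le truncate_integrable f)
  also have "... \<le> sq_dist (truncate n f) f"
   unfolding sq_dist_def using that by (intro nn_integral_mono) (auto simp: truncate_def indicator_def)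
  finally show ?thesis .
 qed
 obtain g where g: "g \<in> borel_measurable borel" "\<And>n. sq_dist (fourier (truncate n f)) g \<le> sq_dist (truncate n f) f"
  by (rule Riesz_Fischer[OF fourier_measurable[OF truncate_integrable[OF f]] le truncate_tail[OF f]]) (assumption | rule that)+
 have "(\<lambda>n. sq_dist (fourier (truncate n f)) g) \<longlonglongrightarrow> 0"
  by (rule tendsto_0_le_ennreal[OF g(2) truncate_tail[OF f]])
 with g(1) have "\<exists>g. g \<in> borel_measurable borel \<and> (\<lambda>n. sq_dist (fourier (truncate n f)) g) \<longlonglongrightarrow> 0" by blast
 from someI_ex[OF this] show "L2_fourier f \<in> borel_measurable borel" "(\<lambda>n. sq_dist (fourier (truncate n f)) (L2_fourier f)) \<longlonglongrightarrow> 0"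
  unfolding L2_fourier_def by auto
qed

lemma L2_fourier_unique:
 assumes f: "square_integrable f" and g: "g \<in> borel_measurable borel" "(\<lambda>n. sq_dist (fourier (truncate n f)) g) \<longlonglongrightarrow> 0"
 shows "AE xi in lborel. L2_fourier f xi = g xi"
 using fourier_measurable[OF truncate_integrable[OF f]] L2_fourier_limit(1)[OF f] g(1) L2_fourier_limit(2)[OF f] g(2)
 by (rule sq_dist_limit_unique)

text \<open>Equality holds everywhere: the transforms of the truncations coincide pointwise, so both
  choices are made from the same predicate.\<close>

lemma L2_fourier_cong_AE:
 assumes [measurable]: "f \<in> borel_measurable borel" "g \<in> borel_measurable borel" and "AE x in lborel. f x = g x"
 shows "L2_fourier f = L2_fourier g"
proof -
 have "fourier (truncate n f) = fourier (truncate n g)" for n unfolding fourier_def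
  by (intro ext integral_cong_AE) (measurable, use assms(3) in \<open>eventually_elim, simp add: truncate_def\<close>)
 then show ?thesis by (simp add: L2_fourier_def)
qed

lemma L2_fourier_linear:
 assumes f: "square_integrable f" and g: "square_integrable g" and fg: "square_integrable (\<lambda>x. c * f x + g x)"
 shows "AE xi in lborel. L2_fourier (\<lambda>x. c * f x + g x) xi = c * L2_fourier f xi + L2_fourier g xi"
proof (rule L2_fourier_unique[OF fg])
 note m [measurable] = L2_fourier_limit(1)[OF f] L2_fourier_limit(1)[OF g]
  fourier_measurable[OF truncate_integrable[OF f]] fourier_measurable[OF truncate_integrable[OF g]]
 show "(\<lambda>xi. c * L2_fourier f xi + L2_fourier g xi) \<in> borel_measurable borel" by measurable
 have eq: "fourier (truncate n (\<lambda>x. c * f x + g x)) xi = c * fourier (truncate n f) xi + fourier (truncate n g) xi" for n xi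
  using fourier_linear[OF truncate_integrable[OF f, of n] truncate_integrable[OF g, of n], of c xi]
  by (simp add: truncate_def[abs_def] algebra_simps)
 let ?b = "\<lambda>n. ennreal (2 * (cmod c)\<^sup>2) * sq_dist (fourier (truncate n f)) (L2_fourier f) + 2 * sq_dist (fourier (truncate n g)) (L2_fourier g)"
 have le: "sq_dist (fourier (truncate n (\<lambda>x. c * f x + g x))) (\<lambda>xi. c * L2_fourier f xi + L2_fourier g xi) \<le> ?b n" for n
 proof -
  have *: "(cmod (c * a + b - (c * a' + b')))\<^sup>2 \<le> 2 * (cmod c)\<^sup>2 * (cmod (a - a'))\<^sup>2 + 2 * (cmod (b - b'))\<^sup>2" for a b a' b'
  proof -
   have eq: "c * a + b - (c * a' + b') = c * (a - a') + (b - b')" by (simp add: algebra_simps)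
   show ?thesis unfolding eq using sq_norm_add[of "c * (a - a')" "b - b'"] by (simp add: norm_mult power_mult_distrib mult.assoc)
  qed
  have "sq_dist (fourier (truncate n (\<lambda>x. c * f x + g x))) (\<lambda>xi. c * L2_fourier f xi + L2_fourier g xi)
   \<le> (\<integral>\<^sup>+xi. ennreal (2 * (cmod c)\<^sup>2) * ennreal ((cmod (fourier (truncate n f) xi - L2_fourier f xi))\<^sup>2)
    + 2 * ennreal ((cmod (fourier (truncate n g) xi - L2_fourier g xi))\<^sup>2) \<partial>lborel)"
   unfolding sq_dist_def eq
  proof (intro nn_integral_mono)
   fix xi
   let ?u = "(cmod (fourier (truncate n f) xi - L2_fourier f xi))\<^sup>2" and ?v = "(cmod (fourier (truncate n g) xi - L2_fourier g xi))\<^sup>2"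
   have "ennreal ((cmod (c * fourier (truncate n f) xi + fourier (truncate n g) xi - (c * L2_fourier f xi + L2_fourier g xi)))\<^sup>2)
     \<le> ennreal (2 * (cmod c)\<^sup>2 * ?u + 2 * ?v)" by (intro ennreal_leI *)
   also have "... = ennreal (2 * (cmod c)\<^sup>2) * ennreal ?u + 2 * ennreal ?v"
    by (subst ennreal_plus) (simp_all add: ennreal_mult')
   finally show "ennreal ((cmod (c * fourier (truncate n f) xi + fourier (truncate n g) xi - (c * L2_fourier f xi + L2_fourier g xi)))\<^sup>2)
     \<le> ennreal (2 * (cmod c)\<^sup>2) * ennreal ?u + 2 * ennreal ?v" .
  qed
  also have "... = ?b n"
   unfolding sq_dist_def by (subst nn_integral_add, measurable, subst (1 2) nn_integral_cmult, measurable)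
  finally show ?thesis .
 qed
 have "?b \<longlonglongrightarrow> ennreal (2 * (cmod c)\<^sup>2) * 0 + 2 * 0"
  by (intro tendsto_add ennreal_tendsto_cmult L2_fourier_limit f g) auto
 then show "(\<lambda>n. sq_dist (fourier (truncate n (\<lambda>x. c * f x + g x))) (\<lambda>xi. c * L2_fourier f xi + L2_fourier g xi)) \<longlonglongrightarrow> 0"
  by (intro tendsto_0_le_ennreal[OF le]) simp
qed

text \<open>The contraction bound for the truncations passes to the limit through
  \<open>sq_dist_triangle\<close>, whence the factor 2; Plancherel's theorem would give 1, but any
  constant serves for boundedness.\<close>

lemma L2_fourier_bound:
 assumes f: "square_integrable f"
 shows "(\<integral>\<^sup>+xi. ennreal ((cmod (L2_fourier f xi))\<^sup>2) \<partial>lborel) \<le> 2 * (\<integral>\<^sup>+x. ennreal ((cmod (f x))\<^sup>2) \<partial>lborel)"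
proof -
 let ?f = "\<integral>\<^sup>+x. ennreal ((cmod (f x))\<^sup>2) \<partial>lborel"
 note m [measurable] = L2_fourier_limit(1)[OF f] fourier_measurable[OF truncate_integrable[OF f]]
 have "sq_dist (fourier (truncate n f)) (\<lambda>_. 0) \<le> ?f" for n
 proof -
  have "sq_dist (fourier (truncate n f)) (\<lambda>_. 0) \<le> (\<integral>\<^sup>+x. ennreal ((cmod (truncate n f x))\<^sup>2) \<partial>lborel)"
   using fourier_L2_bound[OF truncate_integrable[OF f]] by (simp add: sq_dist_def)
  also have "... \<le> ?f" by (intro nn_integral_mono) (auto simp: truncate_def indicator_def)
  finally show ?thesis .
 qed
 then have "sq_dist (L2_fourier f) (\<lambda>_. 0) \<le> 2 * sq_dist (fourier (truncate n f)) (L2_fourier f) + 2 * ?f" for n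
  using sq_dist_triangle[OF m(1) m(2), of "\<lambda>_. 0" n] 
  by (subst sq_dist_commute[of "fourier (truncate n f)" "L2_fourier f"]) (rule order_trans[OF _ add_left_mono[OF mult_left_mono]]; simp)
 moreover have "(\<lambda>n. 2 * sq_dist (fourier (truncate n f)) (L2_fourier f) + 2 * ?f) \<longlonglongrightarrow> 2 * 0 + 2 * ?f"
  by (intro tendsto_add tendsto_const ennreal_tendsto_cmult L2_fourier_limit f) auto
 ultimately have "sq_dist (L2_fourier f) (\<lambda>_. 0) \<le> 2 * 0 + 2 * ?f" by (intro LIMSEQ_le_const) auto
 then show ?thesis by (simp add: sq_dist_def)
qed

lemma L2_fourier_eq_fourier:
 assumes f: "square_integrable f" and i: "integrable lborel f"
 shows "AE xi in lborel. L2_fourier f xi = fourier f xi"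
proof (rule L2_fourier_unique[OF f fourier_measurable[OF i]])
 show "(\<lambda>n. sq_dist (fourier (truncate n f)) (fourier f)) \<longlonglongrightarrow> 0"
  by (rule tendsto_0_le_ennreal[OF sq_dist_fourier_le truncate_tail[OF f]]) (intro truncate_integrable f i)+
qed

section \<open>The Fourier transform of square integrable sequence-valued functions\<close>

text \<open>Norms are expressed by the counting measure on a countable set \<open>La\<close>, so
  that Tonelli's theorem can exchange the sum over coordinates with integrals in x.\<close>

lemma l2_nn_integral_le:
 fixes z :: "'a::euclidean_space => complex"
 assumes "z \<in> l2 0"
 shows "(\<integral>\<^sup>+mu. ennreal ((cmod (z mu))\<^sup>2) \<partial>count_space La) \<le> ennreal ((l2_norm 0 z)\<^sup>2)"
proof -
 have "(\<integral>\<^sup>+mu. ennreal ((cmod (z mu))\<^sup>2) \<partial>count_space La) \<le> (\<integral>\<^sup>+mu. ennreal ((cmod (z mu))\<^sup>2) \<partial>count_space UNIV)"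
  by (auto simp: nn_integral_count_space_indicator indicator_def intro!: nn_integral_mono)
 also have "... = ennreal ((l2_norm 0 z)\<^sup>2)"
  using l2_count_space[OF assms] by (simp add: nn_integral_eq_integral)
 finally show ?thesis .
qed

lemma l2_nn_integral_ge:
 fixes z :: "'a::euclidean_space => complex"
 assumes 0: "\<And>mu. mu \<notin> La ==> z mu = 0" and fin: "(\<integral>\<^sup>+mu. ennreal ((cmod (z mu))\<^sup>2) \<partial>count_space La) \<noteq> \<infinity>"
 shows "z \<in> l2 0" and "ennreal ((l2_norm 0 z)\<^sup>2) \<le> (\<integral>\<^sup>+mu. ennreal ((cmod (z mu))\<^sup>2) \<partial>count_space La)"
proof -
 define B where "B = enn2real (\<integral>\<^sup>+mu. ennreal ((cmod (z mu))\<^sup>2) \<partial>count_space La)"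
 have B: "(\<integral>\<^sup>+mu. ennreal ((cmod (z mu))\<^sup>2) \<partial>count_space La) = ennreal B" "B \<ge> 0"
  using fin by (auto simp: B_def less_top)
 have *: "wsec 0 z F \<le> sqrt B" if F: "finite F" for F
 proof -
  have "ennreal ((wsec 0 z F)\<^sup>2) = (\<integral>\<^sup>+mu. ennreal ((cmod (z mu))\<^sup>2) \<partial>count_space F)"
   unfolding wsec_square using F by (simp add: nn_integral_count_space_finite)
  also have "... \<le> ennreal B" unfolding B(1)[symmetric] using 0
   by (auto simp: nn_integral_count_space_indicator indicator_def intro!: nn_integral_mono)
  finally show ?thesis using B(2) by (intro real_le_rsqrt) (simp add: ennreal_le_iff)
 qed
 show "z \<in> l2 0" using * by (rule l2I)
 have "l2_norm 0 z \<le> sqrt B" using * by (rule l2_norm_leI)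
 then have "(l2_norm 0 z)\<^sup>2 \<le> (sqrt B)\<^sup>2" by (intro power_mono) auto
 then show "ennreal ((l2_norm 0 z)\<^sup>2) \<le> (\<integral>\<^sup>+mu. ennreal ((cmod (z mu))\<^sup>2) \<partial>count_space La)"
  unfolding B(1) using B(2) by (intro ennreal_leI) simp
qed

lemma L2_l2_iff: "F \<in> L2_l2 \<longleftrightarrow> sobolev_density 0 0 F"
 by (simp add: L2_l2_def sobolev_density_def weighted_energy_def)

lemma L2_l2_norm_eq: "L2_l2_norm F = sqrt (enn2real (weighted_energy 0 0 F))"
 by (simp add: L2_l2_norm_def weighted_energy_def)

lemma L2_l2_coord:
 assumes "F \<in> L2_l2" "f \<in> borel_measurable borel" "AE x in lborel. F x mu = f x"
 shows "square_integrable f"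
proof -
 have F: "range F \<subseteq> l2 0" "weighted_energy 0 0 F < \<infinity>"
  using assms(1) by (auto simp: L2_l2_iff sobolev_density_def l2_measurable_def)
 have "(\<integral>\<^sup>+x. ennreal ((cmod (f x))\<^sup>2) \<partial>lborel) \<le> weighted_energy 0 0 F"
  unfolding weighted_energy_def
 proof (intro nn_integral_mono_AE)
  show "AE x in lborel. ennreal ((cmod (f x))\<^sup>2) \<le> ennreal ((l2_norm 0 (F x))\<^sup>2 * bracket x powr (2 * 0))"
   using assms(3)
  proof eventually_elim
   case (elim x)
   have "cmod (F x mu) \<le> l2_norm 0 (F x)" using l2_coord[of "F x" 0 mu] F(1) by auto
   then show ?case using elim by (auto intro!: ennreal_leI power_mono)
  qed
 qed
 then show ?thesis using F(2) assms(2) by (auto simp: square_integrable_def intro: le_less_trans)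
qed

lemma nn_integral_reflect:
 fixes f :: "'a::euclidean_space => ennreal"
 assumes "f \<in> borel_measurable borel" "\<bar>sg\<bar> = 1"
 shows "(\<integral>\<^sup>+x. f (sg *\<^sub>R x) \<partial>lborel) = (\<integral>\<^sup>+x. f x \<partial>lborel)"
 using nn_integral_affine[OF assms(1), of sg 0] assms(2) by (cases "sg = 0") auto

lemma AE_reflect:
 fixes f g :: "'a::euclidean_space => complex"
 assumes [measurable]: "f \<in> borel_measurable borel" "g \<in> borel_measurable borel"
  and "AE x in lborel. f x = g x" "\<bar>sg\<bar> = 1"
 shows "AE x in lborel. f (sg *\<^sub>R x) = g (sg *\<^sub>R x)"
proof -
 have "(\<integral>\<^sup>+x. ennreal (cmod (f x - g x)) \<partial>lborel) = 0"
  using assms(3) by (subst nn_integral_0_iff_AE) (auto elim!: eventually_mono)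
 then have "(\<integral>\<^sup>+x. ennreal (cmod (f (sg *\<^sub>R x) - g (sg *\<^sub>R x))) \<partial>lborel) = 0"
  using nn_integral_reflect[of "\<lambda>x. ennreal (cmod (f x - g x))" sg] assms(4) by simp
 then have "AE x in lborel. ennreal (cmod (f (sg *\<^sub>R x) - g (sg *\<^sub>R x))) = 0"
  by (subst (asm) nn_integral_0_iff_AE) auto
 then show ?thesis by eventually_elim simp
qed

text \<open>The sign \<open>1\<close> gives the Fourier transform and \<open>-1\<close> its inverse.\<close>

definition is_vector_fourier :: "real => ('a::euclidean_space => 'a => complex) => ('a => 'a => complex) => bool" where
 "is_vector_fourier sg F G \<longleftrightarrow> l2_measurable 0 G \<and> weighted_energy 0 0 G \<le> 2 * weighted_energy 0 0 F \<and>
  (\<forall>mu. \<forall>f\<in>borel_measurable borel. (AE x in lborel. F x mu = f x) \<longrightarrow> (AE xi in lborel. G xi mu = L2_fourier f (sg *\<^sub>R xi)))"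

text \<open>The coordinates are transformed one by one over the countable support of a Borel
  representative, and Tonelli's theorem adds up the scalar bounds.\<close>

lemma ex_vector_fourier:
 fixes F :: "'a::euclidean_space => 'a => complex"
 assumes F: "F \<in> L2_l2" and sg: "\<bar>sg\<bar> = 1"
 shows "\<exists>G. is_vector_fourier sg F G"
proof -
 have Fm: "l2_measurable 0 F" using F by (simp add: L2_l2_def)
 obtain F' La where F': "countable La" "\<And>mu. (\<lambda>x. F' x mu) \<in> borel_measurable borel"
  "\<And>x mu. mu \<notin> La ==> F' x mu = 0" "AE x in lborel. F x = F' x"
  using coord_measurable_representative[of F] Fm[unfolded l2_measurable_iff] by blast
 have F'_AE: "AE x in lborel. F x mu = F' x mu" for mu using F'(4) by eventually_elim simp
 have sq: "square_integrable (\<lambda>x. F' x mu)" for mu by (rule L2_l2_coord[OF F F'(2) F'_AE])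
 define W where "W xi mu = (if mu \<in> La then L2_fourier (\<lambda>x. F' x mu) (sg *\<^sub>R xi) else 0)" for xi mu
 have Wm [measurable]: "(\<lambda>xi. W xi mu) \<in> borel_measurable borel" for mu
  unfolding W_def using L2_fourier_limit(1)[OF sq] by measurable
 define B where "B xi = (\<integral>\<^sup>+mu. ennreal ((cmod (W xi mu))\<^sup>2) \<partial>count_space La)" for xi
 have Bm: "B \<in> borel_measurable borel"
 proof -
  interpret sigma_finite_measure "count_space La" by (rule sigma_finite_measure_count_space_countable[OF F'(1)])
  have "(\<lambda>(xi, mu). ennreal ((cmod (W xi mu))\<^sup>2)) \<in> borel_measurable (borel \<Otimes>\<^sub>M count_space La)"
   by (subst measurable_pair_swap_iff, rule measurable_pair_measure_countable1[OF F'(1)]) simp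
  then show ?thesis unfolding B_def by (rule borel_measurable_nn_integral)
 qed
 have "(\<integral>\<^sup>+xi. B xi \<partial>lborel) = (\<integral>\<^sup>+mu. \<integral>\<^sup>+xi. ennreal ((cmod (W xi mu))\<^sup>2) \<partial>lborel \<partial>count_space La)"
  unfolding B_def by (rule nn_integral_count_space_nn_integral[OF F'(1)]) measurable
 also have "... \<le> (\<integral>\<^sup>+mu. 2 * (\<integral>\<^sup>+x. ennreal ((cmod (F' x mu))\<^sup>2) \<partial>lborel) \<partial>count_space La)"
 proof (intro nn_integral_mono)
  fix mu assume "mu \<in> space (count_space La)"
  then have "(\<integral>\<^sup>+xi. ennreal ((cmod (W xi mu))\<^sup>2) \<partial>lborel) = (\<integral>\<^sup>+xi. ennreal ((cmod (L2_fourier (\<lambda>x. F' x mu) xi))\<^sup>2) \<partial>lborel)"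
   using L2_fourier_limit(1)[OF sq, of mu] nn_integral_reflect[OF _ sg, of "\<lambda>xi. ennreal ((cmod (L2_fourier (\<lambda>x. F' x mu) xi))\<^sup>2)"]
   by (simp add: W_def)
  then show "(\<integral>\<^sup>+xi. ennreal ((cmod (W xi mu))\<^sup>2) \<partial>lborel) \<le> 2 * (\<integral>\<^sup>+x. ennreal ((cmod (F' x mu))\<^sup>2) \<partial>lborel)"
   using L2_fourier_bound[OF sq, of mu] by simp
 qed
 also have "... = 2 * (\<integral>\<^sup>+mu. \<integral>\<^sup>+x. ennreal ((cmod (F' x mu))\<^sup>2) \<partial>lborel \<partial>count_space La)"
  by (rule nn_integral_cmult) simp
 also have "(\<integral>\<^sup>+mu. \<integral>\<^sup>+x. ennreal ((cmod (F' x mu))\<^sup>2) \<partial>lborel \<partial>count_space La)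
   = (\<integral>\<^sup>+x. \<integral>\<^sup>+mu. ennreal ((cmod (F' x mu))\<^sup>2) \<partial>count_space La \<partial>lborel)"
  using F'(2) by (intro nn_integral_count_space_nn_integral[OF F'(1), symmetric]) measurable
 also have "2 * ... \<le> 2 * weighted_energy 0 0 F" unfolding weighted_energy_def
 proof (intro mult_left_mono nn_integral_mono_AE)
  show "AE x in lborel. (\<integral>\<^sup>+mu. ennreal ((cmod (F' x mu))\<^sup>2) \<partial>count_space La) \<le> ennreal ((l2_norm 0 (F x))\<^sup>2 * bracket x powr (2 * 0))"
   using F'(4)
  proof eventually_elim
   case (elim x)
   then show ?case using l2_nn_integral_le[of "F x" La] l2_measurable_range[OF Fm, of x] by simp
  qed
 qed simp
 finally have bound: "(\<integral>\<^sup>+xi. B xi \<partial>lborel) \<le> 2 * weighted_energy 0 0 F" .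
 also have "... < \<infinity>" using F by (simp add: L2_l2_iff sobolev_density_def ennreal_mult_less_top)
 finally have Bfin: "AE xi in lborel. B xi \<noteq> \<infinity>" using Bm by (intro nn_integral_PInf_AE) auto
 have W0: "W xi mu = 0" if "mu \<notin> La" for xi mu using that by (simp add: W_def)
 note W_l2 = l2_nn_integral_ge[of La "W _", OF W0]
 \<comment> \<open>The transformed coordinates form an element of \<open>l2 0\<close> only for
   almost all \<open>xi\<close>, while \<open>l2_measurable\<close> wants all values in the space;
   the exceptional values are set to 0.\<close>
 define G where "G xi = (if W xi \<in> l2 0 then W xi else (\<lambda>_. 0))" for xi
 have G_AE: "AE xi in lborel. W xi = G xi"
  using Bfin by eventually_elim (use W_l2(1) in \<open>auto simp: G_def B_def\<close>)
 have "is_vector_fourier sg F G" unfolding is_vector_fourier_def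
 proof (intro conjI allI ballI impI)
  show "l2_measurable 0 G" unfolding l2_measurable_iff
  proof
   show "range G \<subseteq> l2 0" by (auto simp: G_def)
   show "coord_measurable G" by (rule coord_measurable_cong_AE[OF coord_measurableI[OF F'(1) Wm W0] G_AE])
  qed
  have "weighted_energy 0 0 G \<le> (\<integral>\<^sup>+xi. B xi \<partial>lborel)" unfolding weighted_energy_def
  proof (intro nn_integral_mono_AE)
   show "AE xi in lborel. ennreal ((l2_norm 0 (G xi))\<^sup>2 * bracket xi powr (2 * 0)) \<le> B xi"
    using Bfin by eventually_elim (use W_l2 in \<open>auto simp: G_def B_def\<close>)
  qed
  also note bound
  finally show "weighted_energy 0 0 G \<le> 2 * weighted_energy 0 0 F" .
  fix mu and f :: "'a => complex"
  assume f: "f \<in> borel_measurable borel" "AE x in lborel. F x mu = f x"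
  have "AE x in lborel. F' x mu = f x" using f(2) F'_AE[of mu] by eventually_elim simp
  then have eq: "L2_fourier (\<lambda>x. F' x mu) = L2_fourier f" by (rule L2_fourier_cong_AE[OF F'(2) f(1)])
  show "AE xi in lborel. G xi mu = L2_fourier f (sg *\<^sub>R xi)"
  proof (cases "mu \<in> La")
   case True
   then have W: "W xi mu = L2_fourier f (sg *\<^sub>R xi)" for xi by (simp add: W_def eq)
   show ?thesis unfolding W[symmetric] using G_AE by eventually_elim simp
  next
   case False
   then have 0: "(\<lambda>x. F' x mu) = (\<lambda>_. 0)" using F'(3) by auto
   have "AE xi in lborel. L2_fourier f xi = fourier (\<lambda>_. 0) xi"
    unfolding eq[symmetric] 0 by (rule L2_fourier_eq_fourier) (simp_all add: square_integrable_def)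
   then have "AE xi in lborel. L2_fourier f (sg *\<^sub>R xi) = (\<lambda>_. 0) (sg *\<^sub>R xi)"
    using L2_fourier_limit(1)[OF sq, of mu] by (intro AE_reflect sg) (auto simp: eq fourier_def)
   then have "AE xi in lborel. W xi mu = L2_fourier f (sg *\<^sub>R xi)"
    by eventually_elim (simp add: W0[OF False])
   then show ?thesis using G_AE by eventually_elim simp
  qed
 qed
 then show ?thesis by (rule exI[of "is_vector_fourier sg F"])
qed

definition vector_fourier where "vector_fourier sg F = (SOME G. is_vector_fourier sg F G)"

text \<open>The predicate behind the choice sees \<open>F\<close> only up to null sets, so both
  choices coincide, and the result is a genuine equality.\<close>

lemma vector_fourier_cong_AE:
 assumes "AE x in lborel. F x = G x"
 shows "vector_fourier sg F = vector_fourier sg G"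
proof -
 have "(AE x in lborel. F x mu = f x) \<longleftrightarrow> (AE x in lborel. G x mu = f x)" for mu f
  by (rule eventually_cong) (use assms in \<open>auto elim!: eventually_mono\<close>)
 then show ?thesis using weighted_energy_cong_AE[OF assms] by (simp add: vector_fourier_def is_vector_fourier_def)
qed

lemma vector_fourier:
 assumes "F \<in> L2_l2" "\<bar>sg\<bar> = 1"
 shows "is_vector_fourier sg F (vector_fourier sg F)"
 unfolding vector_fourier_def by (rule someI_ex[OF ex_vector_fourier[OF assms]])

lemma vector_fourier_L2:
 assumes F: "F \<in> L2_l2" and sg: "\<bar>sg\<bar> = 1"
 shows "vector_fourier sg F \<in> L2_l2"
  and "enn2real (weighted_energy 0 0 (vector_fourier sg F)) \<le> 2 * enn2real (weighted_energy 0 0 F)"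
proof -
 have V: "l2_measurable 0 (vector_fourier sg F)" "weighted_energy 0 0 (vector_fourier sg F) \<le> 2 * weighted_energy 0 0 F"
  using vector_fourier[OF assms] by (auto simp: is_vector_fourier_def)
 have fin: "2 * weighted_energy 0 0 F < \<infinity>" using F by (simp add: L2_l2_iff sobolev_density_def ennreal_mult_less_top)
 show "vector_fourier sg F \<in> L2_l2" using V(1) le_less_trans[OF V(2) fin] by (simp add: L2_l2_iff sobolev_density_def)
 show "enn2real (weighted_energy 0 0 (vector_fourier sg F)) \<le> 2 * enn2real (weighted_energy 0 0 F)"
  using enn2real_mono[OF V(2)] fin by (simp add: enn2real_mult)
qed

lemma vector_fourier_coord:
 assumes "F \<in> L2_l2" "\<bar>sg\<bar> = 1" "f \<in> borel_measurable borel" "AE x in lborel. F x mu = f x"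
 shows "AE xi in lborel. vector_fourier sg F xi mu = L2_fourier f (sg *\<^sub>R xi)"
 using vector_fourier[OF assms(1,2)] assms(3,4) unfolding is_vector_fourier_def by blast

lemma L2_l2_coord_measurable: "F \<in> L2_l2 ==> coord_measurable F" by (simp add: L2_l2_def l2_measurable_iff)

lemma L2_l2_representative:
 assumes "F \<in> L2_l2"
 obtains f where "f \<in> borel_measurable borel" "AE x in lborel. F x mu = f x"
 using lebesgue_borel_representative assms unfolding L2_l2_def l2_measurable_iff coord_measurable_def by blast

lemma L2_l2_linear: "F \<in> L2_l2 ==> G \<in> L2_l2 ==> (\<lambda>x mu. c * F x mu + G x mu) \<in> L2_l2"
 unfolding L2_l2_iff by (rule sobolev_density_linear)

lemma vector_fourier_linear:
 assumes F: "F \<in> L2_l2" and G: "G \<in> L2_l2" and sg: "\<bar>sg\<bar> = 1"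
 shows "AE xi in lborel. vector_fourier sg (\<lambda>x mu. c * F x mu + G x mu) xi = (\<lambda>mu. c * vector_fourier sg F xi mu + vector_fourier sg G xi mu)"
proof (rule coord_measurable_AE_eq)
 note FG = L2_l2_linear[OF F G, of c]
 show "coord_measurable (vector_fourier sg (\<lambda>x mu. c * F x mu + G x mu))"
  "coord_measurable (\<lambda>xi mu. c * vector_fourier sg F xi mu + vector_fourier sg G xi mu)"
  by (intro L2_l2_coord_measurable vector_fourier_L2(1) L2_l2_linear F G sg)+
 fix mu
 obtain f where f: "f \<in> borel_measurable borel" "AE x in lborel. F x mu = f x" by (rule L2_l2_representative[OF F])
 obtain g where g: "g \<in> borel_measurable borel" "AE x in lborel. G x mu = g x" by (rule L2_l2_representative[OF G])
 have fg: "(\<lambda>x. c * f x + g x) \<in> borel_measurable borel" "AE x in lborel. c * F x mu + G x mu = c * f x + g x"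
  using f(1) g(1) apply measurable using f(2) g(2) by eventually_elim simp
 note sq = L2_l2_coord[OF F f] L2_l2_coord[OF G g] L2_l2_coord[OF FG fg]
 have "AE xi in lborel. L2_fourier (\<lambda>x. c * f x + g x) (sg *\<^sub>R xi) = (\<lambda>xi. c * L2_fourier f xi + L2_fourier g xi) (sg *\<^sub>R xi)"
  using L2_fourier_limit(1)[OF sq(1)] L2_fourier_limit(1)[OF sq(2)] L2_fourier_limit(1)[OF sq(3)]
  by (intro AE_reflect sg L2_fourier_linear sq) auto
 then show "AE xi in lborel. vector_fourier sg (\<lambda>x mu. c * F x mu + G x mu) xi mu = c * vector_fourier sg F xi mu + vector_fourier sg G xi mu"
  using vector_fourier_coord[OF F sg f] vector_fourier_coord[OF G sg g] vector_fourier_coord[OF FG sg fg]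
  by eventually_elim simp
qed

lemma vector_fourier_eq_fourier:
 assumes F: "F \<in> L2_l2" and sg: "\<bar>sg\<bar> = 1" and G: "AE x in lborel. F x = G x"
  and La: "countable La" "\<And>x mu. mu \<notin> La ==> G x mu = 0" and int: "\<And>mu. integrable lborel (\<lambda>x. G x mu)"
 shows "AE xi in lborel. vector_fourier sg F xi = (\<lambda>mu. fourier (\<lambda>x. G x mu) (sg *\<^sub>R xi))"
proof (rule coord_measurable_AE_eq)
 show "coord_measurable (vector_fourier sg F)" by (intro L2_l2_coord_measurable vector_fourier_L2 F sg)
 have m: "fourier (\<lambda>x. G x mu) \<in> borel_measurable borel" for mu by (rule fourier_measurable[OF int])
 show "coord_measurable (\<lambda>xi mu. fourier (\<lambda>x. G x mu) (sg *\<^sub>R xi))"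
 proof (rule coord_measurableI[OF La(1)])
  show "(\<lambda>xi. fourier (\<lambda>x. G x mu) (sg *\<^sub>R xi)) \<in> borel_measurable borel" for mu
   by (rule measurable_compose[OF _ m]) simp
 qed (use La(2) in \<open>simp add: fourier_def\<close>)
 fix mu
 have Gmu: "(\<lambda>x. G x mu) \<in> borel_measurable borel" "AE x in lborel. F x mu = G x mu"
  using int[of mu] G by (auto elim!: eventually_mono)
 note sq = L2_l2_coord[OF F Gmu]
 have "AE xi in lborel. L2_fourier (\<lambda>x. G x mu) (sg *\<^sub>R xi) = fourier (\<lambda>x. G x mu) (sg *\<^sub>R xi)"
  by (intro AE_reflect sg L2_fourier_eq_fourier L2_fourier_limit sq int m)
 then show "AE xi in lborel. vector_fourier sg F xi mu = fourier (\<lambda>x. G x mu) (sg *\<^sub>R xi)"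
  using vector_fourier_coord[OF F sg Gmu] by eventually_elim simp
qed

lemma l2_norm_le_sum:
 assumes "finite La" "\<And>mu. mu \<notin> La ==> z mu = 0"
 shows "l2_norm s z \<le> (\<Sum>mu\<in>La. bracket mu powr s * cmod (z mu))"
proof (rule l2_norm_leI)
 fix F :: "'a set" assume "finite F"
 have "wsec s z F \<le> (\<Sum>mu\<in>F. bracket mu powr s * cmod (z mu))"
  unfolding wsec_def by (rule L2_set_le_sum) simp
 also have "... = (\<Sum>mu\<in>F \<inter> La. bracket mu powr s * cmod (z mu))"
  using \<open>finite F\<close> assms(2) by (intro sum.mono_neutral_right) auto
 also have "... \<le> (\<Sum>mu\<in>La. bracket mu powr s * cmod (z mu))" by (intro sum_mono2 assms) auto
 finally show "wsec s z F \<le> (\<Sum>mu\<in>La. bracket mu powr s * cmod (z mu))" .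
qed

lemma l2_integrable_decay:
 fixes F :: "'a::euclidean_space => 'a => complex"
 assumes m: "l2_measurable s F" and C: "\<And>x. bracket x ^ (2 * DIM('a)) * l2_norm s (F x) \<le> C"
 shows "l2_integrable s F"
proof -
 have int: "integrable lborel (\<lambda>x::'a. \<bar>C\<bar> * inverse (bracket x ^ (2 * DIM('a))))"
  using integrable_bracket[where 'a = 'a] by simp
 have "l2_norm s (F x) \<le> \<bar>C\<bar> * inverse (bracket x ^ (2 * DIM('a)))" for x
  using order_trans[OF C[of x] abs_ge_self] by (simp add: divide_inverse[symmetric] pos_le_divide_eq mult.commute)
 then have "(\<integral>\<^sup>+x. ennreal (l2_norm s (F x)) \<partial>lborel) \<le> (\<integral>\<^sup>+x. ennreal (\<bar>C\<bar> * inverse (bracket (x::'a) ^ (2 * DIM('a)))) \<partial>lborel)"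
  by (intro nn_integral_mono ennreal_leI)
 also have "... < \<infinity>" using nn_integral_eq_integral[OF int] by (simp add: less_imp_le)
 finally show ?thesis using m by (simp add: l2_integrable_def)
qed

lemma l2_integrable_unimodular:
 assumes "l2_integrable s F" "h \<in> borel_measurable borel" "\<And>x. cmod (h x) = 1"
 shows "l2_integrable s (\<lambda>x mu. h x * F x mu)"
 using assms by (simp add: l2_integrable_def l2_measurable_mult l2_norm_cmult)

lemma dist_of_density_cong_AE:
 assumes "l2_measurable s F" "AE xi in lborel. F xi = G xi"
 shows "dist_of_density F = dist_of_density G"
proof
 fix ps :: "'a => complex"
 show "dist_of_density F ps = dist_of_density G ps"
 proof (cases "ps \<in> schwartz")
  case True
  have "coord_measurable (\<lambda>xi mu. fourier ps (- xi) * F xi mu)"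
   using l2_measurable_mult[OF schwartz_measurable[OF schwartz_reflect[OF schwartz_fourier[OF True]]] assms(1)]
   by (simp add: l2_measurable_iff)
  then have "coord_integral (\<lambda>xi mu. fourier ps (- xi) * F xi mu) = coord_integral (\<lambda>xi mu. fourier ps (- xi) * G xi mu)"
   by (rule coord_integral_cong_AE) (use assms(2) in \<open>auto elim!: eventually_mono\<close>)
  then show ?thesis by (simp add: dist_of_density_def)
 qed (simp add: dist_of_density_def)
qed

lemma dist_of_density_linear:
 assumes F: "sobolev_density t s F" and G: "sobolev_density t s G"
 shows "dist_of_density (\<lambda>xi mu. c * F xi mu + G xi mu) = (\<lambda>ps mu. c * dist_of_density F ps mu + dist_of_density G ps mu)"
proof
 fix ps :: "'a => complex"
 show "dist_of_density (\<lambda>xi mu. c * F xi mu + G xi mu) ps = (\<lambda>mu. c * dist_of_density F ps mu + dist_of_density G ps mu)"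
 proof (cases "ps \<in> schwartz")
  case True
  have S: "(\<lambda>xi. fourier ps (- xi)) \<in> schwartz" using schwartz_reflect[OF schwartz_fourier[OF True]] .
  have "(\<lambda>xi mu. fourier ps (- xi) * (c * F xi mu + G xi mu)) = (\<lambda>xi mu. c * (fourier ps (- xi) * F xi mu) + fourier ps (- xi) * G xi mu)"
   by (intro ext) (simp add: distrib_left mult.left_commute)
  then show ?thesis
   using True coord_integral_linear[OF schwartz_density_integrable[OF F S] schwartz_density_integrable[OF G S], of c]
   by (simp add: dist_of_density_def)
 qed (simp add: dist_of_density_def)
qed

lemma fourier_duality:
 fixes f g :: "'a::euclidean_space => complex"
 assumes f: "integrable lborel f" and g: "integrable lborel g"
 shows "(LINT x|lborel. f x * fourier g (- x)) = (LINT xi|lborel. fourier f (- xi) * g xi)"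
proof -
 have [measurable]: "f \<in> borel_measurable borel" "fourier g \<in> borel_measurable borel"
  using f fourier_measurable[OF g] by auto
 have f': "integrable lborel (\<lambda>x. f (- x))" using integrable_affine[OF f, of "-1" 0] by simp
 have eq: "fourier (\<lambda>x. f (- x)) xi = fourier f (- xi)" for xi
  using integral_reflect[of "\<lambda>x. f x * cis (2 * pi * (x \<bullet> xi))"] by (simp add: fourier_def)
 have "(LINT x|lborel. f x * fourier g (- x)) = (LINT x|lborel. f (- x) * fourier g x)"
  using integral_reflect[of "\<lambda>x. f x * fourier g (- x)"] by simp
 also have "... = (LINT xi|lborel. fourier (\<lambda>x. f (- x)) xi * g xi)"
  by (rule fourier_multiplication_formula[OF f' g, symmetric])
 also have "... = (LINT xi|lborel. fourier f (- xi) * g xi)" using eq by simp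
 finally show ?thesis .
qed

section \<open>Schwartz functions with finitely many coordinates\<close>

text \<open>The coordinate form of \<open>schwartz_l2f\<close>, in which repeated indices of a
  representation have been collected; it is stable under the Fourier transform.\<close>

definition l2f :: "'a set => ('a::euclidean_space => 'a => complex) => bool" where
 "l2f La F \<longleftrightarrow> finite La \<and> (\<forall>mu. (\<lambda>x. F x mu) \<in> schwartz) \<and> (\<forall>x mu. mu \<notin> La \<longrightarrow> F x mu = 0)"

lemma schwartz_l2f_imp_l2f:
 assumes "F \<in> schwartz_l2f"
 shows "\<exists>La. l2f La F"
proof -
 obtain n :: nat and ph mu where ph: "\<And>j. j < n ==> ph j \<in> schwartz"
  and F: "F = (\<lambda>x nu. \<Sum>j<n. ph j x * delta_seq (mu j) nu)" using assms by (auto simp: schwartz_l2f_def)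
 have "(\<lambda>x. \<Sum>j<n. ph j x * delta_seq (mu j) nu) \<in> schwartz" for nu
  using schwartz_cmult[OF ph, of _ "delta_seq (mu _) nu"] by (intro schwartz_sum) (simp_all add: mult.commute)
 moreover have "(\<Sum>j<n. ph j x * delta_seq (mu j) nu) = 0" if "nu \<notin> mu ` {..<n}" for x nu
  using that by (intro sum.neutral) (auto simp: delta_seq_def)
 ultimately show ?thesis unfolding F l2f_def by (intro exI[of _ "mu ` {..<n}"]) simp
qed

context
 fixes La :: "'a::euclidean_space set" and F :: "'a => 'a => complex"
 assumes F: "l2f La F"
begin

lemma l2f_coord: "(\<lambda>x. F x mu) \<in> schwartz" and l2f_0: "mu \<notin> La ==> F x mu = 0" and l2f_finite: "finite La"
 using F by (auto simp: l2f_def)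

lemma l2f_l2: "F x \<in> l2 s" by (rule l2_finite_support[OF l2f_finite l2f_0])

lemma l2f_measurable: "l2_measurable s F" unfolding l2_measurable_iff
 using coord_measurableI[OF countable_finite[OF l2f_finite] schwartz_measurable[OF l2f_coord] l2f_0] l2f_l2 by auto

lemma l2f_decay: "\<exists>C\<ge>0. \<forall>x. bracket x ^ N * l2_norm s (F x) \<le> C"
proof (intro exI conjI allI)
 let ?S = "\<lambda>mu. \<bar>schwartz_seminorm N [] (\<lambda>x. F x mu)\<bar>"
 show "0 \<le> (\<Sum>mu\<in>La. bracket mu powr s * ?S mu)" by (intro sum_nonneg) simp
 fix x
 have "bracket x ^ N * l2_norm s (F x) \<le> bracket x ^ N * (\<Sum>mu\<in>La. bracket mu powr s * cmod (F x mu))"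
  by (intro mult_left_mono l2_norm_le_sum l2f_finite l2f_0) (auto simp: less_imp_le)
 also have "... = (\<Sum>mu\<in>La. bracket mu powr s * (bracket x ^ N * cmod (F x mu)))"
  by (simp add: sum_distrib_left mult_ac)
 also have "... \<le> (\<Sum>mu\<in>La. bracket mu powr s * ?S mu)"
  by (intro sum_mono mult_left_mono order_trans[OF schwartz_decay[OF l2f_coord] abs_ge_self]) simp
 finally show "bracket x ^ N * l2_norm s (F x) \<le> (\<Sum>mu\<in>La. bracket mu powr s * ?S mu)" .
qed

lemma l2f_sobolev_density: "sobolev_density t s F" unfolding sobolev_density_def
proof
 show "l2_measurable s F" by (rule l2f_measurable)
 define N where "N = nat \<lceil>\<bar>t\<bar>\<rceil> + DIM('a)"
 have N: "\<bar>t\<bar> + real DIM('a) \<le> real N" unfolding N_def by linarith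
 obtain C where C: "C \<ge> 0" "\<And>x. bracket x ^ N * l2_norm s (F x) \<le> C" using l2f_decay by blast
 have le: "(l2_norm s (F x))\<^sup>2 * bracket x powr (2 * t) \<le> C\<^sup>2 * inverse (bracket x ^ (2 * DIM('a)))" for x
 proof -
  have "l2_norm s (F x) \<le> C * bracket x powr (- real N)"
   using C(2)[of x] by (simp add: powr_minus powr_realpow divide_inverse[symmetric] pos_le_divide_eq mult.commute)
  then have "(l2_norm s (F x))\<^sup>2 \<le> (C * bracket x powr (- real N))\<^sup>2" by (rule power_mono) simp
  then have "(l2_norm s (F x))\<^sup>2 * bracket x powr (2 * t) \<le> (C * bracket x powr (- real N))\<^sup>2 * bracket x powr (2 * t)"
   by (rule mult_right_mono) simp
  also have "... = C\<^sup>2 * bracket x powr (2 * t - 2 * real N)"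
   by (simp add: power_mult_distrib powr_power powr_add[symmetric] mult.commute)
  also have "... \<le> C\<^sup>2 * bracket x powr (- real (2 * DIM('a)))"
   using N bracket_ge_1[of x] by (intro mult_left_mono powr_mono) auto
  also have "bracket x powr (- real (2 * DIM('a))) = inverse (bracket x ^ (2 * DIM('a)))"
   unfolding powr_minus by (subst powr_realpow) auto
  finally show ?thesis .
 qed
 have int: "integrable lborel (\<lambda>x::'a. C\<^sup>2 * inverse (bracket x ^ (2 * DIM('a))))"
  using integrable_bracket[where 'a = 'a] by simp
 have "weighted_energy t s F \<le> (\<integral>\<^sup>+x. ennreal (C\<^sup>2 * inverse (bracket (x::'a) ^ (2 * DIM('a)))) \<partial>lborel)"
  unfolding weighted_energy_def by (intro nn_integral_mono ennreal_leI le)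
 also have "... < \<infinity>" using nn_integral_eq_integral[OF int] by (simp add: less_imp_le)
 finally show "weighted_energy t s F < \<infinity>" .
qed

lemma l2f_integrable: "l2_integrable s F"
 using l2f_decay[of "2 * DIM('a)" s] l2f_measurable l2_integrable_decay by blast

lemma l2f_l2_fourier: "l2_fourier F xi = (\<lambda>mu. fourier (\<lambda>x. F x mu) xi)"
proof -
 have "l2_fourier F xi = coord_integral (\<lambda>x mu. cis (- 2 * pi * (x \<bullet> xi)) * F x mu)"
  unfolding l2_fourier_def by (intro l2_integral_eq l2_integrable_unimodular l2f_integrable) auto
 also have "... = (\<lambda>mu. fourier (\<lambda>x. F x mu) xi)"
 proof
  fix mu
  have [measurable]: "(\<lambda>x. F x mu) \<in> borel_measurable borel" by (rule schwartz_measurable[OF l2f_coord])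
  show "coord_integral (\<lambda>x mu. cis (- 2 * pi * (x \<bullet> xi)) * F x mu) mu = fourier (\<lambda>x. F x mu) xi"
   unfolding coord_integral_def fourier_def by (subst integral_completion) (auto simp: mult.commute)
 qed
 finally show ?thesis .
qed

lemma l2f_fourier: "l2f La (l2_fourier F)" unfolding l2f_def l2f_l2_fourier
 by (intro conjI allI impI l2f_finite schwartz_fourier l2f_coord) (simp add: l2f_0 fourier_def)

end

text \<open>The multiplication formula in every coordinate identifies the classical transform with
  the density of the distribution.\<close>

lemma l2f_fourier_density:
 assumes F: "l2f La F"
 shows "fourier_density s (dist_of_fun s F) (l2_fourier F)" unfolding fourier_density_def
proof (intro conjI allI impI)
 note S = l2f_sobolev_density[OF F] l2f_sobolev_density[OF l2f_fourier[OF F]]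
 show "l2_fourier F \<in> L2_loc s" by (rule sobolev_density_L2_loc[OF S(2)[of 0]])
 fix ph :: "'a => complex" assume "test_function ph"
 then have ph: "ph \<in> schwartz" by (rule test_function_schwartz)
 have "dist_fourier (dist_of_fun s F) ph = coord_integral (\<lambda>x mu. fourier ph x * F x mu)"
  using ph schwartz_fourier[OF ph] schwartz_density_integrable[OF S(1)[of 0 s] schwartz_fourier[OF ph]]
  by (simp add: dist_fourier_def dist_of_fun_def l2_integral_eq)
 also have "... = coord_integral (\<lambda>xi mu. ph xi * l2_fourier F xi mu)"
 proof
  fix mu
  note C = l2f_coord[OF F, of mu]
  have "(\<lambda>x. fourier ph x * F x mu) \<in> borel_measurable borel" "(\<lambda>x. ph x * fourier (\<lambda>x. F x mu) x) \<in> borel_measurable borel"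
   by (intro borel_measurable_times schwartz_measurable schwartz_fourier ph C)+
  then show "coord_integral (\<lambda>x mu. fourier ph x * F x mu) mu = coord_integral (\<lambda>xi mu. ph xi * l2_fourier F xi mu) mu"
   using fourier_multiplication_formula[OF schwartz_integrable[OF ph] schwartz_integrable[OF C]]
   by (simp add: coord_integral_def l2f_l2_fourier[OF F] integral_completion)
 qed
 finally show "l2_has_integral s (\<lambda>xi mu. ph xi * l2_fourier F xi mu) (dist_fourier (dist_of_fun s F) ph)"
  using schwartz_density_integrable[OF S(2)[of 0 s] ph] by (simp add: l2_has_integral_iff)
qed

section \<open>The operator U(a)(D) on densities and on finitely supported data\<close>

locale APS_symbol =
 fixes a :: "'a::euclidean_space \<times> 'a => complex" and m \<rho> \<delta> :: real
 assumes \<delta>: "0 \<le> \<delta>" "\<delta> < 1" "\<delta> \<le> \<rho>" and a: "a \<in> APS m \<rho> \<delta>"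
begin

lemma continuous_fourier_coeff: "continuous_on UNIV (fourier_coeff a mu)"
 using ap_symbol.continuous_ap_coeff[OF APS_ap_symbol[OF \<delta> a], of mu] by (simp add: fourier_coeff_eq[abs_def])

lemma countable_fourier_coeff: "countable {nu. \<exists>xi. fourier_coeff a nu xi \<noteq> 0}"
 using ap_symbol.countable_spectrum[OF APS_ap_symbol[OF \<delta> a]] by (simp add: fourier_coeff_eq)

text \<open>All indices that U(a)(\<xi>) can reach, for any \<xi>, from sequences supported in
  \<open>La\<close>: the entry from \<open>mu'\<close> to \<open>mu\<close> carries the coefficient
  of index \<open>mu' - mu\<close>.\<close>

definition shifted_spectrum :: "'a set => 'a set" where
 "shifted_spectrum La = (\<lambda>(mu, nu). mu - nu) ` (La \<times> {nu. \<exists>xi. fourier_coeff a nu xi \<noteq> 0})"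

lemma countable_shifted_spectrum: "countable La ==> countable (shifted_spectrum La)"
 unfolding shifted_spectrum_def using countable_fourier_coeff by simp

lemma U_symbol_eq_0:
 assumes "\<And>mu. mu \<notin> La ==> z mu = 0" "mu \<notin> shifted_spectrum La"
 shows "U_symbol a xi z mu = 0" unfolding U_symbol_def
proof (intro infsum_0)
 fix mu'
 have "mu' \<in> La ==> fourier_coeff a (mu' - mu) et = 0" for et
  using assms(2) image_eqI[of mu "\<lambda>(mu, nu). mu - nu" "(mu', mu' - mu)"] unfolding shifted_spectrum_def by auto
 then show "fourier_coeff a (mu' - mu) (xi - mu') * z mu' = 0" using assms(1) by (cases "mu' \<in> La") auto
qed

lemma U_symbol_bound:
 "\<exists>C\<ge>0. \<forall>xi. \<forall>z\<in>l2 s. U_symbol a xi z \<in> l2 (s - m) \<and>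
  l2_norm (s - m) (U_symbol a xi z) \<le> C * bracket xi powr (\<bar>s\<bar> + \<bar>m - s\<bar>) * l2_norm s z"
proof -
 obtain C where C: "C \<ge> 0" "\<And>xi. weighted_opbound s (s - m) (U_kernel a xi) (C * bracket xi powr (\<bar>s\<bar> + \<bar>m - s\<bar>))"
  using U_kernel_bound(1)[OF \<delta> a] by blast
 show ?thesis unfolding U_symbol_eq
  by (intro exI[of _ C] conjI allI ballI C(1) kernel_apply_l2[OF C(2)] kernel_apply_norm[OF C(2)]) (simp_all add: C(1))
qed

lemma U_symbol_linear:
 assumes "z \<in> l2 s" "y \<in> l2 s"
 shows "U_symbol a xi (\<lambda>mu. c * z mu + y mu) = (\<lambda>mu. c * U_symbol a xi z mu + U_symbol a xi y mu)"
proof -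
 obtain C where C: "C \<ge> 0" "\<And>xi. weighted_opbound s (s - m) (U_kernel a xi) (C * bracket xi powr (\<bar>s\<bar> + \<bar>m - s\<bar>))"
  using U_kernel_bound(1)[OF \<delta> a] by blast
 show ?thesis unfolding U_symbol_eq by (rule kernel_apply_linear[OF C(2) _ assms]) (simp add: C(1))
qed

lemma U_symbol_summable:
 assumes "z \<in> l2 s"
 shows "(\<lambda>mu'. fourier_coeff a (mu' - mu) (xi - mu') * z mu') summable_on UNIV"
proof -
 obtain C where C: "C \<ge> 0" "\<And>xi. weighted_opbound s (s - m) (U_kernel a xi) (C * bracket xi powr (\<bar>s\<bar> + \<bar>m - s\<bar>))"
  using U_kernel_bound(1)[OF \<delta> a] by blast
 show ?thesis
  using kernel_apply_abs_summable[OF C(2) assms, of xi mu] C(1) unfolding U_kernel_def by (auto intro: abs_summable_summable)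
qed

text \<open>The coordinates of the image are limits of finite sums of continuous coefficients times
  Borel functions, and the countable set \<open>shifted_spectrum\<close> supports almost all of its
  values.\<close>

lemma U_symbol_measurable:
 assumes G: "l2_measurable s G"
 shows "l2_measurable (s - m) (\<lambda>xi. U_symbol a xi (G xi))" unfolding l2_measurable_iff
proof
 have l2: "G xi \<in> l2 s" for xi by (rule l2_measurable_range[OF G])
 show "range (\<lambda>xi. U_symbol a xi (G xi)) \<subseteq> l2 (s - m)" using U_symbol_bound[of s] l2 by blast
 obtain G' La where G': "countable La" "\<And>mu. (\<lambda>x. G' x mu) \<in> borel_measurable borel"
  "\<And>x mu. mu \<notin> La ==> G' x mu = 0" "AE x in lborel. G x = G' x"
  using coord_measurable_representative[of G] G[unfolded l2_measurable_iff] by blast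
 note [measurable] = G'(2)
 obtain E where E: "\<And>n. finite (E n)" "\<And>n. E n \<subseteq> La" "incseq E" "(\<Union>n. E n) = La"
  by (rule countable_exhaust[OF G'(1)]) (rule that; simp)
 define h where "h n mu xi = (\<Sum>mu'\<in>E n. fourier_coeff a (mu' - mu) (xi - mu') * G' xi mu')" for n mu xi
 have [measurable]: "(\<lambda>xi. fourier_coeff a nu (xi - mu)) \<in> borel_measurable borel" for nu mu
  by (intro borel_measurable_continuous_onI continuous_on_compose2[OF continuous_fourier_coeff] continuous_intros) auto
 have [measurable]: "h n mu \<in> borel_measurable borel" for n mu unfolding h_def by measurable
 define H where "H xi mu = (if mu \<in> shifted_spectrum La then lim (\<lambda>n. h n mu xi) else 0)" for xi mu
 have "AE xi in lborel. H xi = U_symbol a xi (G xi)" using G'(4)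
 proof eventually_elim
  case (elim xi)
  have supp: "\<And>mu. mu \<notin> La ==> G xi mu = 0" using elim G'(3) by simp
  have "(\<lambda>n. h n mu xi) \<longlonglongrightarrow> U_symbol a xi (G xi) mu" for mu
   unfolding h_def elim[symmetric] U_symbol_def
   by (rule has_sum_exhaust[OF has_sum_infsum[OF U_symbol_summable[OF l2]] _ E]) (simp add: supp)
  from limI[OF this] U_symbol_eq_0[OF supp] show ?case by (auto simp: H_def)
 qed
 moreover have "coord_measurable H"
 proof (rule coord_measurableI[OF countable_shifted_spectrum[OF G'(1)]])
  show "(\<lambda>xi. H xi mu) \<in> borel_measurable borel" for mu unfolding H_def by measurable
 qed (simp add: H_def)
 ultimately show "coord_measurable (\<lambda>xi. U_symbol a xi (G xi))" by (rule coord_measurable_cong_AE[rotated])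
qed

text \<open>The growth \<open>\<bar>s\<bar> + \<bar>m - s\<bar>\<close> of the matrix norm in the
  frequency lowers the Sobolev exponent by the same amount.\<close>

lemma U_sobolev_density:
 "\<exists>C\<ge>0. \<forall>t G. sobolev_density t s G \<longrightarrow>
  sobolev_density (t - (\<bar>s\<bar> + \<bar>m - s\<bar>)) (s - m) (\<lambda>xi. U_symbol a xi (G xi)) \<and>
  enn2real (weighted_energy (t - (\<bar>s\<bar> + \<bar>m - s\<bar>)) (s - m) (\<lambda>xi. U_symbol a xi (G xi))) \<le> C\<^sup>2 * enn2real (weighted_energy t s G)"
proof -
 let ?r = "\<bar>s\<bar> + \<bar>m - s\<bar>"
 obtain C where C: "C \<ge> 0" "\<And>xi z. z \<in> l2 s ==> l2_norm (s - m) (U_symbol a xi z) \<le> C * bracket xi powr ?r * l2_norm s z"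
  using U_symbol_bound[of s] by blast
 show ?thesis
 proof (intro exI[of _ C] conjI allI impI C(1))
  fix t and G :: "'a => 'a => complex" assume G: "sobolev_density t s G"
  then have m: "l2_measurable s G" by (simp add: sobolev_density_def)
  have le: "(l2_norm (s - m) (U_symbol a xi (G xi)))\<^sup>2 * bracket xi powr (2 * (t - ?r))
    \<le> C\<^sup>2 * ((l2_norm s (G xi))\<^sup>2 * bracket xi powr (2 * t))" for xi
  proof -
   have "(l2_norm (s - m) (U_symbol a xi (G xi)))\<^sup>2 \<le> (C * bracket xi powr ?r * l2_norm s (G xi))\<^sup>2"
    by (intro power_mono C l2_measurable_range[OF m]) simp
   then have "(l2_norm (s - m) (U_symbol a xi (G xi)))\<^sup>2 * bracket xi powr (2 * (t - ?r))
     \<le> (C * bracket xi powr ?r * l2_norm s (G xi))\<^sup>2 * bracket xi powr (2 * (t - ?r))"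
    by (rule mult_right_mono) simp
   also have "... = C\<^sup>2 * ((l2_norm s (G xi))\<^sup>2 * (bracket xi powr (2 * ?r) * bracket xi powr (2 * (t - ?r))))"
    by (simp add: power_mult_distrib powr_power mult_ac)
   also have "bracket xi powr (2 * ?r) * bracket xi powr (2 * (t - ?r)) = bracket xi powr (2 * t)"
    by (simp add: powr_add[symmetric])
   finally show ?thesis .
  qed
  show "sobolev_density (t - ?r) (s - m) (\<lambda>xi. U_symbol a xi (G xi))"
   "enn2real (weighted_energy (t - ?r) (s - m) (\<lambda>xi. U_symbol a xi (G xi))) \<le> C\<^sup>2 * enn2real (weighted_energy t s G)"
   by (rule sobolev_density_mono[OF U_symbol_measurable[OF m] G le]; simp)+
 qed
qed

lemma U_L2_bounded:
 assumes "m \<le> 0"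
 shows "\<exists>C\<ge>0. \<forall>G\<in>L2_l2. (\<lambda>xi. U_symbol a xi (G xi)) \<in> L2_l2 \<and>
  enn2real (weighted_energy 0 0 (\<lambda>xi. U_symbol a xi (G xi))) \<le> C\<^sup>2 * enn2real (weighted_energy 0 0 G)"
proof -
 obtain C where C: "C \<ge> 0" "\<And>xi. weighted_opbound 0 0 (U_kernel a xi) C"
  using U_kernel_bound(2)[OF \<delta> a assms] by blast
 show ?thesis
 proof (intro exI[of _ C] conjI ballI C(1))
  fix G :: "'a => 'a => complex" assume "G \<in> L2_l2"
  then have G: "sobolev_density 0 0 G" by (simp add: L2_l2_iff)
  then have m: "l2_measurable 0 G" by (simp add: sobolev_density_def)
  note l2 = l2_measurable_range[OF m]
  have U: "l2_measurable 0 (\<lambda>xi. U_symbol a xi (G xi))"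
   using U_symbol_measurable[OF m] kernel_apply_l2[OF C(2) l2 C(1)] by (auto simp: l2_measurable_iff U_symbol_eq)
  have le: "(l2_norm 0 (U_symbol a xi (G xi)))\<^sup>2 * bracket xi powr (2 * 0) \<le> C\<^sup>2 * ((l2_norm 0 (G xi))\<^sup>2 * bracket xi powr (2 * 0))" for xi
   using power_mono[OF kernel_apply_norm[OF C(2) l2 C(1)], of xi xi 2] by (simp add: U_symbol_eq power_mult_distrib)
  show "(\<lambda>xi. U_symbol a xi (G xi)) \<in> L2_l2"
   "enn2real (weighted_energy 0 0 (\<lambda>xi. U_symbol a xi (G xi))) \<le> C\<^sup>2 * enn2real (weighted_energy 0 0 G)"
   unfolding L2_l2_iff by (rule sobolev_density_mono[OF U G le]; simp)+
 qed
qed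

context
 fixes La :: "'a set" and G H :: "'a => 'a => complex"
 assumes G: "l2f La G" and H: "H = (\<lambda>xi. U_symbol a xi (G xi))"
begin

lemma U_l2f_support: "mu \<notin> shifted_spectrum La ==> H xi mu = 0"
 unfolding H by (rule U_symbol_eq_0[OF l2f_0[OF G]])

lemma U_l2f_continuous: "continuous_on UNIV (\<lambda>xi. H xi mu)"
proof -
 have "H xi mu = (\<Sum>mu'\<in>La. fourier_coeff a (mu' - mu) (xi - mu') * G xi mu')" for xi
 proof -
  have "H xi mu = (\<Sum>\<^sub>\<infinity>mu'\<in>La. fourier_coeff a (mu' - mu) (xi - mu') * G xi mu')"
   unfolding H U_symbol_def by (rule infsum_cong_neutral) (auto simp: l2f_0[OF G])
  then show ?thesis using l2f_finite[OF G] by simp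
 qed
 then show ?thesis by (simp only:) (intro continuous_on_sum continuous_on_mult schwartz_continuous l2f_coord[OF G]
   continuous_on_compose2[OF continuous_fourier_coeff] continuous_on_diff continuous_on_id continuous_on_const subset_UNIV)
qed

text \<open>The rapid decay of \<open>G\<close> absorbs the polynomial growth of the matrix norm.
  The exponent \<open>s\<close> is arbitrary: \<open>s = m\<close> gives integrability in
  \<open>l2 0\<close>, where \<open>U_multiplier\<close> integrates, and other values give it in the
  target spaces.\<close>

lemma U_l2f_integrable: "l2_integrable (s - m) H"
proof -
 let ?r = "\<bar>s\<bar> + \<bar>m - s\<bar>"
 obtain C where C: "C \<ge> 0" "\<And>xi z. z \<in> l2 s ==> l2_norm (s - m) (U_symbol a xi z) \<le> C * bracket xi powr ?r * l2_norm s z"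
  using U_symbol_bound[of s] by blast
 define N where "N = nat \<lceil>?r\<rceil>"
 obtain D where D: "\<And>xi. bracket xi ^ (2 * DIM('a) + N) * l2_norm s (G xi) \<le> D" using l2f_decay[OF G] by blast
 have "bracket xi ^ (2 * DIM('a)) * l2_norm (s - m) (H xi) \<le> C * D" for xi
 proof -
  have "bracket xi powr ?r \<le> bracket xi powr real N"
   using bracket_ge_1[of xi] unfolding N_def by (intro powr_mono) linarith+
  then have r: "bracket xi powr ?r \<le> bracket xi ^ N" by (simp add: powr_realpow)
  have "bracket xi ^ (2 * DIM('a)) * l2_norm (s - m) (H xi) \<le> bracket xi ^ (2 * DIM('a)) * (C * bracket xi ^ N * l2_norm s (G xi))"
   unfolding H
   by (intro mult_left_mono order_trans[OF C(2)[OF l2f_l2[OF G]] mult_right_mono[OF mult_left_mono[OF r C(1)]]]) auto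
  also have "... = C * (bracket xi ^ (2 * DIM('a) + N) * l2_norm s (G xi))" by (simp add: power_add mult_ac)
  also have "... \<le> C * D" by (intro mult_left_mono D C(1))
  finally show ?thesis .
 qed
 then show ?thesis unfolding H by (rule l2_integrable_decay[OF U_symbol_measurable[OF l2f_measurable[OF G]]])
qed

lemma U_l2f_integrable_coord: "integrable lborel (\<lambda>xi. H xi mu)"
 using l2_integrable_coord[OF U_l2f_integrable[of m], of mu] borel_measurable_continuous_onI[OF U_l2f_continuous, of mu]
 by (simp add: integrable_completion)

lemma
 shows U_l2f_integral_eq: "l2_integral 0 (\<lambda>xi mu. cis (2 * pi * (xi \<bullet> x)) * H xi mu) = (\<lambda>mu. fourier (\<lambda>xi. H xi mu) (- x))"
  and U_l2f_fourier_l2: "(\<lambda>mu. fourier (\<lambda>xi. H xi mu) (- x)) \<in> l2 (s - m)"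
  and U_l2f_fourier_bound: "l2_norm (s - m) (\<lambda>mu. fourier (\<lambda>xi. H xi mu) (- x)) \<le> (LINT xi|lebesgue. l2_norm (s - m) (H xi))"
proof -
 let ?e = "\<lambda>xi. cis (2 * pi * (xi \<bullet> x))"
 have int: "l2_integrable (s - m) (\<lambda>xi mu. ?e xi * H xi mu)" for s
  by (intro l2_integrable_unimodular U_l2f_integrable) auto
 have eq: "coord_integral (\<lambda>xi mu. ?e xi * H xi mu) = (\<lambda>mu. fourier (\<lambda>xi. H xi mu) (- x))"
 proof
  fix mu
  have [measurable]: "(\<lambda>xi. H xi mu) \<in> borel_measurable borel" by (rule borel_measurable_continuous_onI[OF U_l2f_continuous])
  show "coord_integral (\<lambda>xi mu. ?e xi * H xi mu) mu = fourier (\<lambda>xi. H xi mu) (- x)"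
   unfolding coord_integral_def fourier_def by (subst integral_completion) (auto simp: mult.commute)
 qed
 show "l2_integral 0 (\<lambda>xi mu. ?e xi * H xi mu) = (\<lambda>mu. fourier (\<lambda>xi. H xi mu) (- x))"
  using l2_integral_eq[OF int[of m]] eq by simp
 show "(\<lambda>mu. fourier (\<lambda>xi. H xi mu) (- x)) \<in> l2 (s - m)"
  using coord_integral_l2[OF int] by (simp add: eq)
 show "l2_norm (s - m) (\<lambda>mu. fourier (\<lambda>xi. H xi mu) (- x)) \<le> (LINT xi|lebesgue. l2_norm (s - m) (H xi))"
  using coord_integral_norm[OF int[of s]] by (simp add: eq l2_norm_cmult)
qed

text \<open>Duality of the Fourier transform in every coordinate. The inverse transform of
  \<open>H\<close> is bounded in norm, so its product with a Schwartz function is Bochner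
  integrable.\<close>

lemma U_l2f_dist: "dist_of_fun (s - m) (\<lambda>x mu. fourier (\<lambda>xi. H xi mu) (- x)) = dist_of_density H"
proof
 fix ps :: "'a => complex"
 let ?F = "\<lambda>x mu. fourier (\<lambda>xi. H xi mu) (- x)"
 show "dist_of_fun (s - m) ?F ps = dist_of_density H ps"
 proof (cases "ps \<in> schwartz")
  case True
  have Fm: "(\<lambda>x. ?F x mu) \<in> borel_measurable borel" for mu
   by (rule measurable_compose[OF _ fourier_measurable[OF U_l2f_integrable_coord]]) simp
  have "coord_measurable ?F"
   by (rule coord_measurableI[OF countable_shifted_spectrum[OF countable_finite[OF l2f_finite[OF G]]] Fm])
    (simp add: U_l2f_support fourier_def)
  then have m: "l2_measurable (s - m) ?F" using U_l2f_fourier_l2 by (auto simp: l2_measurable_iff)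
  let ?M = "LINT xi|lebesgue. l2_norm (s - m) (H xi)"
  have M: "?M \<ge> 0" by (intro Bochner_Integration.integral_nonneg) simp
  have iM: "integrable lborel (\<lambda>x. cmod (ps x) * ?M)" using schwartz_integrable[OF True] by simp
  have "(\<integral>\<^sup>+x. ennreal (l2_norm (s - m) (\<lambda>mu. ps x * ?F x mu)) \<partial>lborel) \<le> (\<integral>\<^sup>+x. ennreal (cmod (ps x) * ?M) \<partial>lborel)"
   unfolding l2_norm_cmult by (intro nn_integral_mono ennreal_leI mult_left_mono U_l2f_fourier_bound) simp
  also have "... < \<infinity>" using nn_integral_eq_integral[OF iM] M by simp
  finally have int: "l2_integrable (s - m) (\<lambda>x mu. ps x * ?F x mu)"
   using l2_measurable_mult[OF schwartz_measurable[OF True] m] by (simp add: l2_integrable_def)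
  have "coord_integral (\<lambda>x mu. ps x * ?F x mu) = coord_integral (\<lambda>xi mu. fourier ps (- xi) * H xi mu)"
  proof
   fix mu
   have "(\<lambda>x. ps x * ?F x mu) \<in> borel_measurable borel" "(\<lambda>xi. fourier ps (- xi) * H xi mu) \<in> borel_measurable borel"
    by (intro borel_measurable_times Fm schwartz_measurable schwartz_reflect schwartz_fourier True
      borel_measurable_continuous_onI U_l2f_continuous)+
   then show "coord_integral (\<lambda>x mu. ps x * ?F x mu) mu = coord_integral (\<lambda>xi mu. fourier ps (- xi) * H xi mu) mu"
    using fourier_duality[OF schwartz_integrable[OF True] U_l2f_integrable_coord[of mu]]
    by (simp add: coord_integral_def integral_completion)
  qed
  then show ?thesis using True l2_integral_eq[OF int] by (simp add: dist_of_fun_def dist_of_density_def)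
 qed (simp add: dist_of_fun_def dist_of_density_def)
qed

end

lemma U_multiplier_eq:
 assumes "l2f La F"
 shows "U_multiplier a F = (\<lambda>x mu. fourier (\<lambda>xi. U_symbol a xi (l2_fourier F xi) mu) (- x))"
 using U_l2f_integral_eq[OF l2f_fourier[OF assms] refl] by (simp add: U_multiplier_def fun_eq_iff)

text \<open>\<open>T\<close> multiplies a chosen density by the matrix and returns to distributions.
  Any other density gives the same result by uniqueness; this makes \<open>T\<close> linear and
  allows the classical transform to be used as the density on \<open>schwartz_l2f\<close>.\<close>

lemma Sobolev_extension:
 "\<exists>T. bounded_linear_map (Sobolev s s) (Sobolev_norm s s)
    (Sobolev (s - \<bar>s\<bar> - \<bar>m - s\<bar>) (s - m)) (Sobolev_norm (s - \<bar>s\<bar> - \<bar>m - s\<bar>) (s - m)) (=) T \<and>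
   (\<forall>F\<in>schwartz_l2f. T (dist_of_fun s F) = dist_of_fun (s - m) (U_multiplier a F))"
proof -
 define U where "U G xi = U_symbol a xi (G xi)" for G and xi :: 'a
 define T where "T u = dist_of_density (U (some_density s u))" for u
 let ?t = "s - \<bar>s\<bar> - \<bar>m - s\<bar>"
 obtain C where C: "C \<ge> 0" "\<And>G. sobolev_density s s G ==> sobolev_density ?t (s - m) (U G)"
  "\<And>G. sobolev_density s s G ==> enn2real (weighted_energy ?t (s - m) (U G)) \<le> C\<^sup>2 * enn2real (weighted_energy s s G)"
  using U_sobolev_density[of s] unfolding U_def diff_diff_eq by blast
 have T: "T u = dist_of_density (U G)" if G: "fourier_density s u G" "sobolev_density s s G" for u G unfolding T_def
 proof (rule dist_of_density_cong_AE[symmetric])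
  show "l2_measurable (s - m) (U G)" using C(2)[OF G(2)] by (simp add: sobolev_density_def)
  have "fourier_density s u (some_density s u)" unfolding some_density_def by (rule someI[of "fourier_density s u", OF G(1)])
  from fourier_density_unique[OF G(1) this] show "AE xi in lborel. U G xi = U (some_density s u) xi"
   by eventually_elim (simp add: U_def)
 qed
 have "bounded_linear_map (Sobolev s s) (Sobolev_norm s s) (Sobolev ?t (s - m)) (Sobolev_norm ?t (s - m)) (=) T"
  unfolding bounded_linear_map_def
 proof (intro conjI ballI allI exI[of _ C])
  fix u :: "('a => complex) => 'a => complex" assume u: "u \<in> Sobolev s s"
  note G = some_density[OF u]
  show "T u \<in> Sobolev ?t (s - m)" unfolding T[OF G] by (intro dist_of_density_Sobolev C G)
  have "sqrt (enn2real (weighted_energy ?t (s - m) (U (some_density s u)))) \<le> sqrt (C\<^sup>2 * enn2real (weighted_energy s s (some_density s u)))"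
   by (intro real_sqrt_le_mono C G)
  then show "Sobolev_norm ?t (s - m) (T u) \<le> C * Sobolev_norm s s u"
   unfolding Sobolev_norm_eq[OF dist_of_density_fourier_density[OF C(2)[OF G(2)]], folded T[OF G]] Sobolev_norm_eq[OF G(1)]
   using C(1) by (simp add: real_sqrt_mult)
  fix v :: "('a => complex) => 'a => complex" and c assume v: "v \<in> Sobolev s s"
  note H = some_density[OF v]
  have l2: "some_density s w xi \<in> l2 s" if "w \<in> Sobolev s s" for w xi
   using some_density(2)[OF that] by (auto simp: sobolev_density_def l2_measurable_range)
  have "T (\<lambda>ph mu. c * u ph mu + v ph mu) = dist_of_density (U (\<lambda>xi mu. c * some_density s u xi mu + some_density s v xi mu))"
   by (rule T[OF fourier_density_linear[OF G H] sobolev_density_linear[OF G(2) H(2)]])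
  also have "U (\<lambda>xi mu. c * some_density s u xi mu + some_density s v xi mu)
    = (\<lambda>xi mu. c * U (some_density s u) xi mu + U (some_density s v) xi mu)"
   using U_symbol_linear[OF l2[OF u] l2[OF v]] by (simp add: U_def fun_eq_iff)
  also have "dist_of_density ... = (\<lambda>ph mu. c * T u ph mu + T v ph mu)"
   unfolding T_def by (rule dist_of_density_linear[OF C(2)[OF G(2)] C(2)[OF H(2)]])
  finally show "T (\<lambda>ph mu. c * u ph mu + v ph mu) = (\<lambda>ph mu. c * T u ph mu + T v ph mu)" .
 qed
 moreover have "T (dist_of_fun s F) = dist_of_fun (s - m) (U_multiplier a F)" if F_l2f: "F \<in> schwartz_l2f" for F
 proof -
  obtain La where F: "l2f La F" using schwartz_l2f_imp_l2f[OF F_l2f] by blast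
  have "T (dist_of_fun s F) = dist_of_density (U (l2_fourier F))"
   by (rule T[OF l2f_fourier_density[OF F] l2f_sobolev_density[OF l2f_fourier[OF F]]])
  also have "... = dist_of_fun (s - m) (U_multiplier a F)"
   unfolding U_multiplier_eq[OF F] U_def[abs_def] by (rule U_l2f_dist[OF l2f_fourier[OF F] refl, symmetric])
  finally show ?thesis .
 qed
 ultimately show ?thesis by blast
qed

text \<open>Conjugation of the matrix multiplication with the vector-valued Fourier transform. The
  inner transform is linear only almost everywhere; by \<open>vector_fourier_cong_AE\<close> the
  outer one does not see the exceptional null sets.\<close>

lemma L2_extension:
 assumes "m \<le> 0"
 shows "\<exists>T. bounded_linear_map L2_l2 L2_l2_norm L2_l2 L2_l2_norm ae_eq T \<and>
  (\<forall>F\<in>schwartz_l2f. ae_eq (T F) (U_multiplier a F))"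
proof -
 define U where "U G xi = U_symbol a xi (G xi)" for G and xi :: 'a
 define T where "T F = vector_fourier (- 1) (U (vector_fourier 1 F))" for F
 obtain C where C: "C \<ge> 0" "\<And>G. G \<in> L2_l2 ==> U G \<in> L2_l2"
  "\<And>G. G \<in> L2_l2 ==> enn2real (weighted_energy 0 0 (U G)) \<le> C\<^sup>2 * enn2real (weighted_energy 0 0 G)"
  using U_L2_bounded[OF assms] unfolding U_def by blast
 have V: "vector_fourier sg F \<in> L2_l2" "enn2real (weighted_energy 0 0 (vector_fourier sg F)) \<le> 2 * enn2real (weighted_energy 0 0 F)"
  if "F \<in> L2_l2" "\<bar>sg\<bar> = 1" for F :: "'a => 'a => complex" and sg
  using vector_fourier_L2[OF that] by auto
 have "bounded_linear_map L2_l2 L2_l2_norm L2_l2 L2_l2_norm ae_eq T" unfolding bounded_linear_map_def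
 \<comment> \<open>The energy is multiplied by 2 in each of the two transforms and by
   \<open>C\<^sup>2\<close> in the matrix, so the norm grows by at most
   \<open>2 * C\<close>.\<close>
 proof (intro conjI ballI allI exI[of _ "2 * C"])
  fix F :: "'a => 'a => complex" assume F: "F \<in> L2_l2"
  show "T F \<in> L2_l2" unfolding T_def by (intro V C F) auto
  have "enn2real (weighted_energy 0 0 (T F)) \<le> 2 * enn2real (weighted_energy 0 0 (U (vector_fourier 1 F)))"
   unfolding T_def by (intro V C F) auto
  also have "... \<le> 2 * (C\<^sup>2 * enn2real (weighted_energy 0 0 (vector_fourier 1 F)))"
   by (intro mult_left_mono C V F) auto
  also have "... \<le> 2 * (C\<^sup>2 * (2 * enn2real (weighted_energy 0 0 F)))" by (intro mult_left_mono V F) auto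
  finally have "sqrt (enn2real (weighted_energy 0 0 (T F))) \<le> sqrt ((2 * C)\<^sup>2 * enn2real (weighted_energy 0 0 F))"
   by (intro real_sqrt_le_mono) (simp add: power_mult_distrib)
  then show "L2_l2_norm (T F) \<le> 2 * C * L2_l2_norm F"
   unfolding L2_l2_norm_eq using C(1) by (simp add: real_sqrt_mult)
  fix G :: "'a => 'a => complex" and c assume G: "G \<in> L2_l2"
  note VF = V(1)[OF F, of 1, simplified] and VG = V(1)[OF G, of 1, simplified]
  have l2: "vector_fourier 1 F xi \<in> l2 0" "vector_fourier 1 G xi \<in> l2 0" for xi
   using VF VG by (auto simp: L2_l2_def l2_measurable_range)
  have "AE xi in lborel. U (vector_fourier 1 (\<lambda>x mu. c * F x mu + G x mu)) xi
    = (\<lambda>mu. c * U (vector_fourier 1 F) xi mu + U (vector_fourier 1 G) xi mu)"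
   using vector_fourier_linear[OF F G, of 1 c, simplified] by eventually_elim (simp add: U_def U_symbol_linear[OF l2])
  then have "T (\<lambda>x mu. c * F x mu + G x mu) = vector_fourier (- 1) (\<lambda>xi mu. c * U (vector_fourier 1 F) xi mu + U (vector_fourier 1 G) xi mu)"
   unfolding T_def by (rule vector_fourier_cong_AE)
  then show "ae_eq (T (\<lambda>x mu. c * F x mu + G x mu)) (\<lambda>x mu. c * T F x mu + T G x mu)"
   using vector_fourier_linear[OF C(2)[OF VF] C(2)[OF VG], of "- 1" c] by (simp add: ae_eq_def T_def)
 qed
 moreover have "ae_eq (T F) (U_multiplier a F)" if F_l2f: "F \<in> schwartz_l2f" for F
 proof -
  obtain La where F: "l2f La F" using schwartz_l2f_imp_l2f[OF F_l2f] by blast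
  have FL: "F \<in> L2_l2" using l2f_sobolev_density[OF F] by (simp add: L2_l2_iff)
  have "AE xi in lborel. vector_fourier 1 F xi = (\<lambda>mu. fourier (\<lambda>x. F x mu) (1 *\<^sub>R xi))"
   by (rule vector_fourier_eq_fourier[OF FL _ _ countable_finite[OF l2f_finite[OF F]] l2f_0[OF F] schwartz_integrable[OF l2f_coord[OF F]]]) auto
  then have "AE xi in lborel. U (vector_fourier 1 F) xi = U (l2_fourier F) xi"
   by eventually_elim (simp add: U_def l2f_l2_fourier[OF F])
  moreover have "U (vector_fourier 1 F) \<in> L2_l2" by (intro C V FL) simp
  moreover note L = l2f_fourier[OF F]
  note facts = U_l2f_support[OF L refl, folded U_def] U_l2f_integrable_coord[OF L refl, folded U_def]
  ultimately have "AE x in lborel. T F x = (\<lambda>mu. fourier (\<lambda>xi. U (l2_fourier F) xi mu) ((- 1) *\<^sub>R x))"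
   unfolding T_def
   by (intro vector_fourier_eq_fourier[OF _ _ _ countable_shifted_spectrum[OF countable_finite[OF l2f_finite[OF L]]] facts]) auto
  then show ?thesis by (simp add: ae_eq_def U_multiplier_eq[OF F] U_def)
 qed
 ultimately show ?thesis by blast
qed

end

theorem corollary3p2:
  fixes a :: "'a::euclidean_space \<times> 'a \<Rightarrow> complex" and m \<rho> \<delta> :: real
  assumes "0 < \<rho>" "\<rho> \<le> 1" "0 \<le> \<delta>" "\<delta> < 1" "\<delta> \<le> \<rho>"
    and "a \<in> APS m \<rho> \<delta>"
  shows "(\<forall>s::real. \<exists>T.
            bounded_linear_map
              (Sobolev s s) (Sobolev_norm s s)
              (Sobolev (s - \<bar>s\<bar> - \<bar>m - s\<bar>) (s - m)) (Sobolev_norm (s - \<bar>s\<bar> - \<bar>m - s\<bar>) (s - m))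
              (=) T \<and>
            (\<forall>F\<in>schwartz_l2f.
               T (dist_of_fun s F) = dist_of_fun (s - m) (U_multiplier a F))) \<and>
         (m \<le> 0 \<longrightarrow> (\<exists>T.
            bounded_linear_map L2_l2 L2_l2_norm L2_l2 L2_l2_norm ae_eq T \<and>
            (\<forall>F\<in>schwartz_l2f. ae_eq (T F) (U_multiplier a F))))"
proof -
  interpret APS_symbol a m \<rho> \<delta> by unfold_locales fact+
  show ?thesis using Sobolev_extension L2_extension by blast
qed

end
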